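(* Let $M\in\mathbb{N}\setminus\{0\}$, $\gamma\in(0,\infty)$, and let $\rho$ and $I$ be as in the context (with $\rho$ otherwise arbitrary). Then: (1) Every map $u=r\,e_{MR}\in\mathcal{A}_r^M$ whose profile $r$ is a weak solution of the radial problem is a stationary point of $I$ in $\mathcal{A}_{u_M}$, i.e. $\int_B(\nabla u+\rho'(\det\nabla u)\operatorname{cof}\nabla u)\cdot\nabla\varphi\,dx=0$ for all $\varphi\in W^{1,2}_0(B,\mathbb{R}^2)$. (2) If $M=1$, then $u=\mathrm{Id}$ is the unique global minimizer of $I$ in $\mathcal{A}_{u_1}$. (3) If $M\ge 2$, then every map $u=r\,e_{MR}$ whose profile $r$ is a weak solution of the radial problem satisfies: (a) $u\in C^1(\overline B,\mathbb{R}^2)$; (b) $r\in C^1([0,1])\cap C^\infty((0,1])$, $r\ge0$ and $\dot r\ge 0$ on $[0,1]$, and $r(0)=\dot r(0)=0$; (c) $d=\det\nabla u=\frac{Mr\dot r}{R}\in C([0,1])\cap C^\infty((0,1])$, $d\ge 0$ on $[0,1]$, $d(0)=0$ and $\dot d\ge 0$ on $(0,1]$; (d) if $\rho$ is a delayed lift-off function, then $r,d\in C^\infty([0,1])$ and $u\in C^\infty(\overline B,\mathbb{R}^2)$; (e) if $\rho$ is an immediate lift-off function, then either $r$ is a delayed lift-off function with $r\in C^\infty([0,1])$, or $r$ is an immediate lift-off function with $r\in C^1([0,1])\cap C^\infty((0,1])$ and $r(0)=\dot r(0)=0$; if in addition $u\in W^{2,2}(B,\mathbb{R}^2)$, then $r,d\in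 C^\infty([0,1])$ and $u\in C^\infty(\overline B,\mathbb{R}^2)$.
   Context: Let $B\subset\mathbb{R}^2$ be the open unit ball. Fix constants $\gamma>0$, $s_0\ge0$, $\kappa\ge-\gamma s_0$ and a convex function $\rho\in C^\infty(\mathbb{R})$ with $\rho(s)=0$ for $s\le0$, $\rho(s)=\gamma s+\kappa$ for $s\ge s_0$, and $\rho=\rho_1$ on $[0,s_0]$ where $\rho_1$ is smooth and convex with $\rho_1(0)=0$, $\rho_1(s_0)=\gamma s_0+\kappa$. Define $I(u)=\int_B\frac12|\nabla u|^2+\rho(\det\nabla u)\,dx$ for $u\in W^{1,2}(B,\mathbb{R}^2)$. For a $2\times2$ matrix $A=(a_{ij})$, $\operatorname{cof}A=\begin{pmatrix}a_{22}&-a_{21}\\-a_{12}&a_{11}\end{pmatrix}$. Use polar coordinates $x=R(\cos\theta,\sin\theta)$ and for $M\in\mathbb{N}\setminus\{0\}$ set $e_{MR}=(\cos M\theta,\sin M\theta)^T$, $u_M(x)=R\,e_{MR}$, $\mathcal{A}_{u_M}=\{u\in W^{1,2}(B,\mathbb{R}^2):u=u_M\text{ on }\partial B\text{ in the trace sense}\}$, and $\mathcal{A}_r^M=\{u\in W^{1,2}(B,\mathbb{R}^2): u(x)=r(R)e_{MR}\text{ for some }r:[0,1]\to\mathbb{R}\text{ with }r(1)=1\}$. For such $u$, $d:=\det\nabla u=\frac{M r\dot r}{R}$. A weak solution of the radial problem is a function $r$ on $(0,1]$, absolutely continuous on compact subsets of $(0,1]$, with $r\in L^2((0,1),R^{-1}dR)$,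 $\dot r\in L^2((0,1),R\,dR)$, $r(1)=1$, and $\int_0^1\dot g\,(R\dot r+M\rho'(d)r)+g\,(\frac{M^2r}{R}+M\rho'(d)\dot r)\,dR=0$ for all $g\in C_c^\infty((0,1))$. A continuous function $h$ is an immediate lift-off function if $h(0)=0$ and $h(R)>0$ for all $R>0$; it is a delayed lift-off function if there is $\delta>0$ with $h\equiv0$ on $[0,\delta]$ and $h(R)>0$ for all $R>\delta$. *)

theory Defs
  imports "HOL-Analysis.Analysis"
begin

fun Ck :: "nat \<Rightarrow> 'a::euclidean_space set \<Rightarrow> ('a \<Rightarrow> 'b::real_normed_vector) \<Rightarrow> bool" where
  "Ck 0 S f = continuous_on S f"
| "Ck (Suc k) S f =
     (\<exists>D::'a \<Rightarrow> ('a \<Rightarrow>\<^sub>L 'b).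
        (\<forall>x\<in>S. (f has_derivative blinfun_apply (D x)) (at x within S)) \<and>
        (\<forall>v. Ck k S (\<lambda>x. blinfun_apply (D x) v)))"

definition Cinf :: "'a::euclidean_space set \<Rightarrow> ('a \<Rightarrow> 'b::real_normed_vector) \<Rightarrow> bool" where
  "Cinf S f \<longleftrightarrow> (\<forall>k. Ck k S f)"

definition Cc_inf :: "'a::euclidean_space set \<Rightarrow> ('a \<Rightarrow> 'b::real_normed_vector) \<Rightarrow> bool" where
  "Cc_inf U f \<longleftrightarrow> Cinf UNIV f \<and> compact (closure {x. f x \<noteq> 0}) \<and> closure {x. f x \<noteq> 0} \<subseteq> U"

definition abs_cont_on :: "real set \<Rightarrow> (real \<Rightarrow> real) \<Rightarrow> bool" where
  "abs_cont_on S f \<longleftrightarrow>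
    (\<forall>e>0. \<exists>d>0. \<forall>(n::nat) (a::nat \<Rightarrow> real) b.
       (\<forall>k<n. a k \<le> b k \<and> {a k..b k} \<subseteq> S) \<and>
       (\<forall>i<n. \<forall>j<n. i \<noteq> j \<longrightarrow> b i \<le> a j \<or> b j \<le> a i) \<and>
       (\<Sum>k<n. b k - a k) < d \<longrightarrow>
       (\<Sum>k<n. \<bar>f (b k) - f (a k)\<bar>) < e)"

definition L2_on :: "(real^2) set \<Rightarrow> (real^2 \<Rightarrow> 'b::euclidean_space) \<Rightarrow> bool" where
  "L2_on U f \<longleftrightarrow> set_borel_measurable lebesgue U f \<and>
                  set_integrable lebesgue U (\<lambda>x. (norm (f x))\<^sup>2)"

definition weak_partial :: "(real^2) set \<Rightarrow> (real^2 \<Rightarrow> 'b::euclidean_space) \<Rightarrow> real^2 \<Rightarrow> (real^2 \<Rightarrow> 'b) \<Rightarrow> bool" where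
  "weak_partial U u e g \<longleftrightarrow>
     (\<forall>\<phi>::real^2 \<Rightarrow> real. Cc_inf U \<phi> \<longrightarrow>
        (LINT x:U|lebesgue. frechet_derivative \<phi> (at x) e *\<^sub>R u x)
          = - (LINT x:U|lebesgue. \<phi> x *\<^sub>R g x))"

definition weak_grad :: "(real^2) set \<Rightarrow> (real^2 \<Rightarrow> real^2) \<Rightarrow> (real^2 \<Rightarrow> real^2^2) \<Rightarrow> bool" where
  "weak_grad U u Du \<longleftrightarrow> (\<forall>j. weak_partial U u (axis j 1) (\<lambda>x. column j (Du x)))"

definition W12 :: "(real^2) set \<Rightarrow> (real^2 \<Rightarrow> real^2) \<Rightarrow> bool" where
  "W12 U u \<longleftrightarrow> L2_on U u \<and> (\<exists>Du. weak_grad U u Du \<and> L2_on U Du)"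

definition W22 :: "(real^2) set \<Rightarrow> (real^2 \<Rightarrow> real^2) \<Rightarrow> bool" where
  "W22 U u \<longleftrightarrow> W12 U u \<and>
     (\<exists>Du. weak_grad U u Du \<and> L2_on U Du \<and> (\<forall>j. W12 U (\<lambda>x. column j (Du x))))"

definition W012 :: "(real^2) set \<Rightarrow> (real^2 \<Rightarrow> real^2) \<Rightarrow> bool" where
  "W012 U v \<longleftrightarrow> W12 U v \<and>
     (\<exists>Dv. weak_grad U v Dv \<and> L2_on U Dv \<and>
        (\<exists>\<phi>s::nat \<Rightarrow> real^2 \<Rightarrow> real^2. (\<forall>k. Cc_inf U (\<phi>s k)) \<and>
           (\<lambda>k. (LINT x:U|lebesgue. (norm (\<phi>s k x - v x))\<^sup>2)
               + (LINT x:U|lebesgue. (norm (jacobian (\<phi>s k) (at x) - Dv x))\<^sup>2))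
             \<longlonglongrightarrow> 0))"

text \<open>The (a.e. unique) weak gradient.\<close>
definition wgrad :: "(real^2) set \<Rightarrow> (real^2 \<Rightarrow> real^2) \<Rightarrow> real^2 \<Rightarrow> real^2^2" where
  "wgrad U u = (SOME Du. weak_grad U u Du \<and> L2_on U Du)"

abbreviation Bdisk :: "(real^2) set" where
  "Bdisk \<equiv> ball 0 1"

definition cof2 :: "real^2^2 \<Rightarrow> real^2^2" where
  "cof2 A = vector [vector [A$2$2, - (A$2$1)], vector [- (A$1$2), A$1$1]]"

definition theta :: "real^2 \<Rightarrow> real" where
  "theta x = Arg (Complex (x$1) (x$2))"

definition eM :: "nat \<Rightarrow> real^2 \<Rightarrow> real^2" where
  "eM M x = vector [cos (real M * theta x), sin (real M * theta x)]"

definition uM :: "nat \<Rightarrow> real^2 \<Rightarrow> real^2" where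
  "uM M x = norm x *\<^sub>R eM M x"

definition energy :: "(real \<Rightarrow> real) \<Rightarrow> (real^2 \<Rightarrow> real^2) \<Rightarrow> real" where
  "energy \<rho> u = (LINT x:Bdisk|lebesgue.
      (norm (wgrad Bdisk u x))\<^sup>2 / 2 + \<rho> (det (wgrad Bdisk u x)))"

definition A_uM :: "nat \<Rightarrow> (real^2 \<Rightarrow> real^2) set" where
  "A_uM M = {u. W12 Bdisk u \<and> W012 Bdisk (\<lambda>x. u x - uM M x)}"

definition in_Ar :: "nat \<Rightarrow> (real^2 \<Rightarrow> real^2) \<Rightarrow> (real \<Rightarrow> real) \<Rightarrow> bool" where
  "in_Ar M u r \<longleftrightarrow> W12 Bdisk u \<and> r 1 = 1 \<and>
     (AE x in lebesgue. x \<in> Bdisk \<longrightarrow> u x = r (norm x) *\<^sub>R eM M x)"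

text \<open>Weak solution of the radial problem; rdot is deriv r (defined a.e.).\<close>
definition radial_weak_sol :: "(real \<Rightarrow> real) \<Rightarrow> nat \<Rightarrow> (real \<Rightarrow> real) \<Rightarrow> bool" where
  "radial_weak_sol \<rho> M r \<longleftrightarrow>
     (\<forall>a. 0 < a \<and> a \<le> 1 \<longrightarrow> abs_cont_on {a..1} r) \<and>
     set_integrable lborel {0<..<1} (\<lambda>R. (r R)\<^sup>2 / R) \<and>
     set_integrable lborel {0<..<1} (\<lambda>R. (deriv r R)\<^sup>2 * R) \<and>
     r 1 = 1 \<and>
     (\<forall>g::real \<Rightarrow> real. Cc_inf {0<..<1} g \<longrightarrow>
        (LINT R:{0<..<1}|lborel.
            deriv g R * (R * deriv r R + real M * deriv \<rho> (real M * r R * deriv r R / R) * r R)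
          + g R * ((real M)\<^sup>2 * r R / R + real M * deriv \<rho> (real M * r R * deriv r R / R) * deriv r R))
        = 0)"

definition stationary :: "(real \<Rightarrow> real) \<Rightarrow> (real^2 \<Rightarrow> real^2) \<Rightarrow> bool" where
  "stationary \<rho> u \<longleftrightarrow>
     (\<forall>Du \<phi> D\<phi>. weak_grad Bdisk u Du \<and> L2_on Bdisk Du \<and>
        W012 Bdisk \<phi> \<and> weak_grad Bdisk \<phi> D\<phi> \<and> L2_on Bdisk D\<phi> \<longrightarrow>
        set_integrable lebesgue Bdisk
          (\<lambda>x. inner (Du x + deriv \<rho> (det (Du x)) *\<^sub>R cof2 (Du x)) (D\<phi> x)) \<and>
        (LINT x:Bdisk|lebesgue.
           inner (Du x + deriv \<rho> (det (Du x)) *\<^sub>R cof2 (Du x)) (D\<phi> x)) = 0)"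

definition immediate_liftoff :: "real set \<Rightarrow> (real \<Rightarrow> real) \<Rightarrow> bool" where
  "immediate_liftoff S h \<longleftrightarrow> continuous_on S h \<and> h 0 = 0 \<and> (\<forall>R\<in>S. R > 0 \<longrightarrow> h R > 0)"

definition delayed_liftoff :: "real set \<Rightarrow> (real \<Rightarrow> real) \<Rightarrow> bool" where
  "delayed_liftoff S h \<longleftrightarrow> continuous_on S h \<and>
     (\<exists>\<delta>>0. (\<forall>R\<in>S. 0 \<le> R \<and> R \<le> \<delta> \<longrightarrow> h R = 0) \<and> (\<forall>R\<in>S. R > \<delta> \<longrightarrow> h R > 0))"

end

theory Submission
  imports Defs
begin

text \<open>
  By the lemma of du Bois-Reymond and the strict monotonicity of the flux \<open>p \<mapsto> R p + M \<rho>'(M r p / R) r\<close>, a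
  radial weak solution \<open>r\<close> is continuously differentiable on \<open>(0,1]\<close>. There \<open>d\<close> is nondecreasing, so that
  integrability of \<open>r\<^sup>2 / R\<close> forces \<open>d \<ge> 0\<close> and \<open>r\<^sup>2 \<le> c R\<^sup>2\<close>. The logarithmic derivative \<open>q = R r' / r\<close> solves
  \<open>R q' = 2 q - 2 q\<^sup>2 + (q\<^sup>2 + M\<^sup>2 - 2 q) / (1 + \<epsilon>)\<close> with \<open>\<epsilon> = M\<^sup>2 \<rho>''(d) r\<^sup>2 / R\<^sup>2\<close>, which traps it in
  \<open>[1, M]\<close> and gives \<open>M - q = O(R\<^sup>2)\<close>. In the variable \<open>s = R\<^sup>2\<close>, with \<open>r = R\<^sup>M H(s)\<close> and \<open>q = M + s \<pi>(s)\<close>,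
  the equation for \<open>\<pi>\<close> has a regular singularity at \<open>0\<close>, and solving it by averaging bootstraps \<open>H\<close> and \<open>\<pi>\<close> to
  smooth functions on \<open>[0,1]\<close>. Hence \<open>u = H(\<bar>x\<bar>\<^sup>2) z\<^sup>M\<close> is smooth up to the boundary for every \<open>\<rho>\<close>, and its
  stationarity amounts to the pointwise vanishing of the divergence of the stress. For \<open>M = 1\<close> the trapping gives
  \<open>r = R\<close>; the identity is minimal because \<open>\<rho>\<close> is convex while the entries and the determinant of
  \<open>\<nabla>\<phi>\<close> have integral zero for \<open>\<phi>\<close> vanishing on the boundary, and unique by Poincare's inequality.
\<close>

section \<open>Calculus of continuously differentiable functions\<close>

text \<open>The origin is the obstacle: the radial equation is singular there, and integrability of
  \<open>r^2 / R\<close> is all that a weak solution says about it. On the scale \<open>ln R\<close>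
  the origin is minus infinity, so a solution is a trajectory that exists for all past times. For
  \<open>\<epsilon> = 0\<close> the equation reads \<open>R q' = M^2 - q^2\<close>; followed
  backwards, the root \<open>M\<close> repels, and a value off \<open>M\<close> runs to negative
  values or to infinity. The \<open>\<epsilon>\<close> term keeps the root between \<open>1\<close>
  and \<open>M\<close> and, for \<open>M \<ge> 2\<close>, dies out at the origin. So bounds on
  \<open>q\<close> need no data at \<open>0\<close>, and they improve themselves: a smaller
  \<open>r\<close> gives a smaller \<open>\<epsilon>\<close>, hence a \<open>q\<close> closer to
  \<open>M\<close>. The variable is \<open>R^2\<close> because smoothness of \<open>H\<close> in
  \<open>R\<close> alone would not make \<open>H z^M\<close> smooth at the origin. The bounds on
  \<open>\<rho>'\<close> keep the stress square integrable, so identities for smooth test maps pass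
  to \<open>W012\<close>.\<close>

lemma Ck_cong:
  assumes "Ck k S f" "\<And>x. x \<in> S \<Longrightarrow> f x = g x"
  shows "Ck k S g"
proof (cases k)
  case 0
  then show ?thesis using assms by (simp cong: continuous_on_cong)
next
  case (Suc m)
  then obtain D :: "'a \<Rightarrow> ('a \<Rightarrow>\<^sub>L 'b)" where
    "\<forall>x\<in>S. (f has_derivative blinfun_apply (D x)) (at x within S)" "\<forall>v. Ck m S (\<lambda>x. blinfun_apply (D x) v)"
    using assms by auto
  then show ?thesis unfolding Suc Ck.simps
    by (intro exI[of _ D]) (auto intro!: has_derivative_transform[OF _ assms(2)[symmetric]])
qed

text \<open>The derivative may be given as a plain function, which suits the derivative rules;
  \<open>Ck\<close> itself asks for a map into bounded linear operators.\<close>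

lemma Ck_SucI:
  assumes "\<And>x. x \<in> S \<Longrightarrow> (f has_derivative D x) (at x within S)"
    and "\<And>v. Ck k S (\<lambda>x. D x v)"
  shows "Ck (Suc k) S f"
proof -
  \<comment> \<open>Outside \<open>S\<close> the value \<open>D x\<close> may fail to be linear and
    \<open>Blinfun\<close> is then arbitrary; only points of \<open>S\<close> matter, by
    \<open>Ck_cong\<close>.\<close>
  define B where "B x = Blinfun (D x)" for x
  have B: "blinfun_apply (B x) = D x" if "x \<in> S" for x
    unfolding B_def using assms(1)[OF that] by (intro bounded_linear_Blinfun_apply has_derivative_bounded_linear)
  show ?thesis unfolding Ck.simps
    using assms(1) B by (intro exI[of _ B]) (auto intro!: Ck_cong[OF assms(2)])
qed

lemma Ck_SucE:
  assumes "Ck (Suc k) S f"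
  obtains D where "\<And>x. bounded_linear (D x)"
    "\<And>x. x \<in> S \<Longrightarrow> (f has_derivative D x) (at x within S)" "\<And>v. Ck k S (\<lambda>x. D x v)"
proof -
  obtain B :: "'a \<Rightarrow> ('a \<Rightarrow>\<^sub>L 'b)" where
    "\<forall>x\<in>S. (f has_derivative blinfun_apply (B x)) (at x within S)" "\<forall>v. Ck k S (\<lambda>x. blinfun_apply (B x) v)"
    using assms by auto
  then show ?thesis by (intro that[of "\<lambda>x. blinfun_apply (B x)"]) (auto intro: blinfun.bounded_linear_right)
qed

lemma Ck_imp_continuous_on: "Ck k S f \<Longrightarrow> continuous_on S f"
  by (cases k) (auto intro: has_derivative_continuous simp: continuous_on_eq_continuous_within)

lemma Ck_SucD: "Ck (Suc k) S f \<Longrightarrow> Ck k S f"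
proof (induction k arbitrary: f)
  case 0
  then show ?case using Ck_imp_continuous_on[OF 0] by simp
next
  case (Suc k)
  from Suc.prems obtain D where D: "\<And>x. bounded_linear (D x)"
    "\<And>x. x \<in> S \<Longrightarrow> (f has_derivative D x) (at x within S)" "\<And>v. Ck (Suc k) S (\<lambda>x. D x v)"
    by (rule Ck_SucE) blast
  show ?case by (intro Ck_SucI[of S f D] D(2) Suc.IH D(3))
qed

declare Ck.simps(2) [simp del]

lemma Ck_subset: "Ck k S f \<Longrightarrow> T \<subseteq> S \<Longrightarrow> Ck k T f"
proof (induction k arbitrary: f)
  case 0
  then show ?case by (auto intro: continuous_on_subset)
next
  case (Suc k)
  from Suc.prems(1) obtain D where D: "\<And>x. bounded_linear (D x)"
    "\<And>x. x \<in> S \<Longrightarrow> (f has_derivative D x) (at x within S)" "\<And>v. Ck k S (\<lambda>x. D x v)"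
    by (rule Ck_SucE) blast
  show ?case using D Suc.IH Suc.prems(2) by (intro Ck_SucI[of T f D]) (auto intro!: has_derivative_subset[of f _ _ S T])
qed

lemma Ck_const [simp]: "Ck k S (\<lambda>x. c)"
proof (induction k arbitrary: c)
  case (Suc k)
  then show ?case by (intro Ck_SucI[of _ _ "\<lambda>x h. 0"]) (auto intro: derivative_eq_intros)
qed simp

lemma Ck_bounded_linear:
  assumes "bounded_linear L" "Ck k S f"
  shows "Ck k S (\<lambda>x. L (f x))"
  using assms(2)
proof (induction k arbitrary: f)
  case 0
  then show ?case by (auto intro: bounded_linear.continuous_on[OF assms(1)])
next
  case (Suc k)
  from Suc.prems(1) obtain D where D: "\<And>x. bounded_linear (D x)"
    "\<And>x. x \<in> S \<Longrightarrow> (f has_derivative D x) (at x within S)" "\<And>v. Ck k S (\<lambda>x. D x v)"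
    by (rule Ck_SucE) blast
  show ?case using D Suc.IH
    by (intro Ck_SucI[of S _ "\<lambda>x h. L (D x h)"]) (auto intro: bounded_linear.has_derivative[OF assms(1)])
qed

lemma Ck_linear: "bounded_linear L \<Longrightarrow> Ck k S L"
proof (cases k)
  case 0
  assume "bounded_linear L"
  then show ?thesis using 0 by (simp add: linear_continuous_on)
next
  case (Suc m)
  assume "bounded_linear L"
  then show ?thesis unfolding Suc by (intro Ck_SucI[of _ _ "\<lambda>x. L"]) (auto intro: bounded_linear_imp_has_derivative)
qed

lemma Ck_add:
  assumes "Ck k S f" "Ck k S g" shows "Ck k S (\<lambda>x. f x + g x)"
  using assms
proof (induction k arbitrary: f g)
  case 0
  then show ?case by (auto intro: continuous_intros)
next
  case (Suc k)
  obtain D where D: "\<And>x. x \<in> S \<Longrightarrow> (f has_derivative D x) (at x within S)" "\<And>v. Ck k S (\<lambda>x. D x v)"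
    using Suc.prems(1) by (rule Ck_SucE) blast
  obtain E where E: "\<And>x. x \<in> S \<Longrightarrow> (g has_derivative E x) (at x within S)" "\<And>v. Ck k S (\<lambda>x. E x v)"
    using Suc.prems(2) by (rule Ck_SucE) blast
  show ?case using D E Suc.IH
    by (intro Ck_SucI[of S _ "\<lambda>x h. D x h + E x h"]) (auto intro: has_derivative_add)
qed

lemma Ck_sum: "(\<And>i. i \<in> I \<Longrightarrow> Ck k S (f i)) \<Longrightarrow> Ck k S (\<lambda>x. \<Sum>i\<in>I. f i x)"
  by (induction I rule: infinite_finite_induct) (auto intro: Ck_add)

lemma Ck_uminus: "Ck k S f \<Longrightarrow> Ck k S (\<lambda>x. - f x)"
  by (rule Ck_bounded_linear[OF bounded_linear_minus[OF bounded_linear_ident]])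

lemma Ck_diff: "Ck k S f \<Longrightarrow> Ck k S g \<Longrightarrow> Ck k S (\<lambda>x. f x - g x)"
  using Ck_add[of k S f "\<lambda>x. - g x"] Ck_uminus by force

lemma Ck_bilinear:
  assumes B: "bounded_bilinear B" and "Ck k S f" "Ck k S g"
  shows "Ck k S (\<lambda>x. B (f x) (g x))"
  using assms(2,3)
proof (induction k arbitrary: f g)
  case 0
  then show ?case by (auto intro: bounded_bilinear.continuous_on[OF B])
next
  case (Suc k)
  obtain D where D: "\<And>x. x \<in> S \<Longrightarrow> (f has_derivative D x) (at x within S)" "\<And>v. Ck k S (\<lambda>x. D x v)"
    using Suc.prems(1) by (rule Ck_SucE) blast
  obtain E where E: "\<And>x. x \<in> S \<Longrightarrow> (g has_derivative E x) (at x within S)" "\<And>v. Ck k S (\<lambda>x. E x v)"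
    using Suc.prems(2) by (rule Ck_SucE) blast
  have "Ck k S f" "Ck k S g" using Suc.prems Ck_SucD by auto
  then show ?case using Suc.IH D E
    by (intro Ck_SucI[of S _ "\<lambda>x h. B (f x) (E x h) + B (D x h) (g x)"])
      (auto intro: bounded_bilinear.FDERIV[OF B] Ck_add)
qed

lemmas Ck_mult = Ck_bilinear[OF bounded_bilinear_mult]
lemmas Ck_scaleR = Ck_bilinear[OF bounded_bilinear_scaleR]
lemmas Ck_inner = Ck_bilinear[OF bounded_bilinear_inner]

lemma Ck_ident: "Ck k S (\<lambda>x. x)"
  by (rule Ck_linear[OF bounded_linear_ident])

lemma Ck_power: "Ck k S f \<Longrightarrow> Ck k S (\<lambda>x. f x ^ n :: real)"
  by (induction n) (auto intro: Ck_mult)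

lemma Ck_prod: "(\<And>i. i \<in> I \<Longrightarrow> Ck k S (f i)) \<Longrightarrow> Ck k S (\<lambda>x. \<Prod>i\<in>I. f i x :: real)"
  by (induction I rule: infinite_finite_induct) (auto intro: Ck_mult)

text \<open>\<open>Ck\<close> speaks of derivatives in fixed directions, but the chain rule applies
  \<open>E (f x)\<close> to the moving vector \<open>D x v\<close>. Expanding this vector in
  \<open>Basis\<close> leaves products of functions of class \<open>k\<close>, to which the
  induction hypothesis applies.\<close>

lemma Ck_compose:
  fixes f :: "'a::euclidean_space \<Rightarrow> 'b::euclidean_space" and g :: "'b \<Rightarrow> 'c::real_normed_vector"
  assumes "Ck k T g" "Ck k S f" "f ` S \<subseteq> T"
  shows "Ck k S (\<lambda>x. g (f x))"
  using assms(1,2)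
proof (induction k arbitrary: g)
  case 0
  then show ?case using assms(3) by (auto intro: continuous_on_compose2)
next
  case (Suc k)
  obtain E where E: "\<And>y. bounded_linear (E y)"
    "\<And>y. y \<in> T \<Longrightarrow> (g has_derivative E y) (at y within T)" "\<And>v. Ck k T (\<lambda>y. E y v)"
    using Suc.prems(1) by (rule Ck_SucE) blast
  obtain D where D: "\<And>x. x \<in> S \<Longrightarrow> (f has_derivative D x) (at x within S)" "\<And>v. Ck k S (\<lambda>x. D x v)"
    using Suc.prems(2) by (rule Ck_SucE) blast
  have f: "Ck k S f" using Suc.prems(2) by (rule Ck_SucD)
  show ?case
  proof (rule Ck_SucI[of S _ "\<lambda>x h. E (f x) (D x h)"])
    fix x assume x: "x \<in> S"
    show "((\<lambda>x. g (f x)) has_derivative (\<lambda>h. E (f x) (D x h))) (at x within S)"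
      using E(2) x assms(3)
      by (intro has_derivative_in_compose[OF D(1)[OF x], of g "E (f x)"]) (auto intro: has_derivative_subset)
  next
    fix v
    have "E (f x) (D x v) = (\<Sum>b\<in>Basis. (D x v \<bullet> b) *\<^sub>R E (f x) b)" for x
    proof -
      interpret bounded_linear "E (f x)" by (rule E(1))
      show ?thesis by (subst (1) euclidean_representation[of "D x v", symmetric]) (simp only: sum scaleR)
    qed
    then show "Ck k S (\<lambda>x. E (f x) (D x v))"
      using E(3) D(2) f Suc.IH by (auto intro!: Ck_sum Ck_scaleR Ck_inner)
  qed
qed

lemma Ck_real_SucI:
  fixes f :: "real \<Rightarrow> 'b::real_normed_vector"
  assumes "\<And>x. x \<in> S \<Longrightarrow> (f has_vector_derivative f' x) (at x within S)" "Ck k S f'"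
  shows "Ck (Suc k) S f"
  using assms(1) by (intro Ck_SucI[of S f "\<lambda>x h. h *\<^sub>R f' x"])
    (auto simp: has_vector_derivative_def intro: Ck_bounded_linear[OF bounded_linear_scaleR_right assms(2)])

lemma Ck_real_SucE:
  fixes f :: "real \<Rightarrow> real"
  assumes "Ck (Suc k) S f"
  obtains f' where "\<And>x. x \<in> S \<Longrightarrow> (f has_real_derivative f' x) (at x within S)" "Ck k S f'"
proof -
  obtain D where D: "\<And>x. bounded_linear (D x)"
    "\<And>x. x \<in> S \<Longrightarrow> (f has_derivative D x) (at x within S)" "\<And>v. Ck k S (\<lambda>x. D x v)"
    using assms by (rule Ck_SucE) blast
  have e: "D x = (*) (D x 1)" for x
  proof
    fix h
    have "D x (h *\<^sub>R 1) = h *\<^sub>R D x 1"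
      by (rule linear.scaleR[OF bounded_linear.linear[OF D(1)]])
    then have "D x h = h * D x 1" by simp
    then show "D x h = D x 1 * h" by (simp only: mult.commute)
  qed
  have "(f has_real_derivative D x 1) (at x within S)" if "x \<in> S" for x
    unfolding has_field_derivative_def
    by (rule subst[where P = "\<lambda>F. (f has_derivative F) (at x within S)", OF e D(2)[OF that]])
  then show ?thesis using that[of "\<lambda>x. D x 1"] D(3) by blast
qed

lemma Ck_inverse_aux: "Ck k (- {0}) (inverse :: real \<Rightarrow> real)"
proof (induction k)
  case (Suc k)
  show ?case
  proof (rule Ck_real_SucI)
    show "(inverse has_vector_derivative - (inverse x * inverse x)) (at x within - {0})" if "x \<in> - {0}" for x :: real
      using DERIV_inverse[of x "- {0}"] that
      by (simp add: has_real_derivative_iff_has_vector_derivative power2_eq_square)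
    show "Ck k (- {0}) (\<lambda>x. - (inverse x * inverse x) :: real)"
      by (intro Ck_uminus Ck_mult Suc)
  qed
qed (auto intro: continuous_intros)

lemma Ck_inverse:
  fixes f :: "'a::euclidean_space \<Rightarrow> real"
  assumes "Ck k S f" "\<And>x. x \<in> S \<Longrightarrow> f x \<noteq> 0"
  shows "Ck k S (\<lambda>x. inverse (f x))"
  using assms by (intro Ck_compose[OF Ck_inverse_aux]) auto

lemma Ck_divide:
  fixes f g :: "'a::euclidean_space \<Rightarrow> real"
  assumes "Ck k S f" "Ck k S g" "\<And>x. x \<in> S \<Longrightarrow> g x \<noteq> 0"
  shows "Ck k S (\<lambda>x. f x / g x)"
  unfolding divide_inverse using assms by (intro Ck_mult Ck_inverse)

text \<open>Membership in every \<open>Ck\<close> provides a derivative for each \<open>k\<close>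
  separately. They coincide because derivatives are unique where \<open>at x within S\<close> is not
  trivial, so one of them serves all \<open>k\<close>.\<close>

lemma Cinf_obtain_derivative:
  fixes f :: "real \<Rightarrow> real"
  assumes f: "Cinf S f" and S: "\<And>x. x \<in> S \<Longrightarrow> at x within S \<noteq> bot"
  obtains f' where "\<And>x. x \<in> S \<Longrightarrow> (f has_real_derivative f' x) (at x within S)" "Cinf S f'"
proof -
  have *: "\<exists>f'. (\<forall>x\<in>S. (f has_real_derivative f' x) (at x within S)) \<and> Ck k S f'" for k
  proof -
    have "Ck (Suc k) S f" using f unfolding Cinf_def by blast
    then show ?thesis by (rule Ck_real_SucE) blast
  qed
  then obtain F where F: "\<And>x k. x \<in> S \<Longrightarrow> (f has_real_derivative F k x) (at x within S)" "\<And>k. Ck k S (F k)"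
    by metis
  have "F k x = F 0 x" if "x \<in> S" for k x
    by (rule has_field_derivative_unique[OF F(1)[OF that] F(1)[OF that] S[OF that]])
  then have "Cinf S (F 0)" unfolding Cinf_def using Ck_cong[OF F(2)] by blast
  then show ?thesis using F(1) by (rule that[rotated])
qed

text \<open>The functions \<open>x\<^sup>-\<^sup>k exp (- 1 / x)\<close> on the positive half line, extended by zero;
  each derivative is a combination of two functions of the same kind.\<close>

definition flat :: "nat \<Rightarrow> real \<Rightarrow> real" where
  "flat k x = (if 0 < x then inverse x ^ k * exp (- inverse x) else 0)"

lemma flat_tendsto_0: "(flat k \<longlongrightarrow> 0) (at 0)"
proof -
  have "((\<lambda>x. inverse x ^ k * exp (- inverse x)) \<longlongrightarrow> 0) (at_right (0::real))"
    using filterlim_compose[OF tendsto_power_div_exp_0[of k] filterlim_inverse_at_top_right]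
    by (simp add: exp_minus field_simps)
  then have "(flat k \<longlongrightarrow> 0) (at_right 0)"
    by (rule Lim_transform_eventually) (auto simp: flat_def eventually_at_filter)
  moreover have "(flat k \<longlongrightarrow> 0) (at_left 0)"
    by (rule tendsto_eventually) (auto simp: flat_def eventually_at_filter)
  ultimately show ?thesis by (simp add: filterlim_split_at)
qed

lemma flat_derivative: "(flat k has_real_derivative (flat (k + 2) x - real k * flat (k + 1) x)) (at x)"
proof -
  consider "x < 0" | "x = 0" | "x > 0" by linarith
  then show ?thesis
  proof cases
    case 1
    have "((\<lambda>_. 0) has_real_derivative 0) (at x)" by simp
    moreover have "\<forall>\<^sub>F y in nhds x. flat k y = 0"
      using eventually_nhds_in_open[of "{..<0}" x] 1 by (auto elim!: eventually_mono simp: flat_def)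
    ultimately show ?thesis using 1 DERIV_cong_ev[OF refl, of "flat k" "\<lambda>_. 0" x] by (simp add: flat_def)
  next
    case 2
    \<comment> \<open>Off \<open>0\<close> the difference quotient of \<open>flat k\<close> at
      \<open>0\<close> is \<open>flat (k + 1)\<close>, so the limit of these functions settles all
      derivatives there.\<close>
    have "(\<lambda>h. (flat k (0 + h) - flat k 0) / h) \<midarrow>0\<rightarrow> 0"
      by (rule Lim_transform_eventually[OF flat_tendsto_0[of "k + 1"]])
        (auto simp: flat_def field_simps eventually_at_filter)
    then show ?thesis using 2 by (simp add: DERIV_def flat_def)
  next
    case 3
    have "((\<lambda>x. inverse x ^ k * exp (- inverse x)) has_real_derivative
        real k * inverse x ^ (k - 1) * (- (inverse x * inverse x)) * exp (- inverse x)
          + inverse x ^ k * (exp (- inverse x) * (inverse x * inverse x))) (at x)"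
      using 3 by (auto intro!: derivative_eq_intros simp: power2_eq_square)
    also have "real k * inverse x ^ (k - 1) * (- (inverse x * inverse x)) * exp (- inverse x)
          + inverse x ^ k * (exp (- inverse x) * (inverse x * inverse x)) = flat (k + 2) x - real k * flat (k + 1) x"
      using 3 by (cases k) (auto simp: flat_def algebra_simps)
    finally have "((\<lambda>x. inverse x ^ k * exp (- inverse x)) has_real_derivative
        (flat (k + 2) x - real k * flat (k + 1) x)) (at x)" .
    moreover have "\<forall>\<^sub>F y in nhds x. flat k y = inverse y ^ k * exp (- inverse y)"
      using eventually_nhds_in_open[of "{0<..}" x] 3 by (auto elim!: eventually_mono simp: flat_def)
    ultimately show ?thesis using DERIV_cong_ev[OF refl, of "flat k" _ x] by fast
  qed
qed

lemma Ck_flat: "Ck n UNIV (flat k)"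
proof (induction n arbitrary: k)
  case 0
  have "continuous_on UNIV (flat k)"
    by (rule DERIV_continuous_on) (rule flat_derivative)
  then show ?case by simp
next
  case (Suc n)
  then show ?case
    by (intro Ck_real_SucI[of _ _ "\<lambda>x. flat (k + 2) x - real k * flat (k + 1) x"] Ck_diff Ck_mult Ck_const)
      (auto simp: has_real_derivative_iff_has_vector_derivative[symmetric] simp del: One_nat_def add_2_eq_Suc'
        intro: flat_derivative)
qed

section \<open>Test functions and the fundamental lemma\<close>

text \<open>Each factor is \<open>exp (-1 / (n t))\<close> in the signed distance \<open>t\<close>
  to a face of the box and vanishes beyond the face. The parameter \<open>n\<close> sharpens it: at
  a fixed interior point it tends to \<open>1\<close>, so the bumps approximate the indicator of the
  open box from below.\<close>

definition bump :: "'a::euclidean_space \<Rightarrow> 'a \<Rightarrow> nat \<Rightarrow> 'a \<Rightarrow> real" where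
  "bump a b n x = (\<Prod>i\<in>Basis. flat 0 (real n * ((x - a) \<bullet> i)) * flat 0 (real n * ((b - x) \<bullet> i)))"

lemma flat0_bounds: "0 \<le> flat 0 x" "flat 0 x \<le> 1"
  by (auto simp: flat_def)

lemma Ck_bump: "Ck k S (bump a b n)"
proof -
  have "Ck k S (\<lambda>x. flat 0 (real n * ((x - a) \<bullet> i)))" "Ck k S (\<lambda>x. flat 0 (real n * ((b - x) \<bullet> i)))" for i
    by (intro Ck_compose[OF Ck_flat] Ck_mult Ck_inner Ck_diff Ck_const Ck_ident; simp)+
  then show ?thesis unfolding bump_def[abs_def] by (intro Ck_prod Ck_mult)
qed

lemma bump_bounds: "0 \<le> bump a b n x" "bump a b n x \<le> 1"
  unfolding bump_def using flat0_bounds by (auto intro!: prod_nonneg prod_le_1 mult_le_one)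

lemma bump_outside: "x \<notin> box a b \<Longrightarrow> bump a b n x = 0"
proof -
  assume "x \<notin> box a b"
  then obtain i where i: "i \<in> Basis" "x \<bullet> i \<le> a \<bullet> i \<or> b \<bullet> i \<le> x \<bullet> i"
    by (auto simp: box_def not_less)
  then have "flat 0 (real n * ((x - a) \<bullet> i)) * flat 0 (real n * ((b - x) \<bullet> i)) = 0"
    by (auto simp: flat_def inner_diff_left zero_less_mult_iff)
  then show ?thesis unfolding bump_def using i(1) by (intro prod_zero) auto
qed

lemma bump_pos: "x \<in> box a b \<Longrightarrow> 0 < n \<Longrightarrow> 0 < bump a b n x"
  by (auto simp: bump_def flat_def box_def inner_diff_left intro!: prod_pos)

lemma flat0_tendsto_1: "0 < c \<Longrightarrow> (\<lambda>n. flat 0 (real n * c)) \<longlonglongrightarrow> 1"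
proof -
  assume c: "0 < c"
  have "(\<lambda>n. exp (- (inverse c * inverse (real n)))) \<longlonglongrightarrow> exp (- (inverse c * 0))"
    by (intro tendsto_intros lim_inverse_n)
  then have "(\<lambda>n. exp (- (inverse c * inverse (real n)))) \<longlonglongrightarrow> 1" by simp
  then show ?thesis
    by (rule Lim_transform_eventually)
      (use c in \<open>auto simp: flat_def mult.commute eventually_sequentially intro!: exI[of _ 1]\<close>)
qed

lemma bump_tendsto: "(\<lambda>n. bump a b n x) \<longlonglongrightarrow> indicator (box a b) x"
proof (cases "x \<in> box a b")
  case True
  have "(\<lambda>n. bump a b n x) \<longlonglongrightarrow> (\<Prod>i\<in>(Basis::'a set). 1 * 1)"
    unfolding bump_def using True
    by (intro tendsto_prod tendsto_mult flat0_tendsto_1) (auto simp: box_def inner_diff_left)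
  then show ?thesis using True by simp
qed (simp add: bump_outside)

lemma Cc_inf_bump:
  assumes "cbox a b \<subseteq> U" shows "Cc_inf U (bump a b n)"
proof -
  have "closure {x. bump a b n x \<noteq> 0} \<subseteq> cbox a b"
    by (rule closure_minimal) (use bump_outside box_subset_cbox in blast, rule closed_cbox)
  moreover have "bounded {x. bump a b n x \<noteq> 0}"
    by (rule bounded_subset[OF bounded_cbox[of a b]]) (use bump_outside box_subset_cbox in blast)
  ultimately show ?thesis
    using assms unfolding Cc_inf_def Cinf_def by (auto simp: Ck_bump)
qed

text \<open>Lebesgue's differentiation theorem for cubes with corner \<open>x\<close>: outside a
  null set, \<open>f x\<close> is the limit of averages over the cubes
  \<open>cbox x (x + h *\<^sub>R One)\<close>, which vanish as soon as the cube lies in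
  \<open>U\<close>.\<close>

lemma absolutely_integrable_AE_zero:
  fixes f :: "'a::euclidean_space \<Rightarrow> real"
  assumes f: "integrable lebesgue f"
    and z: "\<And>a b. cbox a b \<subseteq> U \<Longrightarrow> (LINT x:cbox a b|lebesgue. f x) = 0" and U: "open U"
  shows "AE x in lebesgue. x \<in> U \<longrightarrow> f x = 0"
proof -
  have fi: "set_integrable lebesgue (cbox a b) f" for a b
    unfolding set_integrable_def by (intro integrable_mult_indicator f) auto
  obtain N where N: "negligible N"
    "\<And>x e. \<lbrakk>x \<notin> N; 0 < e\<rbrakk> \<Longrightarrow> \<exists>d>0. \<forall>h. 0 < h \<and> h < d \<longrightarrow>
       norm (integral (cbox x (x + h *\<^sub>R One)) f /\<^sub>R h ^ DIM('a) - f x) < e"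
    by (rule integrable_ccontinuous_explicit[OF set_lebesgue_integral_eq_integral(1)[OF fi]]) blast
  have "f x = 0" if x: "x \<in> U" "x \<notin> N" for x
  proof (rule ccontr)
    assume "f x \<noteq> 0"
    then obtain d where d: "d > 0" "\<And>h. 0 < h \<Longrightarrow> h < d \<Longrightarrow>
       norm (integral (cbox x (x + h *\<^sub>R One)) f /\<^sub>R h ^ DIM('a) - f x) < \<bar>f x\<bar>"
      using N(2)[OF x(2), of "\<bar>f x\<bar>"] by auto
    obtain e where e: "e > 0" "ball x e \<subseteq> U" using U x(1) by (meson openE)
    \<comment> \<open>The cube has side \<open>h\<close>, so its points are within
      \<open>h * DIM('a) < e\<close> of \<open>x\<close> in the sum norm, hence inside the
      ball.\<close>
    define h where "h = min (d / 2) (e / (2 * real DIM('a)))"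
    have h: "0 < h" "h < d" "h * real DIM('a) < e"
      using d(1) e(1) by (auto simp: h_def min_def field_simps)
    have "cbox x (x + h *\<^sub>R One) \<subseteq> U"
    proof
      fix y assume y: "y \<in> cbox x (x + h *\<^sub>R One)"
      have "norm (y - x) \<le> (\<Sum>i\<in>Basis. \<bar>(y - x) \<bullet> i\<bar>)" by (rule norm_le_l1)
      also have "\<dots> \<le> (\<Sum>i\<in>(Basis::'a set). h)"
        using y by (intro sum_mono) (auto simp: mem_box inner_diff_left inner_add_left)
      also have "\<dots> < e" using h(3) by (simp add: mult.commute)
      finally show "y \<in> U" using e(2) by (auto simp: dist_norm norm_minus_commute)
    qed
    then have "integral (cbox x (x + h *\<^sub>R One)) f = 0"
      using z set_lebesgue_integral_eq_integral(2)[OF fi] by metis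
    then show False using d(2)[OF h(1,2)] by simp
  qed
  then have "{x. \<not> (x \<in> U \<longrightarrow> f x = 0)} \<subseteq> N" by blast
  moreover have "N \<in> null_sets lebesgue" using N(1) by (simp add: negligible_iff_null_sets)
  ultimately show ?thesis by (intro AE_I'[of N]) auto
qed

text \<open>Bumps tend boundedly to the indicator of the open box, and the boundary of the box is a
  null set.\<close>

lemma fundamental_lemma_aux:
  fixes f :: "'a::euclidean_space \<Rightarrow> real"
  assumes f: "\<And>\<phi>. Cc_inf U \<phi> \<Longrightarrow> (LINT x:U|lebesgue. \<phi> x * f x) = 0"
    and i: "set_integrable lebesgue (cbox a b) f" and U: "cbox a b \<subseteq> U"
  shows "(LINT x:cbox a b|lebesgue. f x) = 0"
proof -
  have e: "(LINT x:U|lebesgue. bump a b n x * f x) = (LINT x:cbox a b|lebesgue. bump a b n x * f x)" for n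
    unfolding set_lebesgue_integral_def using U bump_outside[of _ a b n] box_subset_cbox[of a b]
    by (intro Bochner_Integration.integral_cong) (auto simp: indicator_def)
  have "(\<lambda>n. LINT x|lebesgue. indicator (cbox a b) x *\<^sub>R (bump a b n x * f x))
      \<longlonglongrightarrow> (LINT x|lebesgue. indicator (cbox a b) x *\<^sub>R (indicator (box a b) x * f x))"
  proof (rule integral_dominated_convergence[where w = "\<lambda>x. norm (indicator (cbox a b) x *\<^sub>R f x)"])
    have fm: "(\<lambda>x. indicator (cbox a b) x *\<^sub>R f x) \<in> borel_measurable lebesgue"
      using i unfolding set_integrable_def by auto
    have bm: "bump a b n \<in> borel_measurable lebesgue" for n
      using Ck_imp_continuous_on[OF Ck_bump[of 0 UNIV a b n]]
      by (intro measurable_completion) (simp add: borel_measurable_continuous_onI)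
    have "(\<lambda>x. bump a b n x * (indicator (cbox a b) x *\<^sub>R f x)) \<in> borel_measurable lebesgue" for n
      by (rule borel_measurable_times[OF bm fm])
    then show "(\<lambda>x. indicator (cbox a b) x *\<^sub>R (bump a b n x * f x)) \<in> borel_measurable lebesgue" for n
      by (simp add: mult.left_commute)
    have "(\<lambda>x. indicator (box a b) x * (indicator (cbox a b) x *\<^sub>R f x)) \<in> borel_measurable lebesgue"
      by (rule borel_measurable_times[OF _ fm]) (simp add: borel_measurable_indicator)
    then show "(\<lambda>x. indicator (cbox a b) x *\<^sub>R (indicator (box a b) x * f x)) \<in> borel_measurable lebesgue"
      by (simp add: mult.left_commute)
    show "integrable lebesgue (\<lambda>x. norm (indicator (cbox a b) x *\<^sub>R f x))"
      using i unfolding set_integrable_def by (rule integrable_norm)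
    show "AE x in lebesgue. (\<lambda>n. indicator (cbox a b) x *\<^sub>R (bump a b n x * f x))
        \<longlonglongrightarrow> indicator (cbox a b) x *\<^sub>R (indicator (box a b) x * f x)"
      by (intro AE_I2 tendsto_intros bump_tendsto)
    show "AE x in lebesgue. norm (indicator (cbox a b) x *\<^sub>R (bump a b n x * f x))
        \<le> norm (indicator (cbox a b) x *\<^sub>R f x)" for n
      using bump_bounds[of a b n] by (intro AE_I2) (auto simp: abs_mult indicator_def mult_left_le_one_le)
  qed
  moreover have "(LINT x|lebesgue. indicator (cbox a b) x *\<^sub>R (indicator (box a b) x * f x))
      = (LINT x|lebesgue. indicator (cbox a b) x *\<^sub>R f x)"
  proof (rule integral_cong_AE)
    have "AE x in lebesgue. x \<notin> cbox a b - box a b"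
      by (rule AE_not_in) (metis negligible_iff_null_sets negligible_frontier_interval)
    then show "AE x in lebesgue. indicator (cbox a b) x *\<^sub>R (indicator (box a b) x * f x)
        = indicator (cbox a b) x *\<^sub>R f x" by eventually_elim (auto simp: indicator_def)
    show fm: "(\<lambda>x. indicator (cbox a b) x *\<^sub>R f x) \<in> borel_measurable lebesgue"
      using i unfolding set_integrable_def by auto
    have "(\<lambda>x. indicator (box a b) x * (indicator (cbox a b) x *\<^sub>R f x)) \<in> borel_measurable lebesgue"
      by (rule borel_measurable_times[OF _ fm]) (simp add: borel_measurable_indicator)
    then show "(\<lambda>x. indicator (cbox a b) x *\<^sub>R (indicator (box a b) x * f x)) \<in> borel_measurable lebesgue"
      by (simp add: mult.left_commute)
  qed
  ultimately show ?thesis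
    using f[OF Cc_inf_bump[OF U]] e unfolding set_lebesgue_integral_def
    by (simp add: LIMSEQ_const_iff)
qed

text \<open>\<open>f\<close> is integrable on boxes inside \<open>U\<close> only. Cutting it off at
  a closed box gives a globally integrable function, to which the differentiation argument applies
  on the open box; countably many boxes exhaust \<open>U\<close>.\<close>

lemma fundamental_lemma:
  fixes f :: "'a::euclidean_space \<Rightarrow> real"
  assumes U: "open U" and f: "\<And>\<phi>. Cc_inf U \<phi> \<Longrightarrow> (LINT x:U|lebesgue. \<phi> x * f x) = 0"
    and i: "\<And>a b. cbox a b \<subseteq> U \<Longrightarrow> set_integrable lebesgue (cbox a b) f"
  shows "AE x in lebesgue. x \<in> U \<longrightarrow> f x = 0"
proof -
  obtain E where E: "countable E" "E \<subseteq> Pow U" "\<And>X. X \<in> E \<Longrightarrow> \<exists>a b. X = cbox a b" "\<Union>E = U"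
    using open_countable_Union_open_cbox[OF U] by metis
  have "AE x in lebesgue. x \<in> X \<longrightarrow> f x = 0" if XE: "X \<in> E" for X
  proof -
    obtain a b where X: "X = cbox a b" using E(3)[OF XE] by auto
    have sub: "cbox a b \<subseteq> U" using E(2) XE X by auto
    have "AE x in lebesgue. x \<in> box a b \<longrightarrow> indicator (cbox a b) x *\<^sub>R f x = 0"
    proof (rule absolutely_integrable_AE_zero)
      show "integrable lebesgue (\<lambda>x. indicator (cbox a b) x *\<^sub>R f x)"
        using i[OF sub] by (simp add: set_integrable_def)
      fix c d assume cd: "cbox c d \<subseteq> box a b"
      then have cd': "cbox c d \<subseteq> cbox a b" using box_subset_cbox by blast
      have "(LINT x:cbox c d|lebesgue. indicator (cbox a b) x *\<^sub>R f x) = (LINT x:cbox c d|lebesgue. f x)"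
        using cd' by (intro set_lebesgue_integral_cong) (auto simp: indicator_def)
      also have "\<dots> = 0"
        using cd' sub by (intro fundamental_lemma_aux[OF f] i) auto
      finally show "(LINT x:cbox c d|lebesgue. indicator (cbox a b) x *\<^sub>R f x) = 0" .
    qed auto
    moreover have "AE x in lebesgue. x \<notin> cbox a b - box a b"
      by (rule AE_not_in) (metis negligible_iff_null_sets negligible_frontier_interval)
    ultimately show ?thesis unfolding X by eventually_elim (auto simp: indicator_def)
  qed
  then have "AE x in lebesgue. \<forall>X\<in>E. x \<in> X \<longrightarrow> f x = 0"
    by (subst AE_ball_countable[OF E(1)]) blast
  then show ?thesis by eventually_elim (use E(4) in blast)
qed

text \<open>By translation invariance the difference quotients of \<open>F\<close> in direction
  \<open>e\<close> have integral zero. They converge to \<open>F' x e\<close> dominatedly, which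
  settles every dimension without iterated integrals.\<close>

lemma integral_derivative_eq_0:
  fixes F :: "'a::euclidean_space \<Rightarrow> 'b::euclidean_space"
  assumes F: "\<And>x. (F has_derivative F' x) (at x)" and c: "continuous_on UNIV (\<lambda>x. F' x e)"
    and K: "compact K" "\<And>x. x \<notin> K \<Longrightarrow> F x = 0"
  shows "(LINT x|lborel. F' x e) = 0"
proof (cases "e = 0")
  case True
  then show ?thesis using F by (simp add: linear_0[OF has_derivative_linear[OF F]])
next
  case False
  have F0: "F' x e = 0" if "x \<notin> K" for x
  proof -
    have "((\<lambda>_. 0) has_derivative (\<lambda>_. 0)) (at x)" by simp
    then have "(F has_derivative (\<lambda>_. 0)) (at x)"
      by (rule has_derivative_transform_within_open[of _ _ _ _ "- K"])
        (use that K compact_imp_closed in auto)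
    then have "F' x = (\<lambda>_. 0)" using F has_derivative_unique by blast
    then show ?thesis by simp
  qed
  have "bounded ((\<lambda>x. F' x e) ` K)"
    using c K(1) by (meson compact_continuous_image compact_imp_bounded continuous_on_subset subset_UNIV)
  then obtain B0 where "\<And>x. x \<in> K \<Longrightarrow> norm (F' x e) \<le> B0" by (auto simp: bounded_iff)
  then have B: "norm (F' x e) \<le> \<bar>B0\<bar>" for x using F0[of x] by (cases "x \<in> K") force+
  obtain r where r: "K \<subseteq> cball 0 r" using compact_imp_bounded[OF K(1)] unfolding bounded_iff subset_iff mem_cball_0 by blast
  define q where "q n x = real (Suc n) *\<^sub>R (F (e /\<^sub>R real (Suc n) + x) - F x)" for n x
  have Fc: "continuous_on UNIV F" using F by (auto intro: has_derivative_continuous_on has_derivative_at_withinI)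
  have Fm [measurable]: "F \<in> borel_measurable borel" by (rule borel_measurable_continuous_onI[OF Fc])
  have Fi: "integrable lborel F"
  proof -
    have "integrable lborel (\<lambda>x. indicator K x *\<^sub>R F x)"
      using borel_integrable_compact[OF K(1) continuous_on_subset[OF Fc subset_UNIV]]
      by (simp add: set_integrable_def indicator_scaleR_eq_if)
    moreover have "(\<lambda>x. indicator K x *\<^sub>R F x) = F" using K(2) by (auto simp: fun_eq_iff indicator_def)
    ultimately show ?thesis by simp
  qed
  have Ft: "integrable lborel (\<lambda>x. F (v + x))" "(LINT x|lborel. F (v + x)) = (LINT x|lborel. F x)" for v
  proof -
    show "integrable lborel (\<lambda>x. F (v + x))"
      using integrable_distr[of "(+) v" lborel borel F] Fi by (simp add: lborel_distr_plus)
    show "(LINT x|lborel. F (v + x)) = (LINT x|lborel. F x)"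
      using integral_distr[of "(+) v" lborel borel F] by (simp add: lborel_distr_plus)
  qed
  have "(LINT x|lborel. q n x) = 0" for n
    unfolding q_def using Ft Fi by simp
  moreover have "(\<lambda>n. LINT x|lborel. q n x) \<longlonglongrightarrow> (LINT x|lborel. F' x e)"
  \<comment> \<open>The increments are at most \<open>norm e\<close> long, so the quotients vanish
    outside the ball enlarged by \<open>norm e\<close>; the mean value inequality bounds them by
    \<open>\<bar>B0\<bar>\<close>.\<close>
  proof (rule integral_dominated_convergence[where w = "\<lambda>x. indicator (cball 0 (r + norm e)) x *\<^sub>R \<bar>B0\<bar>"])
    show "(\<lambda>x. F' x e) \<in> borel_measurable lborel" using c by (simp add: borel_measurable_continuous_onI)
    show "q n \<in> borel_measurable lborel" for n unfolding q_def by simp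
    show "integrable lborel (\<lambda>x. indicator (cball 0 (r + norm e)) x *\<^sub>R \<bar>B0\<bar>)"
      using borel_integrable_compact[of "cball 0 (r + norm e)" "\<lambda>_. \<bar>B0\<bar>"] 
      by (simp add: indicator_scaleR_eq_if)
    show "AE x in lborel. (\<lambda>n. q n x) \<longlonglongrightarrow> F' x e"
    proof (rule AE_I2)
      fix x
      let ?h = "\<lambda>n. e /\<^sub>R real (Suc n)"
      have h0: "?h \<longlonglongrightarrow> 0"
        using tendsto_scaleR[OF LIMSEQ_inverse_real_of_nat tendsto_const[of e]] by simp
      have "((\<lambda>h. norm (F (x + h) - F x - F' x h) / norm h) \<longlongrightarrow> 0) (at 0)"
        using F[of x] by (simp add: has_derivative_at)
      then have "(\<lambda>n. norm (F (x + ?h n) - F x - F' x (?h n)) / norm (?h n)) \<longlonglongrightarrow> 0"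
        by (rule filterlim_compose) (use h0 False in \<open>auto simp: filterlim_at\<close>)
      moreover have "norm (F (x + ?h n) - F x - F' x (?h n)) / norm (?h n) = norm (q n x - F' x e) / norm e" for n
      proof -
        have "q n x - F' x e = real (Suc n) *\<^sub>R (F (x + ?h n) - F x - F' x (?h n))"
          unfolding q_def linear_simps(5)[OF has_derivative_bounded_linear[OF F[of x]]]
          by (simp add: scaleR_diff_right add.commute del: of_nat_Suc)
        then have "norm (q n x - F' x e) = real (Suc n) * norm (F (x + ?h n) - F x - F' x (?h n))"
          by (simp only: norm_scaleR abs_of_nat)
        then show ?thesis using False by (simp add: field_simps del: of_nat_Suc)
      qed
      ultimately have "(\<lambda>n. norm (q n x - F' x e) / norm e * norm e) \<longlonglongrightarrow> 0 * norm e"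
        by (intro tendsto_mult tendsto_const) simp
      then have "(\<lambda>n. norm (q n x - F' x e)) \<longlonglongrightarrow> 0" using False by simp
      then show "(\<lambda>n. q n x) \<longlonglongrightarrow> F' x e" by (metis LIM_zero_cancel tendsto_norm_zero_iff)
    qed
    show "AE x in lborel. norm (q n x) \<le> indicator (cball 0 (r + norm e)) x *\<^sub>R \<bar>B0\<bar>" for n
    proof (rule AE_I2)
      fix x
      let ?t = "inverse (real (Suc n))"
      have "norm (F (x + ?t *\<^sub>R e) - F (x + 0 *\<^sub>R e)) \<le> \<bar>B0\<bar> * norm (?t - 0)"
      proof (rule differentiable_bound[of "{0..?t}" "\<lambda>s. F (x + s *\<^sub>R e)" "\<lambda>s h. F' (x + s *\<^sub>R e) (h *\<^sub>R e)"])
        fix s :: real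
        show "((\<lambda>s. F (x + s *\<^sub>R e)) has_derivative (\<lambda>h. F' (x + s *\<^sub>R e) (h *\<^sub>R e))) (at s within {0..?t})"
          by (rule has_derivative_compose[OF _ F]) (auto intro!: derivative_eq_intros)
        show "onorm (\<lambda>h. F' (x + s *\<^sub>R e) (h *\<^sub>R e)) \<le> \<bar>B0\<bar>"
          using B[of "x + s *\<^sub>R e"]
          by (intro onorm_le) (auto simp: linear_simps(5)[OF has_derivative_bounded_linear[OF F]] mult.commute mult_left_mono)
      qed auto
      then have 1: "norm (q n x) \<le> \<bar>B0\<bar>"
        unfolding q_def norm_scaleR by (simp add: add.commute field_simps del: of_nat_Suc scaleR_right_diff_distrib)
      show "norm (q n x) \<le> indicator (cball 0 (r + norm e)) x *\<^sub>R \<bar>B0\<bar>"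
      proof (cases "x \<in> cball 0 (r + norm e)")
        case False
        then have x: "norm x > r + norm e" by simp
        have "norm x \<le> norm (e /\<^sub>R real (Suc n) + x) + norm (e /\<^sub>R real (Suc n))"
          by (metis add_diff_cancel_left' norm_triangle_ineq4)
        also have "norm (e /\<^sub>R real (Suc n)) \<le> norm e"
          using mult_left_le_one_le[of "norm e" "inverse (real (Suc n))"] by (simp add: field_simps)
        finally have "norm (e /\<^sub>R real (Suc n) + x) > r" "norm x > r" using x norm_ge_zero[of e] by linarith+
        then have "e /\<^sub>R real (Suc n) + x \<notin> K" "x \<notin> K" using r by (auto simp: subset_iff simp del: of_nat_Suc)
        then show ?thesis using K(2) by (simp add: q_def)
      qed (use 1 in simp)
    qed
  qed
  ultimately show ?thesis by (simp add: LIMSEQ_const_iff)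
qed

lemma set_integrable_compact_support:
  fixes f :: "'a::euclidean_space \<Rightarrow> 'b::euclidean_space"
  assumes "compact K" "K \<subseteq> U" "\<And>x. x \<in> U - K \<Longrightarrow> f x = 0" "continuous_on U f"
  shows "set_integrable lebesgue U f"
proof -
  have "integrable lborel (\<lambda>x. indicator K x *\<^sub>R f x)"
    by (rule borel_integrable_compact[OF assms(1) continuous_on_subset[OF assms(4,2)]])
  then have "integrable lebesgue (\<lambda>x. indicator K x *\<^sub>R f x)"
    using integrable_completion borel_measurable_integrable by blast
  moreover have "(\<lambda>x. indicator K x *\<^sub>R f x) = (\<lambda>x. indicator U x *\<^sub>R f x)"
    using assms(2,3) by (auto simp: fun_eq_iff indicator_def)
  ultimately show ?thesis by (simp add: set_integrable_def)
qed

text \<open>\<open>F\<close> is differentiable in \<open>U\<close> only. Its extension by zero is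
  differentiable everywhere, because \<open>U\<close> and the complement of \<open>K\<close> are
  open and cover the space.\<close>

lemma set_integral_derivative_eq_0:
  fixes F :: "'a::euclidean_space \<Rightarrow> 'b::euclidean_space"
  assumes U: "open U" and F: "\<And>x. x \<in> U \<Longrightarrow> (F has_derivative F' x) (at x)"
    and c: "continuous_on U (\<lambda>x. F' x e)"
    and K: "compact K" "K \<subseteq> U" "\<And>x. x \<in> U - K \<Longrightarrow> F x = 0"
  shows "(LINT x:U|lebesgue. F' x e) = 0"
proof -
  define G where "G x = (if x \<in> U then F x else 0)" for x
  define G' where "G' x = (if x \<in> U then F' x else (\<lambda>_. 0))" for x
  have oK: "open (- K)" using K(1) by (simp add: compact_imp_closed open_Compl)
  have G: "(G has_derivative G' x) (at x)" for x
  proof (cases "x \<in> U")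
    case True
    then show ?thesis unfolding G'_def
      using has_derivative_transform_within_open[OF F[OF True] U True, of G] by (simp add: G_def)
  next
    case False
    have "((\<lambda>_. 0) has_derivative (\<lambda>_. 0)) (at x)" by simp
    then have "(G has_derivative (\<lambda>_. 0)) (at x)"
      by (rule has_derivative_transform_within_open[OF _ oK]) (use False K in \<open>auto simp: G_def\<close>)
    then show ?thesis using False by (simp add: G'_def)
  qed
  have G0: "G' x e = 0" if "x \<in> - K" for x
  proof -
    have "((\<lambda>_. 0) has_derivative (\<lambda>_. 0)) (at x)" by simp
    then have "(G has_derivative (\<lambda>_. 0)) (at x)"
      by (rule has_derivative_transform_within_open[OF _ oK]) (use that K in \<open>auto simp: G_def\<close>)
    then have "G' x = (\<lambda>_. 0)" using G has_derivative_unique by blast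
    then show ?thesis by simp
  qed
  have "continuous_on (U \<union> - K) (\<lambda>x. G' x e)"
  proof (rule continuous_on_open_Un[OF U oK])
    show "continuous_on U (\<lambda>x. G' x e)" using c by (simp add: G'_def cong: continuous_on_cong)
    show "continuous_on (- K) (\<lambda>x. G' x e)" by (rule continuous_on_eq[OF continuous_on_const[of _ 0]]) (simp add: G0)
  qed
  moreover have "U \<union> - K = UNIV" using K(2) by blast
  ultimately have c': "continuous_on UNIV (\<lambda>x. G' x e)" by simp
  have "(LINT x|lborel. G' x e) = 0"
    by (rule integral_derivative_eq_0[OF G c' K(1)]) (use K(3) in \<open>auto simp: G_def\<close>)
  moreover have "(LINT x:U|lebesgue. F' x e) = (LINT x|lebesgue. G' x e)"
    unfolding set_lebesgue_integral_def by (intro Bochner_Integration.integral_cong) (auto simp: G'_def)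
  moreover have "(LINT x|lebesgue. G' x e) = (LINT x|lborel. G' x e)"
    by (intro integral_completion) (simp add: borel_measurable_continuous_onI[OF c'])
  ultimately show ?thesis by simp
qed

lemma Cc_infD:
  assumes "Cc_inf U \<phi>"
  obtains K where "compact K" "K \<subseteq> U" "\<And>x. x \<notin> K \<Longrightarrow> \<phi> x = 0"
    "\<And>x. (\<phi> has_derivative frechet_derivative \<phi> (at x)) (at x)"
    "\<And>e. continuous_on UNIV (\<lambda>x. frechet_derivative \<phi> (at x) e)"
    "\<And>x e. x \<notin> K \<Longrightarrow> frechet_derivative \<phi> (at x) e = 0"
proof -
  define K where "K = closure {x. \<phi> x \<noteq> 0}"
  have cK: "closed K" by (simp add: K_def)
  have "Ck (Suc 0) UNIV \<phi>" using assms by (simp add: Cc_inf_def Cinf_def)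
  then obtain D where D: "\<And>x. (\<phi> has_derivative D x) (at x)" "\<And>v. continuous_on UNIV (\<lambda>x. D x v)"
    by (rule Ck_SucE) auto
  have D': "frechet_derivative \<phi> (at x) = D x" for x using frechet_derivative_at[OF D(1)] by simp
  have K0: "\<phi> x = 0" if "x \<notin> K" for x using that closure_subset[of "{x. \<phi> x \<noteq> 0}"] unfolding K_def by blast
  have D0: "D x e = 0" if "x \<notin> K" for x e
  proof -
    have "((\<lambda>_. 0) has_derivative (\<lambda>_. 0)) (at x)" by simp
    then have "(\<phi> has_derivative (\<lambda>_. 0)) (at x)"
      by (rule has_derivative_transform_within_open[of _ _ _ _ "- K"]) (use that K0 cK in auto)
    then have "D x = (\<lambda>_. 0)" using D(1) has_derivative_unique by blast
    then show ?thesis by simp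
  qed
  show ?thesis
  proof (rule that[of K])
    show "compact K" "K \<subseteq> U" using assms by (auto simp: Cc_inf_def K_def)
    show "\<phi> x = 0" "frechet_derivative \<phi> (at x) e = 0" if "x \<notin> K" for x e
      unfolding D' by (rule K0[OF that], rule D0[OF that])
    show "(\<phi> has_derivative frechet_derivative \<phi> (at x)) (at x)" for x unfolding D' by (rule D(1))
    show "continuous_on UNIV (\<lambda>x. frechet_derivative \<phi> (at x) e)" for e unfolding D' by (rule D(2))
  qed
qed

section \<open>Absolutely continuous functions\<close>

text \<open>Finite sets of pairs instead of the indexed families of \<open>abs_cont_on\<close>, so
  that cutting and joining become set operations. Strict inequality rules out degenerate intervals:
  families inside non-overlapping intervals are then disjoint as sets, and sums over their union
  split.\<close>

definition intervals_in :: "real set \<Rightarrow> (real \<times> real) set \<Rightarrow> bool" where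
  "intervals_in S D \<longleftrightarrow> finite D \<and> (\<forall>p\<in>D. fst p < snd p \<and> {fst p..snd p} \<subseteq> S) \<and>
     pairwise (\<lambda>p q. snd p \<le> fst q \<or> snd q \<le> fst p) D"

definition variation_sum :: "(real \<Rightarrow> real) \<Rightarrow> (real \<times> real) set \<Rightarrow> real" where
  "variation_sum f D = (\<Sum>p\<in>D. \<bar>f (snd p) - f (fst p)\<bar>)"

definition total_length :: "(real \<times> real) set \<Rightarrow> real" where
  "total_length D = (\<Sum>p\<in>D. snd p - fst p)"

definition abs_cont_intervals :: "real set \<Rightarrow> (real \<Rightarrow> real) \<Rightarrow> bool" where
  "abs_cont_intervals S f \<longleftrightarrow>
     (\<forall>e>0. \<exists>d>0. \<forall>D. intervals_in S D \<and> total_length D < d \<longrightarrow> variation_sum f D < e)"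

lemma abs_cont_on_imp_intervals:
  assumes "abs_cont_on S f" shows "abs_cont_intervals S f"
  unfolding abs_cont_intervals_def
proof (intro allI impI)
  fix e :: real assume "e > 0"
  with assms obtain d where d: "d > 0"
    "\<forall>(n::nat) (a::nat \<Rightarrow> real) b. (\<forall>k<n. a k \<le> b k \<and> {a k..b k} \<subseteq> S) \<and>
       (\<forall>i<n. \<forall>j<n. i \<noteq> j \<longrightarrow> b i \<le> a j \<or> b j \<le> a i) \<and> (\<Sum>k<n. b k - a k) < d \<longrightarrow>
       (\<Sum>k<n. \<bar>f (b k) - f (a k)\<bar>) < e"
    unfolding abs_cont_on_def by (elim allE[of _ e] impE exE conjE) simp_all
  have "variation_sum f D < e" if D: "intervals_in S D" "total_length D < d" for D
  proof -
    obtain h where h: "bij_betw h {..<card D} D"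
      using D(1) ex_bij_betw_nat_finite[of D] by (auto simp: intervals_in_def atLeast0LessThan)
    have hD: "h k \<in> D" if "k < card D" for k using h that by (auto simp: bij_betw_def)
    have hi: "h i \<noteq> h j" if "i < card D" "j < card D" "i \<noteq> j" for i j
      using h that by (auto simp: bij_betw_def inj_on_def)
    have "(\<Sum>k<card D. \<bar>f (snd (h k)) - f (fst (h k))\<bar>) < e"
    proof (rule d(2)[THEN spec[of _ "card D"], THEN spec[of _ "\<lambda>k. fst (h k)"],
            THEN spec[of _ "\<lambda>k. snd (h k)"], THEN mp], intro conjI)
      show "\<forall>k<card D. fst (h k) \<le> snd (h k) \<and> {fst (h k)..snd (h k)} \<subseteq> S"
        using D(1) hD unfolding intervals_in_def by (auto simp: less_imp_le)
      show "\<forall>i<card D. \<forall>j<card D. i \<noteq> j \<longrightarrow> snd (h i) \<le> fst (h j) \<or> snd (h j) \<le> fst (h i)"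
        using D(1) hD hi unfolding intervals_in_def pairwise_def by blast
      show "(\<Sum>k<card D. snd (h k) - fst (h k)) < d"
        using D(2) sum.reindex_bij_betw[OF h, of "\<lambda>p. snd p - fst p"] by (simp add: total_length_def)
    qed
    then show ?thesis
      using sum.reindex_bij_betw[OF h, of "\<lambda>p. \<bar>f (snd p) - f (fst p)\<bar>"] by (simp add: variation_sum_def)
  qed
  then show "\<exists>d>0. \<forall>D. intervals_in S D \<and> total_length D < d \<longrightarrow> variation_sum f D < e"
    using d(1) by blast
qed

lemma intervals_in_subset: "intervals_in S D \<Longrightarrow> S \<subseteq> T \<Longrightarrow> intervals_in T D"
  unfolding intervals_in_def by (meson subset_trans)

lemma intervals_in_insert:
  assumes "intervals_in S D" "fst u < snd u" "{fst u..snd u} \<subseteq> S"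
    and "\<And>p. p \<in> D \<Longrightarrow> snd p \<le> fst u \<or> snd u \<le> fst p"
  shows "intervals_in S (insert u D)"
  unfolding intervals_in_def pairwise_def
proof (intro conjI ballI impI)
  fix p q assume "p \<in> insert u D" "q \<in> insert u D" "p \<noteq> q"
  then show "snd p \<le> fst q \<or> snd q \<le> fst p"
    using assms(1,4) unfolding intervals_in_def pairwise_def by blast
qed (use assms in \<open>auto simp: intervals_in_def simp del: atLeastatMost_subset_iff\<close>)

text \<open>For refining every interval of a family at once, as in the proof that the variation is
  absolutely continuous.\<close>

lemma intervals_in_Union:
  assumes E: "intervals_in S E" and D: "\<And>p. p \<in> E \<Longrightarrow> intervals_in {fst p..snd p} (D p)"
  shows "intervals_in S (\<Union>p\<in>E. D p)"
    and "(\<Sum>q\<in>(\<Union>p\<in>E. D p). g q) = (\<Sum>p\<in>E. \<Sum>q\<in>D p. (g q :: real))"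
proof -
  have sub: "fst p \<le> fst q" "fst q < snd q" "snd q \<le> snd p" if "p \<in> E" "q \<in> D p" for p q
    using D[OF that(1)] that(2) unfolding intervals_in_def by (auto dest!: bspec)
  have sep: "snd p \<le> fst p' \<or> snd p' \<le> fst p" if "p \<in> E" "p' \<in> E" "p \<noteq> p'" for p p'
    using E that unfolding intervals_in_def pairwise_def by blast
  have ES: "{fst p..snd p} \<subseteq> S" if "p \<in> E" for p
    using E that unfolding intervals_in_def by blast
  have sub': "{fst q..snd q} \<subseteq> S" if "p \<in> E" "q \<in> D p" for p q
  proof -
    have "{fst q..snd q} \<subseteq> {fst p..snd p}" using sub[OF that] by auto
    then show ?thesis using ES[OF that(1)] by blast
  qed
  have fin: "finite E" "\<And>p. p \<in> E \<Longrightarrow> finite (D p)" using E D by (auto simp: intervals_in_def)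
  have pw: "snd q \<le> fst q' \<or> snd q' \<le> fst q"
    if "p \<in> E" "q \<in> D p" "p' \<in> E" "q' \<in> D p'" "q \<noteq> q'" for p q p' q'
  proof (cases "p = p'")
    case True
    then show ?thesis using D[OF that(1)] that unfolding intervals_in_def pairwise_def by blast
  next
    case False
    then show ?thesis using sep[OF that(1,3)] sub[OF that(1,2)] sub[OF that(3,4)] by linarith
  qed
  show "intervals_in S (\<Union>p\<in>E. D p)"
    unfolding intervals_in_def pairwise_def
  proof (intro conjI ballI impI)
    show "finite (\<Union>p\<in>E. D p)" using fin by blast
    fix q assume "q \<in> (\<Union>p\<in>E. D p)"
    then obtain p where p: "p \<in> E" "q \<in> D p" by blast
    show "fst q < snd q" "{fst q..snd q} \<subseteq> S" using sub[OF p] sub'[OF p] by auto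
    fix q' assume "q' \<in> (\<Union>p\<in>E. D p)" "q \<noteq> q'"
    then show "snd q \<le> fst q' \<or> snd q' \<le> fst q" using pw[OF p] by blast
  qed
  show "(\<Sum>q\<in>(\<Union>p\<in>E. D p). g q) = (\<Sum>p\<in>E. \<Sum>q\<in>D p. g q)"
  proof (rule sum.UNION_disjoint)
    show "\<forall>i\<in>E. \<forall>j\<in>E. i \<noteq> j \<longrightarrow> D i \<inter> D j = {}"
    proof (intro ballI impI)
      fix p q assume pq: "p \<in> E" "q \<in> E" "p \<noteq> q"
      have False if "z \<in> D p" "z \<in> D q" for z
        using sep[OF pq] sub[OF pq(1) that(1)] sub[OF pq(2) that(2)] by linarith
      then show "D p \<inter> D q = {}" by blast
    qed
  qed (use fin in auto)
qed

text \<open>Comparing Lebesgue measures of disjoint open intervals avoids any ordering of the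
  family.\<close>

lemma total_length_le:
  assumes "intervals_in {x..y} D" "x \<le> y" shows "total_length D \<le> y - x"
proof -
  have D: "finite D" "\<And>p. p \<in> D \<Longrightarrow> fst p < snd p \<and> x \<le> fst p \<and> snd p \<le> y"
    using assms unfolding intervals_in_def by (auto dest!: bspec)
  have "total_length D = (\<Sum>p\<in>D. measure lborel {fst p<..<snd p})"
    unfolding total_length_def using D(2) by (intro sum.cong) (auto simp: less_imp_le)
  also have "\<dots> = measure lborel (\<Union>p\<in>D. {fst p<..<snd p})"
  proof (rule measure_finite_Union[symmetric])
    show "disjoint_family_on (\<lambda>p. {fst p<..<snd p}) D"
      unfolding disjoint_family_on_def
    proof (intro ballI impI)
      fix p q assume "p \<in> D" "q \<in> D" "p \<noteq> q"
      then have "snd p \<le> fst q \<or> snd q \<le> fst p"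
        using assms(1) unfolding intervals_in_def pairwise_def by blast
      then show "{fst p<..<snd p} \<inter> {fst q<..<snd q} = {}" by auto
    qed
  qed (use D in \<open>auto simp: less_imp_le\<close>)
  also have "\<dots> \<le> measure lborel {x..y}"
  proof (rule measure_mono_fmeasurable)
    show "(\<Union>p\<in>D. {fst p<..<snd p}) \<subseteq> {x..y}"
    proof
      fix t assume "t \<in> (\<Union>p\<in>D. {fst p<..<snd p})"
      then obtain p where "p \<in> D" "fst p < t" "t < snd p" by auto
      then show "t \<in> {x..y}" using D(2)[of p] by auto
    qed
  qed (use D(1) in \<open>auto intro!: fmeasurableI sets.finite_UN simp: emeasure_lborel_Icc_eq\<close>)
  finally show ?thesis using assms(2) by simp
qed

text \<open>At most one interval straddles \<open>y\<close>. Cutting it at \<open>y\<close> does not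
  lower its contribution, by the triangle inequality.\<close>

lemma intervals_in_split:
  assumes D: "intervals_in {x..z} D" and y: "x \<le> y" "y \<le> z"
  obtains D1 D2 where "intervals_in {x..y} D1" "intervals_in {y..z} D2"
    "variation_sum f D \<le> variation_sum f D1 + variation_sum f D2"
proof -
  have fin: "finite D" using D by (simp add: intervals_in_def)
  have p: "x \<le> fst p" "fst p < snd p" "snd p \<le> z" if "p \<in> D" for p
    using D that unfolding intervals_in_def by (auto dest!: bspec)
  have sep: "snd p \<le> fst p' \<or> snd p' \<le> fst p" if "p \<in> D" "p' \<in> D" "p \<noteq> p'" for p p'
    using D that unfolding intervals_in_def pairwise_def by blast
  define L where "L = {p \<in> D. snd p \<le> y}"
  define R where "R = {p \<in> D. y \<le> fst p}"
  have LR: "L \<subseteq> D" "R \<subseteq> D" "L \<inter> R = {}"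
    using p(2) unfolding L_def R_def by (blast, blast, force)
  have L: "intervals_in {x..y} L" and R: "intervals_in {y..z} R"
    using D p fin unfolding intervals_in_def pairwise_def L_def R_def by auto
  show ?thesis
  proof (cases "\<exists>p\<in>D. fst p < y \<and> y < snd p")
    case False
    then have "D = L \<union> R" using p by (force simp: L_def R_def)
    moreover have "finite L" "finite R"
      using finite_subset[OF LR(1) fin] finite_subset[OF LR(2) fin] by auto
    ultimately have "variation_sum f D = variation_sum f L + variation_sum f R"
      unfolding variation_sum_def using LR(3) by (simp add: sum.union_disjoint)
    then show ?thesis using that[OF L R] by simp
  next
    case True
    then obtain u where u: "u \<in> D" "fst u < y" "y < snd u" by blast
    have "D = insert u (L \<union> R)"
    proof
      show "D \<subseteq> insert u (L \<union> R)"
      proof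
        fix q assume q: "q \<in> D"
        show "q \<in> insert u (L \<union> R)"
        proof (cases "q = u")
          case False
          from sep[OF q u(1) False] show ?thesis using u(2,3) q unfolding L_def R_def by force
        qed simp
      qed
    qed (use u(1) LR in blast)
    moreover have "u \<notin> L \<union> R" using u by (auto simp: L_def R_def)
    moreover have finLR: "finite L" "finite R"
      using finite_subset[OF LR(1) fin] finite_subset[OF LR(2) fin] by auto
    ultimately have 1: "variation_sum f D = \<bar>f (snd u) - f (fst u)\<bar> + (variation_sum f L + variation_sum f R)"
      unfolding variation_sum_def using LR(3) by (simp add: sum.union_disjoint)
    have L': "intervals_in {x..y} (insert (fst u, y) L)"
    proof (rule intervals_in_insert[OF L])
      fix q assume "q \<in> L"
      then have "q \<in> D" "snd q \<le> y" "q \<noteq> u" using u by (auto simp: L_def)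
      then show "snd q \<le> fst (fst u, y) \<or> snd (fst u, y) \<le> fst q"
        using sep[of q u] u p(2)[of q] by auto
    qed (use u p[OF u(1)] y in auto)
    have R': "intervals_in {y..z} (insert (y, snd u) R)"
    proof (rule intervals_in_insert[OF R])
      fix q assume "q \<in> R"
      then have "q \<in> D" "y \<le> fst q" "q \<noteq> u" using u by (auto simp: R_def)
      then show "snd q \<le> fst (y, snd u) \<or> snd (y, snd u) \<le> fst q"
        using sep[of q u] u p(2)[of q] by auto
    qed (use u p[OF u(1)] y in auto)
    have "(fst u, y) \<notin> D"
    proof
      assume "(fst u, y) \<in> D"
      moreover have "(fst u, y) \<noteq> u" using u by (auto simp: prod_eq_iff)
      ultimately show False using sep[of "(fst u, y)" u] u by auto
    qed
    moreover have "(y, snd u) \<notin> D"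
    proof
      assume "(y, snd u) \<in> D"
      moreover have "(y, snd u) \<noteq> u" using u by (auto simp: prod_eq_iff)
      ultimately show False using sep[of "(y, snd u)" u] u by auto
    qed
    ultimately have "(fst u, y) \<notin> L" "(y, snd u) \<notin> R" using LR by auto
    then have "variation_sum f D \<le> variation_sum f (insert (fst u, y) L) + variation_sum f (insert (y, snd u) R)"
      using 1 finLR unfolding variation_sum_def by simp
    then show ?thesis using that[OF L' R'] by blast
  qed
qed

section \<open>Total variation of an absolutely continuous function\<close>

definition variation :: "(real \<Rightarrow> real) \<Rightarrow> real \<Rightarrow> real \<Rightarrow> real" where
  "variation f x y = Sup (variation_sum f ` {D. intervals_in {x..y} D})"

context
  fixes f :: "real \<Rightarrow> real" and a b :: real
  assumes ac: "abs_cont_intervals {a..b} f"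
begin

text \<open>With the \<open>d\<close> that belongs to \<open>e = 1\<close>, a stretch shorter than
  \<open>d\<close> contributes less than \<open>1\<close>. The induction is over the number of
  stretches of length \<open>d / 2\<close> that cover the interval.\<close>

lemma variation_sum_bdd: "a \<le> x \<Longrightarrow> x \<le> y \<Longrightarrow> y \<le> b \<Longrightarrow> \<exists>C. \<forall>D. intervals_in {x..y} D \<longrightarrow> variation_sum f D \<le> C"
proof -
  obtain d where d: "d > 0" "\<And>D. intervals_in {a..b} D \<Longrightarrow> total_length D < d \<Longrightarrow> variation_sum f D < 1"
    using ac unfolding abs_cont_intervals_def by (metis zero_less_one)
  have *: "\<exists>C. \<forall>D. intervals_in {x..y} D \<longrightarrow> variation_sum f D \<le> C"
    if "y - x \<le> real n * (d / 2)" "a \<le> x" "x \<le> y" "y \<le> b" for n x y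
    using that
  proof (induction n arbitrary: y)
    case 0
    then have "y = x" by simp
    have "variation_sum f D < 1" if "intervals_in {x..y} D" for D
      using that total_length_le[OF that] \<open>y = x\<close> d(1) 0 by (intro d(2)) (auto intro: intervals_in_subset)
    then show ?case by (meson less_imp_le)
  next
    case (Suc n)
    define m where "m = max x (y - d / 2)"
    have m: "x \<le> m" "m \<le> y" "m - x \<le> real n * (d / 2)" "y - m < d"
      using Suc.prems d(1) by (auto simp: m_def max_def algebra_simps)
    obtain C where C: "\<And>D. intervals_in {x..m} D \<Longrightarrow> variation_sum f D \<le> C"
      using Suc.IH[of m] m Suc.prems by auto
    have "variation_sum f D \<le> C + 1" if iD: "intervals_in {x..y} D" for D
    proof -
      obtain D1 D2 where D: "intervals_in {x..m} D1" "intervals_in {m..y} D2"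
        "variation_sum f D \<le> variation_sum f D1 + variation_sum f D2"
        using intervals_in_split[OF iD m(1,2)] by metis
      have "variation_sum f D2 < 1"
        using D(2) total_length_le[OF D(2)] m Suc.prems by (intro d(2)) (auto elim!: intervals_in_subset)
      then show ?thesis using D(3) C[OF D(1)] by linarith
    qed
    then show ?case by blast
  qed
  assume xy: "a \<le> x" "x \<le> y" "y \<le> b"
  obtain n where "(y - x) / (d / 2) \<le> real n" using real_arch_simple by blast
  then have "y - x \<le> real n * (d / 2)" using d(1) by (simp add: field_simps)
  then show ?thesis using *[of y x n] xy by blast
qed

lemma variation_bdd_above: "a \<le> x \<Longrightarrow> x \<le> y \<Longrightarrow> y \<le> b \<Longrightarrow> bdd_above (variation_sum f ` {D. intervals_in {x..y} D})"
  using variation_sum_bdd[of x y] by (auto simp: bdd_above_def)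

lemma variation_sum_le_variation:
  "a \<le> x \<Longrightarrow> x \<le> y \<Longrightarrow> y \<le> b \<Longrightarrow> intervals_in {x..y} D \<Longrightarrow> variation_sum f D \<le> variation f x y"
  unfolding variation_def by (intro cSup_upper variation_bdd_above) auto

lemma intervals_in_empty: "intervals_in S {}"
  by (simp add: intervals_in_def)

lemma variation_approx:
  assumes "a \<le> x" "x \<le> y" "y \<le> b" "e > 0"
  obtains D where "intervals_in {x..y} D" "variation f x y < variation_sum f D + e"
proof -
  have "variation f x y - e < Sup (variation_sum f ` {D. intervals_in {x..y} D})"
    using assms unfolding variation_def by simp
  then obtain v where "v \<in> variation_sum f ` {D. intervals_in {x..y} D}" "variation f x y - e < v"
    by (rule less_cSupE) (use intervals_in_empty in blast)
  then show ?thesis using that by force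
qed

text \<open>Additivity, in spite of the name: a family on the long interval can be cut at
  \<open>y\<close>, and near-optimal families on both sides can be joined.\<close>

lemma variation_triangle:
  assumes "a \<le> x" "x \<le> y" "y \<le> z" "z \<le> b"
  shows "variation f x z = variation f x y + variation f y z"
proof (rule antisym)
  show "variation f x z \<le> variation f x y + variation f y z"
    unfolding variation_def[of f x z]
  proof (rule cSup_least)
    show "variation_sum f ` {D. intervals_in {x..z} D} \<noteq> {}" using intervals_in_empty by blast
    fix v assume "v \<in> variation_sum f ` {D. intervals_in {x..z} D}"
    then obtain D where D: "intervals_in {x..z} D" "v = variation_sum f D" by blast
    obtain D1 D2 where "intervals_in {x..y} D1" "intervals_in {y..z} D2"
        "variation_sum f D \<le> variation_sum f D1 + variation_sum f D2"
      using intervals_in_split[OF D(1) assms(2,3)] by metis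
    then show "v \<le> variation f x y + variation f y z"
      using D(2) variation_sum_le_variation[of x y D1] variation_sum_le_variation[of y z D2] assms by linarith
  qed
  show "variation f x y + variation f y z \<le> variation f x z"
  proof (rule field_le_epsilon)
    fix e :: real assume "e > 0"
    then have e: "e / 2 > 0" by simp
    obtain D1 where D1: "intervals_in {x..y} D1" "variation f x y < variation_sum f D1 + e / 2"
      using variation_approx[OF _ _ _ e] assms by (metis order_trans)
    obtain D2 where D2: "intervals_in {y..z} D2" "variation f y z < variation_sum f D2 + e / 2"
      using variation_approx[OF _ _ _ e] assms by (metis order_trans)
    have b1: "snd p \<le> y" "fst p < snd p" if "p \<in> D1" for p using D1(1) that unfolding intervals_in_def by (auto dest!: bspec)
    have b2: "y \<le> fst p" "fst p < snd p" if "p \<in> D2" for p using D2(1) that unfolding intervals_in_def by (auto dest!: bspec)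
    have "intervals_in {x..z} D1" "intervals_in {x..z} D2"
      using D1(1) D2(1) assms by (auto elim!: intervals_in_subset)
    then have "intervals_in {x..z} (D1 \<union> D2)"
      using b1(1) b2(1) unfolding intervals_in_def pairwise_def by (metis (no_types, lifting) UnE finite_UnI order_trans)
    moreover have "D1 \<inter> D2 = {}" using b1 b2 by fastforce
    then have "variation_sum f (D1 \<union> D2) = variation_sum f D1 + variation_sum f D2"
      using D1(1) D2(1) unfolding variation_sum_def intervals_in_def by (simp add: sum.union_disjoint)
    ultimately show "variation f x y + variation f y z \<le> variation f x z + e"
      using variation_sum_le_variation[of x z "D1 \<union> D2"] D1(2) D2(2) assms by linarith
  qed
qed

lemma abs_diff_le_variation:
  assumes "a \<le> x" "x \<le> y" "y \<le> b" shows "\<bar>f y - f x\<bar> \<le> variation f x y"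
proof (cases "x = y")
  case True
  then show ?thesis using variation_sum_le_variation[OF assms intervals_in_empty] by (simp add: variation_sum_def)
next
  case False
  then have i: "intervals_in {x..y} {(x, y)}" using assms by (simp add: intervals_in_def)
  show ?thesis using variation_sum_le_variation[OF assms i] by (simp add: variation_sum_def)
qed

text \<open>Replacing every interval of \<open>E\<close> by a near-optimal family inside it does not
  increase the total length, so the \<open>d\<close> that works for \<open>f\<close> and
  \<open>e / 2\<close> works for the variation and \<open>e\<close>.\<close>

lemma abs_cont_variation: "abs_cont_intervals {a..b} (variation f a)"
  unfolding abs_cont_intervals_def
proof (intro allI impI)
  fix e :: real assume e: "e > 0"
  then obtain d where d: "d > 0" "\<And>D. intervals_in {a..b} D \<Longrightarrow> total_length D < d \<Longrightarrow> variation_sum f D < e / 2"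
    using ac unfolding abs_cont_intervals_def by (metis half_gt_zero)
  have "variation_sum (variation f a) E < e" if E: "intervals_in {a..b} E" "total_length E < d" for E
  proof -
    have p: "a \<le> fst p" "fst p < snd p" "snd p \<le> b" if "p \<in> E" for p
      using E(1) that unfolding intervals_in_def by (auto dest!: bspec)
    \<comment> \<open>The slack per interval: summed over \<open>E\<close> it is at most
      \<open>e / 2\<close>. The summand \<open>1\<close> covers an empty \<open>E\<close>.\<close>
    define n where "n = e / (2 * (real (card E) + 1))"
    have n: "n > 0" using e by (auto simp: n_def intro!: divide_pos_pos)
    have "\<forall>p\<in>E. \<exists>D. intervals_in {fst p..snd p} D \<and> variation f (fst p) (snd p) < variation_sum f D + n"
      using variation_approx[OF _ _ _ n] p by (metis less_imp_le)
    then obtain D where D: "\<And>p. p \<in> E \<Longrightarrow> intervals_in {fst p..snd p} (D p)"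
      "\<And>p. p \<in> E \<Longrightarrow> variation f (fst p) (snd p) < variation_sum f (D p) + n" by metis
    note U = intervals_in_Union[OF E(1) D(1)]
    have "total_length (\<Union>p\<in>E. D p) = (\<Sum>p\<in>E. total_length (D p))"
      unfolding total_length_def by (rule U(2))
    also have "\<dots> \<le> total_length E"
      unfolding total_length_def[of E] using p D(1) by (intro sum_mono total_length_le) (auto simp: less_imp_le)
    finally have "variation_sum f (\<Union>p\<in>E. D p) < e / 2" using E(2) U(1) d(2) by fastforce
    moreover have "variation_sum f (\<Union>p\<in>E. D p) = (\<Sum>p\<in>E. variation_sum f (D p))"
      unfolding variation_sum_def by (rule U(2))
    moreover have "variation_sum (variation f a) E \<le> (\<Sum>p\<in>E. variation_sum f (D p) + n)"
      unfolding variation_sum_def[of _ E]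
    proof (rule sum_mono)
      fix q assume q: "q \<in> E"
      have "variation f a (snd q) = variation f a (fst q) + variation f (fst q) (snd q)"
        using p[OF q] by (intro variation_triangle) auto
      moreover have "0 \<le> variation f (fst q) (snd q)"
        using abs_diff_le_variation[of "fst q" "snd q"] p[OF q] by linarith
      ultimately show "\<bar>variation f a (snd q) - variation f a (fst q)\<bar> \<le> variation_sum f (D q) + n"
        using D(2)[OF q] by simp
    qed
    moreover have "(\<Sum>p\<in>E. variation_sum f (D p) + n) = (\<Sum>p\<in>E. variation_sum f (D p)) + real (card E) * n"
      by (simp add: sum.distrib)
    moreover have "real (card E) * n \<le> e / 2" using e by (simp add: n_def field_simps)
    ultimately show ?thesis by linarith
  qed
  then show "\<exists>d>0. \<forall>D. intervals_in {a..b} D \<and> total_length D < d \<longrightarrow> variation_sum (variation f a) D < e"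
    using d(1) by blast
qed

end

lemma abs_cont_intervals_diff:
  assumes "abs_cont_intervals S f" "abs_cont_intervals S g"
  shows "abs_cont_intervals S (\<lambda>x. f x - g x)"
  unfolding abs_cont_intervals_def
proof (intro allI impI)
  fix e :: real assume e: "e > 0"
  obtain d1 where d1: "d1 > 0" "\<And>D. intervals_in S D \<Longrightarrow> total_length D < d1 \<Longrightarrow> variation_sum f D < e / 2"
    using assms(1) e unfolding abs_cont_intervals_def by (metis half_gt_zero)
  obtain d2 where d2: "d2 > 0" "\<And>D. intervals_in S D \<Longrightarrow> total_length D < d2 \<Longrightarrow> variation_sum g D < e / 2"
    using assms(2) e unfolding abs_cont_intervals_def by (metis half_gt_zero)
  have "variation_sum (\<lambda>x. f x - g x) D < e" if "intervals_in S D" "total_length D < min d1 d2" for D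
  proof -
    have "variation_sum (\<lambda>x. f x - g x) D \<le> variation_sum f D + variation_sum g D"
      unfolding variation_sum_def sum.distrib[symmetric] by (rule sum_mono) linarith
    then show ?thesis using d1(2)[OF that(1)] d2(2)[OF that(1)] that(2) by linarith
  qed
  then show "\<exists>d>0. \<forall>D. intervals_in S D \<and> total_length D < d \<longrightarrow> variation_sum (\<lambda>x. f x - g x) D < e"
    using d1(1) d2(1) by (intro exI[of _ "min d1 d2"]) auto
qed

lemma abs_cont_intervals_imp_continuous:
  assumes "abs_cont_intervals {a..b} f" shows "continuous_on {a..b} f"
  unfolding continuous_on_iff
proof (intro ballI allI impI)
  fix x e :: real assume x: "x \<in> {a..b}" and e: "e > 0"
  obtain d where d: "d > 0" "\<And>D. intervals_in {a..b} D \<Longrightarrow> total_length D < d \<Longrightarrow> variation_sum f D < e"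
    using assms e unfolding abs_cont_intervals_def by metis
  have "dist (f y) (f x) < e" if y: "y \<in> {a..b}" "dist y x < d" for y
  proof (cases "x = y")
    case False
    have i: "intervals_in {a..b} {(min x y, max x y)}" 
      using x y False by (auto simp: intervals_in_def)
    have "variation_sum f {(min x y, max x y)} < e"
      using y(2) by (intro d(2)[OF i]) (auto simp: total_length_def dist_real_def)
    then show ?thesis by (auto simp: variation_sum_def dist_real_def min_def max_def split: if_splits)
  qed (use e in simp)
  then show "\<exists>d>0. \<forall>x'\<in>{a..b}. dist x' x < d \<longrightarrow> dist (f x') (f x) < e" using d(1) by blast
qed

text \<open>The Stieltjes measure of an increasing absolutely continuous function has a Radon--Nikodym density.\<close>

lemma mono_abs_cont_eq_integral:
  fixes F :: "real \<Rightarrow> real"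
  assumes ab: "a < b" and mono: "\<And>x y. a \<le> x \<Longrightarrow> x \<le> y \<Longrightarrow> y \<le> b \<Longrightarrow> F x \<le> F y"
    and ac: "abs_cont_intervals {a..b} F"
  obtains g where "set_integrable lborel {a..b} g"
    "\<And>x. x \<in> {a..b} \<Longrightarrow> F x - F a = (LINT t:{a..x}|lborel. g t)"
proof -
  \<comment> \<open>\<open>F\<close> frozen outside \<open>[a, b]\<close>: a continuous increasing
    function on the whole line, as \<open>interval_measure\<close> requires.\<close>
  define G where "G x = F (max a (min b x))" for x
  have cl: "max a (min b x) \<in> {a..b}" for x using ab by auto
  have GF: "G x = F x" if "x \<in> {a..b}" for x using that by (simp add: G_def)
  have Gm: "G x \<le> G y" if "x \<le> y" for x y unfolding G_def using ab that by (intro mono) auto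
  have Gc: "continuous_on UNIV G" unfolding G_def
    by (rule continuous_on_compose2[OF abs_cont_intervals_imp_continuous[OF ac]])
      (use cl in \<open>auto intro!: continuous_intros\<close>)
  define \<mu> where "\<mu> = interval_measure G"
  have Icc: "emeasure \<mu> {x..y} = ennreal (G y - G x)" if "x \<le> y" for x y
    unfolding \<mu>_def using Gm Gc that by (intro emeasure_interval_measure_Icc) auto
  have s\<mu> [measurable_cong, simp]: "sets \<mu> = sets borel" by (simp add: \<mu>_def)
  define \<nu> where "\<nu> = density \<mu> (indicator {a..b})"
  have e\<nu>: "emeasure \<nu> A = emeasure \<mu> ({a..b} \<inter> A)" if "A \<in> sets borel" for A
  proof -
    have "emeasure \<nu> A = (\<integral>\<^sup>+x. indicator {a..b} x * indicator A x \<partial>\<mu>)"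
      unfolding \<nu>_def using that by (intro emeasure_density) auto
    also have "\<dots> = (\<integral>\<^sup>+x. indicator ({a..b} \<inter> A) x \<partial>\<mu>)"
      by (intro nn_integral_cong) (simp add: indicator_inter_arith)
    also have "\<dots> = emeasure \<mu> ({a..b} \<inter> A)"
      using that by (intro nn_integral_indicator) auto
    finally show ?thesis .
  qed
  \<comment> \<open>A null set lies in an open set of small measure, and its part in
    \<open>[a, b]\<close> is covered by countably many non-overlapping intervals inside that set.
    Absolute continuity of \<open>F\<close> bounds the Stieltjes measure of every finite union of
    them.\<close>
  have ac': "absolutely_continuous lborel \<nu>"
    unfolding absolutely_continuous_def
  proof
    fix N :: "real set" assume N: "N \<in> null_sets lborel"
    then have Nb: "N \<in> sets borel" by auto
    have small: "emeasure \<mu> ({a..b} \<inter> N) \<le> ennreal e" if e: "e > 0" for e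
    proof -
      obtain d where d: "d > 0" "\<And>D. intervals_in {a..b} D \<Longrightarrow> total_length D < d \<Longrightarrow> variation_sum F D < e"
        using ac e unfolding abs_cont_intervals_def by metis
      obtain U where U: "open U" "N \<subseteq> U" "emeasure lborel (U - N) < ennreal d"
        using outer_regular_lborel[OF Nb, of d] d(1) by auto
      have Ud: "emeasure lborel U < ennreal d"
      proof -
        have "emeasure lborel U \<le> emeasure lborel (U - N) + emeasure lborel N"
          using U(1) Nb N U(2) by (metis Un_Diff_cancel2 emeasure_subadditive sets.Diff sets_lborel borel_open sup.absorb1)
        then show ?thesis using U(3) N by (simp add: null_setsD1)
      qed
      \<comment> \<open>With this gauge a cell that is tagged in \<open>N\<close> lies inside
        \<open>U\<close>.\<close>
      obtain g where g: "gauge g" "\<And>x. x \<in> U \<Longrightarrow> g x \<subseteq> U"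
        using U(1) by (intro that[of "\<lambda>x. if x \<in> U then U else UNIV"]) (auto simp: gauge_def)
      obtain \<D> where D: "countable \<D>" "\<Union>\<D> \<subseteq> cbox a b"
        "\<And>K. K \<in> \<D> \<Longrightarrow> interior K \<noteq> {} \<and> (\<exists>c d. K = cbox c d)"
        "pairwise (\<lambda>A B. interior A \<inter> interior B = {}) \<D>"
        "\<And>K. K \<in> \<D> \<Longrightarrow> \<exists>x \<in> ({a..b} \<inter> N) \<inter> K. K \<subseteq> g x" "({a..b} \<inter> N) \<subseteq> \<Union>\<D>"
        by (rule covering_lemma[of "{a..b} \<inter> N" a b g]) (use ab g(1) in \<open>auto simp: cbox_interval\<close>)
      have "\<forall>K\<in>\<D>. \<exists>p. K = {fst p..snd p} \<and> fst p < snd p"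
      proof
        fix K assume K: "K \<in> \<D>"
        then obtain c d where cd: "K = {c..d}" using D(3)[OF K] by (auto simp: cbox_interval)
        moreover have "c < d" using D(3)[OF K] by (simp add: cd interior_atLeastAtMost_real)
        ultimately show "\<exists>p. K = {fst p..snd p} \<and> fst p < snd p" by (intro exI[of _ "(c, d)"]) simp
      qed
      then obtain P where P: "\<And>K. K \<in> \<D> \<Longrightarrow> K = {fst (P K)..snd (P K)}" "\<And>K. K \<in> \<D> \<Longrightarrow> fst (P K) < snd (P K)"
        by metis
      have Pinj: "inj_on P \<D>" using P(1) by (metis inj_onI)
      have fin: "emeasure \<mu> (\<Union>\<F>) \<le> ennreal e" if FF: "finite \<F>" "\<F> \<subseteq> \<D>" for \<F>
      proof -
        have K: "K = {fst (P K)..snd (P K)}" "fst (P K) < snd (P K)" "a \<le> fst (P K)" "snd (P K) \<le> b" if "K \<in> \<F>" for K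
        proof -
          show 1: "K = {fst (P K)..snd (P K)}" "fst (P K) < snd (P K)" using P FF that by auto
          have "K \<subseteq> {a..b}" using D(2) FF(2) that by (auto simp: cbox_interval)
          then show "a \<le> fst (P K)" "snd (P K) \<le> b" using 1 by (metis atLeastatMost_subset_iff less_imp_le not_le)+
        qed
        have int: "intervals_in {a..b} (P ` \<F>)"
          unfolding intervals_in_def
        proof (intro conjI ballI)
          show "pairwise (\<lambda>p q. snd p \<le> fst q \<or> snd q \<le> fst p) (P ` \<F>)"
          proof (rule pairwise_imageI)
            fix A B assume AB: "A \<in> \<F>" "B \<in> \<F>" "A \<noteq> B"
            have "interior A \<inter> interior B = {}" using D(4) FF(2) AB by (auto simp: pairwise_def)
            then have "{fst (P A)<..<snd (P A)} \<inter> {fst (P B)<..<snd (P B)} = {}"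
              using K(1)[OF AB(1)] K(1)[OF AB(2)] by (metis interior_atLeastAtMost_real)
            then show "snd (P A) \<le> fst (P B) \<or> snd (P B) \<le> fst (P A)"
              using K(2)[OF AB(1)] K(2)[OF AB(2)] dense[of "max (fst (P A)) (fst (P B))" "min (snd (P A)) (snd (P B))"]
              by (auto simp: disjoint_iff not_le)
          qed
        qed (use FF K in auto)
        have PF: "inj_on P \<F>" using Pinj FF(2) by (rule inj_on_subset)
        have "total_length (P ` \<F>) = (\<Sum>A\<in>\<F>. snd (P A) - fst (P A))"
          unfolding total_length_def sum.reindex[OF PF] by simp
        moreover have "(\<Sum>A\<in>\<F>. emeasure lborel {fst (P A)<..<snd (P A)}) = (\<Sum>A\<in>\<F>. ennreal (snd (P A) - fst (P A)))"
          using K(2) by (intro sum.cong) (auto simp: less_imp_le)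
        moreover have "(\<Sum>A\<in>\<F>. ennreal (snd (P A) - fst (P A))) = ennreal (\<Sum>A\<in>\<F>. snd (P A) - fst (P A))"
          using K(2) by (intro sum_ennreal) (simp add: less_imp_le)
        ultimately have "ennreal (total_length (P ` \<F>)) = (\<Sum>A\<in>\<F>. emeasure lborel {fst (P A)<..<snd (P A)})" by simp
        also have "\<dots> = emeasure lborel (\<Union>A\<in>\<F>. {fst (P A)<..<snd (P A)})"
        proof (rule sum_emeasure)
          show "disjoint_family_on (\<lambda>A. {fst (P A)<..<snd (P A)}) \<F>"
            unfolding disjoint_family_on_def
          proof (intro ballI impI)
            fix A B assume AB: "A \<in> \<F>" "B \<in> \<F>" "A \<noteq> B"
            have "interior A \<inter> interior B = {}" using D(4) FF(2) AB by (auto simp: pairwise_def)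
            then show "{fst (P A)<..<snd (P A)} \<inter> {fst (P B)<..<snd (P B)} = {}"
              using K(1)[OF AB(1)] K(1)[OF AB(2)] by (metis interior_atLeastAtMost_real)
          qed
        qed (use FF in auto)
        also have "\<dots> \<le> emeasure lborel U"
        proof (rule emeasure_mono)
          show "(\<Union>A\<in>\<F>. {fst (P A)<..<snd (P A)}) \<subseteq> U"
          proof
            fix t assume "t \<in> (\<Union>A\<in>\<F>. {fst (P A)<..<snd (P A)})"
            then obtain A where A: "A \<in> \<F>" "t \<in> {fst (P A)<..<snd (P A)}" by blast
            then have "t \<in> A" using K(1)[OF A(1)] by (metis greaterThanLessThan_subseteq_atLeastAtMost_iff order_refl subsetD)
            moreover obtain x where "x \<in> N" "A \<subseteq> g x" using D(5) A(1) FF(2) by blast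
            ultimately show "t \<in> U" using g(2) U(2) by blast
          qed
        qed (use U(1) in simp)
        also note Ud
        finally have "ennreal (total_length (P ` \<F>)) < ennreal d" .
        moreover have "0 \<le> total_length (P ` \<F>)"
          unfolding total_length_def by (rule sum_nonneg) (use K(2) in \<open>auto simp: less_imp_le\<close>)
        ultimately have "total_length (P ` \<F>) < d" by (simp add: ennreal_less_iff)
        then have v: "variation_sum F (P ` \<F>) < e" using d(2)[OF int] by blast
        have "emeasure \<mu> (\<Union>\<F>) \<le> (\<Sum>A\<in>\<F>. emeasure \<mu> A)"
        proof -
          have "A \<in> sets \<mu>" if "A \<in> \<F>" for A
            unfolding s\<mu> by (subst K(1)[OF that]) simp
          then have "(\<lambda>x. x) ` \<F> \<subseteq> sets \<mu>" by auto
          then show ?thesis using emeasure_subadditive_finite[OF FF(1), of "\<lambda>x. x" \<mu>] by simp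
        qed
        also have "\<dots> = (\<Sum>A\<in>\<F>. ennreal \<bar>F (snd (P A)) - F (fst (P A))\<bar>)"
        proof (rule sum.cong[OF refl])
          fix A assume A: "A \<in> \<F>"
          have "emeasure \<mu> A = ennreal (G (snd (P A)) - G (fst (P A)))"
            using Icc[of "fst (P A)" "snd (P A)"] K[OF A] by simp
          also have "G (snd (P A)) - G (fst (P A)) = \<bar>F (snd (P A)) - F (fst (P A))\<bar>"
            using K(2-)[OF A] mono[of "fst (P A)" "snd (P A)"] by (simp add: GF)
          finally show "emeasure \<mu> A = ennreal \<bar>F (snd (P A)) - F (fst (P A))\<bar>" .
        qed
        also have "\<dots> = ennreal (variation_sum F (P ` \<F>))"
          unfolding variation_sum_def sum.reindex[OF PF] by (simp add: sum_ennreal)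
        also have "\<dots> \<le> ennreal e" using v by (simp add: ennreal_leI less_imp_le)
        finally show ?thesis .
      qed
      show ?thesis
      proof (cases "\<D> = {}")
        case False
        \<comment> \<open>The countably many cells are turned into an increasing sequence of finite
          unions, so the bound \<open>e\<close> passes to the supremum.\<close>
        define A where "A n = (\<Union>k\<le>n. from_nat_into \<D> k)" for n
        have "(SUP n. emeasure \<mu> (A n)) = emeasure \<mu> (\<Union>n. A n)"
        proof (rule SUP_emeasure_incseq)
          have "from_nat_into \<D> k \<in> sets borel" for k
            by (subst P(1)[OF from_nat_into[OF False, of k]]) simp
          then show "range A \<subseteq> sets \<mu>" unfolding A_def by auto
          show "incseq A" unfolding A_def by (intro monoI UN_mono) auto
        qed
        moreover have "emeasure \<mu> (A n) \<le> ennreal e" for n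
          unfolding A_def using fin[of "from_nat_into \<D> ` {..n}"] from_nat_into[OF False] by auto
        then have "(SUP n. emeasure \<mu> (A n)) \<le> ennreal e" by (rule SUP_least)
        moreover have "{a..b} \<inter> N \<subseteq> (\<Union>n. A n)"
        proof
          fix t assume "t \<in> {a..b} \<inter> N"
          then obtain K where K: "K \<in> \<D>" "t \<in> K" using D(6) by blast
          then have "K = from_nat_into \<D> (to_nat_on \<D> K)" using D(1) by simp
          then show "t \<in> (\<Union>n. A n)" using K unfolding A_def by blast
        qed
        moreover have "(\<Union>n. A n) \<in> sets \<mu>"
        proof -
          have "from_nat_into \<D> k \<in> sets borel" for k
            by (subst P(1)[OF from_nat_into[OF False, of k]]) simp
          then show ?thesis unfolding A_def by auto
        qed
        ultimately show ?thesis by (metis emeasure_mono order_trans)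
      qed (use D(6) in simp)
    qed
    have "emeasure \<mu> ({a..b} \<inter> N) \<le> 0"
      by (rule ennreal_le_epsilon) (use small in simp)
    then show "N \<in> null_sets \<nu>" using e\<nu>[OF Nb] Nb by (auto simp: null_sets_def \<nu>_def)
  qed
  obtain h where h: "h \<in> borel_measurable lborel" "density lborel h = \<nu>"
    using sigma_finite_measure.Radon_Nikodym[OF sigma_finite_lborel ac'] by (auto simp: \<nu>_def)
  have nn: "(\<integral>\<^sup>+t. h t * indicator {a..x} t \<partial>lborel) = ennreal (F x - F a)" if x: "x \<in> {a..b}" for x
  proof -
    have "(\<integral>\<^sup>+t. h t * indicator {a..x} t \<partial>lborel) = emeasure \<nu> {a..x}"
      unfolding h(2)[symmetric] using h(1) by (simp add: emeasure_density)
    also have "\<dots> = emeasure \<mu> {a..x}" using e\<nu>[of "{a..x}"] x by (simp add: Int_absorb1 Int_commute)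
    also have "\<dots> = ennreal (F x - F a)" using Icc[of a x] x ab by (simp add: GF)
    finally show ?thesis .
  qed
  have AEf: "AE t in lborel. h t * indicator {a..b} t \<noteq> \<infinity>"
    using nn[of b] ab h(1) by (intro nn_integral_noteq_infinite) auto
  define g where "g t = enn2real (h t)" for t
  have [measurable]: "g \<in> borel_measurable lborel" using h(1) unfolding g_def by simp
  have eq: "(\<integral>\<^sup>+t. ennreal (indicator {a..x} t *\<^sub>R g t) \<partial>lborel) = ennreal (F x - F a)" if x: "x \<in> {a..b}" for x
  proof -
    have "(\<integral>\<^sup>+t. ennreal (indicator {a..x} t *\<^sub>R g t) \<partial>lborel) = (\<integral>\<^sup>+t. h t * indicator {a..x} t \<partial>lborel)"
    proof (rule nn_integral_cong_AE)
      show "AE t in lborel. ennreal (indicator {a..x} t *\<^sub>R g t) = h t * indicator {a..x} t"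
        using AEf by eventually_elim
          (use x in \<open>auto simp: g_def indicator_def ennreal_enn2real less_top split: if_splits\<close>)
    qed
    then show ?thesis using nn[OF x] by simp
  qed
  have int: "integrable lborel (\<lambda>t. indicator {a..x} t *\<^sub>R g t)" if "x \<in> {a..b}" for x
  proof (rule integrableI_nonneg)
    show "(\<lambda>t. indicator {a..x} t *\<^sub>R g t) \<in> borel_measurable lborel" by measurable
    show "AE t in lborel. 0 \<le> indicator {a..x} t *\<^sub>R g t" by (simp add: g_def)
    show "(\<integral>\<^sup>+t. ennreal (indicator {a..x} t *\<^sub>R g t) \<partial>lborel) < \<infinity>" unfolding eq[OF that] by simp
  qed
  show ?thesis
  proof (rule that[of g])
    show "set_integrable lborel {a..b} g" using int[of b] ab by (simp add: set_integrable_def)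
    fix x assume x: "x \<in> {a..b}"
    have "(LINT t:{a..x}|lborel. g t) = enn2real (\<integral>\<^sup>+t. ennreal (indicator {a..x} t *\<^sub>R g t) \<partial>lborel)"
      unfolding set_lebesgue_integral_def
    proof (rule integral_eq_nn_integral)
      show "(\<lambda>t. indicator {a..x} t *\<^sub>R g t) \<in> borel_measurable lborel" by measurable
      show "AE t in lborel. 0 \<le> indicator {a..x} t *\<^sub>R g t" by (simp add: g_def)
    qed
    also have "\<dots> = F x - F a" unfolding eq[OF x] using mono[of a x] x by simp
    finally show "F x - F a = (LINT t:{a..x}|lborel. g t)" by simp
  qed
qed

text \<open>Averages over intervals to the right of a point give the right derivative. Applied to
  the reflected integrand they give the left one; the second exceptional set has to be reflected
  back.\<close>

lemma indefinite_integral_derivative: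
  fixes g :: "real \<Rightarrow> real"
  assumes g: "set_integrable lborel {a..b} g"
    and f: "\<And>x. x \<in> {a..b} \<Longrightarrow> f x - f a = (LINT t:{a..x}|lborel. g t)"
  shows "AE x in lborel. x \<in> {a<..<b} \<longrightarrow> (f has_real_derivative g x) (at x)"
proof -
  define G where "G t = indicator {a..b} t *\<^sub>R g t" for t
  have Gi: "integrable lborel G" using g by (simp add: set_integrable_def G_def[abs_def])
  have Gio: "G integrable_on {x..y}" for x y
    by (rule integrable_on_subcbox[OF integrable_on_lborel[OF Gi], of x y, unfolded cbox_interval]) simp
  have inc: "f y - f x = integral {x..y} G" if "a \<le> x" "x \<le> y" "y \<le> b" for x y
  proof -
    have *: "f x - f a = integral {a..x} G" if "a \<le> x" "x \<le> b" for x
    proof -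
      have "set_integrable lborel {a..x} g" by (rule set_integrable_subset[OF g]) (use that in auto)
      then have "(LINT t:{a..x}|lborel. g t) = integral {a..x} g" by (rule set_borel_integral_eq_integral(2))
      also have "\<dots> = integral {a..x} G"
        by (rule Henstock_Kurzweil_Integration.integral_cong) (use that in \<open>auto simp: G_def\<close>)
      finally show ?thesis using f[of x] that by simp
    qed
    have "integral {a..x} G + integral {x..y} G = integral {a..y} G"
      using that by (intro Henstock_Kurzweil_Integration.integral_combine Gio) auto
    then show ?thesis using *[of x] *[of y] that by simp
  qed
  obtain N where N: "negligible N" "\<And>x e. \<lbrakk>x \<notin> N; 0 < e\<rbrakk> \<Longrightarrow> \<exists>d>0. \<forall>h. 0 < h \<and> h < d \<longrightarrow>
       norm (integral (cbox x (x + h *\<^sub>R One)) G /\<^sub>R h ^ DIM(real) - G x) < e"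
    by (rule integrable_ccontinuous_explicit[of G]) (use Gio in \<open>auto simp: cbox_interval\<close>)
  obtain N' where N': "negligible N'" "\<And>x e. \<lbrakk>x \<notin> N'; 0 < e\<rbrakk> \<Longrightarrow> \<exists>d>0. \<forall>h. 0 < h \<and> h < d \<longrightarrow>
       norm (integral (cbox x (x + h *\<^sub>R One)) (\<lambda>t. G (- t)) /\<^sub>R h ^ DIM(real) - G (- x)) < e"
  proof (rule integrable_ccontinuous_explicit[of "\<lambda>t. G (- t)"])
    show "(\<lambda>t. G (- t)) integrable_on cbox x y" for x y
      using Gio[of "- y" "- x"] Henstock_Kurzweil_Integration.integrable_reflect_real[where f = G and a = "- y" and b = "- x"] by (simp add: cbox_interval)
  qed blast
  have der: "(f has_real_derivative g x) (at x)" if x: "x \<in> {a<..<b}" "x \<notin> N" "- x \<notin> N'" for x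
    unfolding DERIV_def LIM_def
  proof (intro allI impI)
    fix e :: real assume e: "e > 0"
    have Gx: "G x = g x" using x by (simp add: G_def)
    obtain d1 where d1: "d1 > 0" "\<And>h. 0 < h \<Longrightarrow> h < d1 \<Longrightarrow> \<bar>integral {x..x + h} G / h - g x\<bar> < e"
      using N(2)[OF x(2) e] Gx by (auto simp: cbox_interval divide_inverse mult.commute)
    obtain d2 where d2: "d2 > 0" "\<And>h. 0 < h \<Longrightarrow> h < d2 \<Longrightarrow> \<bar>integral {- x..- x + h} (\<lambda>t. G (- t)) / h - g x\<bar> < e"
      using N'(2)[OF x(3) e] Gx by (auto simp: cbox_interval divide_inverse mult.commute)
    define d where "d = min (min d1 d2) (min (x - a) (b - x))"
    have "\<bar>(f (x + h) - f x) / h - g x\<bar> < e" if h: "h \<noteq> 0" "\<bar>h\<bar> < d" for h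
    proof (cases "h > 0")
      case True
      then have "f (x + h) - f x = integral {x..x + h} G" using h x by (intro inc) (auto simp: d_def)
      then show ?thesis using d1(2)[of h] True h by (simp add: d_def)
    next
      case False
      then have h': "h < 0" using h by simp
      have "f x - f (x + h) = integral {x + h..x} G" using h h' x by (intro inc) (auto simp: d_def)
      also have "\<dots> = integral {- x..- x + (- h)} (\<lambda>t. G (- t))"
        using Henstock_Kurzweil_Integration.integral_reflect_real[where f = G and a = "x + h" and b = x] by simp
      finally have "(f (x + h) - f x) / h = integral {- x..- x + (- h)} (\<lambda>t. G (- t)) / (- h)"
        using h' by (simp add: field_simps)
      then show ?thesis using d2(2)[of "- h"] h' h by (simp add: d_def)
    qed
    then show "\<exists>s>0. \<forall>h. h \<noteq> 0 \<and> dist h 0 < s \<longrightarrow> dist ((f (x + h) - f x) / h) (g x) < e"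
      using d1(1) d2(1) x(1) by (intro exI[of _ d]) (auto simp: d_def dist_real_def)
  qed
  have "negligible (uminus ` N')" 
    by (rule negligible_differentiable_image_negligible[OF order_refl N'(1)])
      (intro differentiable_on_minus differentiable_on_ident)
  then have "AE x in lebesgue. x \<notin> N \<union> uminus ` N'"
    using N(1) by (intro AE_not_in) (simp add: negligible_iff_null_sets[symmetric])
  then have "AE x in lebesgue. x \<in> {a<..<b} \<longrightarrow> (f has_real_derivative g x) (at x)"
  proof eventually_elim
    case (elim x)
    then have "- x \<notin> N'" by (metis UnI2 image_eqI minus_minus)
    then show ?case using der elim by blast
  qed
  then show ?thesis by (simp add: AE_completion_iff)
qed

text \<open>Jordan decomposition: with \<open>V\<close> the variation, \<open>f\<close> is the
  difference of the increasing absolutely continuous functions \<open>V\<close> and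
  \<open>V - f\<close>, each of which has a density.\<close>

theorem abs_cont_on_eq_integral:
  fixes f :: "real \<Rightarrow> real"
  assumes f: "abs_cont_on {a..b} f" and ab: "a < b"
  obtains g where "set_integrable lborel {a..b} g"
    "\<And>x. x \<in> {a..b} \<Longrightarrow> f x - f a = (LINT t:{a..x}|lborel. g t)"
    "AE x in lborel. x \<in> {a<..<b} \<longrightarrow> (f has_real_derivative g x) (at x)"
proof -
  have ac: "abs_cont_intervals {a..b} f" by (rule abs_cont_on_imp_intervals[OF f])
  define V where "V = variation f a"
  have V: "V x + \<bar>f y - f x\<bar> \<le> V y" if "a \<le> x" "x \<le> y" "y \<le> b" for x y
    using variation_triangle[OF ac order_refl that] abs_diff_le_variation[OF ac that] by (simp add: V_def)
  have Vm: "V x \<le> V y" "V x - f x \<le> V y - f y" if "a \<le> x" "x \<le> y" "y \<le> b" for x y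
    using V[OF that] by auto
  have acV: "abs_cont_intervals {a..b} V" unfolding V_def by (rule abs_cont_variation[OF ac])
  obtain g1 where g1: "set_integrable lborel {a..b} g1" "\<And>x. x \<in> {a..b} \<Longrightarrow> V x - V a = (LINT t:{a..x}|lborel. g1 t)"
    by (rule mono_abs_cont_eq_integral[OF ab Vm(1) acV]) blast+
  obtain g2 where g2: "set_integrable lborel {a..b} g2"
    "\<And>x. x \<in> {a..b} \<Longrightarrow> (V x - f x) - (V a - f a) = (LINT t:{a..x}|lborel. g2 t)"
    by (rule mono_abs_cont_eq_integral[OF ab Vm(2) abs_cont_intervals_diff[OF acV ac]]) blast+
  have gi: "set_integrable lborel {a..b} (\<lambda>t. g1 t - g2 t)" using g1(1) g2(1) by (rule set_integral_diff)
  moreover have fi: "f x - f a = (LINT t:{a..x}|lborel. g1 t - g2 t)" if x: "x \<in> {a..b}" for x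
  proof -
    have "set_integrable lborel {a..x} g1" "set_integrable lborel {a..x} g2"
      using x by (auto intro!: set_integrable_subset[OF g1(1)] set_integrable_subset[OF g2(1)])
    then show ?thesis using g1(2)[OF x] g2(2)[OF x] by (simp add: set_integral_diff)
  qed
  ultimately show ?thesis using that indefinite_integral_derivative[OF gi fi] by blast
qed

text \<open>\<open>radial_weak_sol\<close> is written with \<open>deriv r\<close>, which has a value
  at every point; this lemma makes such integrands measurable. Differentiability is a Cauchy
  condition on difference quotients, and rational increments suffice because the quotient is
  continuous in the increment.\<close>

lemma borel_measurable_deriv:
  fixes f :: "real \<Rightarrow> real"
  assumes c: "continuous_on UNIV f"
  shows "deriv f \<in> borel_measurable borel"
proof -
  have [measurable]: "f \<in> borel_measurable borel" by (rule borel_measurable_continuous_onI[OF c])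
  define q where "q h x = (f (x + h) - f x) / h" for h x
  have [measurable]: "q h \<in> borel_measurable borel" for h
    unfolding q_def by measurable
  define I where "I m = {h \<in> \<rat>. h \<noteq> 0 \<and> \<bar>h\<bar> < inverse (real (Suc m))}" for m
  have cI: "countable (I m)" for m unfolding I_def by (rule countable_subset[OF _ countable_rat]) auto
  define D where "D = {x. \<forall>n. \<exists>m. \<forall>h\<in>I m. \<forall>k\<in>I m. \<bar>q h x - q k x\<bar> \<le> inverse (real (Suc n))}"
  have Dm [measurable]: "D \<in> sets borel"
  proof -
    have "D = (\<Inter>n. \<Union>m. \<Inter>h\<in>I m. \<Inter>k\<in>I m. {x. \<bar>q h x - q k x\<bar> \<le> inverse (real (Suc n))})"
      by (auto simp: D_def)
    moreover have "I m \<noteq> {}" for m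
    proof -
      have "inverse (real (Suc (Suc m))) \<in> I m"
        unfolding I_def by (auto simp: field_simps intro!: Rats_inverse)
      then show ?thesis by blast
    qed
    moreover have "{x. \<bar>q h x - q k x\<bar> \<le> inverse (real (Suc n))} \<in> sets borel" for h k n
      by measurable
    ultimately show ?thesis using cI
      by (auto intro!: sets.countable_INT'' sets.countable_UN sets.countable_INT')
  qed
  have qc: "continuous_on (- {0}) (\<lambda>h. q h x)" for x
    unfolding q_def by (intro continuous_intros continuous_on_compose2[OF c]) auto
  have D: "x \<in> D \<longleftrightarrow> (\<exists>L. (f has_real_derivative L) (at x))" for x
  proof
    assume "\<exists>L. (f has_real_derivative L) (at x)"
    then obtain L where L: "(\<lambda>h. q h x) \<midarrow>0\<rightarrow> L" by (auto simp: DERIV_def q_def)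
    show "x \<in> D" unfolding D_def mem_Collect_eq
    proof
      fix n
      have "inverse (real (Suc n)) / 2 > 0" by simp
      then obtain s where s: "s > 0" "\<And>h. h \<noteq> 0 \<Longrightarrow> \<bar>h\<bar> < s \<Longrightarrow> \<bar>q h x - L\<bar> < inverse (real (Suc n)) / 2"
        using L unfolding LIM_def by (metis diff_zero dist_0_norm dist_commute dist_real_def real_norm_def)
      obtain m where m: "inverse (real (Suc m)) < s" using reals_Archimedean[OF s(1)] by blast
      have "\<bar>q h x - q k x\<bar> \<le> inverse (real (Suc n))" if "h \<in> I m" "k \<in> I m" for h k
      proof -
        have "h \<noteq> 0" "\<bar>h\<bar> < s" "k \<noteq> 0" "\<bar>k\<bar> < s" using that m unfolding I_def by auto
        then have "\<bar>q h x - L\<bar> < inverse (real (Suc n)) / 2" "\<bar>q k x - L\<bar> < inverse (real (Suc n)) / 2"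
          using s(2) by blast+
        then show ?thesis by linarith
      qed
      then show "\<exists>m. \<forall>h\<in>I m. \<forall>k\<in>I m. \<bar>q h x - q k x\<bar> \<le> inverse (real (Suc n))" by blast
    qed
  next
    assume xD: "x \<in> D"
    define A where "A m = {h. h \<noteq> 0 \<and> \<bar>h\<bar> < inverse (real (Suc m))}" for m
    have app: "\<exists>s. (\<forall>i. s i \<in> I m) \<and> (\<lambda>i. q (s i) x) \<longlonglongrightarrow> q h x" if h: "h \<in> A m" for h m
    proof -
      have "A m = ball 0 (inverse (real (Suc m))) - {0}" by (auto simp: A_def)
      then have oA: "open (A m)" by (simp add: open_delete)
      have "h \<in> A m \<inter> closure \<rat>" using h by (simp add: Rats_closure_real)
      then have "h \<in> closure (A m \<inter> \<rat>)" using open_Int_closure_subset[OF oA] by blast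
      then obtain s where s: "\<And>i. s i \<in> A m \<inter> \<rat>" "s \<longlonglongrightarrow> h" unfolding closure_sequential by blast
      have "(\<lambda>i. q (s i) x) \<longlonglongrightarrow> q h x"
        by (rule continuous_on_tendsto_compose[OF qc s(2)]) (use s(1) h in \<open>auto simp: A_def\<close>)
      then show ?thesis using s(1) by (intro exI[of _ s]) (auto simp: I_def A_def)
    qed
    have bd: "\<exists>m. \<forall>h\<in>A m. \<forall>k\<in>A m. \<bar>q h x - q k x\<bar> \<le> inverse (real (Suc n))" for n
    proof -
      obtain m where m: "\<And>h k. h \<in> I m \<Longrightarrow> k \<in> I m \<Longrightarrow> \<bar>q h x - q k x\<bar> \<le> inverse (real (Suc n))"
        using xD unfolding D_def by blast
      have "\<bar>q h x - q k x\<bar> \<le> inverse (real (Suc n))" if hk: "h \<in> A m" "k \<in> A m" for h k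
      proof -
        obtain s where s: "\<And>i. s i \<in> I m" "(\<lambda>i. q (s i) x) \<longlonglongrightarrow> q h x" using app[OF hk(1)] by blast
        obtain t where t: "\<And>i. t i \<in> I m" "(\<lambda>i. q (t i) x) \<longlonglongrightarrow> q k x" using app[OF hk(2)] by blast
        have "(\<lambda>i. \<bar>q (s i) x - q (t i) x\<bar>) \<longlonglongrightarrow> \<bar>q h x - q k x\<bar>" by (intro tendsto_intros s t)
        then show ?thesis by (rule LIMSEQ_le_const2) (use m s(1) t(1) in blast)
      qed
      then show ?thesis by blast
    qed
    define u where "u i = q (inverse (real (Suc i))) x" for i
    have uA: "inverse (real (Suc i)) \<in> A m" if "i > m" for i m
      using that by (auto simp: A_def field_simps)
    have "Cauchy u"
    proof (rule metric_CauchyI)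
      fix e :: real assume "e > 0"
      then obtain n where n: "inverse (real (Suc n)) < e" using reals_Archimedean by blast
      obtain m where m: "\<And>h k. h \<in> A m \<Longrightarrow> k \<in> A m \<Longrightarrow> \<bar>q h x - q k x\<bar> \<le> inverse (real (Suc n))" using bd by blast
      have "dist (u i) (u j) < e" if "i \<ge> Suc m" "j \<ge> Suc m" for i j
        using m[OF uA[of m i] uA[of m j]] that n by (simp add: u_def dist_real_def)
      then show "\<exists>M. \<forall>i\<ge>M. \<forall>j\<ge>M. dist (u i) (u j) < e" by blast
    qed
    then obtain L where L: "u \<longlonglongrightarrow> L" using Cauchy_convergent convergent_def by blast
    have "(\<lambda>h. q h x) \<midarrow>0\<rightarrow> L" unfolding LIM_def
    proof (intro allI impI)
      fix e :: real assume "e > 0"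
      then obtain n where n: "inverse (real (Suc n)) < e" using reals_Archimedean by blast
      obtain m where m: "\<And>h k. h \<in> A m \<Longrightarrow> k \<in> A m \<Longrightarrow> \<bar>q h x - q k x\<bar> \<le> inverse (real (Suc n))" using bd by blast
      have "\<bar>q h x - L\<bar> \<le> inverse (real (Suc n))" if h: "h \<in> A m" for h
      proof (rule LIMSEQ_le_const2)
        show "(\<lambda>i. \<bar>q h x - u i\<bar>) \<longlonglongrightarrow> \<bar>q h x - L\<bar>" by (intro tendsto_intros L)
        show "\<exists>N. \<forall>i\<ge>N. \<bar>q h x - u i\<bar> \<le> inverse (real (Suc n))"
          using m[OF h uA[of m]] unfolding u_def by (meson Suc_le_eq)
      qed
      then show "\<exists>s>0. \<forall>h. h \<noteq> 0 \<and> dist h 0 < s \<longrightarrow> dist (q h x) L < e"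
        using n by (intro exI[of _ "inverse (real (Suc m))"]) (fastforce simp: A_def dist_real_def)
    qed
    then show "\<exists>L. (f has_real_derivative L) (at x)" by (auto simp: DERIV_def q_def)
  qed
  \<comment> \<open>\<open>deriv\<close> is a choice. At a point without derivative its predicate is
    constantly false, so all such points share one value.\<close>
  define c where "c = (SOME L::real. False)"
  have "deriv f = (\<lambda>x. if x \<in> D then lim (\<lambda>i. q (inverse (real (Suc i))) x) else c)"
  proof
    fix x
    show "deriv f x = (if x \<in> D then lim (\<lambda>i. q (inverse (real (Suc i))) x) else c)"
    proof (cases "x \<in> D")
      case True
      then obtain L where L: "(f has_real_derivative L) (at x)" using D by blast
      then have "(\<lambda>h. q h x) \<midarrow>0\<rightarrow> L" by (simp add: DERIV_def q_def)
      then have "(\<lambda>i. q (inverse (real (Suc i))) x) \<longlonglongrightarrow> L"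
        by (rule filterlim_compose) (simp add: filterlim_at LIMSEQ_inverse_real_of_nat del: of_nat_Suc)
      then show ?thesis using True DERIV_imp_deriv[OF L] by (simp add: limI del: of_nat_Suc)
    next
      case False
      then have "(\<lambda>L. (f has_real_derivative L) (at x)) = (\<lambda>_. False)" using D by auto
      then show ?thesis using False by (simp add: deriv_def c_def)
    qed
  qed
  also have "\<dots> \<in> borel_measurable borel"
    by (intro measurable_If_set borel_measurable_lim_metric) auto
  finally show ?thesis .
qed

section \<open>Regularity of radial weak solutions away from the origin\<close>

lemma compact_subset_interval:
  fixes K :: "real set"
  assumes "compact K" "K \<subseteq> {a<..<b}" "a < b"
  obtains l u where "a < l" "l \<le> u" "u < b" "K \<subseteq> {l..u}"
proof (cases "K = {}")
  case True
  then show ?thesis using that[of "(a + b) / 2" "(a + b) / 2"] assms(3) by auto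
next
  case False
  obtain l u where l: "l \<in> K" "\<And>x. x \<in> K \<Longrightarrow> l \<le> x" and u: "u \<in> K" "\<And>x. x \<in> K \<Longrightarrow> x \<le> u"
    using compact_attains_inf[OF assms(1) False] compact_attains_sup[OF assms(1) False] by metis
  show ?thesis by (rule that[of l u]) (use l u assms(2) in auto)
qed

lemma Cc_inf_realD:
  fixes g :: "real \<Rightarrow> real"
  assumes "Cc_inf {a<..<b} g" "a < b"
  obtains l u where "a < l" "l \<le> u" "u < b" "\<And>x. x \<notin> {l..u} \<Longrightarrow> g x = 0" "\<And>x. x \<notin> {l..u} \<Longrightarrow> deriv g x = 0"
    "\<And>x. (g has_real_derivative deriv g x) (at x)" "continuous_on UNIV (deriv g)"
proof -
  obtain K where K: "compact K" "K \<subseteq> {a<..<b}" "\<And>x. x \<notin> K \<Longrightarrow> g x = 0"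
    "\<And>x. (g has_derivative frechet_derivative g (at x)) (at x)"
    "\<And>e. continuous_on UNIV (\<lambda>x. frechet_derivative g (at x) e)"
    "\<And>x e. x \<notin> K \<Longrightarrow> frechet_derivative g (at x) e = 0"
    using Cc_infD[OF assms(1)] by blast
  obtain l u where lu: "a < l" "l \<le> u" "u < b" "K \<subseteq> {l..u}"
    using compact_subset_interval[OF K(1,2) assms(2)] by blast
  have "Ck (Suc 0) UNIV g" using assms(1) by (simp add: Cc_inf_def Cinf_def)
  then obtain g' where g': "\<And>x. (g has_real_derivative g' x) (at x)" "Ck 0 UNIV g'"
    by (rule Ck_real_SucE) auto
  have dg: "deriv g = g'" using DERIV_imp_deriv[OF g'(1)] by auto
  have "g' x = 0" if "x \<notin> {l..u}" for x
  proof -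
    have "g' x * 1 = frechet_derivative g (at x) 1"
      using has_derivative_unique[OF g'(1)[of x, unfolded has_field_derivative_def] K(4)[of x]] by metis
    moreover have "x \<notin> K" using that lu(4) by blast
    ultimately show ?thesis using K(6)[of x 1] by simp
  qed
  then show ?thesis using that[OF lu(1-3)] K(3) lu(4) g' unfolding dg by (auto simp: subset_iff)
qed

lemma Cc_inf_eq_0: "Cc_inf U g \<Longrightarrow> x \<notin> U \<Longrightarrow> g x = 0"
  using closure_subset[of "{x. g x \<noteq> 0}"] by (auto simp: Cc_inf_def)

lemma Cc_inf_continuous: "Cc_inf U g \<Longrightarrow> continuous_on S g"
  using Ck_imp_continuous_on[of 0 UNIV g] continuous_on_subset by (auto simp: Cc_inf_def Cinf_def)

lemma Cc_inf_integrable: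
  fixes g :: "'a::euclidean_space \<Rightarrow> real"
  assumes "Cc_inf U g" shows "integrable lborel g"
proof -
  obtain K where K: "compact K" "\<And>x. x \<notin> K \<Longrightarrow> g x = 0" by (rule Cc_infD[OF assms], rule that)
  have "integrable lborel (\<lambda>x. indicator K x *\<^sub>R g x)"
    by (rule borel_integrable_compact[OF K(1) Cc_inf_continuous[OF assms]])
  moreover have "(\<lambda>x. indicator K x *\<^sub>R g x) = g" using K(2) by (auto simp: fun_eq_iff indicator_def)
  ultimately show ?thesis by simp
qed

lemma Cc_inf_linear_comb:
  fixes f g :: "'a::euclidean_space \<Rightarrow> real"
  assumes "Cc_inf U f" "Cc_inf U g" shows "Cc_inf U (\<lambda>x. f x - c * g x)"
proof -
  let ?A = "closure {x. f x \<noteq> 0}" let ?B = "closure {x. g x \<noteq> 0}"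
  have "{x. f x - c * g x \<noteq> 0} \<subseteq> {x. f x \<noteq> 0} \<union> {x. g x \<noteq> 0}" by auto
  also have "\<dots> \<subseteq> ?A \<union> ?B" by (intro Un_mono closure_subset)
  finally have sub: "closure {x. f x - c * g x \<noteq> 0} \<subseteq> ?A \<union> ?B" by (rule closure_minimal) auto
  have AB: "compact (?A \<union> ?B)" "?A \<union> ?B \<subseteq> U" using assms by (auto simp: Cc_inf_def)
  define X where "X = closure {x. f x - c * g x \<noteq> 0}"
  have X: "X \<subseteq> ?A \<union> ?B" "closed X" using sub by (simp_all add: X_def)
  have "(?A \<union> ?B) \<inter> X = X" using X(1) by (simp only: inf.absorb2)
  with compact_Int_closed[OF AB(1) X(2)] have "compact X" by (simp only:)
  moreover have "X \<subseteq> U" using X(1) AB(2) by (rule subset_trans)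
  moreover have "Ck k UNIV (\<lambda>x. f x - c * g x)" for k
    using assms unfolding Cc_inf_def Cinf_def by (intro Ck_diff Ck_mult Ck_const) auto
  ultimately show ?thesis unfolding Cc_inf_def Cinf_def X_def by blast
qed

text \<open>A vanishing total integral is what makes the primitive return to zero to the right of
  the support.\<close>

lemma Cc_inf_primitive:
  fixes \<psi> :: "real \<Rightarrow> real"
  assumes \<psi>: "Cc_inf {a<..<b} \<psi>" and ab: "a < b" and z: "(LINT x|lborel. \<psi> x) = 0"
  obtains g where "Cc_inf {a<..<b} g" "\<And>x. (g has_real_derivative \<psi> x) (at x)"
proof -
  obtain l u where lu: "a < l" "l \<le> u" "u < b" "\<And>x. x \<notin> {l..u} \<Longrightarrow> \<psi> x = 0"
    by (rule Cc_inf_realD[OF \<psi> ab], rule that)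
  define g where "g x = (LBINT y=a..x. \<psi> y)" for x :: real
  have d: "(g has_real_derivative \<psi> x) (at x)" for x
  proof -
    define A B where "A = min a x - 1" and "B = max a x + 1"
    have "(g has_vector_derivative \<psi> x) (at x within {A..B})"
      unfolding g_def by (rule interval_integral_FTC2) (auto simp: A_def B_def intro: Cc_inf_continuous[OF \<psi>])
    moreover have "A < x" "x < B" by (auto simp: A_def B_def min_def max_def)
    ultimately have "(g has_vector_derivative \<psi> x) (at x)" by (simp add: at_within_Icc_at)
    then show ?thesis by (simp add: has_real_derivative_iff_has_vector_derivative)
  qed
  have ga: "g a = 0" by (simp add: g_def)
  have gb: "g b = 0"
  proof -
    have "g b = (LINT y:{a..b}|lborel. \<psi> y)" unfolding g_def using ab by (simp add: interval_integral_Icc)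
    also have "\<dots> = (LINT x|lborel. \<psi> x)"
      unfolding set_lebesgue_integral_def
    proof (rule Bochner_Integration.integral_cong[OF refl])
      show "indicator {a..b} x *\<^sub>R \<psi> x = \<psi> x" for x
        using lu(4)[of x] lu(1-3) by (cases "x \<in> {a..b}") auto
    qed
    finally show ?thesis using z by simp
  qed
  have gc: "continuous_on S g" for S
    by (rule DERIV_continuous_on) (rule has_field_derivative_at_within[OF d])
  have const: "g x = g y" if "x < y" "y \<le> l \<or> u \<le> x" for x y
  proof (rule DERIV_isconst_end[OF that(1) gc, symmetric])
    fix t assume "x < t" "t < y"
    then have "\<psi> t = 0" using that(2) by (intro lu(4)) auto
    then show "DERIV g t :> 0" using d[of t] by simp
  qed
  have g0: "g x = 0" if "x \<notin> {l..u}" for x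
  proof (cases "x < l")
    case True
    then show ?thesis using const[of x a] const[of a x] ga lu(1) by (cases x a rule: linorder_cases) auto
  next
    case False
    then have "u < x" using that by auto
    then show ?thesis using const[of x b] const[of b x] gb lu(3) by (cases x b rule: linorder_cases) auto
  qed
  have Ckg: "Ck k UNIV g" for k
  proof (cases k)
    case 0
    then show ?thesis using gc by simp
  next
    case (Suc n)
    show ?thesis unfolding Suc
      by (rule Ck_real_SucI[of UNIV g \<psi>])
        (use d \<psi> in \<open>auto simp: Cc_inf_def Cinf_def has_real_derivative_iff_has_vector_derivative[symmetric]\<close>)
  qed
  have sub: "{x. g x \<noteq> 0} \<subseteq> {l..u}" using g0 by blast
  have "closure {x. g x \<noteq> 0} \<subseteq> {l..u}" by (rule closure_minimal[OF sub closed_atLeastAtMost])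
  moreover have "bounded {x. g x \<noteq> 0}" by (rule bounded_subset[OF bounded_closed_interval sub])
  moreover have "{l..u} \<subseteq> {a<..<b}" using lu(1-3) by auto
  ultimately have "Cc_inf {a<..<b} g" unfolding Cc_inf_def Cinf_def compact_closure using Ckg by blast
  then show ?thesis using d that by blast
qed

text \<open>Integration by parts turns \<open>g V\<close> into \<open>- g' F\<close> with
  \<open>F\<close> the primitive of \<open>V\<close>. So \<open>W - F\<close> annihilates every
  derivative of a test function, that is, every test function of mean zero, and is therefore
  constant.\<close>

lemma du_Bois_Reymond:
  fixes W V :: "real \<Rightarrow> real"
  assumes ab: "a < b" and W: "set_integrable lborel {a<..<b} W" and V: "set_integrable lborel {a<..<b} V"
    and test: "\<And>g. Cc_inf {a<..<b} g \<Longrightarrow>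
      (LINT R:{a<..<b}|lborel. deriv g R * W R + g R * V R) = 0"
  obtains c where "AE R in lborel. R \<in> {a<..<b} \<longrightarrow> W R = c + integral {a..R} V"
proof -
  define u where "u s = indicator {a<..<b} s * V s" for s
  have ui: "integrable lborel u" using V by (simp add: u_def[abs_def] set_integrable_def)
  then have [measurable]: "u \<in> borel_measurable borel" by (simp add: borel_measurable_integrable)
  define F where "F R = integral {a..R} V" for R
  have Vio: "V integrable_on {a..b}"
    using set_borel_integral_eq_integral(1)[OF V] integrable_on_Icc_iff_Ioo by blast
  have Fc: "continuous_on {a..b} F" unfolding F_def by (rule indefinite_integral_continuous_1[OF Vio])
  have F: "(LINT s|lborel. u s * indicator {..R} s) = F R" if R: "R \<in> {a<..<b}" for R
  proof -
    have Vi: "set_integrable lborel {a<..R} V" by (rule set_integrable_subset[OF V]) (use R in auto)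
    have "(LINT s|lborel. u s * indicator {..R} s) = (LINT s:{a<..R}|lborel. V s)"
      unfolding set_lebesgue_integral_def u_def using R
      by (intro Bochner_Integration.integral_cong) (auto simp: indicator_def)
    also have "\<dots> = integral {a<..R} V" by (rule set_borel_integral_eq_integral(2)[OF Vi])
    also have "\<dots> = F R" unfolding F_def
      by (rule integral_spike_set) (auto intro!: negligible_subset[OF negligible_sing[of a]])
    finally show ?thesis .
  qed
  have parts: "(LINT s|lborel. u s * g s) = - (LINT R|lborel. deriv g R * (indicator {a<..<b} R * F R))"
    if g: "Cc_inf {a<..<b} g" for g
  proof -
    obtain l r where lr: "a < l" "l \<le> r" "r < b" "\<And>x. x \<notin> {l..r} \<Longrightarrow> g x = 0" "\<And>x. x \<notin> {l..r} \<Longrightarrow> deriv g x = 0"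
      "\<And>x. (g has_real_derivative deriv g x) (at x)" "continuous_on UNIV (deriv g)"
      by (rule Cc_inf_realD[OF g ab], rule that)
    have [measurable]: "deriv g \<in> borel_measurable borel" by (rule borel_measurable_continuous_onI[OF lr(7)])
    have dgi: "integrable lborel (deriv g)"
    proof -
      have "integrable lborel (\<lambda>x. indicator {l..r} x *\<^sub>R deriv g x)"
        by (rule borel_integrable_compact[OF compact_Icc continuous_on_subset[OF lr(7)]]) simp
      moreover have "(\<lambda>x. indicator {l..r} x *\<^sub>R deriv g x) = deriv g" using lr(5) by (auto simp: fun_eq_iff indicator_def)
      ultimately show ?thesis by simp
    qed
    \<comment> \<open>Fubini's theorem for this kernel is the integration by parts: integrating over
      \<open>s\<close> gives \<open>g' F\<close>, integrating over \<open>R\<close> gives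
      \<open>- u g\<close>, since \<open>g\<close> vanishes at \<open>b\<close>.\<close>
    define k where "k s R = u s * deriv g R * indicator {..R} s" for s R :: real
    have km: "case_prod k \<in> borel_measurable (lborel \<Otimes>\<^sub>M lborel)"
    proof -
      have "case_prod k = (\<lambda>p. u (fst p) * deriv g (snd p) * indicator {p. fst p \<le> snd p} p)"
        by (auto simp: k_def indicator_def)
      also have "\<dots> \<in> borel_measurable (lborel \<Otimes>\<^sub>M lborel)" by measurable
      finally show ?thesis .
    qed
    have kb: "norm (k s R) \<le> \<bar>u s\<bar> * \<bar>deriv g R\<bar>" for s R by (auto simp: k_def indicator_def abs_mult)
    have i1: "integrable lborel (\<lambda>R. k s R)" for s
      unfolding k_def by (rule Bochner_Integration.integrable_bound[where f = "\<lambda>R. \<bar>u s\<bar> * \<bar>deriv g R\<bar>"])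
        (use dgi in \<open>auto simp: indicator_def abs_mult intro!: AE_I2\<close>)
    have ki: "integrable (lborel \<Otimes>\<^sub>M lborel) (case_prod k)"
    proof (rule lborel_pair.Fubini_integrable[OF km])
      show "integrable lborel (\<lambda>s. LINT R|lborel. norm (case_prod k (s, R)))"
      proof (rule Bochner_Integration.integrable_bound[where f = "\<lambda>s. \<bar>u s\<bar> * (LINT R|lborel. \<bar>deriv g R\<bar>)"])
        show "integrable lborel (\<lambda>s. \<bar>u s\<bar> * (LINT R|lborel. \<bar>deriv g R\<bar>))" using ui by simp
        show "(\<lambda>s. LINT R|lborel. norm (case_prod k (s, R))) \<in> borel_measurable lborel"
          by (rule lborel.borel_measurable_lebesgue_integral) (use km in simp)
        show "AE s in lborel. norm (LINT R|lborel. norm (case_prod k (s, R)))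
          \<le> norm (\<bar>u s\<bar> * (LINT R|lborel. \<bar>deriv g R\<bar>))"
        proof (rule AE_I2)
          fix s
          have "(LINT R|lborel. norm (k s R)) \<le> (LINT R|lborel. \<bar>u s\<bar> * \<bar>deriv g R\<bar>)"
            by (rule integral_mono) (use i1 dgi kb in auto)
          then show "norm (LINT R|lborel. norm (case_prod k (s, R))) \<le> norm (\<bar>u s\<bar> * (LINT R|lborel. \<bar>deriv g R\<bar>))"
            by (simp add: abs_mult)
        qed
      qed
    qed (use i1 in simp)
    have 1: "(LINT s|lborel. k s R) = deriv g R * (indicator {a<..<b} R * F R)" for R
    proof (cases "R \<in> {a<..<b}")
      case True
      have "(LINT s|lborel. k s R) = (LINT s|lborel. deriv g R * (u s * indicator {..R} s))"
        unfolding k_def by (simp add: mult_ac)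
      then show ?thesis using F[OF True] True by simp
    next
      case False
      then have "deriv g R = 0" using lr(1-3) by (intro lr(5)) auto
      then show ?thesis by (simp add: k_def)
    qed
    have 2: "(LINT R|lborel. k s R) = - (u s * g s)" for s
    proof (cases "s \<in> {a<..<b}")
      case True
      have "(LINT R|lborel. k s R) = u s * (LINT R|lborel. deriv g R * indicator {s..b} R)"
      proof -
        have "deriv g R * indicator {..R} s = deriv g R * indicator {s..b} R" for R
          using lr(5)[of R] lr(1-3) by (cases "R \<le> b") (auto simp: indicator_def)
        then have "k s R = u s * (deriv g R * indicator {s..b} R)" for R unfolding k_def mult.assoc by metis
        then show ?thesis by simp
      qed
      also have "(LINT R|lborel. deriv g R * indicator {s..b} R) = g b - g s"
        by (rule integral_FTC_Icc_real) (use True lr(6) lr(7) in \<open>auto simp: continuous_on_eq_continuous_at\<close>)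
      also have "g b = 0" using lr(1-3) by (intro lr(4)) auto
      finally show ?thesis by simp
    qed (simp add: k_def u_def)
    have "(LINT R|lborel. LINT s|lborel. k s R) = (LINT s|lborel. LINT R|lborel. k s R)"
      by (rule lborel_pair.Fubini_integral[OF ki])
    then show ?thesis unfolding 1 2 by simp
  qed
  define h where "h R = indicator {a<..<b} R * (W R - F R)" for R
  have Fi: "set_integrable lborel {a<..<b} F"
  proof -
    have "set_integrable lborel {a..b} F" unfolding set_integrable_def by (rule borel_integrable_compact[OF compact_Icc Fc])
    then show ?thesis by (rule set_integrable_subset) auto
  qed
  have hi: "integrable lborel h"
    using set_integral_diff(1)[OF W Fi] by (simp add: set_integrable_def h_def[abs_def])
  then have hm [measurable]: "h \<in> borel_measurable borel" by (simp add: borel_measurable_integrable)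
  have bi: "integrable lborel (\<lambda>x. \<phi> x * w x)" if "continuous_on UNIV \<phi>" "\<And>x. x \<notin> {a..b} \<Longrightarrow> \<phi> x = 0" "integrable lborel w" for \<phi> w :: "real \<Rightarrow> real"
  proof -
    have "bounded (\<phi> ` {a..b})"
      using that(1) by (meson compact_Icc compact_continuous_image compact_imp_bounded continuous_on_subset subset_UNIV)
    then obtain B where B0: "\<forall>x\<in>{a..b}. \<bar>\<phi> x\<bar> \<le> B" by (auto simp: bounded_iff)
    have B: "\<bar>\<phi> x\<bar> \<le> \<bar>B\<bar>" for x
    proof (cases "x \<in> {a..b}")
      case True
      then have "\<bar>\<phi> x\<bar> \<le> B" using B0 by blast
      then show ?thesis by linarith
    qed (simp add: that(2))
    have [measurable]: "\<phi> \<in> borel_measurable borel" "w \<in> borel_measurable borel"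
      using that by (auto intro: borel_measurable_continuous_onI simp: borel_measurable_integrable)
    show ?thesis
      by (rule Bochner_Integration.integrable_bound[where f = "\<lambda>x. \<bar>B\<bar> * w x"])
        (use that B in \<open>auto simp: abs_mult intro!: AE_I2 mult_right_mono\<close>)
  qed
  have z: "(LINT R|lborel. \<psi> R * h R) = 0" if \<psi>: "Cc_inf {a<..<b} \<psi>" "(LINT x|lborel. \<psi> x) = 0" for \<psi>
  proof -
    obtain g where g: "Cc_inf {a<..<b} g" "\<And>x. (g has_real_derivative \<psi> x) (at x)"
      using Cc_inf_primitive[OF \<psi>(1) ab \<psi>(2)] by blast
    have dg: "deriv g = \<psi>" using DERIV_imp_deriv[OF g(2)] by auto
    have c: "continuous_on UNIV \<psi>" "continuous_on UNIV g" using \<psi>(1) g(1) Cc_inf_continuous by auto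
    have \<psi>0: "\<psi> x = 0" "g x = 0" if "x \<notin> {a..b}" for x
      using Cc_inf_eq_0[OF \<psi>(1)] Cc_inf_eq_0[OF g(1)] that by auto
    have iW: "integrable lborel (\<lambda>x. indicator {a<..<b} x * W x)" using W by (simp add: set_integrable_def)
    have iF: "integrable lborel (\<lambda>x. indicator {a<..<b} x * F x)" using Fi by (simp add: set_integrable_def)
    note ii = bi[OF c(1) \<psi>0(1) iW] bi[OF c(1) \<psi>0(1) iF] bi[OF c(2) \<psi>0(2) ui]
    have "0 = (LINT R|lborel. \<psi> R * (indicator {a<..<b} R * W R) + g R * u R)"
      using test[OF g(1)] unfolding dg set_lebesgue_integral_def u_def by (simp add: algebra_simps)
    also have "\<dots> = (LINT R|lborel. \<psi> R * (indicator {a<..<b} R * W R)) + (LINT R|lborel. u R * g R)"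
      using ii by (simp add: mult.commute)
    also have "\<dots> = (LINT R|lborel. \<psi> R * (indicator {a<..<b} R * W R)) - (LINT R|lborel. \<psi> R * (indicator {a<..<b} R * F R))"
      using parts[OF g(1)] by (simp add: dg)
    also have "\<dots> = (LINT R|lborel. \<psi> R * h R)"
      using ii by (subst Bochner_Integration.integral_diff[symmetric]) (auto simp: h_def algebra_simps)
    finally show ?thesis by simp
  qed
  define m where "m = (a + b) / 2"
  \<comment> \<open>A fixed test function with positive integral, used to correct the mean of the
    others.\<close>
  define \<eta> where "\<eta> = bump ((a + m) / 2) ((m + b) / 2) 1"
  have \<eta>: "Cc_inf {a<..<b} \<eta>"
    unfolding \<eta>_def by (rule Cc_inf_bump) (use ab in \<open>auto simp: m_def cbox_interval field_simps\<close>)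
  have \<eta>0: "0 \<le> \<eta> x" for x unfolding \<eta>_def by (rule bump_bounds(1))
  have J: "(LINT x|lborel. \<eta> x) > 0"
  proof -
    have "(LINT x|lborel. \<eta> x) \<noteq> 0"
    proof
      assume "(LINT x|lborel. \<eta> x) = 0"
      then have "AE x in lborel. \<eta> x = 0"
        using integral_nonneg_eq_0_iff_AE[OF Cc_inf_integrable[OF \<eta>]] \<eta>0 by simp
      then have "AE x in lborel. x \<notin> {(a + m) / 2<..<(m + b) / 2}"
      proof eventually_elim
        case (elim x)
        then show ?case using bump_pos[of x "(a + m) / 2" "(m + b) / 2" 1] by (auto simp: \<eta>_def box_real)
      qed
      then have "emeasure lborel {(a + m) / 2<..<(m + b) / 2} = 0"
        by (subst (asm) AE_iff_measurable[of "{(a + m) / 2<..<(m + b) / 2}"]) auto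
      then show False using ab by (simp add: m_def field_simps)
    qed
    moreover have "(LINT x|lborel. \<eta> x) \<ge> 0" by (rule Bochner_Integration.integral_nonneg) (rule \<eta>0)
    ultimately show ?thesis by linarith
  qed
  define c where "c = (LINT x|lborel. \<eta> x * h x) / (LINT x|lborel. \<eta> x)"
  have "AE R in lebesgue. R \<in> {a<..<b} \<longrightarrow> h R - c = 0"
  proof (rule fundamental_lemma)
    fix \<phi> :: "real \<Rightarrow> real" assume \<phi>: "Cc_inf {a<..<b} \<phi>"
    \<comment> \<open>\<open>\<phi> - t \<eta>\<close> has mean zero, so it is admissible in
      \<open>z\<close>.\<close>
    define t where "t = (LINT x|lborel. \<phi> x) / (LINT x|lborel. \<eta> x)"
    have 0: "\<phi> x = 0" "\<eta> x = 0" if "x \<notin> {a<..<b}" for x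
      using Cc_inf_eq_0[OF \<phi>] Cc_inf_eq_0[OF \<eta>] that by auto
    have z0: "\<phi> x = 0" "\<eta> x = 0" if "x \<notin> {a..b}" for x using 0[of x] that by auto
    note c' = Cc_inf_continuous[OF \<phi>, of UNIV] Cc_inf_continuous[OF \<eta>, of UNIV]
    note ii = bi[OF c'(1) z0(1) hi] bi[OF c'(2) z0(2) hi] Cc_inf_integrable[OF \<phi>] Cc_inf_integrable[OF \<eta>]
    have "(LINT x|lborel. \<phi> x - t * \<eta> x) = 0" using ii J by (simp add: t_def)
    then have "(LINT x|lborel. (\<phi> x - t * \<eta> x) * h x) = 0"
      by (intro z Cc_inf_linear_comb[OF \<phi> \<eta>])
    then have "(LINT x|lborel. \<phi> x * h x - t * (\<eta> x * h x)) = 0" by (simp add: algebra_simps)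
    then have "(LINT x|lborel. \<phi> x * h x) = t * (LINT x|lborel. \<eta> x * h x)" using ii by simp
    also have "\<dots> = c * (LINT x|lborel. \<phi> x)" by (simp add: t_def c_def)
    finally have "(LINT x|lborel. \<phi> x * (h x - c)) = 0" using ii by (simp add: right_diff_distrib mult.commute)
    moreover have "(LINT x:{a<..<b}|lebesgue. \<phi> x * (h x - c)) = (LINT x|lebesgue. \<phi> x * (h x - c))"
      unfolding set_lebesgue_integral_def using 0(1)
      by (intro Bochner_Integration.integral_cong) (auto simp: indicator_def)
    moreover have "(LINT x|lebesgue. \<phi> x * (h x - c)) = (LINT x|lborel. \<phi> x * (h x - c))"
      by (intro integral_completion) (use borel_measurable_continuous_onI[OF c'(1)] in simp)
    ultimately show "(LINT x:{a<..<b}|lebesgue. \<phi> x * (h x - c)) = 0" by simp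
  next
    fix x y :: real
    have "integrable lborel (\<lambda>t. indicator (cbox x y) t *\<^sub>R (h t - c))"
    proof -
      have "integrable lborel (\<lambda>t. indicator (cbox x y) t *\<^sub>R h t)" by (intro integrable_mult_indicator hi) simp
      moreover have "integrable lborel (\<lambda>t. indicator (cbox x y) t *\<^sub>R c)"
        by (rule borel_integrable_compact) auto
      ultimately show ?thesis by (simp add: right_diff_distrib)
    qed
    then show "set_integrable lebesgue (cbox x y) (\<lambda>t. h t - c)"
      unfolding set_integrable_def using integrable_completion borel_measurable_integrable by blast
  qed simp
  then have "AE R in lborel. R \<in> {a<..<b} \<longrightarrow> h R - c = 0" by (simp add: AE_completion_iff)
  then have "AE R in lborel. R \<in> {a<..<b} \<longrightarrow> W R = c + integral {a..R} V"
    by eventually_elim (auto simp: h_def F_def)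
  then show ?thesis by (rule that)
qed

section \<open>The flux of the radial equation and the regularity it gives\<close>

definition flux :: "(real \<Rightarrow> real) \<Rightarrow> real \<Rightarrow> real \<Rightarrow> real \<Rightarrow> real \<Rightarrow> real" where
  "flux f m R y p = R * p + m * f (m * y * p / R) * y"

text \<open>The flux is the factor of the test function's derivative in the weak equation, with
  \<open>p\<close> for \<open>r'\<close> and \<open>f\<close> for \<open>\<rho>'\<close>. Its second
  term contains \<open>y\<close> inside and outside \<open>f\<close>, so for either sign of
  \<open>y\<close> a monotone \<open>f\<close> contributes an increasing function of
  \<open>p\<close>, and the growth of \<open>R p\<close> remains.\<close>

lemma flux_expanding:
  assumes f: "mono f" and R: "R > 0" and m: "m \<ge> 0"
  shows "R * \<bar>p - q\<bar> \<le> \<bar>flux f m R y p - flux f m R y q\<bar>"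
proof -
  have *: "R * (p - q) \<le> flux f m R y p - flux f m R y q" if "q \<le> p" for p q
  proof -
    have "0 \<le> (f (m * y * p / R) - f (m * y * q / R)) * y"
    proof (cases "y \<ge> 0")
      case True
      then have "m * y * q / R \<le> m * y * p / R" using that R m by (intro divide_right_mono mult_left_mono) auto
      then show ?thesis using f True by (simp add: monoD)
    next
      case False
      then have "m * y * p / R \<le> m * y * q / R" using that R m by (intro divide_right_mono mult_left_mono_neg) (auto simp: mult_le_0_iff)
      then show ?thesis using f False by (simp add: monoD mult_nonpos_nonpos)
    qed
    then have "0 \<le> m * ((f (m * y * p / R) - f (m * y * q / R)) * y)" using m by simp
    then show ?thesis by (simp add: flux_def algebra_simps)
  qed
  show ?thesis
  proof (cases "q \<le> p")
    case True
    then show ?thesis using *[OF True] R by simp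
  next
    case False
    then show ?thesis using *[of p q] R by simp
  qed
qed

text \<open>\<open>f\<close> is bounded, so \<open>R p\<close> dominates for large \<open>p\<close>;
  the intermediate value theorem on \<open>[-L, L]\<close> does the rest.\<close>

lemma flux_surj:
  assumes fc: "continuous_on UNIV f" and fb: "\<And>s. 0 \<le> f s" "\<And>s. f s \<le> \<gamma>" and R: "R > 0" and m: "m \<ge> 0"
  shows "\<exists>p. flux f m R y p = w"
proof -
  define L where "L = (\<bar>w\<bar> + m * \<gamma> * \<bar>y\<bar>) / R"
  have g0: "0 \<le> \<gamma>" using fb order_trans by blast
  have L0: "0 \<le> L" using R m g0 by (auto simp: L_def intro!: divide_nonneg_pos)
  have RL: "R * L = \<bar>w\<bar> + m * \<gamma> * \<bar>y\<bar>" using R by (simp add: L_def)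
  have b: "\<bar>m * f s * y\<bar> \<le> m * \<gamma> * \<bar>y\<bar>" for s
    using fb[of s] m by (auto simp: abs_mult intro!: mult_right_mono mult_left_mono)
  have "flux f m R y (- L) \<le> w" "w \<le> flux f m R y L"
    using b[of "m * y * L / R"] b[of "m * y * (- L) / R"] RL unfolding flux_def by (auto simp: abs_if split: if_splits)
  moreover have "continuous_on {- L..L} (flux f m R y)"
    unfolding flux_def[abs_def] by (intro continuous_intros continuous_on_compose2[OF fc]) (use R in auto)
  ultimately show ?thesis using IVT'[of "flux f m R y" "- L" w L] L0 by auto
qed

text \<open>The lemma of du Bois-Reymond provides a continuous \<open>w\<close> that equals the flux
  of \<open>r\<close> almost everywhere. Solving for the derivative gives a continuous
  \<open>G\<close> equal to \<open>deriv r\<close> almost everywhere; as \<open>r\<close> is the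
  integral of its derivative, \<open>G\<close> is its derivative at every point.\<close>

lemma radial_C1_local:
  assumes fc: "continuous_on UNIV (deriv \<rho>)" and fm: "mono (deriv \<rho>)"
    and fb: "\<And>s. 0 \<le> deriv \<rho> s" "\<And>s. deriv \<rho> s \<le> \<gamma>"
    and sol: "radial_weak_sol \<rho> M r" and a: "0 < a" "a < 1"
  obtains G w where "continuous_on {a..1} G" "continuous_on {a..1} w"
    "\<And>R. R \<in> {a..1} \<Longrightarrow> flux (deriv \<rho>) (real M) R (r R) (G R) = w R"
    "\<And>R. R \<in> {a<..<1} \<Longrightarrow> (r has_real_derivative G R) (at R)"
    "\<And>R. R \<in> {a<..<1} \<Longrightarrow> (w has_real_derivative
       (real M)\<^sup>2 * r R / R + real M * deriv \<rho> (real M * r R * G R / R) * G R) (at R)"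
proof -
  define f where "f = deriv \<rho>"
  define m where "m = real M"
  note fc = fc[folded f_def] and fm = fm[folded f_def] and fb = fb[folded f_def]
  have m: "m \<ge> 0" by (simp add: m_def)
  have g0: "0 \<le> \<gamma>" using fb order_trans by blast
  have [measurable]: "f \<in> borel_measurable borel" by (rule borel_measurable_continuous_onI[OF fc])
  have ac: "abs_cont_on {a..1} r" using sol a unfolding radial_weak_sol_def by auto
  obtain g where g: "set_integrable lborel {a..1} g" "\<And>x. x \<in> {a..1} \<Longrightarrow> r x - r a = (LINT t:{a..x}|lborel. g t)"
    "AE x in lborel. x \<in> {a<..<1} \<longrightarrow> (r has_real_derivative g x) (at x)"
    using abs_cont_on_eq_integral[OF ac a(2)] by blast
  have rc: "continuous_on {a..1} r"
    by (rule abs_cont_intervals_imp_continuous[OF abs_cont_on_imp_intervals[OF ac]])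
  \<comment> \<open>A copy of \<open>r\<close> that is continuous on the whole line, so that
    \<open>deriv s\<close> is Borel measurable; it agrees with \<open>r\<close> on
    \<open>[a, 1]\<close>.\<close>
  define s where "s x = r (max a (min 1 x))" for x
  have sr: "s x = r x" if "x \<in> {a..1}" for x using that by (simp add: s_def)
  have sc: "continuous_on UNIV s" unfolding s_def
    by (rule continuous_on_compose2[OF rc]) (use a in \<open>auto intro!: continuous_intros\<close>)
  have [measurable]: "s \<in> borel_measurable borel" by (rule borel_measurable_continuous_onI[OF sc])
  have ds: "deriv s x = deriv r x" if "x \<in> {a<..<1}" for x
  proof (rule deriv_cong_ev[OF _ refl])
    show "\<forall>\<^sub>F x in nhds x. s x = r x"
      using eventually_nhds_in_open[OF open_greaterThanLessThan that] by eventually_elim (simp add: sr)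
  qed
  have [measurable]: "deriv s \<in> borel_measurable borel" by (rule borel_measurable_deriv[OF sc])
  have gq: "AE x in lborel. x \<in> {a<..<1} \<longrightarrow> deriv s x = g x"
    using g(3) by eventually_elim (auto simp: ds DERIV_imp_deriv)
  have qi: "set_integrable lborel {a<..<1} (deriv s)"
  proof -
    have gi: "set_integrable lborel {a<..<1} g" by (rule set_integrable_subset[OF g(1)]) auto
    show ?thesis unfolding set_integrable_def
    proof (rule integrable_cong_AE_imp[OF gi[unfolded set_integrable_def]])
      show "AE x in lborel. indicator {a<..<1} x *\<^sub>R g x = indicator {a<..<1} x *\<^sub>R deriv s x"
        using gq by eventually_elim (auto simp: indicator_def)
    qed simp
  qed
  have "bounded (s ` {a..1})"
    by (meson compact_Icc compact_continuous_image compact_imp_bounded continuous_on_subset sc subset_UNIV)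
  then obtain B where B: "\<And>x. x \<in> {a..1} \<Longrightarrow> \<bar>s x\<bar> \<le> B" unfolding bounded_iff by (metis imageI real_norm_def)
  have B0: "0 \<le> B" using B[of a] a by (metis abs_ge_zero atLeastAtMost_iff less_imp_le order_refl order_trans)
  define W where "W R = flux f m R (s R) (deriv s R)" for R
  define V where "V R = m\<^sup>2 * s R / R + m * f (m * s R * deriv s R / R) * deriv s R" for R
  have Wm [measurable]: "W \<in> borel_measurable borel" "V \<in> borel_measurable borel"
    unfolding W_def V_def flux_def by measurable
  have ci: "set_integrable lborel {a<..<1} (\<lambda>_. c::real)" for c
  proof -
    have "set_integrable lborel {a..1} (\<lambda>_. c)" unfolding set_integrable_def
      by (rule borel_integrable_compact) auto
    then show ?thesis by (rule set_integrable_subset) auto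
  qed
  have Wi: "set_integrable lborel {a<..<1} W"
  proof (rule set_integrable_bound[OF set_integral_add(1)[OF set_integrable_abs[OF qi] ci[of "m * \<gamma> * B"]]])
    show "set_borel_measurable lborel {a<..<1} W" unfolding set_borel_measurable_def by measurable
    have "norm (W R) \<le> norm (\<bar>deriv s R\<bar> + m * \<gamma> * B)" if R: "R \<in> {a<..<1}" for R
    proof -
      have "\<bar>R * deriv s R\<bar> \<le> \<bar>deriv s R\<bar>" using R a by (simp add: abs_mult mult_left_le_one_le)
      moreover have "\<bar>m * f x * s R\<bar> \<le> m * \<gamma> * B" for x
        using fb[of x] m B[of R] B0 R g0 by (auto simp: abs_mult intro!: mult_mono)
      ultimately show ?thesis unfolding W_def flux_def
        by (smt (verit, del_insts) real_norm_def)
    qed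
    then show "AE R in lborel. R \<in> {a<..<1} \<longrightarrow> norm (W R) \<le> norm (\<bar>deriv s R\<bar> + m * \<gamma> * B)" by blast
  qed
  have Vi: "set_integrable lborel {a<..<1} V"
  proof (rule set_integrable_bound[OF set_integral_add(1)[OF set_integrable_mult_right[OF set_integrable_abs[OF qi], of "m * \<gamma>"] ci[of "m\<^sup>2 * B / a"]]])
    show "set_borel_measurable lborel {a<..<1} V" unfolding set_borel_measurable_def by measurable
    have "norm (V R) \<le> norm (m * \<gamma> * \<bar>deriv s R\<bar> + m\<^sup>2 * B / a)" if R: "R \<in> {a<..<1}" for R
    proof -
      have 1: "\<bar>m\<^sup>2 * s R / R\<bar> \<le> m\<^sup>2 * B / a"
        using R a B[of R] B0 by (auto simp: abs_mult intro!: frac_le mult_left_mono)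
      have 2: "\<bar>m * f x * deriv s R\<bar> \<le> m * \<gamma> * \<bar>deriv s R\<bar>" for x
        using fb[of x] m by (auto simp: abs_mult intro!: mult_mono)
      show ?thesis unfolding V_def real_norm_def
        using 1 2[of "m * s R * deriv s R / R"] by linarith
    qed
    then show "AE R in lborel. R \<in> {a<..<1} \<longrightarrow> norm (V R) \<le> norm (m * \<gamma> * \<bar>deriv s R\<bar> + m\<^sup>2 * B / a)" by blast
  qed
  obtain c where c: "AE R in lborel. R \<in> {a<..<1} \<longrightarrow> W R = c + integral {a..R} V"
  proof (rule du_Bois_Reymond[OF a(2) Wi Vi])
    fix \<phi> :: "real \<Rightarrow> real" assume \<phi>: "Cc_inf {a<..<1} \<phi>"
    obtain l u where lu: "a < l" "l \<le> u" "u < 1" "\<And>x. x \<notin> {l..u} \<Longrightarrow> \<phi> x = 0" "\<And>x. x \<notin> {l..u} \<Longrightarrow> deriv \<phi> x = 0"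
      by (rule Cc_inf_realD[OF \<phi> a(2)], rule that)
    have "Cc_inf {0<..<1} \<phi>" using \<phi> a unfolding Cc_inf_def by auto
    then have "(LINT R:{0<..<1}|lborel. deriv \<phi> R * (R * deriv r R + real M * deriv \<rho> (real M * r R * deriv r R / R) * r R)
          + \<phi> R * ((real M)\<^sup>2 * r R / R + real M * deriv \<rho> (real M * r R * deriv r R / R) * deriv r R)) = 0"
      using sol unfolding radial_weak_sol_def by blast
    moreover have "(LINT R:{a<..<1}|lborel. deriv \<phi> R * W R + \<phi> R * V R) =
      (LINT R:{0<..<1}|lborel. deriv \<phi> R * (R * deriv r R + real M * deriv \<rho> (real M * r R * deriv r R / R) * r R)
          + \<phi> R * ((real M)\<^sup>2 * r R / R + real M * deriv \<rho> (real M * r R * deriv r R / R) * deriv r R))"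
      unfolding set_lebesgue_integral_def
    proof (rule Bochner_Integration.integral_cong[OF refl])
      fix R
      show "indicator {a<..<1} R *\<^sub>R (deriv \<phi> R * W R + \<phi> R * V R) = indicator {0<..<1} R *\<^sub>R
        (deriv \<phi> R * (R * deriv r R + real M * deriv \<rho> (real M * r R * deriv r R / R) * r R)
          + \<phi> R * ((real M)\<^sup>2 * r R / R + real M * deriv \<rho> (real M * r R * deriv r R / R) * deriv r R))"
      proof (cases "R \<in> {a<..<1}")
        case True
        then show ?thesis using a ds[OF True] sr[of R] by (simp add: W_def V_def flux_def f_def m_def)
      next
        case False
        then have "R \<notin> {l..u}" using lu(1-3) by auto
        then show ?thesis using False lu(4,5) by simp
      qed
    qed
    ultimately show "(LINT R:{a<..<1}|lborel. deriv \<phi> R * W R + \<phi> R * V R) = 0" by simp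
  qed (rule that)
  define w where "w R = c + integral {a..R} V" for R
  have "V integrable_on {a..1}"
    using set_borel_integral_eq_integral(1)[OF Vi] integrable_on_Icc_iff_Ioo by blast
  then have wc: "continuous_on {a..1} w" unfolding w_def by (intro continuous_intros indefinite_integral_continuous_1)
  have "\<forall>R. \<exists>p. R > 0 \<longrightarrow> flux f m R (r R) p = w R"
    using flux_surj[OF fc fb _ m] by blast
  then obtain G where G: "\<And>R. R > 0 \<Longrightarrow> flux f m R (r R) (G R) = w R" by metis
  \<comment> \<open>The flux expands distances in \<open>p\<close> at least by the factor
    \<open>a\<close>. So \<open>G R - G x\<close> is controlled by how far the flux at
    \<open>R\<close>, evaluated at the fixed argument \<open>G x\<close>, is from
    \<open>w R\<close>, and this tends to zero.\<close>
  have Gc: "continuous_on {a..1} G"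
    unfolding continuous_on_def
  proof
    fix x assume x: "x \<in> {a..1}"
    have "((\<lambda>R. flux f m R (r R) (G x)) \<longlongrightarrow> flux f m x (r x) (G x)) (at x within {a..1})"
    proof -
      have "continuous_on {a..1} (\<lambda>R. flux f m R (r R) (G x))"
        unfolding flux_def by (intro continuous_intros rc continuous_on_compose2[OF fc]) (use a in auto)
      then show ?thesis using x by (auto simp: continuous_on_def)
    qed
    moreover have "(w \<longlongrightarrow> w x) (at x within {a..1})" using wc x by (auto simp: continuous_on_def)
    ultimately have "((\<lambda>R. \<bar>flux f m R (r R) (G x) - w R\<bar> / a) \<longlongrightarrow> \<bar>flux f m x (r x) (G x) - w x\<bar> / a) (at x within {a..1})"
      using a by (intro tendsto_intros) auto
    then have lim: "((\<lambda>R. \<bar>flux f m R (r R) (G x) - w R\<bar> / a) \<longlongrightarrow> 0) (at x within {a..1})"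
      using G[of x] x a by simp
    have "((\<lambda>R. G R - G x) \<longlongrightarrow> 0) (at x within {a..1})"
    proof (rule Lim_null_comparison[OF _ lim])
      show "\<forall>\<^sub>F R in at x within {a..1}. norm (G R - G x) \<le> \<bar>flux f m R (r R) (G x) - w R\<bar> / a"
        unfolding eventually_at_filter
      proof (rule always_eventually, intro allI impI)
        fix R assume "R \<in> {a..1}"
        then have R: "a \<le> R" by simp
        have "a * \<bar>G x - G R\<bar> \<le> R * \<bar>G x - G R\<bar>" using R by (intro mult_right_mono) auto
        also have "\<dots> \<le> \<bar>flux f m R (r R) (G x) - flux f m R (r R) (G R)\<bar>"
          using R a by (intro flux_expanding fm m) auto
        also have "flux f m R (r R) (G R) = w R" using R a by (intro G) auto
        finally show "norm (G R - G x) \<le> \<bar>flux f m R (r R) (G x) - w R\<bar> / a"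
          using a by (simp add: field_simps abs_minus_commute)
      qed
    qed
    then show "(G \<longlongrightarrow> G x) (at x within {a..1})" by (rule LIM_zero_cancel)
  qed
  have gG: "AE x in lborel. x \<in> {a<..<1} \<longrightarrow> g x = G x"
    using gq c
  proof eventually_elim
    case (elim x)
    show ?case
    proof
      assume x: "x \<in> {a<..<1}"
      have "flux f m x (r x) (g x) = flux f m x (r x) (G x)"
        using elim x G[of x] a sr[of x] by (simp add: W_def w_def)
      moreover have "x * \<bar>g x - G x\<bar> \<le> \<bar>flux f m x (r x) (g x) - flux f m x (r x) (G x)\<bar>"
        using x a by (intro flux_expanding fm m) auto
      ultimately show "g x = G x" using x a by (simp add: mult_le_0_iff)
    qed
  qed
  have rint: "r x = r a + integral {a..x} G" if x: "x \<in> {a..1}" for x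
  proof -
    have Gi: "set_integrable lborel {a..x} G" unfolding set_integrable_def
      by (rule borel_integrable_compact[OF compact_Icc continuous_on_subset[OF Gc]]) (use x in auto)
    have "(LINT t:{a..x}|lborel. g t) = (LINT t:{a..x}|lborel. G t)"
      unfolding set_lebesgue_integral_def
    proof (rule integral_cong_AE)
      have "set_integrable lborel {a..x} g" by (rule set_integrable_subset[OF g(1)]) (use x in auto)
      then show "(\<lambda>t. indicator {a..x} t *\<^sub>R g t) \<in> borel_measurable lborel"
        unfolding set_integrable_def by (rule borel_measurable_integrable)
      show "(\<lambda>t. indicator {a..x} t *\<^sub>R G t) \<in> borel_measurable lborel"
        using Gi unfolding set_integrable_def by (rule borel_measurable_integrable)
      show "AE t in lborel. indicator {a..x} t *\<^sub>R g t = indicator {a..x} t *\<^sub>R G t"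
        using gG AE_lborel_singleton[of a] AE_lborel_singleton[of 1]
      proof eventually_elim
        case (elim t)
        then show ?case using x by (cases "t \<in> {a..x}") auto
      qed
    qed
    also have "\<dots> = integral {a..x} G" by (rule set_borel_integral_eq_integral(2)[OF Gi])
    finally show ?thesis using g(2)[OF x] by simp
  qed
  have rd: "(r has_real_derivative G R) (at R)" if R: "R \<in> {a<..<1}" for R
  proof -
    have "((\<lambda>x. r a + integral {a..x} G) has_real_derivative G R) (at R within {a..1})"
      using integral_has_real_derivative[OF Gc, of R] R by (auto intro!: derivative_eq_intros)
    then have "(r has_real_derivative G R) (at R within {a..1})"
      by (rule has_field_derivative_transform_within[OF _ zero_less_one]) (use R rint[symmetric] in auto)
    then show ?thesis using R by (simp add: at_within_Icc_at)
  qed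
  \<comment> \<open>The continuous representative of \<open>V\<close>; with it \<open>w\<close> is
    differentiable at every interior point and not merely almost everywhere.\<close>
  define V' where "V' R = m\<^sup>2 * r R / R + m * f (m * r R * G R / R) * G R" for R
  have V'c: "continuous_on {a..1} V'" unfolding V'_def
    by (intro continuous_intros rc Gc continuous_on_compose2[OF fc]) (use a in auto)
  have VV': "V x = V' x" if "x \<in> {a<..<1}" for x
    using sr[of x] ds[OF that] DERIV_imp_deriv[OF rd[OF that]] that by (simp add: V_def V'_def)
  have wV: "w x = c + integral {a..x} V'" if "x \<in> {a..1}" for x
  proof -
    have "integral {a..x} V = integral {a..x} V'"
    proof (rule integral_spike[of "{a, 1}"])
      fix t assume "t \<in> {a..x} - {a, 1}"
      then show "V' t = V t" using VV'[of t] that by auto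
    qed auto
    then show ?thesis by (simp add: w_def)
  qed
  have wd: "(w has_real_derivative V' R) (at R)" if R: "R \<in> {a<..<1}" for R
  proof -
    have "((\<lambda>x. c + integral {a..x} V') has_real_derivative V' R) (at R within {a..1})"
      using integral_has_real_derivative[OF V'c, of R] R by (auto intro!: derivative_eq_intros)
    then have "(w has_real_derivative V' R) (at R within {a..1})"
      by (rule has_field_derivative_transform_within[OF _ zero_less_one]) (use R wV in auto)
    then show ?thesis using R by (simp add: at_within_Icc_at)
  qed
  show ?thesis
    by (rule that[OF Gc wc]) (use G a rd wd in \<open>auto simp: V'_def f_def m_def\<close>)
qed

theorem radial_C1:
  assumes fc: "continuous_on UNIV (deriv \<rho>)" and fm: "mono (deriv \<rho>)"
    and fb: "\<And>s. 0 \<le> deriv \<rho> s" "\<And>s. deriv \<rho> s \<le> \<gamma>"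
    and sol: "radial_weak_sol \<rho> M r"
  obtains p w where "continuous_on {0<..1} r" "continuous_on {0<..1} p" "continuous_on {0<..1} w"
    "\<And>R. R \<in> {0<..1} \<Longrightarrow> flux (deriv \<rho>) (real M) R (r R) (p R) = w R"
    "\<And>R. R \<in> {0<..<1} \<Longrightarrow> (r has_real_derivative p R) (at R)"
    "\<And>R. R \<in> {0<..<1} \<Longrightarrow> (w has_real_derivative
       (real M)\<^sup>2 * r R / R + real M * deriv \<rho> (real M * r R * p R / R) * p R) (at R)"
proof -
  note loc = radial_C1_local[OF fc fm fb sol]
  obtain G1 where G1: "continuous_on {1/2..1} G1" "\<And>R. R \<in> {1/2<..<1} \<Longrightarrow> (r has_real_derivative G1 R) (at R)"
    by (rule loc[of "1/2"]) auto
  \<comment> \<open>At \<open>1\<close> the value of \<open>deriv r\<close> carries no information,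
    as \<open>r\<close> is constrained only on \<open>(0, 1]\<close>; the left limit
    \<open>G1 1\<close> takes its place.\<close>
  define p where "p R = (if R < 1 then deriv r R else G1 1)" for R
  define w where "w R = flux (deriv \<rho>) (real M) R (r R) (p R)" for R
  have main: "continuous_on {a..1} r \<and> continuous_on {a<..1} p \<and> continuous_on {a<..1} w \<and>
     (\<forall>R\<in>{a<..<1}. (r has_real_derivative p R) (at R) \<and> (w has_real_derivative
       (real M)\<^sup>2 * r R / R + real M * deriv \<rho> (real M * r R * p R / R) * p R) (at R))"
    if a: "0 < a" "a < 1" for a
  proof -
    obtain G v where G: "continuous_on {a..1} G" "continuous_on {a..1} v"
      "\<And>R. R \<in> {a..1} \<Longrightarrow> flux (deriv \<rho>) (real M) R (r R) (G R) = v R"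
      "\<And>R. R \<in> {a<..<1} \<Longrightarrow> (r has_real_derivative G R) (at R)"
      "\<And>R. R \<in> {a<..<1} \<Longrightarrow> (v has_real_derivative
       (real M)\<^sup>2 * r R / R + real M * deriv \<rho> (real M * r R * G R / R) * G R) (at R)"
      using loc[OF a] by blast
    have pG: "p R = G R" if "R \<in> {a<..<1}" for R
      using DERIV_imp_deriv[OF G(4)[OF that]] that by (simp add: p_def)
    have lim: "((\<lambda>R. G R) \<longlongrightarrow> G 1) (at_left 1)" 
      using G(1) a by (auto simp: continuous_on_def at_within_Icc_at_left dest!: bspec[of _ _ 1])
    have "((\<lambda>R. G1 R) \<longlongrightarrow> G1 1) (at_left 1)"
      using G1(1) by (auto simp: continuous_on_def at_within_Icc_at_left dest!: bspec[of _ _ 1])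
    moreover have "\<forall>\<^sub>F R in at_left 1. G1 R = G R"
    proof -
      have "\<forall>\<^sub>F R in at_left 1. R \<in> {max a (1/2)<..<1}"
        by (rule eventually_at_leftI[of "max a (1/2)"]) (use a in auto)
      then show ?thesis by eventually_elim (use G1(2) G(4) in \<open>auto intro: DERIV_unique\<close>)
    qed
    ultimately have "((\<lambda>R. G R) \<longlongrightarrow> G1 1) (at_left 1)" by (rule Lim_transform_eventually)
    then have "G1 1 = G 1" using lim tendsto_unique trivial_limit_at_left_real by blast
    then have pG': "p R = G R" if "R \<in> {a<..1}" for R
      using that pG[of R] by (cases "R < 1") (auto simp: p_def)
    have wv: "w R = v R" if "R \<in> {a<..1}" for R
      using that pG'[OF that] G(3)[of R] by (simp add: w_def)
    have "continuous_on {a..1} r"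
      using sol a unfolding radial_weak_sol_def
      by (intro abs_cont_intervals_imp_continuous abs_cont_on_imp_intervals) auto
    moreover have "continuous_on {a<..1} p"
      by (rule continuous_on_eq[OF continuous_on_subset[OF G(1)]]) (auto simp: pG')
    moreover have "continuous_on {a<..1} w"
      by (rule continuous_on_eq[OF continuous_on_subset[OF G(2)]]) (auto simp: wv)
    moreover have "(w has_real_derivative
       (real M)\<^sup>2 * r R / R + real M * deriv \<rho> (real M * r R * p R / R) * p R) (at R)" if R: "R \<in> {a<..<1}" for R
    proof (rule has_field_derivative_transform_within_open[OF _ open_greaterThanLessThan R])
      show "(v has_real_derivative
       (real M)\<^sup>2 * r R / R + real M * deriv \<rho> (real M * r R * p R / R) * p R) (at R)"
        using G(5)[OF R] pG[OF R] by simp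
    qed (simp add: wv)
    moreover have "(r has_real_derivative p R) (at R)" if R: "R \<in> {a<..<1}" for R
      using G(4)[OF R] pG[OF R] by simp
    ultimately show ?thesis by blast
  qed
  \<comment> \<open>Continuity is local, so the sets \<open>(a, 1]\<close> suffice: near
    \<open>x\<close> one takes \<open>a = x / 2\<close>.\<close>
  have open_cover: "continuous_on {0<..1} h" if "\<And>a. 0 < a \<Longrightarrow> a < 1 \<Longrightarrow> continuous_on {a<..1} h" for h :: "real \<Rightarrow> real"
    unfolding continuous_on_eq_continuous_within
  proof
    fix x :: real assume x: "x \<in> {0<..1}"
    then have "continuous (at x within {x/2<..1}) h"
      using that[of "x/2"] by (auto simp: continuous_on_eq_continuous_within)
    moreover have "at x within {x/2<..1} = at x within {0<..1}"
      by (rule at_within_nhd[of _ "{x/2<..}"]) (use x in auto)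
    ultimately show "continuous (at x within {0<..1}) h" by (simp add: continuous_within)
  qed
  show ?thesis
  proof (rule that[of p w])
    show "continuous_on {0<..1} r"
      by (rule open_cover, rule continuous_on_subset) (use main in auto)
    show "continuous_on {0<..1} p" "continuous_on {0<..1} w" using main by (auto intro!: open_cover)
    fix R :: real assume R: "R \<in> {0<..<1}"
    then show "(r has_real_derivative p R) (at R)" "(w has_real_derivative
       (real M)\<^sup>2 * r R / R + real M * deriv \<rho> (real M * r R * p R / R) * p R) (at R)"
      using main[of "R/2"] by auto
  qed (simp add: w_def)
qed

section \<open>The radial ordinary differential equation\<close>

lemma mono_from_derivative:
  fixes f f' :: "real \<Rightarrow> real"
  assumes "a \<le> b" "continuous_on {a..b} f" "\<And>x. a < x \<Longrightarrow> x < b \<Longrightarrow> (f has_real_derivative f' x) (at x)"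
    and "\<And>x. a < x \<Longrightarrow> x < b \<Longrightarrow> 0 \<le> f' x"
  shows "f a \<le> f b"
proof (cases "a = b")
  case False
  then obtain l z where z: "a < z" "z < b" "DERIV f z :> l" "f b - f a = (b - a) * l"
    using MVT[of a b f] assms by (auto simp: real_differentiable_def)
  then have "l = f' z" using DERIV_unique assms(3) by blast
  then have "0 \<le> (b - a) * l" using z assms(1,4) by simp
  then show ?thesis using z(4) by linarith
qed simp

lemma antimono_from_derivative:
  fixes f f' :: "real \<Rightarrow> real"
  assumes "a \<le> b" "continuous_on {a..b} f" "\<And>x. a < x \<Longrightarrow> x < b \<Longrightarrow> (f has_real_derivative f' x) (at x)"
    and "\<And>x. a < x \<Longrightarrow> x < b \<Longrightarrow> f' x \<le> 0"
  shows "f b \<le> f a"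
  using mono_from_derivative[of a b "\<lambda>x. - f x" "\<lambda>x. - f' x"] assms by (auto intro!: continuous_intros DERIV_minus)

text \<open>Followed backwards in \<open>ln R\<close>, the function decreases at rate at least
  \<open>c\<close> while it is at most \<open>\<mu>\<close>. Once there, it stays there all the way
  to the origin and would become negative.\<close>

lemma trap_above:
  fixes g g' :: "real \<Rightarrow> real"
  assumes g: "\<And>R. R \<in> {0<..<1} \<Longrightarrow> (g has_real_derivative g' R) (at R)" "\<And>R. R \<in> {0<..<1} \<Longrightarrow> 0 \<le> g R"
    and c: "c > 0" "\<And>R. R \<in> {0<..<1} \<Longrightarrow> g R \<le> \<mu> \<Longrightarrow> c \<le> R * g' R"
    and R: "R \<in> {0<..<1}"
  shows "\<mu> < g R"
proof (rule ccontr)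
  assume "\<not> \<mu> < g R"
  then have R\<mu>: "g R \<le> \<mu>" by simp
  have gc: "continuous_on {x..y} g" if "0 < x" "y < 1" for x y
    by (rule DERIV_continuous_on[of _ _ g']) (use g(1) that in \<open>auto intro: has_field_derivative_at_within\<close>)
  have below: "g x \<le> \<mu>" if x: "0 < x" "x < R" for x
  proof (rule ccontr)
    assume nx: "\<not> g x \<le> \<mu>"
    \<comment> \<open>At the first point after \<open>x\<close> where \<open>g\<close> is at most
      \<open>\<mu>\<close>, the positive slope puts an earlier point into \<open>S\<close>.\<close>
    define S where "S = {y \<in> {x..R}. g y \<le> \<mu>}"
    have "closed S" unfolding S_def
      using continuous_closed_preimage[OF gc[of x R], of "{..\<mu>}"] x R by (simp add: vimage_def Int_def conj_commute)
    moreover have "{x..R} \<inter> S = S" by (auto simp: S_def)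
    ultimately have cS: "compact S" using compact_Int_closed[of "{x..R}" S] by simp
    have "R \<in> S" using R\<mu> x by (simp add: S_def)
    then obtain z where z: "z \<in> S" "\<And>y. y \<in> S \<Longrightarrow> z \<le> y" using compact_attains_inf[OF cS] by blast
    have zx: "x < z" "z \<le> R" "g z \<le> \<mu>" using z(1) nx by (auto simp: S_def less_le)
    have z01: "z \<in> {0<..<1}" using zx x R by auto
    have "c \<le> z * g' z" by (rule c(2)[OF z01 zx(3)])
    then have "0 < g' z" using c(1) z01 by (metis greaterThanLessThan_iff less_le_trans zero_less_mult_pos)
    then obtain e where e: "e > 0" "\<And>h. 0 < h \<Longrightarrow> h < e \<Longrightarrow> g (z - h) < g z"
      using DERIV_pos_inc_left[OF g(1)[OF z01]] by blast
    define h where "h = min (e / 2) ((z - x) / 2)"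
    have h: "0 < h" "h < e" "x < z - h" using e(1) zx by (auto simp: h_def min_def field_simps)
    have "z - h \<in> S" using e(2)[OF h(1,2)] zx h by (auto simp: S_def)
    then show False using z(2) h(1) by force
  qed
  \<comment> \<open>Then \<open>ln R - ln x = (\<mu> + 1) / c\<close>, so the decrease is at least
    \<open>\<mu> + 1\<close> and leaves \<open>g x\<close> at most \<open>-1\<close>.\<close>
  define x where "x = R * exp (- (\<mu> + 1) / c)"
  have mu: "0 \<le> \<mu>" using R\<mu> g(2)[OF R] by linarith
  have x: "0 < x" "x < R" using R c(1) mu by (auto simp: x_def divide_less_0_iff)
  have "g x - c * ln x \<le> g R - c * ln R"
  proof (rule mono_from_derivative[where f = "\<lambda>x. g x - c * ln x" and f' = "\<lambda>y. g' y - c * inverse y"])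
    fix y assume y: "x < y" "y < R"
    then have y01: "y \<in> {0<..<1}" using x R by auto
    show "((\<lambda>x. g x - c * ln x) has_real_derivative (g' y - c * inverse y)) (at y)"
      using g(1)[OF y01] y x by (auto intro!: derivative_eq_intros simp: field_simps)
    have "c \<le> y * g' y" using below[of y] y x by (intro c(2)[OF y01]) auto
    then show "0 \<le> g' y - c * inverse y" using y01 by (simp add: field_simps)
  qed (use x R in \<open>auto intro!: continuous_intros gc\<close>)
  moreover have "ln x = ln R - (\<mu> + 1) / c" using R by (simp add: x_def ln_mult diff_divide_distrib add_divide_distrib)
  then have "c * ln x = c * ln R - (\<mu> + 1)" using c(1) by (simp add: right_diff_distrib)
  ultimately have "g x \<le> g R - (\<mu> + 1)" by linarith
  then show False using R\<mu> g(2)[of x] x R by auto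
qed

text \<open>Integrating factor \<open>R^c\<close>: the function \<open>z\<close> is nonincreasing,
  and boundedness of \<open>y\<close> bounds it near \<open>0\<close> by a quantity that tends to
  zero, so \<open>z\<close> is nowhere positive.\<close>

lemma decay_bound:
  fixes y y' :: "real \<Rightarrow> real"
  assumes y: "\<And>R. R \<in> {0<..<1} \<Longrightarrow> (y has_real_derivative y' R) (at R)"
    "\<And>R. R \<in> {0<..<1} \<Longrightarrow> \<bar>y R\<bar> \<le> B"
    and c: "c > 0" "\<alpha> \<ge> 0" "\<And>R. R \<in> {0<..<1} \<Longrightarrow> R * y' R \<le> - c * y R + C * R powr \<alpha>"
    and R: "R \<in> {0<..<1}"
  shows "y R \<le> C / (c + \<alpha>) * R powr \<alpha>"
proof -
  define z where "z R = R powr c * y R - C / (c + \<alpha>) * R powr (c + \<alpha>)" for R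
  have zd: "(z has_real_derivative (R powr c * (c * y R / R + y' R) - C * R powr (c + \<alpha>) / R)) (at R)" if "R \<in> {0<..<1}" for R
  proof -
    have "(z has_real_derivative (c * R powr (c - 1) * y R + R powr c * y' R - C / (c + \<alpha>) * ((c + \<alpha>) * R powr (c + \<alpha> - 1)))) (at R)"
      unfolding z_def using that by (auto intro!: derivative_eq_intros y(1))
    moreover have "R powr (c - 1) = R powr c / R" "R powr (c + \<alpha> - 1) = R powr (c + \<alpha>) / R"
      using that by (simp_all add: powr_diff)
    moreover have "c + \<alpha> \<noteq> 0" using c(1,2) by linarith
    then have "c * R powr (c - 1) * y R + R powr c * y' R - C / (c + \<alpha>) * ((c + \<alpha>) * R powr (c + \<alpha> - 1)) =
        R powr c * (c * y R / R + y' R) - C * R powr (c + \<alpha>) / R" if "R powr (c - 1) = R powr c / R"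
        "R powr (c + \<alpha> - 1) = R powr (c + \<alpha>) / R" unfolding that by (simp add: distrib_left mult_ac)
    ultimately show ?thesis by simp
  qed
  have dec: "z R \<le> z x" if x: "0 < x" "x < R" for x
  proof (rule antimono_from_derivative[where f = z and a = x and b = R])
    fix t assume t: "x < t" "t < R"
    then have t01: "t \<in> {0<..<1}" using x R by auto
    have "t * (t powr c * (c * y t / t + y' t) - C * t powr (c + \<alpha>) / t) = t powr c * (c * y t + t * y' t - C * t powr \<alpha>)"
      using t01 by (simp add: powr_add field_simps)
    also have "\<dots> \<le> 0" using c(3)[OF t01] by (intro mult_nonneg_nonpos) auto
    finally show "t powr c * (c * y t / t + y' t) - C * t powr (c + \<alpha>) / t \<le> 0"
      using t01 by (simp add: mult_le_0_iff)
    show "(z has_real_derivative (t powr c * (c * y t / t + y' t) - C * t powr (c + \<alpha>) / t)) (at t)"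
      by (rule zd[OF t01])
  next
    show "continuous_on {x..R} z"
      by (rule DERIV_continuous_on, rule has_field_derivative_at_within, rule zd) (use x R in auto)
  qed (use x in auto)
  have "((\<lambda>x. x powr c * (B + \<bar>C / (c + \<alpha>)\<bar>)) \<longlongrightarrow> 0) (at_right 0)"
  proof -
    have "((\<lambda>x. x powr c) \<longlongrightarrow> 0) (at_right (0::real))"
      by (rule tendsto_zero_powrI[of "\<lambda>x. x" _ "\<lambda>_. c" c]) (use c(1) in \<open>auto simp: eventually_at_filter\<close>)
    then show ?thesis using tendsto_mult_left_zero by blast
  qed
  moreover have "\<forall>\<^sub>F x in at_right 0. z R \<le> x powr c * (B + \<bar>C / (c + \<alpha>)\<bar>)"
    unfolding eventually_at_right_field
  proof (intro exI[of _ R] conjI allI impI)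
    fix x assume x: "0 < x" "x < R"
    then have x01: "x \<in> {0<..<1}" using R by auto
    have "x powr c * y x \<le> x powr c * B" using y(2)[OF x01] by (intro mult_left_mono) auto
    moreover have "- (C / (c + \<alpha>) * x powr (c + \<alpha>)) \<le> x powr c * \<bar>C / (c + \<alpha>)\<bar>"
    proof -
      have "x powr (c + \<alpha>) \<le> x powr c" using x01 c by (intro powr_mono') auto
      then have "\<bar>C / (c + \<alpha>)\<bar> * x powr (c + \<alpha>) \<le> \<bar>C / (c + \<alpha>)\<bar> * x powr c" by (intro mult_left_mono) auto
      moreover have "- (C / (c + \<alpha>)) * x powr (c + \<alpha>) \<le> \<bar>C / (c + \<alpha>)\<bar> * x powr (c + \<alpha>)"
        by (intro mult_right_mono abs_ge_minus_self) auto
      ultimately show ?thesis by (simp add: mult.commute)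
    qed
    ultimately have "z x \<le> x powr c * (B + \<bar>C / (c + \<alpha>)\<bar>)" unfolding z_def distrib_left by linarith
    then show "z R \<le> x powr c * (B + \<bar>C / (c + \<alpha>)\<bar>)" using dec[OF x] by linarith
  qed (use R in auto)
  ultimately have "z R \<le> 0" by (rule tendsto_lowerbound) simp
  then have "R powr c * (y R - C / (c + \<alpha>) * R powr \<alpha>) \<le> 0"
    by (simp add: z_def powr_add algebra_simps)
  then show ?thesis using R by (simp add: mult_le_0_iff)
qed

text \<open>Here \<open>f\<close> and \<open>f2\<close> stand for \<open>\<rho>'\<close> and
  \<open>\<rho>''\<close>, \<open>p\<close> for \<open>r'\<close>, \<open>w\<close> for the flux and
  \<open>m\<close> for \<open>M\<close>. The information about the origin is contained in
  \<open>r_int\<close>.\<close>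

locale radial_ode =
  fixes f f2 r p w :: "real \<Rightarrow> real" and m \<gamma> K :: real
  assumes f_deriv: "\<And>s. (f has_real_derivative f2 s) (at s)"
    and f_bounds: "\<And>s. 0 \<le> f s" "\<And>s. f s \<le> \<gamma>"
    and f2_bounds: "\<And>s. 0 \<le> f2 s" "\<And>s. f2 s \<le> K"
    and m1: "1 \<le> m"
    and r_cont: "continuous_on {0<..1} r" and p_cont: "continuous_on {0<..1} p" and w_cont: "continuous_on {0<..1} w"
    and w_eq: "\<And>R. R \<in> {0<..1} \<Longrightarrow> flux f m R (r R) (p R) = w R"
    and r_deriv: "\<And>R. R \<in> {0<..<1} \<Longrightarrow> (r has_real_derivative p R) (at R)"
    and w_deriv: "\<And>R. R \<in> {0<..<1} \<Longrightarrow>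
      (w has_real_derivative (m\<^sup>2 * r R / R + m * f (m * r R * p R / R) * p R)) (at R)"
    and r_int: "set_integrable lborel {0<..<1} (\<lambda>R. (r R)\<^sup>2 / R)"
    and r_1: "r 1 = 1"
begin

definition d where "d R = m * r R * p R / R"

text \<open>The value found by differentiating \<open>R^2 / m * d + m * r^2 * f(d) = r * w\<close>,
  which is the definition of the flux multiplied by \<open>r\<close>.\<close>

definition d' where
  "d' R = (R * (p R)\<^sup>2 + m\<^sup>2 * (r R)\<^sup>2 / R - 2 * r R * p R) / (R\<^sup>2 / m + m * (r R)\<^sup>2 * f2 (d R))"

lemma f_mono: "x \<le> y \<Longrightarrow> f x \<le> f y"
  by (rule DERIV_nonneg_imp_nondecreasing) (use f_deriv f2_bounds(1) in auto)

lemma K_nonneg: "0 \<le> K"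
  using f2_bounds order_trans by blast

lemma d_cont: "continuous_on {0<..1} d"
  unfolding d_def by (intro continuous_intros r_cont p_cont) auto

lemma d_den_pos: "R > 0 \<Longrightarrow> 0 < R\<^sup>2 / m + m * (r R)\<^sup>2 * f2 x"
  using m1 f2_bounds(1) by (intro add_pos_nonneg) auto

text \<open>\<open>p\<close> is not known to be differentiable, so \<open>d\<close> is treated as
  the solution of \<open>A d + B f(d) = C\<close> with differentiable \<open>A\<close>,
  \<open>B\<close>, \<open>C\<close>. Writing the increment of \<open>f\<close> with Caratheodory's
  slope \<open>\<sigma>\<close>, which is nonnegative, makes the increment of \<open>d\<close> an
  explicit quotient.\<close>

lemma d_deriv:
  assumes R: "R \<in> {0<..<1}" shows "(d has_real_derivative d' R) (at R)"
proof -
  obtain \<sigma> where \<sigma>: "\<And>z. f z - f (d R) = \<sigma> z * (z - d R)" "isCont \<sigma> (d R)" "\<sigma> (d R) = f2 (d R)"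
    using f_deriv[of "d R"] unfolding CARAT_DERIV by blast
  have \<sigma>0: "0 \<le> \<sigma> z" for z
  proof (cases z "d R" rule: linorder_cases)
    case less
    then have "\<sigma> z * (z - d R) \<le> 0" using f_mono[of z "d R"] \<sigma>(1)[of z] by simp
    then show ?thesis using less by (simp add: mult_le_0_iff)
  next
    case equal
    then show ?thesis using \<sigma>(3) f2_bounds(1) by simp
  next
    case greater
    then have "0 \<le> \<sigma> z * (z - d R)" using f_mono[of "d R" z] \<sigma>(1)[of z] by simp
    then show ?thesis using greater by (simp add: zero_le_mult_iff)
  qed
  define A B where "A x = x\<^sup>2 / m" and "B x = m * (r x)\<^sup>2" for x
  define C where "C x = r x * w x" for x
  have ABC: "A x * d x + B x * f (d x) = C x" if "x \<in> {0<..1}" for x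
    using w_eq[OF that, symmetric] m1 that by (simp add: A_def B_def C_def d_def flux_def field_simps power2_eq_square)
  \<comment> \<open>The increments of the coefficients, with \<open>d\<close> frozen at its value at
    \<open>R\<close>.\<close>
  define E where "E x = C x - C R - (A x - A R) * d R - (B x - B R) * f (d R)" for x
  define E' where "E' = R * (p R)\<^sup>2 + m\<^sup>2 * (r R)\<^sup>2 / R - 2 * r R * p R"
  have "(E has_real_derivative
      (p R * w R + r R * (m\<^sup>2 * r R / R + m * f (m * r R * p R / R) * p R)
        - 2 * R / m * d R - m * (2 * r R * p R) * f (d R))) (at R)"
    unfolding E_def C_def A_def B_def using R m1
    by (auto intro!: derivative_eq_intros r_deriv w_deriv simp: power2_eq_square field_simps)
  moreover have "p R * w R + r R * (m\<^sup>2 * r R / R + m * f (m * r R * p R / R) * p R)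
        - 2 * R / m * d R - m * (2 * r R * p R) * f (d R) = E'"
    using w_eq[of R, symmetric] R m1 by (simp add: E'_def d_def flux_def field_simps power2_eq_square)
  ultimately have "(E has_real_derivative E') (at R)" by simp
  then obtain S where S: "\<And>z. E z - E R = S z * (z - R)" "isCont S R" "S R = E'"
    unfolding CARAT_DERIV by blast
  have ER: "E R = 0" by (simp add: E_def)
  define D where "D x = A x + B x * \<sigma> (d x)" for x
  have D0: "0 < D x" if "x \<in> {0<..<1}" for x
    using that m1 \<sigma>0 unfolding D_def A_def B_def by (intro add_pos_nonneg) auto
  have cont: "isCont r R" "isCont d R"
  proof -
    show "isCont r R" using r_deriv[OF R] by (rule DERIV_isCont)
    have "continuous_on {0<..<1} d" by (rule continuous_on_subset[OF d_cont]) auto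
    then show "isCont d R" using R by (simp add: continuous_on_eq_continuous_at)
  qed
  have "isCont D R" unfolding D_def A_def B_def
    by (intro continuous_intros isCont_o2[OF cont(2) \<sigma>(2)] cont) (use m1 in auto)
  have "((\<lambda>x. d R + S x / D x * (x - R)) has_real_derivative E' / D R) (at R)"
    unfolding CARAT_DERIV
    by (intro exI[of _ "\<lambda>x. S x / D x"] conjI allI continuous_intros S(2) \<open>isCont D R\<close>)
      (use D0[OF R] S(3) in auto)
  moreover have "d R + S x / D x * (x - R) = d x" if x: "x \<in> {0<..<1}" for x
  proof -
    have "A x * d x + B x * f (d x) - (A R * d R + B R * f (d R)) = C x - C R"
      using ABC[of x] ABC[of R] x R by simp
    then have "D x * (d x - d R) = E x"
    proof -
      have fu: "f (d x) = f (d R) + \<sigma> (d x) * (d x - d R)" using \<sigma>(1)[of "d x"] by simp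
      show ?thesis using \<open>A x * d x + B x * f (d x) - (A R * d R + B R * f (d R)) = C x - C R\<close>
        unfolding fu D_def E_def by (simp add: algebra_simps)
    qed
    then have "D x * (d x - d R) = S x * (x - R)" using S(1)[of x] ER by simp
    then show ?thesis using D0[OF x] by (simp add: field_simps)
  qed
  ultimately have "(d has_real_derivative E' / D R) (at R)"
    using has_field_derivative_transform_within_open[OF _ open_greaterThanLessThan R] by blast
  moreover have "E' / D R = d' R" by (simp add: d'_def E'_def D_def A_def B_def \<sigma>(3))
  ultimately show ?thesis by simp
qed

text \<open>The numerator times \<open>R\<close> is \<open>(R p - r)^2 + (m^2 - 1) r^2\<close>, and
  \<open>m \<ge> 1\<close>.\<close>

lemma d'_nonneg: "R \<in> {0<..<1} \<Longrightarrow> 0 \<le> d' R"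
proof -
  assume R: "R \<in> {0<..<1}"
  have "R * (R * (p R)\<^sup>2 + m\<^sup>2 * (r R)\<^sup>2 / R - 2 * r R * p R) = (R * p R - r R)\<^sup>2 + (m\<^sup>2 - 1) * (r R)\<^sup>2"
    using R by (simp add: field_simps power2_eq_square)
  also have "\<dots> \<ge> 0" using m1 by auto
  finally have "0 \<le> R * (p R)\<^sup>2 + m\<^sup>2 * (r R)\<^sup>2 / R - 2 * r R * p R" using R by (simp add: zero_le_mult_iff)
  then show ?thesis unfolding d'_def using d_den_pos[of R] R by (intro divide_nonneg_pos) auto
qed

lemma d_mono: "0 < x \<Longrightarrow> x \<le> y \<Longrightarrow> y \<le> 1 \<Longrightarrow> d x \<le> d y"
  by (rule mono_from_derivative[where f = d and f' = d'])
    (auto intro!: d_deriv d'_nonneg continuous_on_subset[OF d_cont])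

text \<open>\<open>\<eta> / R\<close> is not integrable at \<open>0\<close>, whereas
  \<open>r^2 / R\<close> is.\<close>

lemma not_bounded_below:
  assumes \<eta>: "\<eta> > 0" and R0: "0 < R0" "R0 \<le> 1"
  shows "\<exists>R. 0 < R \<and> R < R0 \<and> (r R)\<^sup>2 < \<eta>"
proof (rule ccontr)
  assume nb: "\<not> ?thesis"
  have big: "\<eta> \<le> (r R)\<^sup>2" if "0 < R" "R < R0" for R using nb that by (meson not_le)
  define I where "I = (LINT R:{0<..<1}|lborel. (r R)\<^sup>2 / R)"
  have I0: "0 \<le> I" unfolding I_def set_lebesgue_integral_def
    by (rule Bochner_Integration.integral_nonneg) (auto simp: indicator_def)
  define R1 where "R1 = R0 / 2"
  \<comment> \<open>Chosen so that the integral of \<open>\<eta> / x\<close> over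
    \<open>[a, R1]\<close> is \<open>I + 1\<close>.\<close>
  define a where "a = R1 * exp (- (I + 1) / \<eta>)"
  have R1: "0 < R1" "R1 < R0" using R0 by (auto simp: R1_def)
  have a: "0 < a" "a \<le> R1" using R1 I0 \<eta> by (auto simp: a_def divide_le_0_iff)
  have c: "continuous_on {a..R1} (\<lambda>x. \<eta> / x)" using a by (intro continuous_intros) auto
  have "(LINT x|lborel. (\<eta> / x) * indicator {a..R1} x) = \<eta> * ln R1 - \<eta> * ln a"
    by (rule integral_FTC_Icc_real[OF a(2)]) (use a in \<open>auto intro!: derivative_eq_intros continuous_intros simp: field_simps\<close>)
  also have "\<dots> = I + 1"
  proof -
    have "ln a = ln R1 - (I + 1) / \<eta>" using R1 by (simp add: a_def ln_mult diff_divide_distrib add_divide_distrib)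
    then show ?thesis using \<eta> by (simp add: right_diff_distrib)
  qed
  finally have 1: "(LINT x|lborel. (\<eta> / x) * indicator {a..R1} x) = I + 1" .
  have "(LINT x|lborel. (\<eta> / x) * indicator {a..R1} x) \<le> I"
    unfolding I_def set_lebesgue_integral_def
  proof (rule integral_mono)
    show "integrable lborel (\<lambda>x. (\<eta> / x) * indicator {a..R1} x)"
      using borel_integrable_compact[OF compact_Icc c] by (simp add: mult.commute)
    show "integrable lborel (\<lambda>x. indicator {0<..<1} x *\<^sub>R ((r x)\<^sup>2 / x))"
      using r_int by (simp add: set_integrable_def)
    fix x :: real
    show "(\<eta> / x) * indicator {a..R1} x \<le> indicator {0<..<1} x *\<^sub>R ((r x)\<^sup>2 / x)"
    proof (cases "x \<in> {a..R1}")
      case True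
      then have "0 < x" "x < R0" "x < 1" using a R1 R0 by auto
      then show ?thesis using True big[of x] by (simp add: divide_right_mono)
    qed (auto simp: indicator_def)
  qed
  then show False using 1 by simp
qed

lemma r_square_deriv: "R \<in> {0<..<1} \<Longrightarrow> ((\<lambda>R. (r R)\<^sup>2) has_real_derivative (2 * R * d R / m)) (at R)"
  using m1 by (auto intro!: derivative_eq_intros r_deriv simp: d_def field_simps power2_eq_square)

lemma r_cont_sub: "0 < x \<Longrightarrow> y \<le> 1 \<Longrightarrow> continuous_on {x..y} r"
  by (rule continuous_on_subset[OF r_cont]) auto

text \<open>Otherwise monotonicity makes \<open>d\<close> negative on \<open>(0, R]\<close>; then
  \<open>r^2\<close>, whose derivative is \<open>2 R d / m\<close>, decreases there and stays
  bounded away from zero near the origin.\<close>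

lemma d_nonneg: assumes R: "R \<in> {0<..1}" shows "0 \<le> d R"
proof (rule ccontr)
  assume "\<not> 0 \<le> d R"
  then have neg: "d x < 0" if "0 < x" "x \<le> R" for x using d_mono[of x R] that R by auto
  have dec: "(r y)\<^sup>2 \<le> (r x)\<^sup>2" if "0 < x" "x \<le> y" "y \<le> R" for x y
  proof (rule antimono_from_derivative[where f = "\<lambda>R. (r R)\<^sup>2" and a = x and b = y])
    fix z assume z: "x < z" "z < y"
    show "((\<lambda>R. (r R)\<^sup>2) has_real_derivative (2 * z * d z / m)) (at z)"
      using z that R by (intro r_square_deriv) auto
    show "2 * z * d z / m \<le> 0" using neg[of z] z that m1 by (auto simp: divide_le_0_iff mult_le_0_iff)
  qed (use that R in \<open>auto intro!: continuous_intros r_cont_sub\<close>)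
  have "r (R / 2) \<noteq> 0" using neg[of "R/2"] R by (auto simp: d_def)
  then obtain x where "0 < x" "x < R / 2" "(r x)\<^sup>2 < (r (R / 2))\<^sup>2"
    using not_bounded_below[of "(r (R / 2))\<^sup>2" "R / 2"] R by auto
  then show False using dec[of x "R / 2"] R by auto
qed

text \<open>The slope of \<open>r^2\<close> with respect to \<open>R^2\<close> is
  \<open>d / m\<close>; this is its largest value, as \<open>d\<close> increases up to
  \<open>1\<close>.\<close>

definition c where "c = d 1 / m"

lemma c_nonneg: "0 \<le> c"
  unfolding c_def using d_nonneg[of 1] m1 by simp

text \<open>\<open>r^2 - c R^2\<close> is nonincreasing, so a positive value at \<open>R\<close>
  would persist towards the origin and bound \<open>r^2\<close> from below.\<close>

lemma r_square_le: assumes R: "R \<in> {0<..1}" shows "(r R)\<^sup>2 \<le> c * R\<^sup>2"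
proof (rule ccontr)
  assume "\<not> ?thesis"
  then have pos: "0 < (r R)\<^sup>2 - c * R\<^sup>2" by simp
  obtain x where x: "0 < x" "x < R" "(r x)\<^sup>2 < (r R)\<^sup>2 - c * R\<^sup>2" using not_bounded_below[OF pos, of R] R by auto
  have "(r R)\<^sup>2 - c * R\<^sup>2 \<le> (r x)\<^sup>2 - c * x\<^sup>2"
  proof (rule antimono_from_derivative[where f = "\<lambda>R. (r R)\<^sup>2 - c * R\<^sup>2" and a = x and b = R])
    fix z assume z: "x < z" "z < R"
    show "((\<lambda>R. (r R)\<^sup>2 - c * R\<^sup>2) has_real_derivative (2 * z * d z / m - c * (2 * z))) (at z)"
    proof (rule DERIV_diff)
      show "((\<lambda>R. (r R)\<^sup>2) has_real_derivative (2 * z * d z / m)) (at z)" using z x R by (intro r_square_deriv) auto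
      show "((\<lambda>R. c * R\<^sup>2) has_real_derivative (c * (2 * z))) (at z)" by (auto intro!: derivative_eq_intros)
    qed
    have "2 * z * d z / m \<le> 2 * z * d 1 / m"
      using d_mono[of z 1] z x R m1 by (intro divide_right_mono mult_left_mono) auto
    then show "2 * z * d z / m - c * (2 * z) \<le> 0" by (simp add: c_def mult_ac)
  qed (use x R in \<open>auto intro!: continuous_intros r_cont_sub\<close>)
  then show False using x(3) c_nonneg by (smt (verit) mult_nonneg_nonneg zero_le_power2)
qed

lemma r_square_mono: assumes "0 < x" "x \<le> y" "y \<le> 1" shows "(r x)\<^sup>2 \<le> (r y)\<^sup>2"
proof (rule mono_from_derivative[where f = "\<lambda>R. (r R)\<^sup>2"])
  fix z assume z: "x < z" "z < y"
  show "((\<lambda>R. (r R)\<^sup>2) has_real_derivative (2 * z * d z / m)) (at z)"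
    using z assms by (intro r_square_deriv) auto
  show "0 \<le> 2 * z * d z / m" using d_nonneg[of z] z assms m1 by auto
qed (use assms in \<open>auto intro!: continuous_intros r_cont_sub\<close>)

text \<open>As \<open>r^2\<close> is nondecreasing, a zero at \<open>R\<close> spreads to
  \<open>(0, R]\<close>, and the flux vanishes there too. The bounds on \<open>f\<close> make
  \<open>r'\<close> and \<open>w'\<close> linearly bounded by \<open>r\<close> and \<open>w\<close>,
  so a Gronwall estimate for \<open>r^2 + w^2\<close> carries the zero forward to \<open>1\<close>,
  against \<open>r 1 = 1\<close>.\<close>

lemma r_nonzero: assumes R: "R \<in> {0<..1}" shows "r R \<noteq> 0"
proof
  assume r0: "r R = 0"
  then have R: "0 < R" "R < 1" using R r_1 by (auto simp: less_le)
  have z: "r x = 0" if "0 < x" "x \<le> R" for x using r_square_mono[of x R] that R r0 by simp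
  define a where "a = R / 2"
  have a: "0 < a" "a < R" using R by (auto simp: a_def)
  have pa: "p a = 0"
  proof -
    have a01: "a \<in> {0<..<1}" using a R by auto
    have "((\<lambda>_. 0) has_real_derivative 0) (at a)" by simp
    then have "(r has_real_derivative 0) (at a)"
      by (rule has_field_derivative_transform_within_open[where S = "{0<..<R}"]) (use a z in auto)
    then show ?thesis using r_deriv[OF a01] DERIV_unique by blast
  qed
  have wa: "w a = 0" using w_eq[of a] a R z[of a] pa by (simp add: flux_def)
  \<comment> \<open>\<open>x p = w - m f r\<close> and \<open>x \<ge> a\<close> bound
    \<open>p\<close> by \<open>P\<close> times \<open>\<bar>r\<bar> + \<bar>w\<bar>\<close>.\<close>
  define P where "P = (1 + m * \<gamma>) / a"
  have \<gamma>0: "0 \<le> \<gamma>" using f_bounds order_trans by blast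
  have P0: "0 \<le> P" using a m1 \<gamma>0 by (simp add: P_def)
  \<comment> \<open>The derivative of \<open>E\<close> is at most \<open>L / 2 * s^2\<close> with
    \<open>s = \<bar>r\<bar> + \<bar>w\<bar>\<close>, and \<open>s^2 \<le> 2 E\<close>.\<close>
  define L where "L = 4 * (P + m\<^sup>2 / a + m * \<gamma> * P)"
  define E where "E x = (r x)\<^sup>2 + (w x)\<^sup>2" for x
  have "E 1 * exp (- L * 1) \<le> E a * exp (- L * a)"
  proof (rule antimono_from_derivative[where f = "\<lambda>x. E x * exp (- L * x)" and a = a and b = 1])
    fix x assume x: "a < x" "x < 1"
    then have x01: "x \<in> {0<..<1}" using a by auto
    let ?V = "m\<^sup>2 * r x / x + m * f (m * r x * p x / x) * p x"
    show "((\<lambda>x. E x * exp (- L * x)) has_real_derivative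
        ((2 * r x * p x + 2 * w x * ?V - L * E x) * exp (- L * x))) (at x)"
      unfolding E_def
      by (rule derivative_eq_intros r_deriv[OF x01] w_deriv[OF x01] refl | simp)+ (simp add: algebra_simps)
    define s where "s = \<bar>r x\<bar> + \<bar>w x\<bar>"
    have s: "\<bar>r x\<bar> \<le> s" "\<bar>w x\<bar> \<le> s" "0 \<le> s" by (simp_all add: s_def)
    have mf: "0 \<le> m * f y" "m * f y \<le> m * \<gamma>" for y using m1 f_bounds by (auto intro: mult_left_mono)
    have am: "\<bar>m * f y * t\<bar> = m * f y * \<bar>t\<bar>" for y t
      using mf(1)[of y] by (simp only: abs_mult[of "m * f y" t] abs_of_nonneg)
    have p: "\<bar>p x\<bar> \<le> P * s"
    proof -
      have "w x - m * f (m * r x * p x / x) * r x = x * p x"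
        using w_eq[of x, symmetric] x01 by (simp add: flux_def)
      then have "x * \<bar>p x\<bar> = \<bar>w x - m * f (m * r x * p x / x) * r x\<bar>"
        using x01 by (simp add: abs_mult)
      also have "\<dots> \<le> \<bar>w x\<bar> + m * f (m * r x * p x / x) * \<bar>r x\<bar>"
        using abs_triangle_ineq4[of "w x" "m * f (m * r x * p x / x) * r x"] unfolding am .
      also have "\<dots> \<le> \<bar>w x\<bar> + m * \<gamma> * \<bar>r x\<bar>" using mf(2) by (intro add_left_mono mult_right_mono) auto
      also have "\<dots> \<le> (1 + m * \<gamma>) * s" using m1 \<gamma>0 by (simp add: s_def algebra_simps)
      finally have "x * \<bar>p x\<bar> \<le> (1 + m * \<gamma>) * s" .
      moreover have "a * \<bar>p x\<bar> \<le> x * \<bar>p x\<bar>" using x by (intro mult_right_mono) auto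
      ultimately show ?thesis using a by (simp add: P_def field_simps)
    qed
    have V: "\<bar>?V\<bar> \<le> (m\<^sup>2 / a + m * \<gamma> * P) * s"
    proof -
      have "\<bar>m\<^sup>2 * r x / x\<bar> \<le> m\<^sup>2 * \<bar>r x\<bar> / a"
        using x a by (simp add: abs_mult frac_le)
      also have "\<dots> \<le> m\<^sup>2 / a * s" using a s by (simp add: divide_right_mono mult_left_mono)
      finally have 1: "\<bar>m\<^sup>2 * r x / x\<bar> \<le> m\<^sup>2 / a * s" .
      have "\<bar>m * f (m * r x * p x / x) * p x\<bar> = m * f (m * r x * p x / x) * \<bar>p x\<bar>"
        by (rule am)
      also have "\<dots> \<le> m * \<gamma> * (P * s)" using mf p m1 \<gamma>0 f_bounds(1) by (intro mult_mono) auto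
      finally have "\<bar>m * f (m * r x * p x / x) * p x\<bar> \<le> m * \<gamma> * P * s" by simp
      then have "\<bar>?V\<bar> \<le> m\<^sup>2 / a * s + m * \<gamma> * P * s"
        using 1 abs_triangle_ineq[of "m\<^sup>2 * r x / x" "m * f (m * r x * p x / x) * p x"] by linarith
      then show ?thesis by (simp only: distrib_right)
    qed
    have "2 * r x * p x \<le> 2 * s * (P * s)"
    proof -
      have "r x * p x \<le> \<bar>r x\<bar> * \<bar>p x\<bar>" by (metis abs_ge_self abs_mult)
      also have "\<dots> \<le> s * (P * s)" using p s by (intro mult_mono) auto
      finally show ?thesis by (simp only: mult.assoc mult_le_cancel_left_pos zero_less_numeral)
    qed
    moreover have "2 * w x * ?V \<le> 2 * s * ((m\<^sup>2 / a + m * \<gamma> * P) * s)"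
    proof -
      have "w x * ?V \<le> \<bar>w x\<bar> * \<bar>?V\<bar>" by (metis abs_ge_self abs_mult)
      also have "\<dots> \<le> s * ((m\<^sup>2 / a + m * \<gamma> * P) * s)" using V s by (intro mult_mono) auto
      finally show ?thesis by (simp only: mult.assoc mult_le_cancel_left_pos zero_less_numeral)
    qed
    moreover have "2 * s * (P * s) + 2 * s * ((m\<^sup>2 / a + m * \<gamma> * P) * s) = L / 2 * s\<^sup>2"
      by (simp add: L_def power2_eq_square algebra_simps)
    moreover have "L / 2 * s\<^sup>2 \<le> L / 2 * (2 * E x)"
    proof (rule mult_left_mono)
      have "0 \<le> (\<bar>r x\<bar> - \<bar>w x\<bar>)\<^sup>2" by simp
      then show "s\<^sup>2 \<le> 2 * E x" by (simp add: E_def s_def power2_eq_square algebra_simps)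
      show "0 \<le> L / 2" using P0 a m1 \<gamma>0 by (simp add: L_def)
    qed
    ultimately have "2 * r x * p x + 2 * w x * ?V - L * E x \<le> 0" by simp
    then show "(2 * r x * p x + 2 * w x * ?V - L * E x) * exp (- L * x) \<le> 0"
      by (simp add: mult_le_0_iff)
  next
    show "continuous_on {a..1} (\<lambda>x. E x * exp (- L * x))" unfolding E_def
      using a by (intro continuous_intros continuous_on_subset[OF r_cont] continuous_on_subset[OF w_cont]) auto
  qed (use a R in auto)
  moreover have "E a = 0" using z[of a] wa a by (simp add: E_def)
  ultimately have "E 1 \<le> 0" by (simp add: mult_le_0_iff)
  then show False using r_1 by (simp add: E_def) (smt (verit) zero_le_power2)
qed

text \<open>\<open>r\<close> has no zero and equals \<open>1\<close> at \<open>1\<close>.\<close>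

lemma r_pos: assumes R: "R \<in> {0<..1}" shows "0 < r R"
proof (rule ccontr)
  assume "\<not> 0 < r R"
  then obtain x where "R \<le> x" "x \<le> 1" "r x = 0"
    using IVT'[of r R 0 1] R r_1 r_cont_sub[of R 1] by auto
  then show False using r_nonzero[of x] R by auto
qed

end

section \<open>Bounds and decay for the logarithmic derivative\<close>

context radial_ode
begin

text \<open>\<open>q\<close> is the logarithmic derivative of \<open>r\<close> with respect to \<open>ln R\<close>; in terms of it the radial
  equation has first order, with \<open>r\<close> entering only through \<open>eps\<close>.\<close>

definition q where "q R = R * p R / r R"

definition eps where "eps R = m\<^sup>2 * f2 (d R) * (r R)\<^sup>2 / R\<^sup>2"

definition q' where "q' R = (2 * q R - 2 * (q R)\<^sup>2 + ((q R)\<^sup>2 + m\<^sup>2 - 2 * q R) / (1 + eps R)) / R"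

definition E0 where "E0 = m\<^sup>2 * K * c"

lemma E0_nonneg: "0 \<le> E0"
  unfolding E0_def using K_nonneg c_nonneg by simp

lemma eps_bounds: assumes R: "R \<in> {0<..1}" shows "0 \<le> eps R" "eps R \<le> E0"
proof -
  show "0 \<le> eps R" using f2_bounds(1) by (simp add: eps_def)
  have "(r R)\<^sup>2 / R\<^sup>2 \<le> c" using r_square_le[OF R] R by (simp add: field_simps)
  then have "m\<^sup>2 * f2 (d R) * ((r R)\<^sup>2 / R\<^sup>2) \<le> m\<^sup>2 * K * c"
    using f2_bounds K_nonneg by (intro mult_mono) auto
  then show "eps R \<le> E0" by (simp add: eps_def E0_def)
qed

lemma q_cont: "continuous_on {0<..1} q"
  unfolding q_def by (intro continuous_intros r_cont p_cont) (use r_pos in fastforce)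

lemma p_eq: "R \<in> {0<..1} \<Longrightarrow> p R = q R * r R / R"
  using r_pos[of R] by (simp add: q_def)

lemma d_eq: "R \<in> {0<..1} \<Longrightarrow> d R = m * (r R)\<^sup>2 * q R / R\<^sup>2"
  using r_pos[of R] by (simp add: q_def d_def power2_eq_square)

lemma q_nonneg: "R \<in> {0<..1} \<Longrightarrow> 0 \<le> q R"
proof -
  assume R: "R \<in> {0<..1}"
  have "0 \<le> q R * (m * (r R)\<^sup>2 / R\<^sup>2)" using d_nonneg[OF R] d_eq[OF R] by (simp add: mult_ac)
  moreover have "0 < m * (r R)\<^sup>2 / R\<^sup>2" using R m1 r_pos[OF R] by simp
  ultimately show ?thesis by (simp only: zero_le_mult_iff) linarith
qed

lemma d'_eq: assumes R: "R \<in> {0<..1}"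
  shows "d' R = m * (r R)\<^sup>2 * ((q R)\<^sup>2 + m\<^sup>2 - 2 * q R) / (R ^ 3 * (1 + eps R))"
proof -
  have 1: "R * (p R)\<^sup>2 + m\<^sup>2 * (r R)\<^sup>2 / R - 2 * r R * p R = (r R)\<^sup>2 * ((q R)\<^sup>2 + m\<^sup>2 - 2 * q R) / R"
    unfolding p_eq[OF R] using R by (simp add: field_simps power2_eq_square)
  have 2: "R\<^sup>2 / m + m * (r R)\<^sup>2 * f2 (d R) = R\<^sup>2 * (1 + eps R) / m"
    unfolding eps_def using R m1 by (simp add: field_simps power2_eq_square)
  show ?thesis unfolding d'_def 1 2 by (simp add: power2_eq_square power3_eq_cube mult_ac)
qed

text \<open>\<open>q = R^2 d / (m r^2)\<close>, so \<open>q\<close> inherits differentiability from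
  \<open>d\<close> rather than from \<open>p\<close>.\<close>

lemma q_deriv: assumes R: "R \<in> {0<..<1}" shows "(q has_real_derivative q' R) (at R)"
proof -
  have R': "R \<in> {0<..1}" using R by auto
  have y: "r R > 0" using r_pos[OF R'] .
  have e1: "1 + eps R > 0" using eps_bounds(1)[OF R'] by linarith
  define N where "N = (\<lambda>R. R\<^sup>2 * d R)"
  define D where "D = (\<lambda>R. m * (r R)\<^sup>2)"
  have "(N has_real_derivative (2 * R * d R + R\<^sup>2 * d' R)) (at R)"
    unfolding N_def using R by (auto intro!: derivative_eq_intros d_deriv)
  moreover have "(D has_real_derivative (2 * R * d R)) (at R)"
    unfolding D_def using DERIV_cmult[OF r_square_deriv[OF R], of m] m1 by simp
  ultimately have "((\<lambda>R. N R / D R) has_real_derivative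
      ((2 * R * d R + R\<^sup>2 * d' R) * D R - N R * (2 * R * d R)) / (D R * D R)) (at R)"
    by (rule DERIV_divide) (use y m1 in \<open>auto simp: D_def\<close>)
  moreover have "((2 * R * d R + R\<^sup>2 * d' R) * D R - N R * (2 * R * d R)) / (D R * D R) = q' R"
  proof -
    have "((2 * R * d R + R\<^sup>2 * d' R) * D R - N R * (2 * R * d R)) / (D R * D R)
        = 2 * (R * d R / D R) + R\<^sup>2 * d' R / D R - 2 * R ^ 3 * (d R / D R)\<^sup>2"
      using y m1 by (simp add: D_def N_def field_simps power2_eq_square power3_eq_cube)
    also have "d R / D R = q R / R\<^sup>2" unfolding d_eq[OF R'] D_def using y m1 by simp
    also have "R * d R / D R = q R / R" unfolding d_eq[OF R'] D_def using y m1 R by (simp add: power2_eq_square)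
    also have "R\<^sup>2 * d' R / D R = ((q R)\<^sup>2 + m\<^sup>2 - 2 * q R) / (1 + eps R) / R"
      unfolding d'_eq[OF R'] D_def using y m1 R by (simp add: power2_eq_square power3_eq_cube)
    also have "2 * (q R / R) + ((q R)\<^sup>2 + m\<^sup>2 - 2 * q R) / (1 + eps R) / R - 2 * R ^ 3 * (q R / R\<^sup>2)\<^sup>2 = q' R"
      unfolding q'_def using R by (simp add: diff_divide_distrib add_divide_distrib power2_eq_square power3_eq_cube)
    finally show ?thesis .
  qed
  moreover have "q x = N x / D x" if "x \<in> {0<..<1}" for x
    using that r_pos[of x] m1 by (simp add: N_def D_def d_eq)
  ultimately show ?thesis
    using has_field_derivative_transform_within_open[OF _ open_greaterThanLessThan R, of "\<lambda>R. N R / D R" "q' R" q] by simp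
qed

text \<open>In this form the signs are visible: the numerator is \<open>m^2 - 1 \<ge> 0\<close> at
  \<open>q = 1\<close> and \<open>- 2 eps m (m - 1) \<le> 0\<close> at \<open>q = m\<close>.\<close>

lemma Rq'_eq: assumes R: "R \<in> {0<..1}"
  shows "R * q' R = (m\<^sup>2 - (q R)\<^sup>2 - 2 * eps R * q R * (q R - 1)) / (1 + eps R)"
proof -
  have "1 + eps R \<noteq> 0" using eps_bounds(1)[OF R] by linarith
  moreover have "R * q' R = 2 * q R - 2 * (q R)\<^sup>2 + ((q R)\<^sup>2 + m\<^sup>2 - 2 * q R) / (1 + eps R)"
    using R by (simp add: q'_def)
  ultimately show ?thesis by (simp add: field_simps power2_eq_square)
qed

text \<open>While \<open>q \<le> \<mu>\<close>, the hypothesis bounds the numerator of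
  \<open>R q'\<close> from below by a positive constant, and \<open>q \<ge> 0\<close> excludes this
  by \<open>trap_above\<close>. The maximum treats \<open>\<mu> \<le> 1\<close> and
  \<open>\<mu> > 1\<close> together.\<close>

lemma q_lower: assumes R: "R \<in> {0<..<1}" and \<mu>: "0 < \<mu>" "0 < m\<^sup>2 - \<mu>\<^sup>2 - 2 * E0 * \<mu> * max 0 (\<mu> - 1)"
  shows "\<mu> < q R"
proof (rule trap_above[of q q', OF q_deriv])
  define k where "k = m\<^sup>2 - \<mu>\<^sup>2 - 2 * E0 * \<mu> * max 0 (\<mu> - 1)"
  show "0 < k / (1 + E0)" using \<mu>(2) E0_nonneg by (simp add: k_def)
  fix R :: real assume R: "R \<in> {0<..<1}" and le: "q R \<le> \<mu>"
  then have R': "R \<in> {0<..1}" by auto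
  note e = eps_bounds[OF R']
  have q0: "0 \<le> q R" by (rule q_nonneg[OF R'])
  have "(q R)\<^sup>2 \<le> \<mu>\<^sup>2" using q0 le by (intro power_mono)
  moreover have "2 * eps R * q R * (q R - 1) \<le> 2 * E0 * \<mu> * max 0 (\<mu> - 1)"
  proof -
    have "2 * eps R * q R * (q R - 1) \<le> 2 * eps R * q R * max 0 (\<mu> - 1)"
      using e q0 le by (intro mult_left_mono) auto
    also have "\<dots> \<le> 2 * E0 * \<mu> * max 0 (\<mu> - 1)"
      using e q0 le E0_nonneg by (intro mult_right_mono mult_mono) auto
    finally show ?thesis .
  qed
  ultimately have "k \<le> m\<^sup>2 - (q R)\<^sup>2 - 2 * eps R * q R * (q R - 1)" by (simp add: k_def)
  then have "k / (1 + E0) \<le> (m\<^sup>2 - (q R)\<^sup>2 - 2 * eps R * q R * (q R - 1)) / (1 + eps R)"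
    using \<mu>(2) e by (intro frac_le) (auto simp: k_def)
  then show "k / (1 + E0) \<le> R * q' R" by (simp add: Rq'_eq[OF R'])
qed (use R q_nonneg in auto)

text \<open>For \<open>\<mu> < 1\<close> the term with \<open>E0\<close> vanishes, and the condition
  of \<open>q_lower\<close> reads \<open>\<mu>^2 < m^2\<close>.\<close>

lemma q_ge_1: assumes R: "R \<in> {0<..<1}" shows "1 \<le> q R"
proof (rule field_le_mult_one_interval)
  fix z :: real assume z: "0 < z" "z < 1"
  have "z\<^sup>2 < 1" using z by (simp add: power_less_one_iff)
  moreover have "1 \<le> m\<^sup>2" using m1 by (simp add: one_le_power)
  ultimately have "z < q R" using z by (intro q_lower[OF R]) auto
  then show "z * 1 \<le> q R" by simp
qed

text \<open>Above \<open>m\<close> the function \<open>q\<close> grows towards the origin. Its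
  reciprocal is nonnegative and decreases in that direction, so \<open>trap_above\<close> applies to
  \<open>1 / q\<close>.\<close>

lemma q_le_m: assumes R: "R \<in> {0<..<1}" shows "q R \<le> m"
proof (rule dense_ge)
  fix \<mu> assume \<mu>: "m < \<mu>"
  have "1 / \<mu> < 1 / q R"
  proof (rule trap_above[of "\<lambda>R. 1 / q R" "\<lambda>R. - q' R / (q R)\<^sup>2" "(1 - m\<^sup>2 / \<mu>\<^sup>2) / (1 + E0)" "1 / \<mu>" R])
    have "m\<^sup>2 < \<mu>\<^sup>2" using \<mu> m1 by (intro power_strict_mono) auto
    then have mm: "0 < 1 - m\<^sup>2 / \<mu>\<^sup>2" using \<mu> m1 by simp
    then show "0 < (1 - m\<^sup>2 / \<mu>\<^sup>2) / (1 + E0)" using E0_nonneg by simp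
    fix R :: real assume R: "R \<in> {0<..<1}"
    then have R': "R \<in> {0<..1}" by auto
    note e = eps_bounds[OF R']
    have q1: "1 \<le> q R" by (rule q_ge_1[OF R])
    show "((\<lambda>R. 1 / q R) has_real_derivative - q' R / (q R)\<^sup>2) (at R)"
      using q1 q_deriv[OF R] by (auto intro!: derivative_eq_intros simp: power2_eq_square)
    show "0 \<le> 1 / q R" using q1 by simp
    assume "1 / q R \<le> 1 / \<mu>"
    then have le: "\<mu> \<le> q R" using q1 \<mu> m1 by (simp add: field_simps)
    define A where "A = m\<^sup>2 - (q R)\<^sup>2 - 2 * eps R * q R * (q R - 1)"
    have "m\<^sup>2 / (q R)\<^sup>2 \<le> m\<^sup>2 / \<mu>\<^sup>2" using le \<mu> m1 by (intro divide_left_mono power_mono) auto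
    then have "(1 - m\<^sup>2 / \<mu>\<^sup>2) / (1 + E0) \<le> (1 - m\<^sup>2 / (q R)\<^sup>2) / (1 + eps R)"
      using mm e by (intro frac_le) auto
    also have "\<dots> \<le> (1 - m\<^sup>2 / (q R)\<^sup>2 + 2 * eps R * q R * (q R - 1) / (q R)\<^sup>2) / (1 + eps R)"
      using q1 e by (intro divide_right_mono) auto
    also have "1 - m\<^sup>2 / (q R)\<^sup>2 + 2 * eps R * q R * (q R - 1) / (q R)\<^sup>2
        = - A / (q R)\<^sup>2"
    proof -
      have "(q R)\<^sup>2 \<noteq> 0" using q1 by simp
      then show ?thesis by (simp add: A_def diff_divide_distrib)
    qed
    also have "- A / (q R)\<^sup>2 / (1 + eps R) = - (R * q' R) / (q R)\<^sup>2"
      unfolding Rq'_eq[OF R'] A_def[symmetric] by (simp add: mult.commute)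
    finally show "(1 - m\<^sup>2 / \<mu>\<^sup>2) / (1 + E0) \<le> R * (- q' R / (q R)\<^sup>2)" by simp
  qed (rule R)
  then show "q R \<le> \<mu>" using q_ge_1[OF R] \<mu> m1 by (simp add: field_simps)
qed

lemma r_powr_deriv: assumes R: "R \<in> {0<..<1}"
  shows "((\<lambda>R. ln (r R) - \<mu> * ln R) has_real_derivative (q R - \<mu>) / R) (at R)"
proof -
  have R': "R \<in> {0<..1}" using R by auto
  show ?thesis
    using R r_pos[OF R'] by (auto intro!: derivative_eq_intros r_deriv simp: q_def field_simps)
qed

lemma ln_r_cont: assumes "0 < R" shows "continuous_on {R..1} (\<lambda>R. ln (r R) - \<mu> * ln R)"
proof (intro continuous_intros r_cont_sub ballI)
  show "r x \<noteq> 0" "x \<noteq> 0" if "x \<in> {R..1}" for x using r_nonzero[of x] that assms by auto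
qed (use assms in auto)

lemma r_eq_id_if_m_eq_1: assumes "m = 1" and R: "R \<in> {0<..1}" shows "r R = R"
proof -
  have q1: "q x = 1" if "x \<in> {0<..<1}" for x using q_ge_1[OF that] q_le_m[OF that] assms(1) by simp
  have z: "((\<lambda>R. ln (r R) - 1 * ln R) has_real_derivative 0) (at x)" if "x \<in> {0<..<1}" for x
    using r_powr_deriv[OF that, of 1] q1[OF that] by simp
  show ?thesis
  proof (cases "R = 1")
    case False
    then have R1: "R < 1" using R by simp
    have "ln (r 1) - 1 * ln 1 = ln (r R) - 1 * ln R"
      by (rule DERIV_isconst_end[OF R1 ln_r_cont z]) (use R in auto)
    then have "ln (r R) = ln R" using r_1 by simp
    then show ?thesis using r_pos[OF R] R by simp
  qed (simp add: r_1)
qed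

text \<open>\<open>m - q\<close> obeys a linear differential inequality with damping rate
  \<open>m / (1 + E0)\<close> and a source proportional to \<open>eps\<close>; it inherits the order
  of decay of the source.\<close>

lemma m_minus_q_decay:
  assumes \<alpha>: "0 \<le> \<alpha>" and C: "\<And>R. R \<in> {0<..<1} \<Longrightarrow> eps R \<le> C * R powr \<alpha>"
  obtains C' where "\<And>R. R \<in> {0<..<1} \<Longrightarrow> m - q R \<le> C' * R powr \<alpha>"
proof -
  have "m - q R \<le> (2 * m\<^sup>2 * C) / (m / (1 + E0) + \<alpha>) * R powr \<alpha>" if R: "R \<in> {0<..<1}" for R
  proof (rule decay_bound[where y = "\<lambda>R. m - q R" and y' = "\<lambda>R. - q' R" and B = m, OF _ _ _ \<alpha> _ R])
    show "0 < m / (1 + E0)" using m1 E0_nonneg by simp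
    fix R :: real assume R: "R \<in> {0<..<1}"
    then have R': "R \<in> {0<..1}" by auto
    note e = eps_bounds[OF R'] and q1 = q_ge_1[OF R] and qm = q_le_m[OF R]
    show "((\<lambda>R. m - q R) has_real_derivative - q' R) (at R)"
      using q_deriv[OF R] by (auto intro!: derivative_eq_intros)
    show "\<bar>m - q R\<bar> \<le> m" using q1 qm by linarith
    have 1: "m / (1 + E0) * (m - q R) \<le> (m + q R) * (m - q R) / (1 + eps R)"
    proof -
      have "m * (m - q R) / (1 + E0) \<le> (m + q R) * (m - q R) / (1 + eps R)"
        using m1 q1 qm e by (intro frac_le mult_right_mono) auto
      then show ?thesis by simp
    qed
    have "2 * eps R * q R * (q R - 1) \<le> 2 * (C * R powr \<alpha>) * m * m"
      using q1 qm e C[OF R] by (intro mult_mono) auto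
    then have "2 * eps R * q R * (q R - 1) / (1 + eps R) \<le> 2 * (C * R powr \<alpha>) * m * m"
    proof -
      have "0 \<le> 2 * eps R * q R * (q R - 1)" using e q1 by simp
      then have "2 * eps R * q R * (q R - 1) / (1 + eps R) \<le> 2 * eps R * q R * (q R - 1) / 1"
        using e by (intro divide_left_mono) auto
      then show ?thesis using \<open>2 * eps R * q R * (q R - 1) \<le> _\<close> by simp
    qed
    moreover have "R * (- q' R) = - ((m + q R) * (m - q R) / (1 + eps R)) + 2 * eps R * q R * (q R - 1) / (1 + eps R)"
    proof -
      have "m\<^sup>2 - (q R)\<^sup>2 = (m + q R) * (m - q R)" by (simp add: power2_eq_square algebra_simps)
      then show ?thesis using Rq'_eq[OF R'] by (simp add: diff_divide_distrib)
    qed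
    ultimately show "R * (- q' R) \<le> - (m / (1 + E0)) * (m - q R) + 2 * m\<^sup>2 * C * R powr \<alpha>"
      using 1 by (simp add: power2_eq_square mult_ac)
  qed
  then show ?thesis by (rule that)
qed

text \<open>Bootstrap: \<open>q \<ge> 1 + t\<close> gives \<open>r \<le> R^(1 + t)\<close>, hence
  \<open>eps = O(R^(2 t))\<close> and \<open>m - q = O(R^(2 t))\<close>. This is integrable against
  \<open>dR / R\<close>, so \<open>r = O(R^m)\<close>, which for \<open>m \<ge> 2\<close> gives
  \<open>eps = O(R^2)\<close> and the final rate.\<close>

lemma asymptotics:
  assumes m2: "2 \<le> m"
  obtains C where "\<And>R. R \<in> {0<..<1} \<Longrightarrow> m - q R \<le> C * R\<^sup>2"
    "\<And>R. R \<in> {0<..1} \<Longrightarrow> R powr m \<le> r R" "\<And>R. R \<in> {0<..1} \<Longrightarrow> r R \<le> C * R powr m"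
proof -
  \<comment> \<open>Small enough that
    \<open>(1 + t)^2 + 3 E0 t \<le> 9/4 + 3/4 < 4 \<le> m^2\<close>, which is what
    \<open>q_lower\<close> needs at \<open>\<mu> = 1 + t\<close>.\<close>
  define t where "t = 1 / (2 + 4 * E0)"
  have t: "0 < t" "t \<le> 1 / 2" "3 * E0 * t \<le> 3 / 4"
    using E0_nonneg by (auto simp: t_def field_simps)
  have qt: "1 + t \<le> q R" if R: "R \<in> {0<..<1}" for R
  proof (rule less_imp_le[OF q_lower[OF R]])
    have "(1 + t)\<^sup>2 \<le> (3 / 2)\<^sup>2" using t by (intro power_mono) auto
    then have "(1 + t)\<^sup>2 \<le> 9 / 4" by (simp add: power2_eq_square)
    moreover have "2\<^sup>2 \<le> m\<^sup>2" using m2 by (intro power_mono) auto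
    then have "4 \<le> m\<^sup>2" by simp
    moreover have "2 * E0 * (1 + t) * t \<le> 2 * E0 * (3 / 2) * t"
      using t E0_nonneg by (intro mult_right_mono mult_left_mono) auto
    then have "2 * E0 * (1 + t) * t \<le> 3 * E0 * t" by simp
    then have "2 * E0 * (1 + t) * t \<le> 3 / 4" using t(3) by linarith
    moreover have mx: "max 0 (1 + t - 1) = t" using t by simp
    ultimately show "0 < m\<^sup>2 - (1 + t)\<^sup>2 - 2 * E0 * (1 + t) * max 0 (1 + t - 1)"
      unfolding mx by linarith
  qed (use t in auto)
  have powr_le: "r R \<le> exp k * R powr \<mu>" if "ln (r R) - \<mu> * ln R \<le> k" "R \<in> {0<..1}" for R \<mu> k
  proof -
    have "r R = exp (ln (r R))" using r_pos[OF that(2)] by simp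
    also have "\<dots> \<le> exp (k + \<mu> * ln R)" using that(1) by simp
    finally show ?thesis using that(2) by (simp add: exp_add powr_def)
  qed
  have r1: "r R \<le> R powr (1 + t)" if R: "R \<in> {0<..1}" for R
  proof -
    have "ln (r R) - (1 + t) * ln R \<le> ln (r 1) - (1 + t) * ln 1"
      by (rule mono_from_derivative[where f = "\<lambda>R. ln (r R) - (1 + t) * ln R" and f' = "\<lambda>R. (q R - (1 + t)) / R"])
        (use R qt in \<open>auto intro!: r_powr_deriv ln_r_cont\<close>)
    then show ?thesis using powr_le[of R "1 + t" 0] r_1 R by simp
  qed
  \<comment> \<open>Turns a power bound for \<open>r\<close> into one for \<open>eps\<close>; it is
    used with exponent \<open>1 + t\<close> at the start and \<open>m\<close> at the end.\<close>
  have eps_le: "eps R \<le> m\<^sup>2 * K * B\<^sup>2 * R powr (2 * (\<mu> - 1))" if R: "R \<in> {0<..1}" and r: "r R \<le> B * R powr \<mu>" for R \<mu> B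
  proof -
    have "(r R)\<^sup>2 / R\<^sup>2 \<le> (B * R powr \<mu>)\<^sup>2 / R\<^sup>2"
      using r r_pos[OF R] by (intro divide_right_mono power_mono) auto
    also have "\<dots> = B\<^sup>2 * R powr (2 * (\<mu> - 1))"
    proof -
      have "(R powr \<mu>)\<^sup>2 = R powr (2 * \<mu>)" using powr_power[of R \<mu> 2] R by (simp add: mult.commute)
      moreover have "R powr (2 * (\<mu> - 1)) = R powr (2 * \<mu>) / R\<^sup>2"
        using R powr_diff[of R "2 * \<mu>" 2] by (simp add: algebra_simps powr_numeral)
      ultimately show ?thesis by (simp add: power_mult_distrib)
    qed
    finally have "m\<^sup>2 * f2 (d R) * ((r R)\<^sup>2 / R\<^sup>2) \<le> m\<^sup>2 * K * (B\<^sup>2 * R powr (2 * (\<mu> - 1)))"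
      using f2_bounds K_nonneg by (intro mult_mono) auto
    then show ?thesis by (simp add: eps_def mult.assoc)
  qed
  have "eps R \<le> m\<^sup>2 * K * 1\<^sup>2 * R powr (2 * (1 + t - 1))" if "R \<in> {0<..<1}" for R
    using that r1[of R] by (intro eps_le) auto
  then obtain C1 where C1: "\<And>R. R \<in> {0<..<1} \<Longrightarrow> m - q R \<le> C1 * R powr (2 * t)"
    using m_minus_q_decay[of "2 * t" "m\<^sup>2 * K * 1\<^sup>2"] t by auto
  \<comment> \<open>The integral of \<open>C1 x^(2 t - 1)\<close> over \<open>(0, 1)\<close>; it
    bounds \<open>ln (r / R^m)\<close>.\<close>
  define L where "L = C1 / (2 * t)"
  have upper: "r R \<le> exp L * R powr m" if R: "R \<in> {0<..1}" for R
  proof (rule powr_le[OF _ R])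
    have "ln (r R) - m * ln R + L * R powr (2 * t) \<le> ln (r 1) - m * ln 1 + L * 1 powr (2 * t)"
    proof (rule mono_from_derivative[where f = "\<lambda>R. ln (r R) - m * ln R + L * R powr (2 * t)"
          and f' = "\<lambda>R. (q R - m) / R + L * (2 * t * R powr (2 * t - 1))"])
      fix x assume x: "R < x" "x < 1"
      then have x01: "x \<in> {0<..<1}" using R by auto
      have "((\<lambda>R. L * R powr (2 * t)) has_real_derivative L * (2 * t * x powr (2 * t - 1))) (at x)"
        using x01 by (auto intro!: derivative_eq_intros)
      then show "((\<lambda>R. ln (r R) - m * ln R + L * R powr (2 * t)) has_real_derivative
          (q x - m) / x + L * (2 * t * x powr (2 * t - 1))) (at x)"
        by (rule DERIV_add[OF r_powr_deriv[OF x01]])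
      have "L * (2 * t * x powr (2 * t - 1)) = C1 * x powr (2 * t) / x"
        using x01 t by (simp add: L_def powr_diff)
      then show "0 \<le> (q x - m) / x + L * (2 * t * x powr (2 * t - 1))"
        using C1[OF x01] x01 by (simp add: add_divide_distrib[symmetric])
    next
      show "continuous_on {R..1} (\<lambda>R. ln (r R) - m * ln R + L * R powr (2 * t))"
        using R by (intro continuous_on_add ln_r_cont continuous_intros) auto
    qed (use R in auto)
    moreover have "0 \<le> L * R powr (2 * t)"
    proof -
      have "0 \<le> C1"
      proof (rule ccontr)
        assume "\<not> 0 \<le> C1"
        then have "C1 * (1 / 2) powr (2 * t) < 0" by (intro mult_neg_pos) auto
        then show False using C1[of "1/2"] q_le_m[of "1/2"] by simp
      qed
      then show ?thesis using t by (simp add: L_def)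
    qed
    ultimately show "ln (r R) - m * ln R \<le> L" using r_1 by simp
  qed
  have lower: "R powr m \<le> r R" if R: "R \<in> {0<..1}" for R
  proof -
    have "ln (r 1) - m * ln 1 \<le> ln (r R) - m * ln R"
      by (rule antimono_from_derivative[where f = "\<lambda>R. ln (r R) - m * ln R" and f' = "\<lambda>R. (q R - m) / R"])
        (use R q_le_m in \<open>auto intro!: r_powr_deriv ln_r_cont divide_nonpos_pos\<close>)
    then have "m * ln R \<le> ln (r R)" using r_1 by simp
    then have "exp (m * ln R) \<le> exp (ln (r R))" by simp
    then show ?thesis using R r_pos[OF R] by (simp add: powr_def)
  qed
  have "eps R \<le> m\<^sup>2 * K * (exp L)\<^sup>2 * R powr 2" if R: "R \<in> {0<..<1}" for R
  proof -
    have "eps R \<le> m\<^sup>2 * K * (exp L)\<^sup>2 * R powr (2 * (m - 1))"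
      using R upper[of R] by (intro eps_le) auto
    also have "\<dots> \<le> m\<^sup>2 * K * (exp L)\<^sup>2 * R powr 2"
      using R m2 K_nonneg by (intro mult_left_mono powr_mono') auto
    finally show ?thesis .
  qed
  then obtain C2 where C2: "\<And>R. R \<in> {0<..<1} \<Longrightarrow> m - q R \<le> C2 * R powr 2"
    using m_minus_q_decay[of 2 "m\<^sup>2 * K * (exp L)\<^sup>2"] by auto
  show ?thesis
  proof (rule that[of "max C2 (exp L)"])
    show "m - q R \<le> max C2 (exp L) * R\<^sup>2" if R: "R \<in> {0<..<1}" for R
    proof -
      have "m - q R \<le> C2 * R\<^sup>2" using C2[OF R] R by (simp add: powr_numeral)
      also have "\<dots> \<le> max C2 (exp L) * R\<^sup>2" by (intro mult_right_mono) auto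
      finally show ?thesis .
    qed
    show "r R \<le> max C2 (exp L) * R powr m" if R: "R \<in> {0<..1}" for R
    proof -
      have "exp L * R powr m \<le> max C2 (exp L) * R powr m" by (intro mult_right_mono) auto
      then show ?thesis using upper[OF R] by linarith
    qed
  qed (rule lower)
qed

end

section \<open>Smoothness at the origin\<close>

lemma derivative_extend_closed:
  fixes f g :: "real \<Rightarrow> real"
  assumes f: "continuous_on {0..1} f" and g: "continuous_on {0..1} g"
    and d: "\<And>x. x \<in> {0<..<1} \<Longrightarrow> (f has_real_derivative g x) (at x)" and x: "x \<in> {0..1}"
  shows "(f has_real_derivative g x) (at x within {0..1})"
proof -
  have eq: "f y = f 0 + integral {0..y} g" if y: "y \<in> {0..1}" for y
  proof -
    have "(g has_integral (f y - f 0)) {0..y}"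
      by (rule fundamental_theorem_of_calculus_interior)
        (use y d in \<open>auto intro: continuous_on_subset[OF f] simp: has_real_derivative_iff_has_vector_derivative[symmetric]\<close>)
    then show ?thesis by (simp add: integral_unique)
  qed
  have "((\<lambda>y. f 0 + integral {0..y} g) has_real_derivative g x) (at x within {0..1})"
    using integral_has_real_derivative[OF g x] by (auto intro!: derivative_eq_intros)
  then show ?thesis
    by (rule has_field_derivative_transform_within[OF _ zero_less_one x]) (simp add: eq[symmetric])
qed

lemma Ck_Suc_extend_closed:
  fixes f g :: "real \<Rightarrow> real"
  assumes "continuous_on {0..1} f" "Ck k {0..1} g"
    and "\<And>x. x \<in> {0<..<1} \<Longrightarrow> (f has_real_derivative g x) (at x)"
  shows "Ck (Suc k) {0..1} f"
  by (rule Ck_real_SucI[OF _ assms(2)])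
    (use derivative_extend_closed[OF assms(1) Ck_imp_continuous_on[OF assms(2)] assms(3)] in
      \<open>auto simp: has_real_derivative_iff_has_vector_derivative[symmetric]\<close>)

text \<open>Differentiation under the integral sign brings out one factor \<open>\<tau>\<close>, so
  the induction runs over all exponents \<open>n\<close> at once.\<close>

lemma Ck_scaled_integral:
  fixes N :: "real \<Rightarrow> real"
  assumes "Ck k {0..1} N"
  shows "Ck k {0..1} (\<lambda>s. integral {0..1} (\<lambda>\<tau>. \<tau> ^ n * N (s * \<tau>)))"
  using assms
proof (induction k arbitrary: N n)
  have sub: "s * \<tau> \<in> {0..1}" if "s \<in> {0..1}" "\<tau> \<in> {0..1}" for s \<tau> :: real
    using that by (auto intro: mult_le_one)
  have cont: "continuous_on ({0..1} \<times> cbox 0 1) (\<lambda>(s, \<tau>). \<tau> ^ n * N (s * \<tau>))"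
    if "continuous_on {0..1} N" for N :: "real \<Rightarrow> real" and n
    unfolding case_prod_beta
    by (intro continuous_intros continuous_on_compose2[OF that]) (use sub in auto)
  {
    case 0
    then show ?case using integral_continuous_on_param[OF cont[of N n]] by (simp add: cbox_interval)
  next
    case (Suc k)
    obtain N' where N': "\<And>x. x \<in> {0..1} \<Longrightarrow> (N has_real_derivative N' x) (at x within {0..1})" "Ck k {0..1} N'"
      using Suc.prems by (rule Ck_real_SucE) blast
    have Nc: "continuous_on {0..1} N" using Suc.prems by (rule Ck_imp_continuous_on)
    show ?case
    proof (rule Ck_real_SucI)
      show "Ck k {0..1} (\<lambda>s. integral {0..1} (\<lambda>\<tau>. \<tau> ^ Suc n * N' (s * \<tau>)))"
        by (rule Suc.IH[OF N'(2)])
      fix s :: real assume s: "s \<in> {0..1}"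
      have "((\<lambda>s. integral (cbox 0 1) (\<lambda>\<tau>. \<tau> ^ n * N (s * \<tau>))) has_field_derivative
          integral (cbox 0 1) (\<lambda>\<tau>. \<tau> ^ Suc n * N' (s * \<tau>))) (at s within {0..1})"
      proof (rule leibniz_rule_field_derivative)
        fix x \<tau> :: real assume x: "x \<in> {0..1}" and \<tau>: "\<tau> \<in> cbox 0 1"
        have img: "(\<lambda>x. x * \<tau>) ` {0..1} \<subseteq> {0..1}" using sub \<tau> by (auto simp: cbox_interval intro: mult_le_one)
        have "((\<lambda>x. N (x * \<tau>)) has_real_derivative (N' (x * \<tau>) * \<tau>)) (at x within {0..1})"
        proof -
          have "(N has_real_derivative N' (x * \<tau>)) (at (x * \<tau>) within (\<lambda>x. x * \<tau>) ` {0..1})"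
            by (rule DERIV_subset[OF N'(1) img]) (use sub[OF x] \<tau> in \<open>simp add: cbox_interval\<close>)
          moreover have "((\<lambda>x. x * \<tau>) has_real_derivative \<tau>) (at x within {0..1})"
            by (auto intro!: derivative_eq_intros)
          ultimately show ?thesis using DERIV_image_chain[of N "N' (x * \<tau>)" "\<lambda>x. x * \<tau>" x "{0..1}" \<tau>] by (simp add: o_def)
        qed
        then show "((\<lambda>x. \<tau> ^ n * N (x * \<tau>)) has_real_derivative \<tau> ^ Suc n * N' (x * \<tau>)) (at x within {0..1})"
          by (auto intro!: derivative_eq_intros)
      next
        fix x :: real assume x: "x \<in> {0..1}"
        show "(\<lambda>\<tau>. \<tau> ^ n * N (x * \<tau>)) integrable_on cbox 0 1"
        proof -
          have "continuous_on (cbox 0 1) (\<lambda>\<tau>. N (x * \<tau>))"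
          proof (rule continuous_on_compose2[OF Nc])
            show "continuous_on (cbox 0 1) (\<lambda>\<tau>. x * \<tau>)" by (intro continuous_intros)
            show "(\<lambda>\<tau>. x * \<tau>) ` cbox 0 1 \<subseteq> {0..1}" using sub[OF x] by (simp only: image_subset_iff cbox_interval) blast
          qed
          then show ?thesis by (intro integrable_continuous continuous_on_mult continuous_on_power continuous_on_id)
        qed
      next
        show "continuous_on ({0..1} \<times> cbox 0 1) (\<lambda>(x, \<tau>). \<tau> ^ Suc n * N' (x * \<tau>))"
          by (rule cont[OF Ck_imp_continuous_on[OF N'(2)]])
      qed (use s in auto)
      then show "((\<lambda>s. integral {0..1} (\<lambda>\<tau>. \<tau> ^ n * N (s * \<tau>))) has_vector_derivative
          integral {0..1} (\<lambda>\<tau>. \<tau> ^ Suc n * N' (s * \<tau>))) (at s within {0..1})"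
        by (simp add: cbox_interval has_real_derivative_iff_has_vector_derivative)
    qed
  }
qed

text \<open>The determinant as a function of \<open>s = R\<^sup>2\<close>, with \<open>r = R\<^sup>M H(s)\<close> and
  \<open>Z = R r' / r - M\<close>, and the value that the radial equation forces on its derivative.\<close>

definition det_profile :: "nat \<Rightarrow> (real \<Rightarrow> real) \<Rightarrow> (real \<Rightarrow> real) \<Rightarrow> real \<Rightarrow> real" where
  "det_profile M H Z s = real M * s ^ (M - 1) * (H s)\<^sup>2 * (real M + Z s)"

definition det_profile' :: "(real \<Rightarrow> real) \<Rightarrow> nat \<Rightarrow> (real \<Rightarrow> real) \<Rightarrow> (real \<Rightarrow> real) \<Rightarrow> real \<Rightarrow> real" where
  "det_profile' f2 M H Z s = real M * s ^ (M - 2) * (H s)\<^sup>2 * ((real M + Z s)\<^sup>2 + (real M)\<^sup>2 - 2 * (real M + Z s))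
     / (2 * (1 + s * ((real M)\<^sup>2 * f2 (det_profile M H Z s) * s ^ (M - 2) * (H s)\<^sup>2)))"

lemma Ck_det_profile:
  assumes "Ck k S H" "Ck k S Z" shows "Ck k S (det_profile M H Z)"
  unfolding det_profile_def[abs_def]
  by (intro Ck_mult Ck_power Ck_add Ck_const Ck_ident assms)

lemma Ck_det_profile':
  assumes "Ck k {0..1} H" "Ck k {0..1} Z" "Ck k UNIV f2" "\<And>s. 0 \<le> f2 s"
  shows "Ck k {0..1} (det_profile' f2 M H Z)"
proof -
  have "1 + s * ((real M)\<^sup>2 * f2 (det_profile M H Z s) * s ^ (M - 2) * (H s)\<^sup>2) > 0" if "s \<in> {0..1}" for s
    using that assms(4) by (intro add_pos_nonneg mult_nonneg_nonneg) auto
  then have nz: "2 * (1 + s * ((real M)\<^sup>2 * f2 (det_profile M H Z s) * s ^ (M - 2) * (H s)\<^sup>2)) \<noteq> 0" if "s \<in> {0..1}" for s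
    using that by (metis less_irrefl mult_eq_0_iff zero_neq_numeral)
  show ?thesis unfolding det_profile'_def[abs_def]
    by (intro Ck_divide Ck_mult Ck_power Ck_add Ck_diff Ck_const Ck_ident assms(1,2)
        Ck_compose[OF assms(3)] Ck_det_profile nz) auto
qed

text \<open>The equation for \<open>\<pi>\<close> has a regular singular point at \<open>0\<close>. Its bounded solution is the average
  \<open>1/2 \<integral> \<tau>\<^sup>M N (s \<tau>) d\<tau>\<close> of a right-hand side \<open>N\<close> in which \<open>\<pi>\<close> enters only
  through \<open>s \<pi>\<close> and \<open>s \<pi>\<^sup>2\<close>; the equation shows that these have one derivative more
  than \<open>\<pi>\<close>.\<close>

lemma singular_ode_smooth:
  fixes H \<pi> \<pi>' f2 :: "real \<Rightarrow> real" and M :: nat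
  assumes f2: "\<And>k. Ck k UNIV f2" "\<And>s. 0 \<le> f2 s"
    and Hc: "continuous_on {0..1} H" and \<pi>c: "continuous_on {0<..1} \<pi>"
    and \<pi>b: "\<And>s. s \<in> {0<..1} \<Longrightarrow> \<bar>\<pi> s\<bar> \<le> C"
    and Hd: "\<And>s. s \<in> {0<..<1} \<Longrightarrow> (H has_real_derivative \<pi> s * H s / 2) (at s)"
    and \<pi>d: "\<And>s. s \<in> {0<..<1} \<Longrightarrow> (\<pi> has_real_derivative \<pi>' s) (at s)"
    and eq: "\<And>s. s \<in> {0<..<1} \<Longrightarrow> 2 * s * \<pi>' s = - (2 * real M + 2) * \<pi> s - s * (\<pi> s)\<^sup>2
      - 2 * real M * f2 (det_profile M H (\<lambda>s. s * \<pi> s) s) * det_profile' f2 M H (\<lambda>s. s * \<pi> s) s"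
  obtains \<pi>0 where "\<And>s. s \<in> {0<..1} \<Longrightarrow> \<pi>0 s = \<pi> s" "\<And>k. Ck k {0..1} \<pi>0" "\<And>k. Ck k {0..1} H"
proof -
  define Z where "Z s = s * \<pi> s" for s
  define T where "T s = s * (\<pi> s)\<^sup>2" for s
  define Q where "Q s = 2 * real M * f2 (det_profile M H Z s) * det_profile' f2 M H Z s" for s
  define N where "N s = - T s - Q s" for s
  have C0: "0 \<le> C" using \<pi>b[of 1] by force
  \<comment> \<open>A factor \<open>s\<close> makes a bounded function continuous at
    \<open>0\<close>; boundedness is all that is known of \<open>\<pi>\<close> there before the
    bootstrap.\<close>
  have small: "continuous_on {0..1} (\<lambda>s. s * g s)" if g: "continuous_on {0<..1} g" "\<And>s. s \<in> {0<..1} \<Longrightarrow> \<bar>g s\<bar> \<le> B" for g :: "real \<Rightarrow> real" and B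
    unfolding continuous_on_def
  proof
    fix x :: real assume x: "x \<in> {0..1}"
    show "((\<lambda>s. s * g s) \<longlongrightarrow> x * g x) (at x within {0..1})"
    proof (cases "x = 0")
      case True
      have "((\<lambda>s. s * B) \<longlongrightarrow> 0) (at 0 within {0..1})" by (auto intro!: tendsto_eq_intros)
      then have "((\<lambda>s. s * g s) \<longlongrightarrow> 0) (at 0 within {0..1})"
        by (rule Lim_null_comparison[rotated])
          (use g(2) in \<open>auto simp: eventually_at_filter abs_mult intro!: always_eventually mult_left_mono\<close>)
      then show ?thesis using True by simp
    next
      case False
      then have "x \<in> {0<..1}" using x by simp
      then have "(g \<longlongrightarrow> g x) (at x within {0<..1})" using g(1) by (auto simp: continuous_on_def)
      moreover have "at x within {0<..1} = at x within {0..1}"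
        by (rule at_within_nhd[of _ "{0<..}"]) (use False x in auto)
      ultimately show ?thesis by (auto intro!: tendsto_eq_intros)
    qed
  qed
  have Zc: "continuous_on {0..1} Z" unfolding Z_def by (rule small[OF \<pi>c \<pi>b])
  have Tc: "continuous_on {0..1} T" unfolding T_def
  proof (rule small)
    show "continuous_on {0<..1} (\<lambda>s. (\<pi> s)\<^sup>2)" by (intro continuous_intros \<pi>c)
    show "\<bar>(\<pi> s)\<^sup>2\<bar> \<le> C\<^sup>2" if "s \<in> {0<..1}" for s
      using power_mono[OF \<pi>b[OF that], of 2] by simp
  qed
  have QCk: "Ck k {0..1} Q" if "Ck k {0..1} H" "Ck k {0..1} Z" for k
    unfolding Q_def by (intro Ck_mult Ck_const Ck_compose[OF f2(1)] Ck_det_profile Ck_det_profile' that f2) auto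
  have Nc: "continuous_on {0..1} N"
    unfolding N_def using Ck_imp_continuous_on[OF QCk[of 0]] Hc Zc Tc by (intro continuous_intros) auto
  define \<pi>0 where "\<pi>0 s = integral {0..1} (\<lambda>\<tau>. \<tau> ^ M * N (s * \<tau>)) / 2" for s
  have eq': "2 * s * \<pi>' s = - (2 * real M + 2) * \<pi> s + N s" if "s \<in> {0<..<1}" for s
    using eq[OF that] by (simp add: N_def T_def Q_def Z_def[abs_def])
  have \<pi>0: "\<pi>0 s = \<pi> s" if s: "s \<in> {0<..1}" for s
  proof -
    \<comment> \<open>By the equation the derivative of
      \<open>\<tau>^(M + 1) \<pi>(s \<tau>)\<close> is \<open>\<tau>^M N(s \<tau>) / 2\<close>. The
      power kills the lower boundary term, whatever the value of \<open>\<pi>\<close> at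
      \<open>0\<close>.\<close>
    have "((\<lambda>\<tau>. \<tau> ^ M * N (s * \<tau>) / 2) has_integral (1 ^ (M + 1) * \<pi> (s * 1) - 0 ^ (M + 1) * \<pi> (s * 0))) {0..1}"
    proof (rule fundamental_theorem_of_calculus_interior[of 0 1 "\<lambda>\<tau>. \<tau> ^ (M + 1) * \<pi> (s * \<tau>)"])
      have "continuous_on {0..1} (\<lambda>\<tau>. \<tau> ^ M * (Z (s * \<tau>) / s))"
        by (intro continuous_intros continuous_on_compose2[OF Zc]) (use s in \<open>auto intro: mult_le_one\<close>)
      then show "continuous_on {0..1} (\<lambda>\<tau>. \<tau> ^ (M + 1) * \<pi> (s * \<tau>))"
        by (rule continuous_on_eq) (use s in \<open>auto simp: Z_def\<close>)
      fix \<tau> :: real assume \<tau>: "\<tau> \<in> {0<..<1}"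
      have st: "s * \<tau> \<in> {0<..<1}" using s \<tau> by (auto intro: mult_le_less_imp_less[of s 1 \<tau> 1, simplified] mult_pos_pos)
      have "((\<lambda>\<tau>. \<pi> (s * \<tau>)) has_real_derivative \<pi>' (s * \<tau>) * s) (at \<tau>)"
        by (rule DERIV_chain2[where f = \<pi> and g = "\<lambda>\<tau>. s * \<tau>"], rule \<pi>d[OF st])
          (auto intro!: derivative_eq_intros)
      moreover have "((\<lambda>\<tau>. \<tau> ^ (M + 1)) has_real_derivative real (M + 1) * \<tau> ^ M) (at \<tau>)"
        using DERIV_pow[of "M + 1" \<tau>] by simp
      ultimately have "((\<lambda>\<tau>. \<tau> ^ (M + 1) * \<pi> (s * \<tau>)) has_real_derivative
          (real (M + 1) * \<tau> ^ M * \<pi> (s * \<tau>) + \<pi>' (s * \<tau>) * s * \<tau> ^ (M + 1))) (at \<tau>)"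
        by (rule DERIV_mult[rotated])
      moreover have "real (M + 1) * \<tau> ^ M * \<pi> (s * \<tau>) + \<pi>' (s * \<tau>) * s * \<tau> ^ (M + 1) = \<tau> ^ M * N (s * \<tau>) / 2"
      proof -
        have "N (s * \<tau>) = 2 * (s * \<tau>) * \<pi>' (s * \<tau>) + (2 * real M + 2) * \<pi> (s * \<tau>)"
          using eq'[OF st] by (simp add: algebra_simps)
        then show ?thesis by (simp add: algebra_simps)
      qed
      ultimately show "((\<lambda>\<tau>. \<tau> ^ (M + 1) * \<pi> (s * \<tau>)) has_vector_derivative \<tau> ^ M * N (s * \<tau>) / 2) (at \<tau>)"
        by (simp only: has_real_derivative_iff_has_vector_derivative)
    qed simp
    then have "((\<lambda>\<tau>. \<tau> ^ M * N (s * \<tau>) / 2) has_integral \<pi> s) {0..1}" by simp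
    from integral_unique[OF this] show ?thesis by (simp add: \<pi>0_def)
  qed
  have \<pi>0Ck: "Ck k {0..1} \<pi>0" if "Ck k {0..1} N" for k
    unfolding \<pi>0_def divide_inverse by (intro Ck_mult Ck_const Ck_scaled_integral that)
  have main: "Ck k {0..1} \<pi>0 \<and> Ck k {0..1} H" for k
  proof (induction k)
    case 0
    then show ?case using \<pi>0Ck[of 0] Nc Hc by simp
  next
    case (Suc k)
    then have P: "Ck k {0..1} \<pi>0" and H: "Ck k {0..1} H" by auto
    have Z0: "Ck k {0..1} Z"
    proof (rule Ck_cong[OF Ck_mult[OF Ck_ident P]])
      show "s * \<pi>0 s = Z s" if "s \<in> {0..1}" for s
        using that \<pi>0[of s] by (cases "s = 0") (auto simp: Z_def)
    qed
    have T0: "Ck k {0..1} T"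
    proof (rule Ck_cong[OF Ck_mult[OF Z0 P]])
      show "Z s * \<pi>0 s = T s" if "s \<in> {0..1}" for s
        using that \<pi>0[of s] by (cases "s = 0") (auto simp: Z_def T_def power2_eq_square)
    qed
    have N0: "Ck k {0..1} N" unfolding N_def by (intro Ck_diff Ck_uminus T0 QCk[OF H Z0])
    \<comment> \<open>\<open>V\<close> is \<open>s \<pi>'\<close> expressed through functions
      already of class \<open>k\<close>; it supplies the derivatives of \<open>s \<pi>\<close> and
      \<open>s \<pi>^2\<close>.\<close>
    define V where "V s = - (real M + 1) * \<pi>0 s + N s / 2" for s
    have V: "Ck k {0..1} V" unfolding V_def divide_inverse by (intro Ck_add Ck_mult Ck_const P N0)
    have sV: "s * \<pi>' s = V s" if "s \<in> {0<..<1}" for s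
    proof -
      have "2 * (s * \<pi>' s) = 2 * V s" using eq'[OF that] \<pi>0[of s] that by (simp add: V_def algebra_simps)
      then show ?thesis by simp
    qed
    have H1: "Ck (Suc k) {0..1} H"
    proof (rule Ck_Suc_extend_closed[OF Hc])
      show "Ck k {0..1} (\<lambda>s. \<pi>0 s * H s / 2)" unfolding divide_inverse by (intro Ck_mult Ck_const P H)
      show "(H has_real_derivative \<pi>0 s * H s / 2) (at s)" if "s \<in> {0<..<1}" for s
        using Hd[OF that] \<pi>0[of s] that by simp
    qed
    have Z1: "Ck (Suc k) {0..1} Z"
    proof (rule Ck_Suc_extend_closed[OF Zc])
      show "Ck k {0..1} (\<lambda>s. \<pi>0 s + V s)" by (intro Ck_add P V)
      show "(Z has_real_derivative \<pi>0 s + V s) (at s)" if s: "s \<in> {0<..<1}" for s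
      proof -
        have "(Z has_real_derivative 1 * \<pi> s + \<pi>' s * s) (at s)"
          unfolding Z_def by (intro DERIV_mult DERIV_ident \<pi>d s)
        then show ?thesis using sV[OF s] \<pi>0[of s] s by (simp add: mult.commute)
      qed
    qed
    have T1: "Ck (Suc k) {0..1} T"
    proof (rule Ck_Suc_extend_closed[OF Tc])
      show "Ck k {0..1} (\<lambda>s. \<pi>0 s * \<pi>0 s + 2 * \<pi>0 s * V s)" by (intro Ck_add Ck_mult Ck_const P V)
      show "(T has_real_derivative \<pi>0 s * \<pi>0 s + 2 * \<pi>0 s * V s) (at s)" if s: "s \<in> {0<..<1}" for s
      proof -
        have "(T has_real_derivative 1 * (\<pi> s)\<^sup>2 + (2 * \<pi> s * \<pi>' s) * s) (at s)"
          unfolding T_def using \<pi>d[OF s] by (auto intro!: derivative_eq_intros)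
        moreover have "(2 * \<pi> s * \<pi>' s) * s = 2 * \<pi> s * V s" using sV[OF s] by (simp add: mult_ac)
        ultimately show ?thesis using \<pi>0[of s] s by (simp add: power2_eq_square)
      qed
    qed
    have "Ck (Suc k) {0..1} N" unfolding N_def by (intro Ck_diff Ck_uminus T1 QCk[OF H1 Z1])
    then show ?case using \<pi>0Ck H1 by blast
  qed
  show ?thesis by (rule that[of \<pi>0]) (use \<pi>0 main in auto)
qed

text \<open>With \<open>s = R^2\<close>, the estimates \<open>m - q = O(R^2)\<close> and
  \<open>R^m \<le> r = O(R^m)\<close> say that \<open>\<pi>\<close> and \<open>H\<close> are
  bounded, which is the starting point for \<open>singular_ode_smooth\<close>. The equations in the
  conclusion are recorded for stationarity and for the sign of the derivative of the
  determinant.\<close>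

lemma (in radial_ode) smooth_profile:
  fixes M :: nat
  assumes mM: "m = real M" and M2: "2 \<le> M" and f2: "\<And>k. Ck k UNIV f2"
  obtains H \<pi> where "\<And>k. Ck k {0..1} H" "\<And>k. Ck k {0..1} \<pi>"
    "\<And>s. s \<in> {0..1} \<Longrightarrow> 1 \<le> H s" "\<And>s. s \<in> {0..1} \<Longrightarrow> 0 \<le> real M + s * \<pi> s"
    "\<And>R. R \<in> {0<..1} \<Longrightarrow> r R = R ^ M * H (R\<^sup>2)"
    "\<And>R. R \<in> {0<..1} \<Longrightarrow> p R = R ^ (M - 1) * H (R\<^sup>2) * (real M + R\<^sup>2 * \<pi> (R\<^sup>2))"
    "\<And>s. s \<in> {0<..<1} \<Longrightarrow> (H has_real_derivative \<pi> s * H s / 2) (at s)"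
    "\<And>s. s \<in> {0<..<1} \<Longrightarrow> \<exists>\<pi>'. (\<pi> has_real_derivative \<pi>') (at s) \<and>
       2 * s * \<pi>' = - (2 * real M + 2) * \<pi> s - s * (\<pi> s)\<^sup>2
         - 2 * real M * f2 (det_profile M H (\<lambda>s. s * \<pi> s) s) * det_profile' f2 M H (\<lambda>s. s * \<pi> s) s"
    "\<And>s. s \<in> {0<..<1} \<Longrightarrow> (det_profile M H (\<lambda>s. s * \<pi> s) has_real_derivative
       det_profile' f2 M H (\<lambda>s. s * \<pi> s) s) (at s)"
proof -
  have m2: "2 \<le> m" using M2 mM by simp
  obtain C where C: "\<And>R. R \<in> {0<..<1} \<Longrightarrow> m - q R \<le> C * R\<^sup>2"
    "\<And>R. R \<in> {0<..1} \<Longrightarrow> R powr m \<le> r R" "\<And>R. R \<in> {0<..1} \<Longrightarrow> r R \<le> C * R powr m"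
    using asymptotics[OF m2] by blast
  define h where "h s = r (sqrt s) / sqrt s ^ M" for s
  define \<pi> where "\<pi> s = (q (sqrt s) - m) / s" for s
  have sq: "sqrt s \<in> {0<..1}" if "s \<in> {0<..1}" for s :: real using that by auto
  have sq': "sqrt s \<in> {0<..<1}" if "s \<in> {0<..<1}" for s :: real using that by auto
  have sM: "sqrt s ^ M = sqrt s powr m" if "s > 0" for s using that by (simp add: mM powr_realpow)
  have h1: "1 \<le> h s" "h s \<le> C" if "s \<in> {0<..1}" for s
    using C(2,3)[OF sq[OF that]] that sM[of s] by (simp_all add: h_def field_simps)
  have r_h: "r (sqrt s) = sqrt s ^ M * h s" if "s \<in> {0<..1}" for s using that by (simp add: h_def)
  have q_\<pi>: "q (sqrt s) = m + s * \<pi> s" if "s \<in> {0<..1}" for s using that by (simp add: \<pi>_def)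
  have hd: "(h has_real_derivative \<pi> s * h s / 2) (at s)" if s: "s \<in> {0<..<1}" for s
  proof -
    let ?R = "sqrt s"
    have R: "?R > 0" "r ?R > 0" using s r_pos[OF sq] by auto
    have RR: "s = ?R * ?R" using s by simp
    have "((\<lambda>R. r R / R ^ M) has_real_derivative (p ?R * ?R ^ M - r ?R * (real M * ?R ^ (M - 1))) / (?R ^ M * ?R ^ M)) (at ?R)"
      using DERIV_divide[OF r_deriv[OF sq'[OF s]] DERIV_pow[of M ?R]] R by simp
    then have "((\<lambda>s. r (sqrt s) / sqrt s ^ M) has_real_derivative
        (p ?R * ?R ^ M - r ?R * (real M * ?R ^ (M - 1))) / (?R ^ M * ?R ^ M) * (inverse ?R / 2)) (at s)"
      by (rule DERIV_chain2) (use DERIV_real_sqrt s in auto)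
    moreover have "(p ?R * ?R ^ M - r ?R * (real M * ?R ^ (M - 1))) / (?R ^ M * ?R ^ M) * (inverse ?R / 2) = \<pi> s * h s / 2"
    proof -
      have "p ?R * ?R ^ M - r ?R * (real M * ?R ^ (M - 1)) = (q ?R - m) * r ?R * ?R ^ (M - 1)"
        using R M2 by (cases M) (auto simp: q_def mM algebra_simps)
      moreover have "?R ^ M = ?R * ?R ^ (M - 1)" using M2 by (cases M) auto
      moreover have "x * y * K / (R * K * (R * K)) * (inverse R / 2) = x / (R * R) * (y / (R * K)) / 2"
        if "K \<noteq> 0" "R \<noteq> 0" for x y K R :: real using that by (simp add: field_simps)
      ultimately show ?thesis using R unfolding \<pi>_def h_def by (metis RR less_irrefl power_not_zero)
    qed
    ultimately show ?thesis by (simp add: h_def[abs_def])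
  qed
  have hc: "continuous_on {0<..1} h" unfolding h_def
    by (intro continuous_intros continuous_on_compose2[OF r_cont]) auto
  have \<pi>c: "continuous_on {0<..1} \<pi>" unfolding \<pi>_def
    by (intro continuous_intros continuous_on_compose2[OF q_cont]) auto
  have h_anti: "h y \<le> h x" if "0 < x" "x \<le> y" "y \<le> 1" for x y
  proof (rule antimono_from_derivative[where f = h and f' = "\<lambda>s. \<pi> s * h s / 2"])
    fix s assume s: "x < s" "s < y"
    then have s01: "s \<in> {0<..<1}" using that by auto
    show "(h has_real_derivative \<pi> s * h s / 2) (at s)" by (rule hd[OF s01])
    have "\<pi> s \<le> 0" using q_le_m[OF sq'[OF s01]] s01 by (simp add: \<pi>_def divide_nonpos_pos)
    then show "\<pi> s * h s / 2 \<le> 0" using h1[of s] s01 by (simp add: mult_nonpos_nonneg)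
  qed (use that in \<open>auto intro: continuous_on_subset[OF hc]\<close>)
  \<comment> \<open>\<open>h\<close> is nonincreasing, because \<open>q \<le> m\<close>, and
    bounded, so its supremum is its limit at \<open>0\<close>.\<close>
  define a where "a = Sup (h ` {0<..1})"
  have bdd: "bdd_above (h ` {0<..1})" by (rule bdd_aboveI[of _ C]) (use h1(2) in auto)
  have ha: "h s \<le> a" if "s \<in> {0<..1}" for s unfolding a_def using bdd that by (intro cSup_upper) auto
  have h_lim: "(h \<longlongrightarrow> a) (at_right 0)"
  proof (rule order_tendstoI)
    fix y assume y: "y < a"
    have "h 1 \<in> h ` {0<..1}" by simp
    then have "h ` {0<..1} \<noteq> {}" by blast
    then obtain v where "v \<in> h ` {0<..1}" "y < v"
      using less_cSupE[OF y[unfolded a_def]] by blast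
    then obtain s0 where s0: "s0 \<in> {0<..1}" "y < h s0" by blast
    show "\<forall>\<^sub>F s in at_right 0. y < h s"
      unfolding eventually_at_right_field
      by (intro exI[of _ s0]) (use s0 h_anti in \<open>auto intro: less_le_trans\<close>)
  next
    fix y assume y: "a < y"
    show "\<forall>\<^sub>F s in at_right 0. h s < y"
      unfolding eventually_at_right_field
      by (intro exI[of _ 1]) (auto intro!: le_less_trans[OF ha y])
  qed
  define H where "H s = (if s = 0 then a else h s)" for s
  have Hc: "continuous_on {0..1} H"
    unfolding continuous_on_def
  proof
    fix x :: real assume x: "x \<in> {0..1}"
    show "(H \<longlongrightarrow> H x) (at x within {0..1})"
    proof (cases "x = 0")
      case True
      have "(h \<longlongrightarrow> a) (at 0 within {0..1})" using h_lim by (simp add: at_within_Icc_at_right)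
      then have "(H \<longlongrightarrow> a) (at 0 within {0..1})"
        by (rule Lim_transform_eventually) (auto simp: H_def eventually_at_filter)
      then show ?thesis using True by (simp add: H_def)
    next
      case False
      then have "x \<in> {0<..1}" using x by simp
      then have "(h \<longlongrightarrow> h x) (at x within {0<..1})" using hc by (auto simp: continuous_on_def)
      moreover have "at x within {0<..1} = at x within {0..1}"
        by (rule at_within_nhd[of _ "{0<..}"]) (use False x in auto)
      ultimately have "(h \<longlongrightarrow> H x) (at x within {0..1})" using False by (simp add: H_def)
      moreover have "\<forall>\<^sub>F s in at x within {0..1}. h s = H s"
        unfolding eventually_at_topological using False by (intro exI[of _ "- {0}"]) (auto simp: H_def)
      ultimately show ?thesis by (rule Lim_transform_eventually)
    qed
  qed
  have Hh: "H s = h s" if "s \<in> {0<..1}" for s using that by (simp add: H_def)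
  have \<pi>b: "\<bar>\<pi> s\<bar> \<le> max C \<bar>\<pi> 1\<bar>" if s: "s \<in> {0<..1}" for s
  proof (cases "s = 1")
    case False
    then have s': "s \<in> {0<..<1}" using s by auto
    have "\<bar>\<pi> s\<bar> = (m - q (sqrt s)) / s" using q_le_m[OF sq'[OF s']] s' by (simp add: \<pi>_def abs_divide abs_of_nonpos)
    also have "\<dots> \<le> C" using C(1)[OF sq'[OF s']] s' by (simp add: field_simps)
    finally show ?thesis by simp
  qed simp
  define \<pi>' where "\<pi>' s = q' (sqrt s) / (2 * sqrt s) / s - (q (sqrt s) - m) / s\<^sup>2" for s
  have qs: "((\<lambda>s. q (sqrt s)) has_real_derivative q' (sqrt s) / (2 * sqrt s)) (at s)" if s: "s \<in> {0<..<1}" for s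
    using DERIV_chain2[OF q_deriv[OF sq'[OF s]] DERIV_real_sqrt] s by (simp add: field_simps)
  have \<pi>d: "(\<pi> has_real_derivative \<pi>' s) (at s)" if s: "s \<in> {0<..<1}" for s
    unfolding \<pi>_def[abs_def] \<pi>'_def using s
    by (auto intro!: derivative_eq_intros qs simp: field_simps power2_eq_square)
  have det_d: "det_profile M H (\<lambda>s. s * \<pi> s) s = d (sqrt s)" if s: "s \<in> {0<..1}" for s
  proof -
    have "s = (sqrt s)\<^sup>2" using s by simp
    then have "(sqrt s ^ M)\<^sup>2 = s ^ M" by (metis power_mult_distrib power2_eq_square power_commutes power_mult mult.commute)
    also have "\<dots> = s ^ (M - 1) * s" using M2 by (cases M) auto
    finally have "(sqrt s ^ M)\<^sup>2 = s ^ (M - 1) * s" .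
    then show ?thesis
      using d_eq[OF sq[OF s]] q_\<pi>[OF s] r_h[OF s] s
      by (simp add: det_profile_def Hh[OF s] mM power_mult_distrib)
  qed
  have eps_eq: "eps (sqrt s) = s * (m\<^sup>2 * f2 (det_profile M H (\<lambda>s. s * \<pi> s) s) * s ^ (M - 2) * (H s)\<^sup>2)"
    if s: "s \<in> {0<..1}" for s
  proof -
    have "s = (sqrt s)\<^sup>2" using s by simp
    then have "(sqrt s ^ M)\<^sup>2 = s ^ M" by (metis power_mult_distrib power2_eq_square power_commutes power_mult mult.commute)
    also have "\<dots> = s ^ (M - 2) * s * s" using M2 by (cases M; cases "M - 1") auto
    finally have "(sqrt s ^ M)\<^sup>2 = s ^ (M - 2) * s * s" .
    then show ?thesis
      unfolding eps_def det_d[OF s] Hh[OF s] using r_h[OF s] s by (simp add: power_mult_distrib)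
  qed
  let ?Y = "\<lambda>s. (m + s * \<pi> s)\<^sup>2 + m\<^sup>2 - 2 * (m + s * \<pi> s)"
  have D1: "det_profile' f2 M H (\<lambda>s. s * \<pi> s) s = m * s ^ (M - 2) * (H s)\<^sup>2 * ?Y s / (2 * (1 + eps (sqrt s)))"
    if s: "s \<in> {0<..1}" for s
    unfolding eps_eq[OF s] by (simp add: det_profile'_def mM)
  have eq: "2 * s * \<pi>' s = - (2 * real M + 2) * \<pi> s - s * (\<pi> s)\<^sup>2
      - 2 * real M * f2 (det_profile M H (\<lambda>s. s * \<pi> s) s) * det_profile' f2 M H (\<lambda>s. s * \<pi> s) s"
    if s: "s \<in> {0<..<1}" for s
  proof -
    have s': "s \<in> {0<..1}" using s by auto
    have e: "1 + eps (sqrt s) > 0" using eps_bounds(1)[OF sq[OF s']] by linarith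
    have 1: "2 * s * \<pi>' s = sqrt s * q' (sqrt s) / s - 2 * \<pi> s"
    proof -
      have "q' (sqrt s) / (2 * sqrt s) = sqrt s * q' (sqrt s) / (2 * s)"
        using s by (simp add: field_simps)
      then show ?thesis using s by (simp add: \<pi>'_def \<pi>_def field_simps power2_eq_square)
    qed
    \<comment> \<open>With \<open>q = m + s \<pi>\<close> one has
      \<open>2 q - 2 q^2 + ?Y = m^2 - q^2\<close>; what remains is the perturbation with factor
      \<open>eps / (1 + eps)\<close>.\<close>
    have 2: "sqrt s * q' (sqrt s) = m\<^sup>2 - (m + s * \<pi> s)\<^sup>2 - eps (sqrt s) * ?Y s / (1 + eps (sqrt s))"
    proof -
      have "sqrt s * q' (sqrt s) = 2 * (m + s * \<pi> s) - 2 * (m + s * \<pi> s)\<^sup>2 + ?Y s / (1 + eps (sqrt s))"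
        using s unfolding q'_def q_\<pi>[OF s'] by simp
      moreover have "y / (1 + eps (sqrt s)) = y - eps (sqrt s) * y / (1 + eps (sqrt s))" for y
        using e by (simp add: field_simps)
      from this[of "?Y s"] have "?Y s / (1 + eps (sqrt s)) = ?Y s - eps (sqrt s) * ?Y s / (1 + eps (sqrt s))" .
      ultimately show ?thesis by linarith
    qed
    have 3: "2 * real M * f2 (det_profile M H (\<lambda>s. s * \<pi> s) s) * det_profile' f2 M H (\<lambda>s. s * \<pi> s) s
        = eps (sqrt s) * ?Y s / (1 + eps (sqrt s)) / s"
    proof -
      have ee: "eps (sqrt s) / s = m\<^sup>2 * f2 (det_profile M H (\<lambda>s. s * \<pi> s) s) * s ^ (M - 2) * (H s)\<^sup>2"
        using s by (simp add: eps_eq[OF s'])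
      have gen: "2 * m * x * (m * y * z * Y / (2 * E)) = m\<^sup>2 * x * y * z * Y / E" for x y z Y E :: real
        by (simp add: power2_eq_square)
      have "2 * m * f2 (det_profile M H (\<lambda>s. s * \<pi> s) s) * det_profile' f2 M H (\<lambda>s. s * \<pi> s) s
        = eps (sqrt s) / s * ?Y s / (1 + eps (sqrt s))" unfolding D1[OF s'] ee by (rule gen)
      then show ?thesis by (simp add: mM)
    qed
    have 4: "(m\<^sup>2 - (m + s * \<pi> s)\<^sup>2) / s = - 2 * m * \<pi> s - s * (\<pi> s)\<^sup>2"
      using s by (simp add: field_simps power2_eq_square)
    have "sqrt s * q' (sqrt s) / s = (m\<^sup>2 - (m + s * \<pi> s)\<^sup>2) / s - eps (sqrt s) * ?Y s / (1 + eps (sqrt s)) / s"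
      unfolding 2 by (simp only: diff_divide_distrib)
    then show ?thesis unfolding 1 3 4 by (simp add: mM algebra_simps)
  qed
  \<comment> \<open>At \<open>0\<close> the value of \<open>\<pi>\<close> is a division by zero;
    \<open>\<pi>0\<close> is the smooth function that replaces it.\<close>
  obtain \<pi>0 where \<pi>0: "\<And>s. s \<in> {0<..1} \<Longrightarrow> \<pi>0 s = \<pi> s" "\<And>k. Ck k {0..1} \<pi>0" "\<And>k. Ck k {0..1} H"
  proof (rule singular_ode_smooth[OF f2 f2_bounds(1) Hc \<pi>c \<pi>b _ \<pi>d eq])
    show "(H has_real_derivative \<pi> s * H s / 2) (at s)" if s: "s \<in> {0<..<1}" for s
      by (rule has_field_derivative_transform_within_open[OF _ open_greaterThanLessThan s, of h])
        (use hd[OF s] s in \<open>auto simp: H_def\<close>)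
  qed (use that in blast)+
  have dp: "det_profile M H (\<lambda>s. s * \<pi>0 s) s = det_profile M H (\<lambda>s. s * \<pi> s) s"
    "det_profile' f2 M H (\<lambda>s. s * \<pi>0 s) s = det_profile' f2 M H (\<lambda>s. s * \<pi> s) s" if "s \<in> {0<..1}" for s
    using \<pi>0(1)[OF that] by (simp_all add: det_profile_def det_profile'_def)
  show ?thesis
  proof (rule that[of H \<pi>0])
    show "1 \<le> H s" if "s \<in> {0..1}" for s
      using h1[of s] ha[of 1] h1(1)[of 1] that by (auto simp: H_def less_le)
    show "0 \<le> real M + s * \<pi>0 s" if s: "s \<in> {0..1}" for s
    proof (cases "s = 0")
      case False
      then have s': "s \<in> {0<..1}" using s by auto
      show ?thesis using q_nonneg[OF sq[OF s']] q_\<pi>[OF s'] \<pi>0(1)[OF s'] by (simp add: mM)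
    qed simp
    fix R :: real assume R: "R \<in> {0<..1}"
    then have R2: "R\<^sup>2 \<in> {0<..1}" by (auto simp: power_le_one)
    have sR: "sqrt (R\<^sup>2) = R" using R by simp
    show rR: "r R = R ^ M * H (R\<^sup>2)" using r_h[OF R2] Hh[OF R2] by (simp only: sR)
    have "q R = real M + R\<^sup>2 * \<pi>0 (R\<^sup>2)" using q_\<pi>[OF R2] \<pi>0(1)[OF R2] by (simp only: sR mM)
    then show "p R = R ^ (M - 1) * H (R\<^sup>2) * (real M + R\<^sup>2 * \<pi>0 (R\<^sup>2))"
      using p_eq[OF R] rR R M2 by (cases M) auto
  next
    fix s :: real assume s: "s \<in> {0<..<1}"
    then have s': "s \<in> {0<..1}" by auto
    note tr = has_field_derivative_transform_within_open[OF _ open_greaterThanLessThan s]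
    show "(H has_real_derivative \<pi>0 s * H s / 2) (at s)"
      by (rule tr[of h]) (use hd[OF s] \<pi>0(1)[OF s'] Hh s in auto)
    have "(\<pi>0 has_real_derivative \<pi>' s) (at s)"
      by (rule tr[of \<pi>]) (use \<pi>d[OF s] \<pi>0(1) in auto)
    then show "\<exists>\<pi>'. (\<pi>0 has_real_derivative \<pi>') (at s) \<and>
       2 * s * \<pi>' = - (2 * real M + 2) * \<pi>0 s - s * (\<pi>0 s)\<^sup>2
         - 2 * real M * f2 (det_profile M H (\<lambda>s. s * \<pi>0 s) s) * det_profile' f2 M H (\<lambda>s. s * \<pi>0 s) s"
      using eq[OF s] \<pi>0(1)[OF s'] unfolding dp[OF s'] by auto
    have "((\<lambda>s. d (sqrt s)) has_real_derivative d' (sqrt s) * (inverse (sqrt s) / 2)) (at s)"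
      by (rule DERIV_chain2[OF d_deriv[OF sq'[OF s]] DERIV_real_sqrt]) (use s in auto)
    moreover have "d' (sqrt s) * (inverse (sqrt s) / 2) = det_profile' f2 M H (\<lambda>s. s * \<pi> s) s"
    proof -
      have ss: "s = (sqrt s)\<^sup>2" using s by simp
      then have "(sqrt s ^ M)\<^sup>2 = s ^ M" by (metis power_mult_distrib power2_eq_square power_commutes power_mult mult.commute)
      also have "\<dots> = s ^ (M - 2) * s * s" using M2 by (cases M; cases "M - 1") auto
      finally have r2: "(r (sqrt s))\<^sup>2 = s ^ (M - 2) * s * s * (H s)\<^sup>2" using r_h[OF s'] by (simp add: power_mult_distrib Hh[OF s'])
      have c3: "sqrt s ^ 3 * sqrt s = s * s" using s by (simp add: power3_eq_cube mult.assoc[symmetric])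
      have gen: "m * (K * t * t * h) * Y / (c3 * E) * (inverse c / 2) = m * K * h * Y / (2 * E)"
        if "c3 * c = t * t" "t \<noteq> 0" for K t h Y E c c3 :: real
      proof -
        have "m * (K * t * t * h) * Y / (c3 * E) * (inverse c / 2) = (t * t) * (m * K * h * Y) / ((c3 * c) * (2 * E))"
          by (simp only: divide_inverse inverse_mult_distrib mult_ac)
        also have "\<dots> = m * K * h * Y / (2 * E)" unfolding that(1)
          by (rule mult_divide_mult_cancel_left) (use that(2) in simp)
        finally show ?thesis .
      qed
      have s0: "s \<noteq> 0" using s by simp
      have dd: "d' (sqrt s) = m * (s ^ (M - 2) * s * s * (H s)\<^sup>2) * ?Y s / (sqrt s ^ 3 * (1 + eps (sqrt s)))"
        using d'_eq[OF sq[OF s']] unfolding q_\<pi>[OF s'] r2 .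
      show ?thesis
        unfolding D1[OF s'] dd by (rule gen[OF c3 s0])
    qed
    ultimately have "((\<lambda>s. d (sqrt s)) has_real_derivative det_profile' f2 M H (\<lambda>s. s * \<pi>0 s) s) (at s)"
      unfolding dp(2)[OF s'] by (simp only:)
    then show "(det_profile M H (\<lambda>s. s * \<pi>0 s) has_real_derivative det_profile' f2 M H (\<lambda>s. s * \<pi>0 s) s) (at s)"
    proof (rule tr)
      fix t :: real assume "t \<in> {0<..<1}"
      then have t: "t \<in> {0<..1}" by auto
      show "d (sqrt t) = det_profile M H (\<lambda>s. s * \<pi>0 s) t" unfolding dp(1)[OF t] det_d[OF t] ..
    qed
  qed (use \<pi>0 in auto)
qed

text \<open>\<open>\<rho>'\<close> is increasing, vanishes to the left of \<open>0\<close> and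
  equals \<open>\<gamma>\<close> to the right of \<open>s0\<close>, which gives its bounds;
  \<open>\<rho>''\<close> vanishes outside \<open>[0, s0]\<close>, so it is bounded by
  compactness.\<close>

lemma convex_profile_derivatives:
  fixes \<rho> :: "real \<Rightarrow> real" and \<gamma> s0 \<kappa> :: real
  assumes smooth: "Cinf UNIV \<rho>" and convex: "convex_on UNIV \<rho>"
    and neg: "\<forall>s\<le>0. \<rho> s = 0" and lin: "\<forall>s\<ge>s0. \<rho> s = \<gamma> * s + \<kappa>" and s0: "0 \<le> s0"
  obtains f2 K where "\<And>s. (\<rho> has_real_derivative deriv \<rho> s) (at s)"
    "\<And>s. (deriv \<rho> has_real_derivative f2 s) (at s)" "\<And>k. Ck k UNIV (deriv \<rho>)" "\<And>k. Ck k UNIV f2"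
    "\<And>s. 0 \<le> deriv \<rho> s" "\<And>s. deriv \<rho> s \<le> \<gamma>" "\<And>s. 0 \<le> f2 s" "\<And>s. f2 s \<le> K"
    "\<And>s t. deriv \<rho> s * (t - s) \<le> \<rho> t - \<rho> s"
proof -
  obtain f where f: "\<And>s. (\<rho> has_real_derivative f s) (at s)" "Cinf UNIV f"
    by (rule Cinf_obtain_derivative[OF smooth]) auto
  obtain f2 where f2: "\<And>s. (f has_real_derivative f2 s) (at s)" "Cinf UNIV f2"
    by (rule Cinf_obtain_derivative[OF f(2)]) auto
  have df: "deriv \<rho> = f" using DERIV_imp_deriv[OF f(1)] by auto
  have tangent: "f s * (t - s) \<le> \<rho> t - \<rho> s" for s t
    by (rule convex_on_imp_above_tangent[OF convex]) (use f(1) in auto)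
  have mono: "f s \<le> f t" if "s \<le> t" for s t
  proof (cases "s = t")
    case False
    then have "f s * (t - s) \<le> f t * (t - s)" using tangent[of s t] tangent[of t s] by (simp add: algebra_simps)
    then show ?thesis using False that by simp
  qed simp
  have fneg: "f s = 0" if "s < 0" for s
  proof -
    have "((\<lambda>_. 0) has_real_derivative 0) (at s)" by simp
    then have "(\<rho> has_real_derivative 0) (at s)"
      by (rule has_field_derivative_transform_within_open[where S = "{..<0}"]) (use that neg in auto)
    then show ?thesis using f(1) DERIV_unique by blast
  qed
  have fpos: "f s = \<gamma>" if "s0 < s" for s
  proof -
    have "((\<lambda>s. \<gamma> * s + \<kappa>) has_real_derivative \<gamma>) (at s)" by (auto intro!: derivative_eq_intros)
    then have "(\<rho> has_real_derivative \<gamma>) (at s)"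
      by (rule has_field_derivative_transform_within_open[where S = "{s0<..}"]) (use that lin in auto)
    then show ?thesis using f(1) DERIV_unique by blast
  qed
  have "0 \<le> f s" "f s \<le> \<gamma>" for s
    using mono[of "min s (-1)" s] mono[of s "max s (s0 + 1)"] fneg[of "min s (-1)"] fpos[of "max s (s0 + 1)"] by auto
  moreover have f2n: "0 \<le> f2 s" for s
  proof (rule ccontr)
    assume "\<not> 0 \<le> f2 s"
    then obtain e where e: "e > 0" "\<And>h. 0 < h \<Longrightarrow> h < e \<Longrightarrow> f (s + h) < f s"
      using DERIV_neg_dec_right[OF f2(1)[of s]] by auto
    have "f (s + e / 2) < f s" using e(1) by (intro e(2)) auto
    moreover have "f s \<le> f (s + e / 2)" using e(1) by (intro mono) auto
    ultimately show False by linarith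
  qed
  moreover obtain K where "\<And>s. f2 s \<le> K"
  proof -
    have f2c: "continuous_on S f2" for S
      using Ck_imp_continuous_on[of 0 UNIV f2] f2(2) continuous_on_subset unfolding Cinf_def by blast
    have "bounded (f2 ` {-1..s0 + 1})"
      by (intro compact_imp_bounded compact_continuous_image f2c compact_Icc)
    then obtain B where B: "\<forall>s\<in>{-1..s0 + 1}. \<bar>f2 s\<bar> \<le> B" by (auto simp: bounded_iff)
    have z: "f2 s = 0" if "s < 0 \<or> s0 < s" for s
    proof -
      have "\<exists>c. (\<forall>\<^sub>F t in nhds s. f t = c)"
      proof (cases "s < 0")
        case True
        then show ?thesis using eventually_nhds_in_open[of "{..<0}" s] fneg by (auto elim!: eventually_mono)
      next
        case False
        then show ?thesis using that eventually_nhds_in_open[of "{s0<..}" s] fpos by (auto elim!: eventually_mono)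
      qed
      then obtain c where "\<forall>\<^sub>F t in nhds s. f t = c" by blast
      then have "(f has_real_derivative 0) (at s)" using DERIV_cong_ev[OF refl, of f "\<lambda>_. c" s] by simp
      then show ?thesis using f2(1) DERIV_unique by blast
    qed
    have "f2 s \<le> \<bar>B\<bar>" for s
    proof (cases "s \<in> {-1..s0 + 1}")
      case True
      then have "\<bar>f2 s\<bar> \<le> B" using B by blast
      then show ?thesis by linarith
    next
      case False
      then show ?thesis using z[of s] s0 by auto
    qed
    then show ?thesis by (rule that)
  qed
  ultimately show ?thesis
    using that[of f2 K] f(1) f2 tangent \<open>Cinf UNIV f\<close> unfolding df Cinf_def by blast
qed

section \<open>Square integrable functions and weak gradients\<close>

text \<open>Young's inequality supplies the bound. Measurability is known for functions cut off at
  \<open>U\<close>, and a bilinear map commutes with the cut-off.\<close>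

lemma L2_on_bilinear:
  assumes B: "bounded_bilinear B" and f: "L2_on U f" and g: "L2_on U g"
  shows "set_integrable lebesgue U (\<lambda>x. B (f x) (g x) :: 'c::euclidean_space)"
proof -
  obtain K where K: "0 < K" "\<And>a b. norm (B a b) \<le> norm a * norm b * K"
    using bounded_bilinear.pos_bounded[OF B] by blast
  have m: "(\<lambda>x. indicator U x *\<^sub>R f x) \<in> borel_measurable lebesgue" "(\<lambda>x. indicator U x *\<^sub>R g x) \<in> borel_measurable lebesgue"
    using f g by (auto simp: L2_on_def set_borel_measurable_def)
  have "(\<lambda>x. B (indicator U x *\<^sub>R f x) (indicator U x *\<^sub>R g x)) \<in> borel_measurable lebesgue"
    by (rule borel_measurable_continuous_Pair[OF m])
      (auto intro!: bounded_bilinear.continuous_on[OF B] continuous_intros)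
  moreover have "B (indicator U x *\<^sub>R f x) (indicator U x *\<^sub>R g x) = indicator U x *\<^sub>R B (f x) (g x)" for x
    by (auto simp: indicator_def bounded_bilinear.zero_left[OF B])
  ultimately have mB: "set_borel_measurable lebesgue U (\<lambda>x. B (f x) (g x))" by (simp add: set_borel_measurable_def)
  have i: "set_integrable lebesgue U (\<lambda>x. K * ((norm (f x))\<^sup>2 + (norm (g x))\<^sup>2))"
    using f g by (intro set_integrable_mult_right set_integral_add) (auto simp: L2_on_def)
  have "norm (B (f x) (g x)) \<le> norm (K * ((norm (f x))\<^sup>2 + (norm (g x))\<^sup>2))" for x
  proof -
    have "norm (f x) * norm (g x) \<le> (norm (f x))\<^sup>2 + (norm (g x))\<^sup>2"
    proof -
      have "2 * (norm (f x) * norm (g x)) \<le> (norm (f x))\<^sup>2 + (norm (g x))\<^sup>2"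
        using zero_le_power2[of "norm (f x) - norm (g x)"] by (simp add: power2_diff mult.assoc)
      moreover have "0 \<le> norm (f x) * norm (g x)" by simp
      ultimately show ?thesis by linarith
    qed
    then have "norm (f x) * norm (g x) * K \<le> ((norm (f x))\<^sup>2 + (norm (g x))\<^sup>2) * K"
      using K(1) by (intro mult_right_mono) auto
    with K(2)[of "f x" "g x"] have "norm (B (f x) (g x)) \<le> ((norm (f x))\<^sup>2 + (norm (g x))\<^sup>2) * K" by (rule order_trans)
    then show ?thesis using K(1) by (simp only: real_norm_def mult.commute[of K] abs_le_iff)
  qed
  then show ?thesis by (intro set_integrable_bound[OF i mB]) simp
qed

lemmas L2_on_inner = L2_on_bilinear[OF bounded_bilinear_inner]
lemmas L2_on_scaleR = L2_on_bilinear[OF bounded_bilinear_scaleR]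
lemmas L2_on_mult = L2_on_bilinear[OF bounded_bilinear_mult]

lemma L2_on_bound:
  assumes f: "L2_on U f" and g: "set_borel_measurable lebesgue U g" and le: "\<And>x. x \<in> U \<Longrightarrow> norm (g x) \<le> C * norm (f x)"
  shows "L2_on U g"
proof -
  have gm: "(\<lambda>x. indicator U x *\<^sub>R g x) \<in> borel_measurable lebesgue" using g by (simp add: set_borel_measurable_def)
  have "(\<lambda>x. (norm (indicator U x *\<^sub>R g x))\<^sup>2) \<in> borel_measurable lebesgue" using gm by measurable
  moreover have "(norm (indicator U x *\<^sub>R g x))\<^sup>2 = indicator U x *\<^sub>R (norm (g x))\<^sup>2" for x by (simp add: indicator_def)
  ultimately have m: "set_borel_measurable lebesgue U (\<lambda>x. (norm (g x))\<^sup>2)" by (simp add: set_borel_measurable_def)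
  have i: "set_integrable lebesgue U (\<lambda>x. C\<^sup>2 * (norm (f x))\<^sup>2)"
    using f by (intro set_integrable_mult_right) (auto simp: L2_on_def)
  have "(norm (g x))\<^sup>2 \<le> C\<^sup>2 * (norm (f x))\<^sup>2" if "x \<in> U" for x
    using power_mono[OF le[OF that], of 2] by (simp add: power_mult_distrib)
  then have "set_integrable lebesgue U (\<lambda>x. (norm (g x))\<^sup>2)" by (intro set_integrable_bound[OF i m]) simp
  then show ?thesis using g by (simp add: L2_on_def)
qed

lemma L2_on_linear:
  assumes L: "bounded_linear L" and f: "L2_on U f" shows "L2_on U (\<lambda>x. L (f x))"
proof -
  obtain C where C: "\<And>x. norm (L x) \<le> norm x * C" using bounded_linear.bounded[OF L] by blast
  have "(\<lambda>x. indicator U x *\<^sub>R f x) \<in> borel_measurable lebesgue" using f by (simp add: L2_on_def set_borel_measurable_def)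
  then have "(\<lambda>x. L (indicator U x *\<^sub>R f x)) \<in> borel_measurable lebesgue"
    by (rule measurable_compose) (rule borel_measurable_continuous_onI[OF linear_continuous_on[OF L]])
  then have "set_borel_measurable lebesgue U (\<lambda>x. L (f x))"
    by (simp add: set_borel_measurable_def linear_cmul[OF bounded_linear.linear[OF L]])
  then show ?thesis by (rule L2_on_bound[OF f, of _ C]) (use C in \<open>simp add: mult.commute\<close>)
qed

lemma L2_on_add: assumes "L2_on U f" "L2_on U g" shows "L2_on U (\<lambda>x. f x + g x)"
proof -
  have m: "(\<lambda>x. indicator U x *\<^sub>R f x) \<in> borel_measurable lebesgue" "(\<lambda>x. indicator U x *\<^sub>R g x) \<in> borel_measurable lebesgue"
    using assms by (auto simp: L2_on_def set_borel_measurable_def)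
  have m': "set_borel_measurable lebesgue U (\<lambda>x. f x + g x)"
    using borel_measurable_add[OF m] by (simp add: set_borel_measurable_def scaleR_add_right)
  have "set_integrable lebesgue U (\<lambda>x. (norm (f x))\<^sup>2 + 2 * (f x \<bullet> g x) + (norm (g x))\<^sup>2)"
    using assms by (intro set_integral_add set_integrable_mult_right L2_on_inner) (auto simp: L2_on_def)
  moreover have "(norm (f x))\<^sup>2 + 2 * (f x \<bullet> g x) + (norm (g x))\<^sup>2 = (norm (f x + g x))\<^sup>2" for x
    by (simp add: power2_norm_eq_inner inner_add_left inner_add_right inner_commute)
  ultimately show ?thesis using m' by (simp add: L2_on_def)
qed

lemma L2_on_scale: "L2_on U f \<Longrightarrow> L2_on U (\<lambda>x. c *\<^sub>R f x)"
  by (rule L2_on_linear[OF bounded_linear_scaleR_right])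

lemma L2_on_diff: "L2_on U f \<Longrightarrow> L2_on U g \<Longrightarrow> L2_on U (\<lambda>x. f x - g x)"
  using L2_on_add[of U f "\<lambda>x. (-1) *\<^sub>R g x"] L2_on_scale[of U g "-1"] by simp

text \<open>Continuity up to the boundary gives boundedness, which continuity on the open disk would
  not.\<close>

lemma L2_on_continuous_cball:
  assumes "continuous_on (cball 0 1) f" shows "L2_on Bdisk f"
proof -
  have 1: "set_integrable lebesgue Bdisk g" if "continuous_on (cball 0 1) g" for g :: "real^2 \<Rightarrow> 'z::euclidean_space"
  proof -
    have "set_integrable lebesgue (cball 0 1) g"
      by (rule set_integrable_compact_support[of "cball 0 1"]) (use that in auto)
    then show ?thesis by (rule set_integrable_subset) auto
  qed
  have "set_integrable lebesgue Bdisk f" by (rule 1[OF assms])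
  then have "set_borel_measurable lebesgue Bdisk f"
    unfolding set_integrable_def set_borel_measurable_def by (rule borel_measurable_integrable)
  moreover have "set_integrable lebesgue Bdisk (\<lambda>x. (norm (f x))\<^sup>2)" using assms by (intro 1 continuous_intros)
  ultimately show ?thesis by (simp add: L2_on_def)
qed

lemma L2_on_compact_support:
  assumes "compact K" "K \<subseteq> U" "\<And>x. x \<in> U - K \<Longrightarrow> f x = 0" "continuous_on U f"
  shows "L2_on U f"
proof -
  have "set_integrable lebesgue U f" by (rule set_integrable_compact_support[OF assms])
  then have "set_borel_measurable lebesgue U f"
    unfolding set_integrable_def set_borel_measurable_def by (rule borel_measurable_integrable)
  moreover have "set_integrable lebesgue U (\<lambda>x. (norm (f x))\<^sup>2)"
    by (rule set_integrable_compact_support[OF assms(1,2)]) (use assms(3,4) in \<open>auto intro!: continuous_intros\<close>)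
  ultimately show ?thesis by (simp add: L2_on_def)
qed

lemma L2_on_test:
  assumes "Cc_inf U \<phi>"
  shows "L2_on U \<phi>" "L2_on U (\<lambda>x. frechet_derivative \<phi> (at x) e)"
proof -
  obtain K where K: "compact K" "K \<subseteq> U" "\<And>x. x \<notin> K \<Longrightarrow> \<phi> x = 0"
    "\<And>x. (\<phi> has_derivative frechet_derivative \<phi> (at x)) (at x)"
    "\<And>e. continuous_on UNIV (\<lambda>x. frechet_derivative \<phi> (at x) e)"
    "\<And>x e. x \<notin> K \<Longrightarrow> frechet_derivative \<phi> (at x) e = 0"
    by (rule Cc_infD[OF assms]) (rule that; assumption)
  have "continuous_on UNIV \<phi>" using K(4) by (meson has_derivative_continuous continuous_at_imp_continuous_on)
  then show "L2_on U \<phi>"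
    by (intro L2_on_compact_support[OF K(1,2)] K(3)) (auto intro: continuous_on_subset)
  show "L2_on U (\<lambda>x. frechet_derivative \<phi> (at x) e)"
    by (intro L2_on_compact_support[OF K(1,2)] K(6) continuous_on_subset[OF K(5)]) auto
qed

lemma L2_on_integrable_cbox:
  assumes "L2_on U f" "cbox a b \<subseteq> U" shows "set_integrable lebesgue (cbox a b) f"
proof -
  have 1: "L2_on (cbox a b) (\<lambda>_. 1::real)" by (rule L2_on_compact_support[of "cbox a b"]) auto
  have "set_integrable lebesgue (cbox a b) (\<lambda>x. (norm (f x))\<^sup>2)"
    using assms unfolding L2_on_def by (auto intro: set_integrable_subset)
  moreover have "set_borel_measurable lebesgue (cbox a b) f"
    using assms unfolding L2_on_def by (auto intro: set_borel_measurable_subset)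
  ultimately have "L2_on (cbox a b) f" by (simp add: L2_on_def)
  from L2_on_scaleR[OF 1 this] show ?thesis by simp
qed

text \<open>Testing one coordinate at a time reduces the claim to \<open>fundamental_lemma\<close>.
  The maps \<open>u\<close> and \<open>u'\<close> may differ on a null set, since polar forms are
  given almost everywhere.\<close>

lemma weak_partial_unique:
  assumes U: "open U" and u: "L2_on U u" "L2_on U u'" "AE x in lebesgue. x \<in> U \<longrightarrow> u x = u' x"
    and g: "L2_on U g" "L2_on U g'" and w: "weak_partial U u e g" "weak_partial U u' e g'"
  shows "AE x in lebesgue. x \<in> U \<longrightarrow> g x = g' x"
proof -
  have "AE x in lebesgue. x \<in> U \<longrightarrow> (g x - g' x) \<bullet> b = 0" for b
  proof (rule fundamental_lemma[OF U])
    fix c d assume "cbox c d \<subseteq> U"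
    then have "set_integrable lebesgue (cbox c d) (\<lambda>x. g x - g' x)"
      by (intro L2_on_integrable_cbox[of U] L2_on_diff g)
    then show "set_integrable lebesgue (cbox c d) (\<lambda>x. (g x - g' x) \<bullet> b)"
      unfolding set_integrable_def real_scaleR_def inner_scaleR_left[symmetric] by (rule integrable_inner_left)
  next
    fix \<phi> :: "real^2 \<Rightarrow> real" assume \<phi>: "Cc_inf U \<phi>"
    note L = L2_on_test[OF \<phi>]
    have i: "set_integrable lebesgue U (\<lambda>x. \<phi> x *\<^sub>R g x)" "set_integrable lebesgue U (\<lambda>x. \<phi> x *\<^sub>R g' x)"
      "set_integrable lebesgue U (\<lambda>x. frechet_derivative \<phi> (at x) e *\<^sub>R u x)"
      "set_integrable lebesgue U (\<lambda>x. frechet_derivative \<phi> (at x) e *\<^sub>R u' x)"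
      by (intro L2_on_scaleR L g u)+
    have "(LINT x:U|lebesgue. frechet_derivative \<phi> (at x) e *\<^sub>R u x) = (LINT x:U|lebesgue. frechet_derivative \<phi> (at x) e *\<^sub>R u' x)"
      unfolding set_lebesgue_integral_def
    proof (rule integral_cong_AE)
      show "AE x in lebesgue. indicator U x *\<^sub>R frechet_derivative \<phi> (at x) e *\<^sub>R u x
          = indicator U x *\<^sub>R frechet_derivative \<phi> (at x) e *\<^sub>R u' x"
        using u(3) by eventually_elim (auto simp: indicator_def)
    qed (use i in \<open>auto simp: set_integrable_def intro: borel_measurable_integrable\<close>)
    then have "(LINT x:U|lebesgue. \<phi> x *\<^sub>R g x) = (LINT x:U|lebesgue. \<phi> x *\<^sub>R g' x)"
      using w(1)[unfolded weak_partial_def, rule_format, OF \<phi>] w(2)[unfolded weak_partial_def, rule_format, OF \<phi>] by simp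
    then have 0: "(LINT x:U|lebesgue. \<phi> x *\<^sub>R g x - \<phi> x *\<^sub>R g' x) = 0"
      using i by (simp add: set_integral_diff)
    have id: "integrable lebesgue (\<lambda>x. indicator U x *\<^sub>R (\<phi> x *\<^sub>R g x - \<phi> x *\<^sub>R g' x))"
      using set_integral_diff(1)[OF i(1,2)] by (simp add: set_integrable_def)
    have "(LINT x:U|lebesgue. \<phi> x * ((g x - g' x) \<bullet> b)) = (LINT x|lebesgue. (indicator U x *\<^sub>R (\<phi> x *\<^sub>R g x - \<phi> x *\<^sub>R g' x)) \<bullet> b)"
      unfolding set_lebesgue_integral_def by (intro Bochner_Integration.integral_cong) (auto simp: inner_diff_left right_diff_distrib)
    also have "\<dots> = 0" unfolding integral_inner_left[OF id] using 0 by (simp add: set_lebesgue_integral_def)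
    finally show "(LINT x:U|lebesgue. \<phi> x * ((g x - g' x) \<bullet> b)) = 0" .
  qed
  then have "AE x in lebesgue. \<forall>b\<in>Basis. x \<in> U \<longrightarrow> (g x - g' x) \<bullet> b = 0"
    by (subst AE_ball_countable[OF countable_finite[OF finite_Basis]]) blast
  then show ?thesis
  proof eventually_elim
    case (elim x)
    then show ?case using euclidean_eqI[of "g x" "g' x"] by (auto simp: inner_diff_left)
  qed
qed

lemma bounded_linear_column: "bounded_linear (column j :: real^2^2 \<Rightarrow> real^2)"
  unfolding linear_conv_bounded_linear[symmetric] by (auto simp: linear_iff column_def vec_eq_iff)

lemma weak_grad_unique:
  assumes U: "open U" and u: "L2_on U u" "L2_on U u'" "AE x in lebesgue. x \<in> U \<longrightarrow> u x = u' x"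
    and g: "L2_on U G" "L2_on U G'" and w: "weak_grad U u G" "weak_grad U u' G'"
  shows "AE x in lebesgue. x \<in> U \<longrightarrow> G x = G' x"
proof -
  have "AE x in lebesgue. x \<in> U \<longrightarrow> column j (G x) = column j (G' x)" for j
    using w unfolding weak_grad_def by (intro weak_partial_unique[OF U u] L2_on_linear[OF bounded_linear_column] g) auto
  then have "AE x in lebesgue. (x \<in> U \<longrightarrow> column 1 (G x) = column 1 (G' x)) \<and> (x \<in> U \<longrightarrow> column 2 (G x) = column 2 (G' x))"
    by (simp add: AE_conj_iff)
  then show ?thesis
    by eventually_elim (auto simp: vec_eq_iff column_def forall_2)
qed

text \<open>The product rule for \<open>\<phi> u\<close>, whose derivative has integral
  zero.\<close>

lemma weak_partial_classical:
  fixes u :: "real^2 \<Rightarrow> 'b::euclidean_space"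
  assumes U: "open U" and d: "\<And>x. x \<in> U \<Longrightarrow> (u has_derivative u' x) (at x)" and c: "continuous_on U (\<lambda>x. u' x e)"
  shows "weak_partial U u e (\<lambda>x. u' x e)"
  unfolding weak_partial_def
proof (intro allI impI)
  fix \<phi> :: "real^2 \<Rightarrow> real" assume \<phi>: "Cc_inf U \<phi>"
  obtain K where K: "compact K" "K \<subseteq> U" "\<And>x. x \<notin> K \<Longrightarrow> \<phi> x = 0"
    "\<And>x. (\<phi> has_derivative frechet_derivative \<phi> (at x)) (at x)"
    "\<And>e. continuous_on UNIV (\<lambda>x. frechet_derivative \<phi> (at x) e)"
    "\<And>x e. x \<notin> K \<Longrightarrow> frechet_derivative \<phi> (at x) e = 0"
    by (rule Cc_infD[OF \<phi>]) (rule that; assumption)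
  have cc: "continuous_on U \<phi>" "continuous_on U u"
    using K(4) d by (auto intro!: continuous_at_imp_continuous_on intro: has_derivative_continuous)
  have cd: "continuous_on U (\<lambda>x. frechet_derivative \<phi> (at x) e)" by (rule continuous_on_subset[OF K(5)]) simp
  have i: "set_integrable lebesgue U (\<lambda>x. \<phi> x *\<^sub>R u' x e)" "set_integrable lebesgue U (\<lambda>x. frechet_derivative \<phi> (at x) e *\<^sub>R u x)"
    using K(3,6) cc cd c by (auto intro!: set_integrable_compact_support[OF K(1,2)] continuous_intros)
  have "(LINT x:U|lebesgue. \<phi> x *\<^sub>R u' x e + frechet_derivative \<phi> (at x) e *\<^sub>R u x) = 0"
    by (rule set_integral_derivative_eq_0[where F = "\<lambda>x. \<phi> x *\<^sub>R u x"
        and F' = "\<lambda>x h. \<phi> x *\<^sub>R u' x h + frechet_derivative \<phi> (at x) h *\<^sub>R u x", OF U _ _ K(1,2)])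
      (use K(3) d cc cd c in \<open>auto intro!: has_derivative_scaleR K(4) continuous_intros\<close>)
  then show "(LINT x:U|lebesgue. frechet_derivative \<phi> (at x) e *\<^sub>R u x) = - (LINT x:U|lebesgue. \<phi> x *\<^sub>R u' x e)"
    using i by (simp add: set_integral_add add_eq_0_iff)
qed

lemma weak_grad_classical:
  fixes u :: "real^2 \<Rightarrow> real^2"
  assumes U: "open U" and d: "\<And>x. x \<in> U \<Longrightarrow> (u has_derivative u' x) (at x)"
    and c: "\<And>j. continuous_on U (\<lambda>x. u' x (axis j 1))"
  shows "weak_grad U u (\<lambda>x. matrix (u' x))"
proof -
  have "column j (matrix (u' x)) = u' x (axis j 1)" for j x
    by (simp add: column_def matrix_def)
  then show ?thesis
    unfolding weak_grad_def using weak_partial_classical[OF U d c] by simp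
qed

lemma L2_on_matrix:
  assumes "\<And>j. L2_on U (\<lambda>x. u' x (axis j 1) :: real^2)" shows "L2_on U (\<lambda>x. matrix (u' x) :: real^2^2)"
proof -
  have e: "matrix (u' x) = (\<Sum>i\<in>UNIV. \<Sum>j\<in>UNIV. u' x (axis j 1) $ i *\<^sub>R (axis i (axis j 1)))" for x :: "real^2"
    by (simp add: matrix_def vec_eq_iff sum_2 forall_2 axis_def)
  have "bounded_linear (\<lambda>y :: real^2. y $ i *\<^sub>R (axis i (axis j 1) :: real^2^2))" for i j
    by (intro bounded_linear_scaleR_const bounded_linear_vec_nth)
  then have "L2_on U (\<lambda>x. u' x (axis j 1) $ i *\<^sub>R (axis i (axis j 1) :: real^2^2))" for i j
    by (rule L2_on_linear[OF _ assms])
  then show ?thesis unfolding e sum_2 by (intro L2_on_add)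
qed

lemma test_jacobian:
  fixes \<phi> :: "real^2 \<Rightarrow> real^2"
  assumes "Cc_inf U \<phi>"
  shows "L2_on U (\<lambda>x. jacobian \<phi> (at x))" "jacobian \<phi> (at x) $ i $ j = frechet_derivative \<phi> (at x) (axis j 1) $ i"
proof -
  show "L2_on U (\<lambda>x. jacobian \<phi> (at x))"
    unfolding jacobian_def by (rule L2_on_matrix) (rule L2_on_test[OF assms])
  show "jacobian \<phi> (at x) $ i $ j = frechet_derivative \<phi> (at x) (axis j 1) $ i"
    by (simp add: jacobian_def matrix_def)
qed

text \<open>Young's inequality with a weight \<open>t\<close> that is small compared with the norm
  of \<open>F\<close> plays the part of the Cauchy-Schwarz inequality for integrals.\<close>

lemma L2_on_limit_inner:
  fixes F :: "real^2 \<Rightarrow> 'b::euclidean_space"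
  assumes F: "L2_on U F" and X: "\<And>k. L2_on U (X k)" "(\<lambda>k. LINT x:U|lebesgue. (norm (X k x))\<^sup>2) \<longlonglongrightarrow> 0"
  shows "(\<lambda>k::nat. LINT x:U|lebesgue. F x \<bullet> X k x) \<longlonglongrightarrow> 0"
proof (rule LIMSEQ_I)
  fix e :: real assume e: "0 < e"
  define A where "A = (LINT x:U|lebesgue. (norm (F x))\<^sup>2)"
  have A: "0 \<le> A" unfolding A_def set_lebesgue_integral_def
    by (intro Bochner_Integration.integral_nonneg) (simp add: indicator_def)
  \<comment> \<open>Makes \<open>t A < e / 2\<close>; the summand \<open>1\<close> covers
    \<open>A = 0\<close>.\<close>
  define t where "t = e / (2 * (A + 1))"
  have t: "0 < t" "t * A < e / 2" using e A by (auto simp: t_def field_simps)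
  obtain k0 where k0: "\<And>k. k \<ge> k0 \<Longrightarrow> \<bar>LINT x:U|lebesgue. (norm (X k x))\<^sup>2\<bar> < t * (e / 2)"
    using LIMSEQ_D[OF X(2), of "t * (e / 2)"] t e by auto
  have "\<bar>LINT x:U|lebesgue. F x \<bullet> X k x\<bar> < e" if k: "k \<ge> k0" for k
  proof -
    have i: "set_integrable lebesgue U (\<lambda>x. t * (norm (F x))\<^sup>2 + (norm (X k x))\<^sup>2 / t)"
      using F X(1)[of k] by (intro set_integral_add set_integrable_mult_right set_integrable_divide) (auto simp: L2_on_def)
    have pt: "\<bar>F x \<bullet> X k x\<bar> \<le> t * (norm (F x))\<^sup>2 + (norm (X k x))\<^sup>2 / t" for x
    proof -
      define a b where "a = norm (F x)" and "b = norm (X k x)"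
      have ab: "0 \<le> a" "0 \<le> b" by (auto simp: a_def b_def)
      have "0 \<le> (t * a - b)\<^sup>2" by simp
      then have "a * b * t \<le> (t * a)\<^sup>2 + b\<^sup>2"
        using mult_nonneg_nonneg[OF mult_nonneg_nonneg[OF ab] less_imp_le[OF t(1)]] by (simp add: power2_diff mult_ac)
      then have "a * b \<le> ((t * a)\<^sup>2 + b\<^sup>2) / t" using t(1) by (simp add: pos_le_divide_eq)
      also have "\<dots> = t * a\<^sup>2 + b\<^sup>2 / t" using t(1) by (simp add: add_divide_distrib power2_eq_square)
      finally show ?thesis using Cauchy_Schwarz_ineq2[of "F x" "X k x"] by (simp add: a_def b_def)
    qed
    have "\<bar>LINT x:U|lebesgue. F x \<bullet> X k x\<bar> \<le> (LINT x:U|lebesgue. t * (norm (F x))\<^sup>2 + (norm (X k x))\<^sup>2 / t)"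
      unfolding set_lebesgue_integral_def real_norm_def[symmetric]
    proof (rule Bochner_Integration.integral_norm_bound_integral)
      show "norm (indicator U x *\<^sub>R (F x \<bullet> X k x)) \<le> indicator U x *\<^sub>R (t * (norm (F x))\<^sup>2 + (norm (X k x))\<^sup>2 / t)" for x
        using pt[of x] by (simp add: indicator_def)
    qed (use i L2_on_inner[OF F X(1)] in \<open>auto simp: set_integrable_def\<close>)
    also have "\<dots> = t * A + (LINT x:U|lebesgue. (norm (X k x))\<^sup>2) / t"
      using F X(1)[of k] unfolding A_def by (subst set_integral_add) (auto simp: L2_on_def)
    also have "\<dots> < e"
    proof -
      have "(LINT x:U|lebesgue. (norm (X k x))\<^sup>2) / t < e / 2" using k0[OF k] t(1) by (simp add: field_simps)
      then show ?thesis using t(2) by linarith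
    qed
    finally show ?thesis .
  qed
  then show "\<exists>no. \<forall>n\<ge>no. norm ((LINT x:U|lebesgue. F x \<bullet> X n x) - 0) < e" by auto
qed

section \<open>Null Lagrangians\<close>

text \<open>Provides the dominating bound and the pointwise limit for
  \<open>cross_derivatives\<close>.\<close>

lemma difference_quotient:
  fixes F :: "'a::euclidean_space \<Rightarrow> real"
  assumes F: "\<And>x. (F has_derivative F' x) (at x)" and c: "continuous_on UNIV (\<lambda>x. F' x e)"
    and K: "compact K" "\<And>x. x \<notin> K \<Longrightarrow> F' x e = 0"
  shows "\<exists>B. \<forall>x t. \<bar>F (x + t *\<^sub>R e) - F x\<bar> \<le> B * \<bar>t\<bar>"
    and "t \<longlonglongrightarrow> 0 \<Longrightarrow> (\<And>n. t n \<noteq> 0) \<Longrightarrow> (\<lambda>n::nat. (F (x + t n *\<^sub>R e) - F x) / t n) \<longlonglongrightarrow> F' x e"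
proof -
  have d: "((\<lambda>s. F (x + s *\<^sub>R e)) has_real_derivative F' (x + s *\<^sub>R e) e) (at s)" for x s
  proof -
    have "((\<lambda>s. F (x + s *\<^sub>R e)) has_derivative (\<lambda>h. F' (x + s *\<^sub>R e) (h *\<^sub>R e))) (at s)"
      by (rule has_derivative_compose[OF _ F]) (auto intro!: derivative_eq_intros)
    moreover have "F' (x + s *\<^sub>R e) (h *\<^sub>R e) = F' (x + s *\<^sub>R e) e * h" for h
      using linear_cmul[OF has_derivative_linear[OF F]] by simp
    ultimately show ?thesis by (simp only: has_field_derivative_def)
  qed
  have "bounded ((\<lambda>x. F' x e) ` K)"
    using c K(1) by (meson compact_continuous_image compact_imp_bounded continuous_on_subset subset_UNIV)
  then obtain B0 where B0: "\<forall>x\<in>K. \<bar>F' x e\<bar> \<le> B0" by (auto simp: bounded_iff)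
  have B: "\<bar>F' x e\<bar> \<le> \<bar>B0\<bar>" for x
  proof (cases "x \<in> K")
    case True
    then have "\<bar>F' x e\<bar> \<le> B0" using B0 by blast
    then show ?thesis by linarith
  qed (simp add: K(2))
  have "\<bar>F (x + t *\<^sub>R e) - F x\<bar> \<le> \<bar>B0\<bar> * \<bar>t\<bar>" for x t
    using field_differentiable_bound[of UNIV "\<lambda>s. F (x + s *\<^sub>R e)" "\<lambda>s. F' (x + s *\<^sub>R e) e" "\<bar>B0\<bar>" t 0] d B by simp
  then show "\<exists>B. \<forall>x t. \<bar>F (x + t *\<^sub>R e) - F x\<bar> \<le> B * \<bar>t\<bar>" by blast
  assume t: "t \<longlonglongrightarrow> 0" "\<And>n. t n \<noteq> 0"
  have "((\<lambda>h. (F (x + h *\<^sub>R e) - F x) / h) \<longlongrightarrow> F' x e) (at 0)"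
    using d[of x 0] by (simp add: DERIV_def)
  then show "(\<lambda>n. (F (x + t n *\<^sub>R e) - F x) / t n) \<longlonglongrightarrow> F' x e"
    by (rule filterlim_compose) (use t in \<open>auto simp: filterlim_at\<close>)
qed

text \<open>Moving one derivative across by means of difference quotients of \<open>v\<close> avoids second derivatives.\<close>

lemma cross_derivatives:
  fixes \<phi> v :: "'a::euclidean_space \<Rightarrow> real"
  assumes \<phi>: "Cc_inf U \<phi>" and v: "Cc_inf U v"
  shows "(LINT x|lborel. frechet_derivative \<phi> (at x) a * frechet_derivative v (at x) b)
       = (LINT x|lborel. frechet_derivative \<phi> (at x) b * frechet_derivative v (at x) a)"
proof -
  define D E where "D x = frechet_derivative \<phi> (at x)" and "E x = frechet_derivative v (at x)" for x
  obtain K where K: "compact K" "K \<subseteq> U" "\<And>x. x \<notin> K \<Longrightarrow> \<phi> x = 0" "\<And>x. (\<phi> has_derivative D x) (at x)"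
    "\<And>e. continuous_on UNIV (\<lambda>x. D x e)" "\<And>x e. x \<notin> K \<Longrightarrow> D x e = 0"
    unfolding D_def by (rule Cc_infD[OF \<phi>]) (rule that[unfolded D_def]; assumption)
  obtain L where L: "compact L" "L \<subseteq> U" "\<And>x. x \<notin> L \<Longrightarrow> v x = 0" "\<And>x. (v has_derivative E x) (at x)"
    "\<And>e. continuous_on UNIV (\<lambda>x. E x e)" "\<And>x e. x \<notin> L \<Longrightarrow> E x e = 0"
    unfolding E_def by (rule Cc_infD[OF v]) (rule that[unfolded E_def]; assumption)
  have c: "continuous_on UNIV \<phi>" "continuous_on UNIV v"
    using K(4) L(4) by (auto intro!: continuous_at_imp_continuous_on intro: has_derivative_continuous)
  have ci: "integrable lborel g" if "continuous_on UNIV g" "compact S" "\<And>x. x \<notin> S \<Longrightarrow> g x = 0" for g :: "'a \<Rightarrow> real" and S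
  proof -
    have "integrable lborel (\<lambda>x. indicator S x *\<^sub>R g x)"
      by (rule borel_integrable_compact[OF that(2) continuous_on_subset[OF that(1)]]) simp
    moreover have "(\<lambda>x. indicator S x *\<^sub>R g x) = g" using that(3) by (auto simp: fun_eq_iff indicator_def)
    ultimately show ?thesis by simp
  qed
  have shift: "continuous_on UNIV (\<lambda>x. g (x + y))" if "continuous_on UNIV g" for g :: "'a \<Rightarrow> real" and y
    by (rule continuous_on_compose2[OF that]) (auto intro!: continuous_intros)
  \<comment> \<open>Integration by parts in direction \<open>a\<close> against a translate of
    \<open>v\<close>, which uses first derivatives only.\<close>
  have parts: "(LINT x|lborel. D x a * v (x + y)) = - (LINT x|lborel. \<phi> x * E (x + y) a)" for y
  proof -
    have "((\<lambda>x. v (x + y)) has_derivative E (x + y)) (at x)" for x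
      by (rule has_derivative_compose[OF _ L(4)]) (auto intro!: derivative_eq_intros)
    then have d: "((\<lambda>x. \<phi> x * v (x + y)) has_derivative (\<lambda>h. \<phi> x * E (x + y) h + D x h * v (x + y))) (at x)" for x
      by (intro has_derivative_mult K(4))
    have "(LINT x|lborel. \<phi> x * E (x + y) a + D x a * v (x + y)) = 0"
      by (rule integral_derivative_eq_0[OF d _ K(1)]) (use K(3) in \<open>auto intro!: continuous_intros c shift K(5) L(5)\<close>)
    moreover have "integrable lborel (\<lambda>x. \<phi> x * E (x + y) a)" "integrable lborel (\<lambda>x. D x a * v (x + y))"
      by (rule ci[OF _ K(1)]; use K(3,6) in \<open>auto intro!: continuous_intros c shift K(5) L(5)\<close>)+
    ultimately show ?thesis by (simp add: add_eq_0_iff)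
  qed
  have trans: "(LINT x|lborel. g (x + y)) = (LINT x|lborel. g x)" if "continuous_on UNIV g" for g :: "'a \<Rightarrow> real" and y
  proof -
    have "g \<in> borel_measurable borel" by (rule borel_measurable_continuous_onI[OF that])
    then show ?thesis using integral_distr[of "(+) y" lborel borel g] by (simp add: lborel_distr_plus add.commute)
  qed
  define t where "t n = inverse (real (Suc n))" for n
  have t: "t \<longlonglongrightarrow> 0" "t n \<noteq> 0" for n
    unfolding t_def using LIMSEQ_inverse_real_of_nat by (auto simp: o_def)
  obtain B1 where B1: "\<And>x t. \<bar>v (x + t *\<^sub>R b) - v x\<bar> \<le> B1 * \<bar>t\<bar>"
    using difference_quotient(1)[OF L(4,5,1,6)] by blast
  obtain B2 where B2: "\<And>x t. \<bar>\<phi> (x + t *\<^sub>R b) - \<phi> x\<bar> \<le> B2 * \<bar>t\<bar>"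
    using difference_quotient(1)[OF K(4,5,1,6)] by blast
  have lim: "(\<lambda>n. LINT x|lborel. w x * ((G (x + s n *\<^sub>R b) - G x) / s n)) \<longlonglongrightarrow> (LINT x|lborel. w x * G' x b)"
    if s: "s \<longlonglongrightarrow> 0" "\<And>n. s n \<noteq> 0" and w: "continuous_on UNIV w" "integrable lborel w"
      and G: "continuous_on UNIV G" "continuous_on UNIV (\<lambda>x. G' x b)" "\<And>x t. \<bar>G (x + t *\<^sub>R b) - G x\<bar> \<le> B * \<bar>t\<bar>"
        "\<And>x. (\<lambda>n. (G (x + s n *\<^sub>R b) - G x) / s n) \<longlonglongrightarrow> G' x b"
    for s :: "nat \<Rightarrow> real" and w G :: "'a \<Rightarrow> real" and G' B
  proof (rule integral_dominated_convergence[where w = "\<lambda>x. B * \<bar>w x\<bar>"])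
    have [measurable]: "w \<in> borel_measurable borel" "G \<in> borel_measurable borel" "(\<lambda>x. G' x b) \<in> borel_measurable borel"
      using w G by (auto intro: borel_measurable_continuous_onI)
    show "(\<lambda>x. w x * G' x b) \<in> borel_measurable lborel" by measurable
    show "(\<lambda>x. w x * ((G (x + s n *\<^sub>R b) - G x) / s n)) \<in> borel_measurable lborel" for n by measurable
    show "integrable lborel (\<lambda>x. B * \<bar>w x\<bar>)" using w(2) by simp
    show "AE x in lborel. (\<lambda>n. w x * ((G (x + s n *\<^sub>R b) - G x) / s n)) \<longlonglongrightarrow> w x * G' x b"
      by (intro AE_I2 tendsto_intros G(4))
    show "AE x in lborel. norm (w x * ((G (x + s n *\<^sub>R b) - G x) / s n)) \<le> B * \<bar>w x\<bar>" for n
    proof (rule AE_I2)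
      fix x
      have "\<bar>(G (x + s n *\<^sub>R b) - G x) / s n\<bar> \<le> B" using G(3)[of x "s n"] s(2)[of n] by (simp add: abs_divide divide_le_eq)
      then have "\<bar>w x\<bar> * \<bar>(G (x + s n *\<^sub>R b) - G x) / s n\<bar> \<le> \<bar>w x\<bar> * B" by (intro mult_left_mono) auto
      then show "norm (w x * ((G (x + s n *\<^sub>R b) - G x) / s n)) \<le> B * \<bar>w x\<bar>" by (simp only: real_norm_def abs_mult mult.commute)
    qed
  qed
  have Di: "integrable lborel (\<lambda>x. D x a)" and Ei: "integrable lborel (\<lambda>x. E x a)"
    by (rule ci[OF K(5) K(1) K(6)], assumption, rule ci[OF L(5) L(1) L(6)], assumption)
  have 1: "(\<lambda>n. LINT x|lborel. D x a * ((v (x + t n *\<^sub>R b) - v x) / t n)) \<longlonglongrightarrow> (LINT x|lborel. D x a * E x b)"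
    by (rule lim[of t "\<lambda>x. D x a" v E B1, OF t K(5) Di c(2) L(5) B1]) (rule difference_quotient(2)[OF L(4,5,1,6) t]; assumption)
  have 2: "(\<lambda>n. LINT x|lborel. E x a * ((\<phi> (x + (- t n) *\<^sub>R b) - \<phi> x) / (- t n))) \<longlonglongrightarrow> (LINT x|lborel. E x a * D x b)"
  proof -
    have t': "(\<lambda>n. - t n) \<longlonglongrightarrow> 0" "- t n \<noteq> 0" for n using tendsto_minus[OF t(1)] t(2) by auto
    show ?thesis by (rule lim[of "\<lambda>n. - t n" "\<lambda>x. E x a" \<phi> D B2, OF t' L(5) Ei c(1) K(5) B2]) (rule difference_quotient(2)[OF K(4,5,1,6) t']; assumption)
  qed
  \<comment> \<open>Translation by \<open>t b\<close> moves the difference quotient from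
    \<open>v\<close> to \<open>\<phi>\<close>, with the sign of the increment reversed.\<close>
  have eq: "(LINT x|lborel. D x a * ((v (x + t n *\<^sub>R b) - v x) / t n)) = (LINT x|lborel. E x a * ((\<phi> (x + (- t n) *\<^sub>R b) - \<phi> x) / (- t n)))" for n
  proof -
    let ?y = "t n *\<^sub>R b"
    have i: "integrable lborel (\<lambda>x. D x a * v (x + ?y))" "integrable lborel (\<lambda>x. D x a * v x)"
      by (rule ci[OF _ K(1)]; use K(6) in \<open>auto intro!: continuous_intros c shift K(5) L(5)\<close>)+
    have j: "integrable lborel (\<lambda>x. E x a * \<phi> (x + - ?y))" "integrable lborel (\<lambda>x. E x a * \<phi> x)"
      by (rule ci[OF _ L(1)]; use L(6) in \<open>auto intro!: continuous_intros c shift[of _ "- ?y", simplified] K(5) L(5)\<close>)+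
    have "(LINT x|lborel. D x a * ((v (x + ?y) - v x) / t n)) = ((LINT x|lborel. D x a * v (x + ?y)) - (LINT x|lborel. D x a * v x)) / t n"
      using i by (simp add: right_diff_distrib diff_divide_distrib)
    also have "\<dots> = - ((LINT x|lborel. \<phi> x * E (x + ?y) a) - (LINT x|lborel. \<phi> x * E x a)) / t n"
      using parts[of ?y] parts[of 0] by simp
    also have "(LINT x|lborel. \<phi> x * E (x + ?y) a) = (LINT x|lborel. E x a * \<phi> (x + - ?y))"
    proof -
      have cg: "continuous_on UNIV (\<lambda>x. E x a * \<phi> (x + - ?y))" by (intro continuous_on_mult L(5) shift c)
      show ?thesis using trans[OF cg, of ?y] by (simp add: mult.commute)
    qed
    also have "- ((LINT x|lborel. E x a * \<phi> (x + - ?y)) - (LINT x|lborel. \<phi> x * E x a)) / t n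
        = (LINT x|lborel. E x a * ((\<phi> (x + (- t n) *\<^sub>R b) - \<phi> x) / (- t n)))"
      using j by (simp add: right_diff_distrib diff_divide_distrib mult.commute[of "\<phi> _"])
    finally show ?thesis .
  qed
  show ?thesis using LIMSEQ_unique[OF 1 2[folded eq]] by (simp add: D_def E_def mult.commute)
qed

section \<open>Integral identities for test maps on the disk\<close>

lemma Cc_inf_nth:
  fixes \<phi> :: "real^2 \<Rightarrow> real^2"
  assumes "Cc_inf U \<phi>"
  shows "Cc_inf U (\<lambda>x. \<phi> x $ i)" "frechet_derivative (\<lambda>x. \<phi> x $ i) (at x) e = frechet_derivative \<phi> (at x) e $ i"
proof -
  have sub: "{x. \<phi> x $ i \<noteq> 0} \<subseteq> {x. \<phi> x \<noteq> 0}" by auto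
  then have "closure {x. \<phi> x $ i \<noteq> 0} \<subseteq> closure {x. \<phi> x \<noteq> 0}" by (rule closure_mono)
  moreover have "bounded {x. \<phi> x $ i \<noteq> 0}"
    using assms bounded_subset[OF _ sub] by (auto simp: Cc_inf_def)
  moreover have "Ck k UNIV (\<lambda>x. \<phi> x $ i)" for k
    using assms by (intro Ck_bounded_linear[OF bounded_linear_vec_nth]) (auto simp: Cc_inf_def Cinf_def)
  ultimately show "Cc_inf U (\<lambda>x. \<phi> x $ i)" using assms by (auto simp: Cc_inf_def Cinf_def)
  have "(\<phi> has_derivative frechet_derivative \<phi> (at x)) (at x)"
    by (rule Cc_infD[OF assms])
  from frechet_derivative_at[OF bounded_linear.has_derivative[OF bounded_linear_vec_nth this], of i]
  show "frechet_derivative (\<lambda>x. \<phi> x $ i) (at x) e = frechet_derivative \<phi> (at x) e $ i" by metis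
qed

lemma set_integral_eq_lborel:
  fixes g :: "'a::euclidean_space \<Rightarrow> real"
  assumes "continuous_on UNIV g" "\<And>x. x \<notin> U \<Longrightarrow> g x = 0"
  shows "(LINT x:U|lebesgue. g x) = (LINT x|lborel. g x)"
proof -
  have "(LINT x:U|lebesgue. g x) = (LINT x|lebesgue. g x)"
    unfolding set_lebesgue_integral_def using assms(2)
    by (intro Bochner_Integration.integral_cong) (auto simp: indicator_def)
  also have "\<dots> = (LINT x|lborel. g x)"
    by (rule integral_completion) (simp add: borel_measurable_continuous_onI[OF assms(1)])
  finally show ?thesis .
qed

lemma norm_sq_matrix2: "(norm (A :: real^2^2))\<^sup>2 = (A$1$1)\<^sup>2 + (A$1$2)\<^sup>2 + (A$2$1)\<^sup>2 + (A$2$2)\<^sup>2"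
  unfolding power2_norm_eq_inner by (simp add: inner_vec_def sum_2 power2_eq_square)

context
  fixes \<phi> :: "real^2 \<Rightarrow> real^2"
  assumes \<phi>: "Cc_inf Bdisk \<phi>"
begin

lemma test_entries:
  "jacobian \<phi> (at x) $ i $ j = frechet_derivative (\<lambda>x. \<phi> x $ i) (at x) (axis j 1)"
  using test_jacobian(2)[OF \<phi>] Cc_inf_nth(2)[OF \<phi>] by simp

lemma test_entries_L2: "L2_on Bdisk (\<lambda>x. jacobian \<phi> (at x) $ i $ j)"
  unfolding test_entries by (rule L2_on_test(2)[OF Cc_inf_nth(1)[OF \<phi>]])

text \<open>The determinant is a null Lagrangian: its two products have equal integrals by
  \<open>cross_derivatives\<close>.\<close>

lemma test_det_integral: "(LINT x:Bdisk|lebesgue. det (jacobian \<phi> (at x))) = 0"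
proof -
  let ?D = "\<lambda>i j x. frechet_derivative (\<lambda>x. \<phi> x $ i) (at x) (axis j 1)"
  have D: "continuous_on UNIV (?D i j)" "x \<notin> Bdisk \<Longrightarrow> ?D i j x = 0" for i j x
  proof -
    obtain K where K: "compact K" "K \<subseteq> Bdisk" "\<And>x. x \<notin> K \<Longrightarrow> \<phi> x $ i = 0"
      "\<And>x. ((\<lambda>x. \<phi> x $ i) has_derivative frechet_derivative (\<lambda>x. \<phi> x $ i) (at x)) (at x)"
      "\<And>e. continuous_on UNIV (\<lambda>x. frechet_derivative (\<lambda>x. \<phi> x $ i) (at x) e)"
      "\<And>x e. x \<notin> K \<Longrightarrow> frechet_derivative (\<lambda>x. \<phi> x $ i) (at x) e = 0"
      by (rule Cc_infD[OF Cc_inf_nth(1)[OF \<phi>, of i]]) (rule that; assumption)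
    show "continuous_on UNIV (?D i j)" by (rule K(5))
    show "?D i j x = 0" if "x \<notin> Bdisk" using K(2,6) that by blast
  qed
  have e: "(LINT x:Bdisk|lebesgue. ?D i j x * ?D k l x) = (LINT x|lborel. ?D i j x * ?D k l x)" for i j k l
    by (rule set_integral_eq_lborel) (auto intro!: continuous_intros D)
  have i: "set_integrable lebesgue Bdisk (\<lambda>x. ?D i j x * ?D k l x)" for i j k l
    by (intro L2_on_mult L2_on_test(2)[OF Cc_inf_nth(1)[OF \<phi>]])
  have "(LINT x:Bdisk|lebesgue. det (jacobian \<phi> (at x)))
      = (LINT x:Bdisk|lebesgue. ?D 1 1 x * ?D 2 2 x) - (LINT x:Bdisk|lebesgue. ?D 1 2 x * ?D 2 1 x)"
    unfolding det_2 test_entries by (rule set_integral_diff(2)[OF i i])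
  then show ?thesis
    unfolding e using cross_derivatives[OF Cc_inf_nth(1)[OF \<phi>] Cc_inf_nth(1)[OF \<phi>]] by simp
qed

lemma test_partial_integral: "(LINT x:Bdisk|lebesgue. jacobian \<phi> (at x) $ i $ j) = 0"
proof -
  obtain K where K: "compact K" "K \<subseteq> Bdisk" "\<And>x. x \<notin> K \<Longrightarrow> \<phi> x $ i = 0"
    "\<And>x. ((\<lambda>x. \<phi> x $ i) has_derivative frechet_derivative (\<lambda>x. \<phi> x $ i) (at x)) (at x)"
    "\<And>e. continuous_on UNIV (\<lambda>x. frechet_derivative (\<lambda>x. \<phi> x $ i) (at x) e)"
      "\<And>x e. x \<notin> K \<Longrightarrow> frechet_derivative (\<lambda>x. \<phi> x $ i) (at x) e = 0"
    by (rule Cc_infD[OF Cc_inf_nth(1)[OF \<phi>, of i]]) (rule that; assumption)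
  show ?thesis unfolding test_entries
    by (rule set_integral_derivative_eq_0[OF open_ball K(4) continuous_on_subset[OF K(5)] K(1,2)]) (use K(3) in auto)
qed

text \<open>The inequality comes from integrating \<open>\<partial>\<^sub>1 (x\<^sub>1 \<phi>\<^sub>i\<^sup>2)\<close>.\<close>

lemma test_Poincare:
  "(LINT x:Bdisk|lebesgue. (norm (\<phi> x))\<^sup>2) \<le> 4 * (LINT x:Bdisk|lebesgue. (norm (jacobian \<phi> (at x)))\<^sup>2)"
proof -
  let ?D = "\<lambda>i x. frechet_derivative (\<lambda>x. \<phi> x $ i) (at x) (axis 1 1)"
  have ph: "L2_on Bdisk (\<lambda>x. \<phi> x $ i)" for i by (rule L2_on_test(1)[OF Cc_inf_nth(1)[OF \<phi>]])
  have D: "L2_on Bdisk (?D i)" for i by (rule L2_on_test(2)[OF Cc_inf_nth(1)[OF \<phi>]])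
  have sq: "set_integrable lebesgue Bdisk (\<lambda>x. (\<phi> x $ i)\<^sup>2)" "set_integrable lebesgue Bdisk (\<lambda>x. (?D i x)\<^sup>2)" for i
    using ph[of i] D[of i] by (auto simp: L2_on_def)
  have comp: "(LINT x:Bdisk|lebesgue. (\<phi> x $ i)\<^sup>2) \<le> 4 * (LINT x:Bdisk|lebesgue. (?D i x)\<^sup>2)" for i
  proof -
    obtain K where K: "compact K" "K \<subseteq> Bdisk" "\<And>x. x \<notin> K \<Longrightarrow> \<phi> x $ i = 0"
      "\<And>x. ((\<lambda>x. \<phi> x $ i) has_derivative frechet_derivative (\<lambda>x. \<phi> x $ i) (at x)) (at x)"
      "\<And>e. continuous_on UNIV (\<lambda>x. frechet_derivative (\<lambda>x. \<phi> x $ i) (at x) e)"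
        "\<And>x e. x \<notin> K \<Longrightarrow> frechet_derivative (\<lambda>x. \<phi> x $ i) (at x) e = 0"
      by (rule Cc_infD[OF Cc_inf_nth(1)[OF \<phi>, of i]]) (rule that; assumption)
    have c: "continuous_on S (\<lambda>x. \<phi> x $ i)" for S
      using K(4) by (meson has_derivative_continuous continuous_at_imp_continuous_on)
    have cD: "continuous_on S (?D i)" for S by (rule continuous_on_subset[OF K(5)]) simp
    have cx: "continuous_on S (\<lambda>x :: real^2. x $ 1)" for S by (intro continuous_intros)
    define F' where "F' x h = x $ 1 * (2 * \<phi> x $ i * frechet_derivative (\<lambda>x. \<phi> x $ i) (at x) h) + h $ 1 * (\<phi> x $ i)\<^sup>2" for x h :: "real^2"
    have F'1: "F' x (axis 1 1) = (\<phi> x $ i)\<^sup>2 + 2 * x $ 1 * \<phi> x $ i * ?D i x" for x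
      by (simp add: F'_def axis_def)
    have "(LINT x:Bdisk|lebesgue. F' x (axis 1 1)) = 0"
    proof (rule set_integral_derivative_eq_0[where F = "\<lambda>x. x $ 1 * (\<phi> x $ i)\<^sup>2", OF open_ball _ _ K(1,2)])
      fix x :: "real^2"
      have "((\<lambda>x. (\<phi> x $ i)\<^sup>2) has_derivative (\<lambda>h. 2 * \<phi> x $ i * frechet_derivative (\<lambda>x. \<phi> x $ i) (at x) h)) (at x)"
        using has_derivative_power[OF K(4)[of x], of 2] by (simp add: mult_ac)
      then show "((\<lambda>x. x $ 1 * (\<phi> x $ i)\<^sup>2) has_derivative F' x) (at x)"
        unfolding F'_def by (intro has_derivative_mult bounded_linear_imp_has_derivative[OF bounded_linear_vec_nth])
      show "x $ 1 * (\<phi> x $ i)\<^sup>2 = 0" if "x \<in> Bdisk - K" using K(3) that by simp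
    qed (auto simp: F'1 intro!: continuous_intros c cD)
    then have z: "(LINT x:Bdisk|lebesgue. (\<phi> x $ i)\<^sup>2 + 2 * x $ 1 * \<phi> x $ i * ?D i x) = 0" by (simp only: F'1)
    have xi: "set_integrable lebesgue Bdisk (\<lambda>x. 2 * x $ 1 * \<phi> x $ i * ?D i x)"
      by (rule set_integrable_compact_support[OF K(1,2)]) (use K(3) in \<open>auto intro!: continuous_intros c cD\<close>)
    have "(LINT x:Bdisk|lebesgue. (\<phi> x $ i)\<^sup>2 / 2 - 2 * (?D i x)\<^sup>2)
        \<le> (LINT x:Bdisk|lebesgue. (\<phi> x $ i)\<^sup>2 + 2 * x $ 1 * \<phi> x $ i * ?D i x)"
    proof (rule set_integral_mono)
      show "set_integrable lebesgue Bdisk (\<lambda>x. (\<phi> x $ i)\<^sup>2 / 2 - 2 * (?D i x)\<^sup>2)"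
        using sq by (intro set_integral_diff set_integrable_mult_right set_integrable_divide) auto
      show "set_integrable lebesgue Bdisk (\<lambda>x. (\<phi> x $ i)\<^sup>2 + 2 * x $ 1 * \<phi> x $ i * ?D i x)"
        by (intro set_integral_add sq xi)
      fix x :: "real^2" assume x: "x \<in> Bdisk"
      have x1: "(x $ 1)\<^sup>2 \<le> 1"
      proof -
        have "\<bar>x $ 1\<bar> \<le> norm x" by (rule component_le_norm_cart)
        then have "\<bar>x $ 1\<bar> \<le> 1" using x by simp
        then show ?thesis by (simp add: abs_square_le_1)
      qed
      \<comment> \<open>With \<open>\<bar>x$1\<bar> \<le> 1\<close>, half of this square shows that
        \<open>\<phi>^2 / 2 - 2 (\<partial>\<phi>)^2\<close> is at most the integrand of
        \<open>z\<close>, whose integral is zero; this is where the constant \<open>4\<close> comes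
        from.\<close>
      have "0 \<le> (\<phi> x $ i + 2 * x $ 1 * ?D i x)\<^sup>2" by simp
      also have "\<dots> = (\<phi> x $ i)\<^sup>2 + 4 * x $ 1 * \<phi> x $ i * ?D i x + 4 * ((x $ 1)\<^sup>2 * (?D i x)\<^sup>2)"
        by (simp add: power2_eq_square algebra_simps)
      also have "(x $ 1)\<^sup>2 * (?D i x)\<^sup>2 \<le> 1 * (?D i x)\<^sup>2" using x1 by (intro mult_right_mono) auto
      finally show "(\<phi> x $ i)\<^sup>2 / 2 - 2 * (?D i x)\<^sup>2 \<le> (\<phi> x $ i)\<^sup>2 + 2 * x $ 1 * \<phi> x $ i * ?D i x" by simp
    qed
    moreover have "(LINT x:Bdisk|lebesgue. (\<phi> x $ i)\<^sup>2 / 2 - 2 * (?D i x)\<^sup>2)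
        = (LINT x:Bdisk|lebesgue. (\<phi> x $ i)\<^sup>2) / 2 - 2 * (LINT x:Bdisk|lebesgue. (?D i x)\<^sup>2)"
      using sq by (subst set_integral_diff) auto
    ultimately show ?thesis using z by simp
  qed
  have "(LINT x:Bdisk|lebesgue. (norm (\<phi> x))\<^sup>2) = (LINT x:Bdisk|lebesgue. (\<phi> x $ 1)\<^sup>2 + (\<phi> x $ 2)\<^sup>2)"
    unfolding power2_norm_eq_inner by (simp add: inner_vec_def sum_2 power2_eq_square)
  also have "\<dots> = (LINT x:Bdisk|lebesgue. (\<phi> x $ 1)\<^sup>2) + (LINT x:Bdisk|lebesgue. (\<phi> x $ 2)\<^sup>2)"
    by (rule set_integral_add(2)[OF sq(1) sq(1)])
  also have "\<dots> \<le> 4 * ((LINT x:Bdisk|lebesgue. (?D 1 x)\<^sup>2) + (LINT x:Bdisk|lebesgue. (?D 2 x)\<^sup>2))"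
    using comp[of 1] comp[of 2] by simp
  also have "(LINT x:Bdisk|lebesgue. (?D 1 x)\<^sup>2) + (LINT x:Bdisk|lebesgue. (?D 2 x)\<^sup>2)
      = (LINT x:Bdisk|lebesgue. (?D 1 x)\<^sup>2 + (?D 2 x)\<^sup>2)"
    by (rule set_integral_add(2)[OF sq(2) sq(2), symmetric])
  also have "\<dots> \<le> (LINT x:Bdisk|lebesgue. (norm (jacobian \<phi> (at x)))\<^sup>2)"
  proof (rule set_integral_mono)
    show "set_integrable lebesgue Bdisk (\<lambda>x. (?D 1 x)\<^sup>2 + (?D 2 x)\<^sup>2)" by (intro set_integral_add sq)
    show "set_integrable lebesgue Bdisk (\<lambda>x. (norm (jacobian \<phi> (at x)))\<^sup>2)"
      using test_jacobian(1)[OF \<phi>] by (simp add: L2_on_def)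
    show "(?D 1 x)\<^sup>2 + (?D 2 x)\<^sup>2 \<le> (norm (jacobian \<phi> (at x)))\<^sup>2" for x
      unfolding test_entries[symmetric] norm_sq_matrix2 by simp
  qed
  finally show ?thesis by simp
qed

end

section \<open>Minimality of the identity\<close>

text \<open>De Moivre's formula. In the form of \<open>rcis\<close> it also holds at the origin,
  where \<open>theta\<close> is a convention.\<close>

lemma norm_power_eM:
  "norm x ^ M *\<^sub>R eM M x = vector [Re (Complex (x$1) (x$2) ^ M), Im (Complex (x$1) (x$2) ^ M)]"
proof -
  have "norm x = cmod (Complex (x$1) (x$2))"
    by (simp add: norm_vec_def L2_set_def sum_2 cmod_def)
  then have "Complex (x$1) (x$2) = rcis (norm x) (theta x)" by (simp add: theta_def rcis_cmod_Arg)
  then have "Complex (x$1) (x$2) ^ M = rcis (norm x ^ M) (real M * theta x)" by (simp add: DeMoivre2)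
  then show ?thesis by (simp add: eM_def rcis_def cis.ctr vec_eq_iff forall_2)
qed

lemma uM_1: "uM 1 x = x"
  using norm_power_eM[of x 1] by (simp add: uM_def vec_eq_iff forall_2)

lemma weak_grad_add:
  assumes "L2_on U u" "L2_on U v" "L2_on U G" "L2_on U H" "weak_grad U u G" "weak_grad U v H"
  shows "weak_grad U (\<lambda>x. u x + v x) (\<lambda>x. G x + H x)"
  unfolding weak_grad_def weak_partial_def
proof (intro allI impI)
  fix j and \<phi> :: "real^2 \<Rightarrow> real" assume \<phi>: "Cc_inf U \<phi>"
  note t = L2_on_test[OF \<phi>]
  have c: "column j (G x + H x) = column j (G x) + column j (H x)" for x
    by (simp add: column_def vec_eq_iff)
  have "L2_on U (\<lambda>x. column j (G x))" "L2_on U (\<lambda>x. column j (H x))"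
    using assms(3,4) by (auto intro: L2_on_linear[OF bounded_linear_column])
  then show "(LINT x:U|lebesgue. frechet_derivative \<phi> (at x) (axis j 1) *\<^sub>R (u x + v x))
      = - (LINT x:U|lebesgue. \<phi> x *\<^sub>R column j (G x + H x))"
    using assms(5,6) \<phi> unfolding c weak_grad_def weak_partial_def
    by (simp add: scaleR_add_right set_integral_add(2)[OF L2_on_scaleR[OF t(2) assms(1)] L2_on_scaleR[OF t(2) assms(2)]]
        set_integral_add(2)[OF L2_on_scaleR[OF t(1)] L2_on_scaleR[OF t(1)]])
qed

section \<open>Weak gradients as limits of gradients of test maps\<close>

lemma wgrad_W12:
  assumes "W12 U u" shows "weak_grad U u (wgrad U u)" "L2_on U (wgrad U u)"
  using someI_ex[of "\<lambda>Du. weak_grad U u Du \<and> L2_on U Du"] assms unfolding W12_def wgrad_def by auto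

lemma abs_det_le_norm_sq: "\<bar>det (A :: real^2^2)\<bar> \<le> (norm A)\<^sup>2"
proof -
  have "0 \<le> (A$1$1 + A$2$2)\<^sup>2 + (A$1$2 - A$2$1)\<^sup>2" "0 \<le> (A$1$1 - A$2$2)\<^sup>2 + (A$1$2 + A$2$1)\<^sup>2"
    "0 \<le> (A$1$1)\<^sup>2 + (A$1$2)\<^sup>2 + (A$2$1)\<^sup>2 + (A$2$2)\<^sup>2" by auto
  then show ?thesis unfolding norm_sq_matrix2 det_2 by (auto simp: power2_eq_square algebra_simps abs_le_iff)
qed

text \<open>The determinant is quadratic with gradient \<open>cof2\<close>, so its expansion stops
  after the second-order term.\<close>

lemma det_diff_cof2: "det (X - E) = det X - cof2 X \<bullet> E + det E"
  by (simp add: det_2 cof2_def inner_vec_def sum_2 algebra_simps)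

lemma bounded_linear_cof2: "bounded_linear cof2"
  unfolding linear_conv_bounded_linear[symmetric] by (auto simp: linear_iff cof2_def vec_eq_iff forall_2)

lemma L2_on_det: "L2_on U (A :: real^2 \<Rightarrow> real^2^2) \<Longrightarrow> set_integrable lebesgue U (\<lambda>x. det (A x))"
  unfolding det_2
  by (intro set_integral_diff L2_on_mult L2_on_linear[OF bounded_linear_vec_nth])

lemma L2_on_sq_integrable: "L2_on U f \<Longrightarrow> set_integrable lebesgue U (\<lambda>x. (norm (f x))\<^sup>2)"
  by (simp add: L2_on_def)

lemma L2_on_sq_nonneg: "0 \<le> (LINT x:U|lebesgue. (norm (f x))\<^sup>2)"
  unfolding set_lebesgue_integral_def by (intro Bochner_Integration.integral_nonneg) (simp add: indicator_def)

lemma L2_on_sq_add_le: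
  assumes "L2_on U f" "L2_on U g"
  shows "(LINT x:U|lebesgue. (norm (f x + g x))\<^sup>2) \<le> 2 * (LINT x:U|lebesgue. (norm (f x))\<^sup>2) + 2 * (LINT x:U|lebesgue. (norm (g x))\<^sup>2)"
proof -
  note sq = L2_on_sq_integrable[OF assms(1)] L2_on_sq_integrable[OF assms(2)]
  have "(LINT x:U|lebesgue. (norm (f x + g x))\<^sup>2) \<le> (LINT x:U|lebesgue. 2 * (norm (f x))\<^sup>2 + 2 * (norm (g x))\<^sup>2)"
  proof (rule set_integral_mono)
    show "set_integrable lebesgue U (\<lambda>x. (norm (f x + g x))\<^sup>2)" by (rule L2_on_sq_integrable[OF L2_on_add[OF assms]])
    show "set_integrable lebesgue U (\<lambda>x. 2 * (norm (f x))\<^sup>2 + 2 * (norm (g x))\<^sup>2)"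
      by (intro set_integral_add set_integrable_mult_right sq)
    fix x
    have "(norm (f x + g x))\<^sup>2 \<le> (norm (f x) + norm (g x))\<^sup>2" by (intro power_mono norm_triangle_ineq) simp
    also have "\<dots> \<le> 2 * (norm (f x))\<^sup>2 + 2 * (norm (g x))\<^sup>2"
      using zero_le_power2[of "norm (f x) - norm (g x)"] by (simp add: power2_eq_square algebra_simps)
    finally show "(norm (f x + g x))\<^sup>2 \<le> 2 * (norm (f x))\<^sup>2 + 2 * (norm (g x))\<^sup>2" .
  qed
  then show ?thesis using sq by (simp add: set_integral_add)
qed

text \<open>\<open>W012\<close> approximates some weak gradient of \<open>v\<close>. By uniqueness
  the given \<open>X\<close> may take its place, which matters because stationarity quantifies over
  all weak gradients.\<close>

lemma W012D:
  assumes v: "W012 U v" and U: "open U" and X: "weak_grad U v X" "L2_on U X"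
  obtains \<phi> where "\<And>k::nat. Cc_inf U (\<phi> k)" "(\<lambda>k. LINT x:U|lebesgue. (norm (\<phi> k x - v x))\<^sup>2) \<longlonglongrightarrow> 0"
    "(\<lambda>k. LINT x:U|lebesgue. (norm (X x - jacobian (\<phi> k) (at x)))\<^sup>2) \<longlonglongrightarrow> 0"
proof -
  from v obtain Y \<phi> where Y: "weak_grad U v Y" "L2_on U Y" and \<phi>: "\<And>k::nat. Cc_inf U (\<phi> k)"
    and lim: "(\<lambda>k. (LINT x:U|lebesgue. (norm (\<phi> k x - v x))\<^sup>2)
               + (LINT x:U|lebesgue. (norm (jacobian (\<phi> k) (at x) - Y x))\<^sup>2)) \<longlonglongrightarrow> 0"
    unfolding W012_def by auto
  have L2: "L2_on U v" using v by (simp add: W012_def W12_def)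
  have "AE x in lebesgue. x \<in> U \<longrightarrow> X x = Y x"
    by (rule weak_grad_unique[OF U L2 L2 _ X(2) Y(2) X(1) Y(1)]) simp
  then have "AE x in lebesgue. x \<in> U \<longrightarrow> (norm (X x - jacobian (\<phi> k) (at x)))\<^sup>2 \<le> (norm (jacobian (\<phi> k) (at x) - Y x))\<^sup>2" for k
    by eventually_elim (simp add: norm_minus_commute)
  then have le: "(LINT x:U|lebesgue. (norm (X x - jacobian (\<phi> k) (at x)))\<^sup>2)
      \<le> (LINT x:U|lebesgue. (norm (jacobian (\<phi> k) (at x) - Y x))\<^sup>2)" for k
    using \<phi> X(2) Y(2) by (intro set_integral_mono_AE L2_on_sq_integrable L2_on_diff test_jacobian)
  show ?thesis
  proof (rule that[OF \<phi>])
    show "(\<lambda>k. LINT x:U|lebesgue. (norm (\<phi> k x - v x))\<^sup>2) \<longlonglongrightarrow> 0"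
      by (rule tendsto_sandwich[OF _ _ tendsto_const lim]) (auto intro!: always_eventually L2_on_sq_nonneg)
    show "(\<lambda>k. LINT x:U|lebesgue. (norm (X x - jacobian (\<phi> k) (at x)))\<^sup>2) \<longlonglongrightarrow> 0"
      by (rule tendsto_sandwich[OF _ _ tendsto_const lim])
        (auto intro!: always_eventually L2_on_sq_nonneg add_increasing le)
  qed
qed

text \<open>The functional is continuous in the gradient with respect to the square mean, and
  \<open>W012\<close> is a closure of test maps in that sense.\<close>

lemma W012_inner_eq_0:
  assumes v: "W012 U v" and U: "open U" and X: "weak_grad U v X" "L2_on U X" and F: "L2_on U F"
    and test: "\<And>\<phi>. Cc_inf U \<phi> \<Longrightarrow> (LINT x:U|lebesgue. F x \<bullet> jacobian \<phi> (at x)) = 0"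
  shows "(LINT x:U|lebesgue. F x \<bullet> X x) = 0"
proof -
  obtain \<phi> where \<phi>: "\<And>k::nat. Cc_inf U (\<phi> k)" "(\<lambda>k. LINT x:U|lebesgue. (norm (\<phi> k x - v x))\<^sup>2) \<longlonglongrightarrow> 0"
    "(\<lambda>k. LINT x:U|lebesgue. (norm (X x - jacobian (\<phi> k) (at x)))\<^sup>2) \<longlonglongrightarrow> 0"
    by (rule W012D[OF v U X]) (rule that; assumption)
  note J = test_jacobian(1)[OF \<phi>(1)]
  have "(LINT x:U|lebesgue. F x \<bullet> (X x - jacobian (\<phi> k) (at x))) = (LINT x:U|lebesgue. F x \<bullet> X x)" for k
    using test[OF \<phi>(1)] by (simp add: inner_diff_right set_integral_diff L2_on_inner[OF F X(2)] L2_on_inner[OF F J])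
  with L2_on_limit_inner[OF F L2_on_diff[OF X(2) J] \<phi>(3)] show ?thesis by (simp add: LIMSEQ_const_iff)
qed

lemma L2_on_const: "L2_on Bdisk (\<lambda>_. c)"
  by (intro L2_on_continuous_cball continuous_intros)

text \<open>Expanding the determinant around \<open>X x\<close>, the linear term is an inner product
  with the fixed \<open>cof2 (X x)\<close>, and the quadratic term is bounded by the square of the
  error; both tend to zero.\<close>

lemma W012_det_integral:
  assumes v: "W012 Bdisk v" and X: "weak_grad Bdisk v X" "L2_on Bdisk X"
  shows "(LINT x:Bdisk|lebesgue. det (X x)) = 0"
proof -
  obtain \<phi> where \<phi>: "\<And>k::nat. Cc_inf Bdisk (\<phi> k)" "(\<lambda>k. LINT x:Bdisk|lebesgue. (norm (\<phi> k x - v x))\<^sup>2) \<longlonglongrightarrow> 0"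
    "(\<lambda>k. LINT x:Bdisk|lebesgue. (norm (X x - jacobian (\<phi> k) (at x)))\<^sup>2) \<longlonglongrightarrow> 0"
    by (rule W012D[OF v open_ball X]) (rule that; assumption)
  let ?E = "\<lambda>k x. X x - jacobian (\<phi> k) (at x)"
  have E: "L2_on Bdisk (?E k)" for k by (rule L2_on_diff[OF X(2) test_jacobian(1)[OF \<phi>(1)]])
  have C: "L2_on Bdisk (\<lambda>x. cof2 (X x))" by (rule L2_on_linear[OF bounded_linear_cof2 X(2)])
  have d: "det (X x) = det (jacobian (\<phi> k) (at x)) + cof2 (X x) \<bullet> ?E k x - det (?E k x)" for k x
    using det_diff_cof2[of "X x" "?E k x"] by simp
  have "(LINT x:Bdisk|lebesgue. det (jacobian (\<phi> k) (at x)) + cof2 (X x) \<bullet> ?E k x - det (?E k x)) = (LINT x:Bdisk|lebesgue. cof2 (X x) \<bullet> ?E k x) - (LINT x:Bdisk|lebesgue. det (?E k x))" for k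
    using test_det_integral[OF \<phi>(1)]
    by (simp add: set_integral_diff set_integral_add L2_on_det[OF E] L2_on_inner[OF C E] L2_on_det[OF test_jacobian(1)[OF \<phi>(1)]])
  then have "(LINT x:Bdisk|lebesgue. det (X x)) = (LINT x:Bdisk|lebesgue. cof2 (X x) \<bullet> ?E k x) - (LINT x:Bdisk|lebesgue. det (?E k x))" for k
    by (rule trans[OF arg_cong[where f = "set_lebesgue_integral lebesgue Bdisk", OF ext, OF d]])
  moreover have "(\<lambda>k. LINT x:Bdisk|lebesgue. det (?E k x)) \<longlonglongrightarrow> 0"
  proof (rule tendsto_rabs_zero_cancel, rule tendsto_sandwich[OF _ _ tendsto_const \<phi>(3)])
    have "\<bar>LINT x:Bdisk|lebesgue. det (?E k x)\<bar> \<le> (LINT x:Bdisk|lebesgue. \<bar>det (?E k x)\<bar>)" for k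
      using set_integral_norm_bound[OF L2_on_det[OF E], of k] by simp
    also have "\<dots> k \<le> (LINT x:Bdisk|lebesgue. (norm (?E k x))\<^sup>2)" for k
      by (intro set_integral_mono set_integrable_abs L2_on_det L2_on_sq_integrable E abs_det_le_norm_sq)
    finally show "\<forall>\<^sub>F k in sequentially. \<bar>LINT x:Bdisk|lebesgue. det (?E k x)\<bar> \<le> (LINT x:Bdisk|lebesgue. (norm (?E k x))\<^sup>2)"
      by (intro always_eventually allI)
  qed simp
  from tendsto_diff[OF L2_on_limit_inner[OF C E \<phi>(3)] this] show ?thesis
    by (simp only: calculation[symmetric]) (simp add: LIMSEQ_const_iff)
qed

lemma W012_entry_integral:
  assumes v: "W012 Bdisk v" and X: "weak_grad Bdisk v X" "L2_on Bdisk X"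
  shows "(LINT x:Bdisk|lebesgue. X x $ i $ j) = 0"
proof -
  have a: "axis i (axis j 1) \<bullet> (A :: real^2^2) = A $ i $ j" for A by (simp add: inner_axis')
  show ?thesis
    using W012_inner_eq_0[OF v open_ball X L2_on_const[of "axis i (axis j 1)"]] test_partial_integral
    by (simp only: a)
qed

text \<open>The inequality is applied to the approximating test maps, whose gradients tend to
  \<open>X\<close> and hence to zero in the square mean.\<close>

lemma W012_Poincare:
  assumes v: "W012 Bdisk v" and X: "weak_grad Bdisk v X" "L2_on Bdisk X"
    and 0: "(LINT x:Bdisk|lebesgue. (norm (X x))\<^sup>2) \<le> 0"
  shows "AE x in lebesgue. x \<in> Bdisk \<longrightarrow> v x = 0"
proof -
  obtain \<phi> where \<phi>: "\<And>k::nat. Cc_inf Bdisk (\<phi> k)" "(\<lambda>k. LINT x:Bdisk|lebesgue. (norm (\<phi> k x - v x))\<^sup>2) \<longlonglongrightarrow> 0"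
    "(\<lambda>k. LINT x:Bdisk|lebesgue. (norm (X x - jacobian (\<phi> k) (at x)))\<^sup>2) \<longlonglongrightarrow> 0"
    by (rule W012D[OF v open_ball X]) (rule that; assumption)
  have L2: "L2_on Bdisk v" using v by (simp add: W012_def W12_def)
  have J: "L2_on Bdisk (\<lambda>x. jacobian (\<phi> k) (at x))" for k by (rule test_jacobian(1)[OF \<phi>(1)])
  let ?a = "\<lambda>k. LINT x:Bdisk|lebesgue. (norm (\<phi> k x - v x))\<^sup>2"
  let ?b = "\<lambda>k. LINT x:Bdisk|lebesgue. (norm (X x - jacobian (\<phi> k) (at x)))\<^sup>2"
  \<comment> \<open>\<open>16 = 2 * 4 * 2\<close>, from two uses of \<open>L2_on_sq_add_le\<close>
    and the Poincare constant \<open>4\<close>.\<close>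
  have "(LINT x:Bdisk|lebesgue. (norm (v x))\<^sup>2) \<le> 2 * ?a k + 16 * ?b k" for k
  proof -
    have t: "L2_on Bdisk (\<phi> k)" by (rule L2_on_test(1)[OF \<phi>(1)])
    have "(LINT x:Bdisk|lebesgue. (norm (v x))\<^sup>2) \<le> 2 * ?a k + 2 * (LINT x:Bdisk|lebesgue. (norm (\<phi> k x))\<^sup>2)"
      using L2_on_sq_add_le[OF L2_on_diff[OF L2 t] t] by (simp add: norm_minus_commute)
    also have "(LINT x:Bdisk|lebesgue. (norm (\<phi> k x))\<^sup>2) \<le> 4 * (LINT x:Bdisk|lebesgue. (norm (jacobian (\<phi> k) (at x)))\<^sup>2)"
      by (rule test_Poincare[OF \<phi>(1)])
    also have "(LINT x:Bdisk|lebesgue. (norm (jacobian (\<phi> k) (at x)))\<^sup>2) \<le> 2 * ?b k + 2 * (LINT x:Bdisk|lebesgue. (norm (X x))\<^sup>2)"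
      using L2_on_sq_add_le[OF L2_on_diff[OF J X(2)] X(2)] by (simp add: norm_minus_commute)
    finally show ?thesis using 0 by simp
  qed
  moreover have "(\<lambda>k. 2 * ?a k + 16 * ?b k) \<longlonglongrightarrow> 2 * 0 + 16 * 0"
    by (intro tendsto_intros \<phi>)
  ultimately have "(LINT x:Bdisk|lebesgue. (norm (v x))\<^sup>2) \<le> 2 * 0 + 16 * 0"
    by (intro LIMSEQ_le_const) auto
  then have z: "(LINT x:Bdisk|lebesgue. (norm (v x))\<^sup>2) = 0" using L2_on_sq_nonneg[of Bdisk v] by simp
  have "AE x in lebesgue. indicator Bdisk x *\<^sub>R (norm (v x))\<^sup>2 = 0"
    using integral_nonneg_eq_0_iff_AE[of lebesgue "\<lambda>x. indicator Bdisk x *\<^sub>R (norm (v x))\<^sup>2"] z L2_on_sq_integrable[OF L2]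
    by (simp add: set_lebesgue_integral_def set_integrable_def)
  then show ?thesis by eventually_elim (auto simp: indicator_def)
qed

section \<open>The identity as a competitor and the lower bound for the energy\<close>

lemma W12_ident: "weak_grad Bdisk (\<lambda>x. x) (\<lambda>_. mat 1)" "L2_on Bdisk (\<lambda>x. x)" "W12 Bdisk (\<lambda>x. x)"
proof -
  show 1: "weak_grad Bdisk (\<lambda>x. x) (\<lambda>_. mat 1)"
    using weak_grad_classical[of Bdisk "\<lambda>x. x" "\<lambda>x h. h"] by (simp add: matrix_id_mat_1[unfolded id_def])
  show 2: "L2_on Bdisk (\<lambda>x. x)" by (intro L2_on_continuous_cball continuous_intros)
  show "W12 Bdisk (\<lambda>x. x)" unfolding W12_def using 1 2 L2_on_const by blast
qed

lemma ident_in_A_uM_1: "(\<lambda>x. x) \<in> A_uM 1"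
proof -
  have m0: "matrix (\<lambda>h :: real^2. 0 :: real^2) = 0" by (simp add: matrix_def vec_eq_iff)
  have 0: "weak_grad Bdisk (\<lambda>x. 0) (\<lambda>_. 0)" "jacobian (\<lambda>x. 0) (at (x :: real^2)) = (0 :: real^2^2)" for x
    using weak_grad_classical[of Bdisk "\<lambda>x. 0" "\<lambda>x h. 0"] m0 by (auto simp: jacobian_def)
  have "Cc_inf Bdisk (\<lambda>x. 0 :: real^2)" by (simp add: Cc_inf_def Cinf_def Ck_const)
  then have "W012 Bdisk (\<lambda>x. 0)"
    unfolding W012_def W12_def using 0 L2_on_const
    by (intro conjI exI[of _ "\<lambda>_. 0"] exI[of _ "\<lambda>_ _. 0"] allI) (auto simp: 0 L2_on_const)
  then show ?thesis using W12_ident(3) uM_1 by (simp add: A_uM_def)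
qed

context
  fixes \<rho> :: "real \<Rightarrow> real" and \<gamma> :: real
  assumes der: "\<And>s. (\<rho> has_real_derivative deriv \<rho> s) (at s)"
    and bounds: "\<And>s. 0 \<le> deriv \<rho> s" "\<And>s. deriv \<rho> s \<le> \<gamma>"
    and tangent: "\<And>s t. deriv \<rho> s * (t - s) \<le> \<rho> t - \<rho> s" and zero: "\<rho> 0 = 0"
begin

text \<open>The tangents to \<open>\<rho>\<close> at \<open>0\<close> and at \<open>t\<close> give
  \<open>\<bar>\<rho> t\<bar> \<le> \<gamma> \<bar>t\<bar>\<close>, and the determinant is
  integrable.\<close>

lemma energy_density_integrable:
  fixes G :: "real^2 \<Rightarrow> real^2^2"
  assumes "L2_on Bdisk G"
  shows "set_integrable lebesgue Bdisk (\<lambda>x. (norm (G x))\<^sup>2 / 2 + \<rho> (det (G x)))"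
proof -
  have d: "set_integrable lebesgue Bdisk (\<lambda>x. det (G x))" by (rule L2_on_det[OF assms])
  have le: "\<bar>\<rho> t\<bar> \<le> \<gamma> * \<bar>t\<bar>" for t
  proof -
    have m: "\<bar>deriv \<rho> s * t\<bar> \<le> \<gamma> * \<bar>t\<bar>" for s using bounds by (simp add: abs_mult mult_right_mono)
    show ?thesis using tangent[of t 0] tangent[of 0 t] m[of t] m[of 0] zero by (simp add: abs_le_iff)
  qed
  have "continuous_on UNIV \<rho>" by (intro DERIV_continuous_on) (use der in auto)
  then have "(\<lambda>x. \<rho> (indicator Bdisk x *\<^sub>R det (G x))) \<in> borel_measurable lebesgue"
    using d unfolding set_integrable_def by (intro measurable_compose[OF borel_measurable_integrable borel_measurable_continuous_onI])
  moreover have "\<rho> (indicator Bdisk x *\<^sub>R det (G x)) = indicator Bdisk x *\<^sub>R \<rho> (det (G x))" for x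
    by (simp add: indicator_def zero)
  ultimately have m: "set_borel_measurable lebesgue Bdisk (\<lambda>x. \<rho> (det (G x)))" by (simp add: set_borel_measurable_def)
  have "set_integrable lebesgue Bdisk (\<lambda>x. \<gamma> * \<bar>det (G x)\<bar>)"
    by (intro set_integrable_mult_right set_integrable_abs d)
  then have "set_integrable lebesgue Bdisk (\<lambda>x. \<rho> (det (G x)))"
    by (rule set_integrable_bound[OF _ m]) (use le in \<open>auto intro!: always_eventually order_trans[OF le]\<close>)
  then show ?thesis by (intro set_integral_add set_integrable_divide L2_on_sq_integrable assms)
qed

text \<open>For the gradient \<open>1 + X\<close> the determinant is
  \<open>1 + tr X + det X\<close>. The tangent to \<open>\<rho>\<close> at \<open>1\<close> bounds
  the energy density from below by a constant, \<open>(norm X)^2 / 2\<close> and multiples of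
  \<open>tr X\<close> and \<open>det X\<close>; the last two have integral zero.\<close>

lemma energy_ge:
  assumes v: "v \<in> A_uM 1"
  obtains X where "weak_grad Bdisk (\<lambda>x. v x - x) X" "L2_on Bdisk X" "W012 Bdisk (\<lambda>x. v x - x)"
    "energy \<rho> (\<lambda>x. x) + (LINT x:Bdisk|lebesgue. (norm (X x))\<^sup>2) / 2 \<le> energy \<rho> v"
proof -
  have w: "W012 Bdisk (\<lambda>x. v x - x)" and W: "W12 Bdisk v" using v uM_1 by (simp_all add: A_uM_def)
  from w obtain X where X: "weak_grad Bdisk (\<lambda>x. v x - x) X" "L2_on Bdisk X" unfolding W012_def by blast
  have L2: "L2_on Bdisk v" using W by (simp add: W12_def)
  have X1: "L2_on Bdisk (\<lambda>x. X x + mat 1)" by (rule L2_on_add[OF X(2) L2_on_const])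
  have "weak_grad Bdisk (\<lambda>x. (v x - x) + x) (\<lambda>x. X x + mat 1)"
    by (rule weak_grad_add[OF L2_on_diff[OF L2 W12_ident(2)] W12_ident(2) X(2) L2_on_const X(1) W12_ident(1)])
  then have X1': "weak_grad Bdisk v (\<lambda>x. X x + mat 1)" by simp
  have G: "AE x in lebesgue. x \<in> Bdisk \<longrightarrow> wgrad Bdisk v x = X x + mat 1"
    by (rule weak_grad_unique[OF open_ball L2 L2 _ wgrad_W12(2)[OF W] X1 wgrad_W12(1)[OF W] X1']) simp
  have I: "AE x in lebesgue. x \<in> Bdisk \<longrightarrow> wgrad Bdisk (\<lambda>x. x) x = mat 1"
    by (rule weak_grad_unique[OF open_ball W12_ident(2) W12_ident(2) _ wgrad_W12(2)[OF W12_ident(3)] L2_on_const wgrad_W12(1)[OF W12_ident(3)] W12_ident(1)]) simp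
  have m1: "(norm (mat 1 :: real^2^2))\<^sup>2 = 2" "det (mat 1 :: real^2^2) = 1"
    unfolding norm_sq_matrix2 det_2 by (simp_all add: mat_def)
  \<comment> \<open>The pointwise estimate with \<open>c = \<rho>'(1)\<close>,
    \<open>T = tr X\<close>, \<open>D = det X\<close>, \<open>N = (norm X)^2\<close>,
    \<open>Q = \<rho>(1)\<close> and \<open>P\<close> the value of \<open>\<rho>\<close> at the
    determinant.\<close>
  have arith: "(1 + Q) + N / 2 + (1 + c) * T + c * D \<le> (2 + 2 * T + N) / 2 + P"
    if "c * ((1 + T + D) - 1) \<le> P - Q" for c T D N P Q :: real
  proof -
    have "c * T + c * D \<le> P - Q" using that by (simp add: algebra_simps)
    then have "1 + Q + N / 2 + T + (c * T + c * D) \<le> 1 + Q + N / 2 + T + (P - Q)" by (rule add_left_mono)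
    also have "\<dots> = (2 + 2 * T + N) / 2 + P" by (simp add: add_divide_distrib)
    finally show ?thesis by (simp add: algebra_simps)
  qed
  let ?c = "deriv \<rho> 1"
  let ?t = "\<lambda>x. X x $ 1 $ 1 + X x $ 2 $ 2"
  let ?low = "\<lambda>x. (1 + \<rho> 1) + (norm (X x))\<^sup>2 / 2 + (1 + ?c) * ?t x + ?c * det (X x)"
  have e: "set_integrable lebesgue Bdisk (\<lambda>x. X x $ i $ j)" for i j
    using L2_on_inner[OF L2_on_const[of "axis i (axis j 1)"] X(2)] by (simp add: inner_axis')
  have c: "set_integrable lebesgue Bdisk (\<lambda>x. 1 + \<rho> 1)"
    using L2_on_mult[OF L2_on_const[of 1] L2_on_const[of "1 + \<rho> 1"]] by simp
  note int = c e L2_on_det[OF X(2)] L2_on_sq_integrable[OF X(2)]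
  have "energy \<rho> (\<lambda>x. x) \<le> (LINT x:Bdisk|lebesgue. 1 + \<rho> 1)"
    unfolding energy_def
    by (rule set_integral_mono_AE[OF energy_density_integrable[OF wgrad_W12(2)[OF W12_ident(3)]] c])
      (use I in \<open>eventually_elim, simp add: m1\<close>)
  moreover have "(LINT x:Bdisk|lebesgue. ?low x) \<le> energy \<rho> v"
    unfolding energy_def
  proof (rule set_integral_mono_AE)
    show "set_integrable lebesgue Bdisk ?low"
      by (intro set_integral_add set_integrable_mult_right set_integrable_divide int)
    show "set_integrable lebesgue Bdisk (\<lambda>x. (norm (wgrad Bdisk v x))\<^sup>2 / 2 + \<rho> (det (wgrad Bdisk v x)))"
      by (rule energy_density_integrable[OF wgrad_W12(2)[OF W]])
    show "AE x in lebesgue. x \<in> Bdisk \<longrightarrow> ?low x \<le> (norm (wgrad Bdisk v x))\<^sup>2 / 2 + \<rho> (det (wgrad Bdisk v x))"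
      using G
    proof eventually_elim
      case (elim x)
      have "?c * ((1 + ?t x + det (X x)) - 1) \<le> \<rho> (1 + ?t x + det (X x)) - \<rho> 1" by (rule tangent)
      moreover have "det (X x + mat 1) = 1 + ?t x + det (X x)" by (simp add: det_2 mat_def algebra_simps)
      moreover have "(norm (X x + mat 1))\<^sup>2 = 2 + 2 * ?t x + (norm (X x))\<^sup>2"
        unfolding norm_sq_matrix2 by (simp add: mat_def power2_eq_square algebra_simps)
      ultimately show ?case using elim arith[of ?c "?t x" "det (X x)"] by simp
    qed
  qed
  moreover have "(LINT x:Bdisk|lebesgue. ?low x) = (LINT x:Bdisk|lebesgue. 1 + \<rho> 1) + (LINT x:Bdisk|lebesgue. (norm (X x))\<^sup>2) / 2"
  proof -
    have "(LINT x:Bdisk|lebesgue. ?low x) = (LINT x:Bdisk|lebesgue. 1 + \<rho> 1) + (LINT x:Bdisk|lebesgue. (norm (X x))\<^sup>2 / 2)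
       + (LINT x:Bdisk|lebesgue. (1 + ?c) * ?t x) + (LINT x:Bdisk|lebesgue. ?c * det (X x))"
      by (subst set_integral_add(2), (intro set_integral_add set_integrable_mult_right set_integrable_divide int)+)+ simp
    moreover have "(LINT x:Bdisk|lebesgue. ?t x) = 0"
      using set_integral_add(2)[OF e e] W012_entry_integral[OF w X] by simp
    ultimately show ?thesis using W012_det_integral[OF w X] by simp
  qed
  ultimately show ?thesis by (intro that[OF X w]) simp
qed

lemma ident_unique_minimizer:
  assumes v: "v \<in> A_uM 1"
  shows "energy \<rho> (\<lambda>x. x) \<le> energy \<rho> v"
    and "energy \<rho> v = energy \<rho> (\<lambda>x. x) \<Longrightarrow> AE x in lebesgue. x \<in> Bdisk \<longrightarrow> v x = x"
proof -
  obtain X where X: "weak_grad Bdisk (\<lambda>x. v x - x) X" "L2_on Bdisk X" "W012 Bdisk (\<lambda>x. v x - x)"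
    "energy \<rho> (\<lambda>x. x) + (LINT x:Bdisk|lebesgue. (norm (X x))\<^sup>2) / 2 \<le> energy \<rho> v"
    by (rule energy_ge[OF v])
  show "energy \<rho> (\<lambda>x. x) \<le> energy \<rho> v" using X(4) L2_on_sq_nonneg[of Bdisk X] by simp
  assume "energy \<rho> v = energy \<rho> (\<lambda>x. x)"
  then have "(LINT x:Bdisk|lebesgue. (norm (X x))\<^sup>2) \<le> 0" using X(4) by simp
  from W012_Poincare[OF X(3,1,2) this] show "AE x in lebesgue. x \<in> Bdisk \<longrightarrow> v x = x" by simp
qed

end

section \<open>Stationarity of radial maps\<close>

definition rot90 :: "real^2 \<Rightarrow> real^2" where
  "rot90 y = vector [- (y$2), y$1]"

text \<open>The real form of the complex power \<open>z\<^sup>n\<close>.\<close>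

primrec zpow :: "nat \<Rightarrow> real^2 \<Rightarrow> real^2" where
  "zpow 0 x = axis 1 1"
| "zpow (Suc n) x = x$1 *\<^sub>R zpow n x + x$2 *\<^sub>R rot90 (zpow n x)"

lemma rot90_nth [simp]: "rot90 y $ 1 = - (y$2)" "rot90 y $ 2 = y$1"
  by (simp_all add: rot90_def)

lemma bounded_linear_rot90: "bounded_linear rot90"
  unfolding linear_conv_bounded_linear[symmetric] by (auto simp: linear_iff vec_eq_iff forall_2)

lemma zpow_nth: "zpow n x $ 1 = Re (Complex (x$1) (x$2) ^ n)" "zpow n x $ 2 = Im (Complex (x$1) (x$2) ^ n)"
  by (induction n) (simp_all add: axis_def)

lemma zpow_eM: "zpow n x = norm x ^ n *\<^sub>R eM n x"
  unfolding norm_power_eM by (simp add: vec_eq_iff forall_2 zpow_nth)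

lemma zpow_norm: "(zpow n x $ 1)\<^sup>2 + (zpow n x $ 2)\<^sup>2 = (x \<bullet> x) ^ n"
proof (induction n)
  case (Suc n)
  have "(zpow (Suc n) x $ 1)\<^sup>2 + (zpow (Suc n) x $ 2)\<^sup>2 = (x \<bullet> x) * ((zpow n x $ 1)\<^sup>2 + (zpow n x $ 2)\<^sup>2)"
    by (simp add: inner_vec_def sum_2 power2_eq_square algebra_simps)
  then show ?case using Suc by simp
qed (simp add: axis_def)

text \<open>The complex derivative \<open>n z^(n-1) h\<close> in real coordinates, where
  \<open>rot90\<close> is multiplication by \<open>i\<close>. For \<open>n = 0\<close> the factor
  \<open>real n\<close> makes the truncated exponent harmless.\<close>

definition zpow' :: "nat \<Rightarrow> real^2 \<Rightarrow> real^2 \<Rightarrow> real^2" where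
  "zpow' n x h = real n *\<^sub>R (h$1 *\<^sub>R zpow (n - 1) x + h$2 *\<^sub>R rot90 (zpow (n - 1) x))"

lemma zpow_derivative: "(zpow n has_derivative zpow' n x) (at x)"
proof (induction n)
  case 0
  have "zpow 0 = (\<lambda>x. axis 1 1)" "zpow' 0 x = (\<lambda>h. 0)" by (auto simp: zpow'_def fun_eq_iff)
  then show ?case by simp
next
  case (Suc n)
  have 1: "((\<lambda>x :: real^2. x $ i) has_derivative (\<lambda>h. h $ i)) (at x)" for i
    by (rule bounded_linear_imp_has_derivative[OF bounded_linear_vec_nth])
  have e: "zpow (Suc n) = (\<lambda>x. x$1 *\<^sub>R zpow n x + x$2 *\<^sub>R rot90 (zpow n x))" by (auto simp: fun_eq_iff)
  have "(zpow (Suc n) has_derivative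
      (\<lambda>h. (x$1 *\<^sub>R zpow' n x h + h$1 *\<^sub>R zpow n x) + (x$2 *\<^sub>R rot90 (zpow' n x h) + h$2 *\<^sub>R rot90 (zpow n x)))) (at x)"
    unfolding e by (intro has_derivative_add has_derivative_scaleR 1 bounded_linear.has_derivative[OF bounded_linear_rot90] Suc)
  moreover have "(x$1 *\<^sub>R zpow' n x h + h$1 *\<^sub>R zpow n x) + (x$2 *\<^sub>R rot90 (zpow' n x h) + h$2 *\<^sub>R rot90 (zpow n x)) = zpow' (Suc n) x h" for h
    by (cases n) (auto simp: zpow'_def vec_eq_iff forall_2 algebra_simps)
  ultimately show ?case by (simp only:)
qed

lemma zpow_continuous: "continuous_on S (zpow n)"
  using zpow_derivative by (meson has_derivative_continuous continuous_at_imp_continuous_on)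

lemma rot90_continuous: "continuous_on S f \<Longrightarrow> continuous_on S (\<lambda>x. rot90 (f x))"
  by (rule bounded_linear.continuous_on[OF bounded_linear_rot90])

lemma zpow'_continuous: "continuous_on S (\<lambda>x. zpow' n x h)"
  unfolding zpow'_def by (intro continuous_intros zpow_continuous rot90_continuous)

lemma Ck_zpow: "Ck k S (zpow n)"
proof (induction n)
  case 0
  have "zpow 0 = (\<lambda>x. axis 1 1)" by (auto simp: fun_eq_iff)
  then show ?case by (simp add: Ck_const)
next
  case (Suc n)
  have e: "zpow (Suc n) = (\<lambda>x. x$1 *\<^sub>R zpow n x + x$2 *\<^sub>R rot90 (zpow n x))" by (auto simp: fun_eq_iff)
  show ?case unfolding e
    by (intro Ck_add Ck_scaleR Ck_linear[OF bounded_linear_vec_nth] Ck_bounded_linear[OF bounded_linear_rot90] Suc)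
qed

section \<open>Radial coefficients and the divergence of the stress\<close>

lemma inner_self_le_1: "x \<in> cball 0 1 \<Longrightarrow> x \<bullet> x \<in> {0..1}" for x :: "real^2"
  using power_le_one[of "norm x" 2] by (simp add: power2_norm_eq_inner)

text \<open>\<open>\<alpha>\<close> is differentiable only within \<open>[0, 1]\<close>, so the
  chain rule is used within the disk, where \<open>x \<bullet> x\<close> stays in that interval; as
  the disk is open, the restriction then drops out.\<close>

lemma radial_coefficient_derivative:
  fixes \<alpha> \<alpha>' :: "real \<Rightarrow> real"
  assumes "\<And>s. s \<in> {0..1} \<Longrightarrow> (\<alpha> has_real_derivative \<alpha>' s) (at s within {0..1})" and x: "x \<in> Bdisk"
  shows "((\<lambda>x :: real^2. \<alpha> (x \<bullet> x)) has_derivative (\<lambda>h. \<alpha>' (x \<bullet> x) * (2 * (x \<bullet> h)))) (at x)"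
proof -
  have im: "y \<bullet> y \<in> {0..1}" if "y \<in> Bdisk" for y :: "real^2"
    by (rule inner_self_le_1, rule subsetD[OF ball_subset_cball that])
  have "((\<lambda>y. y \<bullet> y) has_derivative (\<lambda>h. x \<bullet> h + h \<bullet> x)) (at x within Bdisk)"
    by (intro has_derivative_inner has_derivative_ident)
  moreover have "(\<alpha> has_derivative (*) (\<alpha>' (x \<bullet> x))) (at (x \<bullet> x) within (\<lambda>y. y \<bullet> y) ` Bdisk)"
    by (rule has_derivative_subset[OF assms(1)[OF im[OF x], unfolded has_field_derivative_def]]) (use im in blast)
  ultimately have "((\<lambda>y. \<alpha> (y \<bullet> y)) has_derivative (\<lambda>h. \<alpha>' (x \<bullet> x) * (x \<bullet> h + h \<bullet> x))) (at x within Bdisk)"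
    by (rule has_derivative_in_compose)
  moreover have "x \<bullet> h + h \<bullet> x = 2 * (x \<bullet> h)" for h by (simp add: inner_commute)
  ultimately show ?thesis by (simp only: at_within_open[OF x open_ball])
qed

lemma radial_coefficient_continuous:
  assumes "continuous_on {0..1} \<alpha>" "S \<subseteq> cball 0 1"
  shows "continuous_on S (\<lambda>x :: real^2. \<alpha> (x \<bullet> x))"
  by (rule continuous_on_compose2[OF assms(1)]) (use assms(2) inner_self_le_1 in \<open>auto intro!: continuous_intros\<close>)

text \<open>The columns of \<open>\<nabla>u + \<rho>'(det \<nabla>u) cof \<nabla>u\<close> for \<open>u = H(\<bar>x\<bar>\<^sup>2) z\<^sup>M\<close> and \<open>n = M\<close>: the first has
  \<open>R = z\<^sup>M\<^sup>-\<^sup>1\<close> and \<open>(i, j) = (1, 2)\<close>, the second \<open>R = i z\<^sup>M\<^sup>-\<^sup>1\<close> and \<open>(i, j) = (2, 1)\<close> with \<open>- c\<close> for \<open>c\<close>.\<close>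

definition stress_col :: "(real \<Rightarrow> real) \<Rightarrow> (real \<Rightarrow> real) \<Rightarrow> (real \<Rightarrow> real) \<Rightarrow> (real^2 \<Rightarrow> real^2) \<Rightarrow> nat \<Rightarrow> 2 \<Rightarrow> 2 \<Rightarrow> real^2 \<Rightarrow> real^2" where
  "stress_col a b c R n i j x = (x$i * a (x \<bullet> x)) *\<^sub>R zpow n x + b (x \<bullet> x) *\<^sub>R R x + (x$j * c (x \<bullet> x)) *\<^sub>R rot90 (zpow n x)"

definition stress_col' where
  "stress_col' a a' b b' c c' R R' n i j x h =
     ((x$i * a (x \<bullet> x)) *\<^sub>R zpow' n x h + (x$i * (a' (x \<bullet> x) * (2 * (x \<bullet> h))) + h$i * a (x \<bullet> x)) *\<^sub>R zpow n x)
     + (b (x \<bullet> x) *\<^sub>R R' x h + (b' (x \<bullet> x) * (2 * (x \<bullet> h))) *\<^sub>R R x)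
     + ((x$j * c (x \<bullet> x)) *\<^sub>R rot90 (zpow' n x h) + (x$j * (c' (x \<bullet> x) * (2 * (x \<bullet> h))) + h$j * c (x \<bullet> x)) *\<^sub>R rot90 (zpow n x))"
  for a a' b b' c c' :: "real \<Rightarrow> real" and R :: "real^2 \<Rightarrow> real^2" and R' :: "real^2 \<Rightarrow> real^2 \<Rightarrow> real^2"
    and n :: nat and i j :: 2

text \<open>Integration by parts of one column against \<open>\<phi>\<close>. Integrability is
  recorded because the two columns are later added under the integral.\<close>

lemma stress_column:
  fixes a b c a' b' c' :: "real \<Rightarrow> real" and R :: "real^2 \<Rightarrow> real^2" and n :: nat and i j :: 2
  assumes da: "\<And>s. s \<in> {0..1} \<Longrightarrow> (a has_real_derivative a' s) (at s within {0..1})"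
    and db: "\<And>s. s \<in> {0..1} \<Longrightarrow> (b has_real_derivative b' s) (at s within {0..1})"
    and dc: "\<And>s. s \<in> {0..1} \<Longrightarrow> (c has_real_derivative c' s) (at s within {0..1})"
    and cont: "continuous_on {0..1} a'" "continuous_on {0..1} b'" "continuous_on {0..1} c'"
    and R: "\<And>x. (R has_derivative R' x) (at x)" "\<And>h. continuous_on UNIV (\<lambda>x. R' x h)"
    and \<phi>: "Cc_inf Bdisk \<phi>"
  defines "A \<equiv> stress_col a b c R n i j" and "A' \<equiv> stress_col' a a' b b' c c' R R' n i j"
  shows "(LINT x:Bdisk|lebesgue. A x \<bullet> frechet_derivative \<phi> (at x) e + A' x e \<bullet> \<phi> x) = 0"
    and "set_integrable lebesgue Bdisk (\<lambda>x. A x \<bullet> frechet_derivative \<phi> (at x) e + A' x e \<bullet> \<phi> x)"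
proof -
  obtain K where K: "compact K" "K \<subseteq> Bdisk" "\<And>x. x \<notin> K \<Longrightarrow> \<phi> x = 0"
    "\<And>x. (\<phi> has_derivative frechet_derivative \<phi> (at x)) (at x)"
    "\<And>e. continuous_on UNIV (\<lambda>x. frechet_derivative \<phi> (at x) e)"
    "\<And>x e. x \<notin> K \<Longrightarrow> frechet_derivative \<phi> (at x) e = 0"
    by (rule Cc_infD[OF \<phi>]) (rule that; assumption)
  have nth: "((\<lambda>x :: real^2. x $ i) has_derivative (\<lambda>h. h $ i)) (at x)" for x i
    by (rule bounded_linear_imp_has_derivative[OF bounded_linear_vec_nth])
  have dA: "(A has_derivative A' x) (at x)" if x: "x \<in> Bdisk" for x
    unfolding A_def A'_def stress_col_def[abs_def] stress_col'_def
    by (intro has_derivative_add has_derivative_scaleR has_derivative_mult nth zpow_derivative R(1)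
      bounded_linear.has_derivative[OF bounded_linear_rot90] radial_coefficient_derivative[OF da x]
      radial_coefficient_derivative[OF db x] radial_coefficient_derivative[OF dc x])
  have "continuous_on {0..1} a" "continuous_on {0..1} b" "continuous_on {0..1} c"
    by (rule DERIV_continuous_on, erule da, rule DERIV_continuous_on, erule db, rule DERIV_continuous_on, erule dc)
  note co = this[THEN radial_coefficient_continuous, OF ball_subset_cball] cont[THEN radial_coefficient_continuous, OF ball_subset_cball]
  have cR: "continuous_on Bdisk R"
    using R(1) by (meson has_derivative_continuous continuous_at_imp_continuous_on)
  have cA: "continuous_on Bdisk A"
    unfolding A_def stress_col_def[abs_def] by (intro continuous_intros co zpow_continuous rot90_continuous cR)
  have cA': "continuous_on Bdisk (\<lambda>x. A' x e)"
    unfolding A'_def stress_col'_def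
    by (intro continuous_intros co zpow_continuous zpow'_continuous rot90_continuous cR continuous_on_subset[OF R(2)]) auto
  have cp: "continuous_on Bdisk \<phi>" "continuous_on Bdisk (\<lambda>x. frechet_derivative \<phi> (at x) e)"
    using K(4) by (meson has_derivative_continuous continuous_at_imp_continuous_on) (rule continuous_on_subset[OF K(5)], simp)
  have cF: "continuous_on Bdisk (\<lambda>x. A x \<bullet> frechet_derivative \<phi> (at x) e + A' x e \<bullet> \<phi> x)"
    by (intro continuous_intros cA cA' cp)
  show "(LINT x:Bdisk|lebesgue. A x \<bullet> frechet_derivative \<phi> (at x) e + A' x e \<bullet> \<phi> x) = 0"
    by (rule set_integral_derivative_eq_0[where F = "\<lambda>x. A x \<bullet> \<phi> x" and F' = "\<lambda>x h. A x \<bullet> frechet_derivative \<phi> (at x) h + A' x h \<bullet> \<phi> x", OF open_ball _ cF K(1,2)])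
      (use K(3) in \<open>auto intro!: has_derivative_inner dA K(4)\<close>)
  show "set_integrable lebesgue Bdisk (\<lambda>x. A x \<bullet> frechet_derivative \<phi> (at x) e + A' x e \<bullet> \<phi> x)"
    by (rule set_integrable_compact_support[OF K(1,2) _ cF]) (use K(3,6) in auto)
qed

lemma column_inner: "A \<bullet> B = column 1 A \<bullet> column 1 B + column 2 A \<bullet> column 2 B" for A B :: "real^2^2"
  by (simp add: inner_vec_def sum_2 column_def)

text \<open>The terms combine to a function of \<open>s\<close> times \<open>z^(n + 1)\<close>, so
  the system reduces to one scalar equation. The derivative of \<open>c\<close> cancels, since
  \<open>c\<close> enters the two columns with opposite signs.\<close>

lemma stress_divergence:
  fixes x :: "real^2"
  assumes s: "s = x \<bullet> x"
    and ode: "2 * a s + 2 * s * a' s + (real n + 1) * a s + 2 * b' s + (real n + 1) * c s = 0"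
  shows "stress_col' a a' b b' c c' (zpow n) (zpow' n) (Suc n) 1 2 x (axis 1 1)
    + stress_col' a a' b b' (\<lambda>s. - c s) (\<lambda>s. - c' s) (\<lambda>x. rot90 (zpow n x)) (\<lambda>x h. rot90 (zpow' n x h)) (Suc n) 2 1 x (axis 2 1) = 0"
proof -
  have e: "x \<bullet> axis i 1 = x $ i" for i by (simp add: inner_axis)
  have s2: "s = x$1 * x$1 + x$2 * x$2" by (simp add: s inner_vec_def sum_2)
  have "stress_col' a a' b b' c c' (zpow n) (zpow' n) (Suc n) 1 2 x (axis 1 1)
    + stress_col' a a' b b' (\<lambda>s. - c s) (\<lambda>s. - c' s) (\<lambda>x. rot90 (zpow n x)) (\<lambda>x h. rot90 (zpow' n x h)) (Suc n) 2 1 x (axis 2 1)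
    = (2 * a s + 2 * (x$1 * x$1 + x$2 * x$2) * a' s + (real n + 1) * a s + 2 * b' s + (real n + 1) * c s) *\<^sub>R zpow (Suc n) x"
    unfolding stress_col'_def zpow'_def s[symmetric] e
    by (simp add: vec_eq_iff forall_2 axis_def algebra_simps)
  then show ?thesis using ode unfolding s2[symmetric] by simp
qed

text \<open>Adding the vanishing divergence, paired with \<open>\<phi>\<close>, turns the integrand
  into a sum of two partial derivatives of functions with compact support.\<close>

lemma radial_stress_divergence_free:
  fixes a b c a' b' c' :: "real \<Rightarrow> real" and n :: nat
  assumes da: "\<And>s. s \<in> {0..1} \<Longrightarrow> (a has_real_derivative a' s) (at s within {0..1})"
    and db: "\<And>s. s \<in> {0..1} \<Longrightarrow> (b has_real_derivative b' s) (at s within {0..1})"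
    and dc: "\<And>s. s \<in> {0..1} \<Longrightarrow> (c has_real_derivative c' s) (at s within {0..1})"
    and cont: "continuous_on {0..1} a'" "continuous_on {0..1} b'" "continuous_on {0..1} c'"
    and ode: "\<And>s. s \<in> {0..1} \<Longrightarrow> 2 * a s + 2 * s * a' s + (real n + 1) * a s + 2 * b' s + (real n + 1) * c s = 0"
    and A: "\<And>x. x \<in> Bdisk \<Longrightarrow> column 1 (A x) = stress_col a b c (zpow n) (Suc n) 1 2 x"
      "\<And>x. x \<in> Bdisk \<Longrightarrow> column 2 (A x) = stress_col a b (\<lambda>s. - c s) (\<lambda>x. rot90 (zpow n x)) (Suc n) 2 1 x"
    and \<phi>: "Cc_inf Bdisk \<phi>"
  shows "(LINT x:Bdisk|lebesgue. A x \<bullet> jacobian \<phi> (at x)) = 0"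
proof -
  have nc: "continuous_on {0..1} (\<lambda>s. - c' s)" by (intro continuous_intros cont)
  have dnc: "((\<lambda>s. - c s) has_real_derivative - c' s) (at s within {0..1})" if "s \<in> {0..1}" for s
    by (intro DERIV_minus dc that)
  have R: "((\<lambda>x. rot90 (zpow n x)) has_derivative (\<lambda>h. rot90 (zpow' n x h))) (at x)"
    "continuous_on UNIV (\<lambda>x. rot90 (zpow' n x h))" for x h
    by (intro bounded_linear.has_derivative[OF bounded_linear_rot90] zpow_derivative, intro rot90_continuous zpow'_continuous)
  note I1 = stress_column[where a = a and b = b and c = c and R = "zpow n" and n = "Suc n" and i = 1 and j = 2 and e = "axis 1 1",
      OF da db dc cont zpow_derivative zpow'_continuous \<phi>]
  note I2 = stress_column[where a = a and b = b and c = "\<lambda>s. - c s" and R = "\<lambda>x. rot90 (zpow n x)" and n = "Suc n" and i = 2 and j = 1 and e = "axis 2 1",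
      OF da db dnc cont(1,2) nc R \<phi>]
  have J: "column j (jacobian \<phi> (at x)) = frechet_derivative \<phi> (at x) (axis j 1)" for x j
    by (simp add: column_def jacobian_def matrix_def)
  have "(LINT x:Bdisk|lebesgue. A x \<bullet> jacobian \<phi> (at x)) = (LINT x:Bdisk|lebesgue.
       (stress_col a b c (zpow n) (Suc n) 1 2 x \<bullet> frechet_derivative \<phi> (at x) (axis 1 1)
         + stress_col' a a' b b' c c' (zpow n) (zpow' n) (Suc n) 1 2 x (axis 1 1) \<bullet> \<phi> x)
       + (stress_col a b (\<lambda>s. - c s) (\<lambda>x. rot90 (zpow n x)) (Suc n) 2 1 x \<bullet> frechet_derivative \<phi> (at x) (axis 2 1)
         + stress_col' a a' b b' (\<lambda>s. - c s) (\<lambda>s. - c' s) (\<lambda>x. rot90 (zpow n x)) (\<lambda>x h. rot90 (zpow' n x h)) (Suc n) 2 1 x (axis 2 1) \<bullet> \<phi> x))"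
  proof (rule set_lebesgue_integral_cong, simp, intro allI impI)
    fix x :: "real^2" assume x: "x \<in> Bdisk"
    have x': "x \<bullet> x \<in> {0..1}" by (rule inner_self_le_1) (use x in simp)
    have z: "u1 \<bullet> w1 + u2 \<bullet> w2 = (u1 \<bullet> w1 + d1 \<bullet> y) + (u2 \<bullet> w2 + d2 \<bullet> y)" if "d1 + d2 = 0" for u1 u2 w1 w2 d1 d2 y :: "real^2"
    proof -
      have "d1 \<bullet> y + d2 \<bullet> y = 0" using that by (simp add: inner_add_left[symmetric])
      then show ?thesis by simp
    qed
    show "A x \<bullet> jacobian \<phi> (at x) =
       (stress_col a b c (zpow n) (Suc n) 1 2 x \<bullet> frechet_derivative \<phi> (at x) (axis 1 1)
         + stress_col' a a' b b' c c' (zpow n) (zpow' n) (Suc n) 1 2 x (axis 1 1) \<bullet> \<phi> x)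
       + (stress_col a b (\<lambda>s. - c s) (\<lambda>x. rot90 (zpow n x)) (Suc n) 2 1 x \<bullet> frechet_derivative \<phi> (at x) (axis 2 1)
         + stress_col' a a' b b' (\<lambda>s. - c s) (\<lambda>s. - c' s) (\<lambda>x. rot90 (zpow n x)) (\<lambda>x h. rot90 (zpow' n x h)) (Suc n) 2 1 x (axis 2 1) \<bullet> \<phi> x)"
      unfolding column_inner J A(1)[OF x] A(2)[OF x] by (rule z) (rule stress_divergence[OF refl], rule ode[OF x'])
  qed
  also have "\<dots> = 0" using set_integral_add(2)[OF I1(2) I2(2)] I1(1) I2(1) by simp
  finally show ?thesis .
qed

section \<open>From the divergence identity to stationarity\<close>

lemma norm_cof2: "norm (cof2 A) = norm A"
proof -
  have "(norm (cof2 A))\<^sup>2 = (norm A)\<^sup>2" unfolding norm_sq_matrix2 by (simp add: cof2_def)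
  then show ?thesis by (simp add: power2_eq_iff_nonneg)
qed

text \<open>All square integrable weak gradients of \<open>u\<close> agree almost everywhere with
  the classical one of \<open>U\<close>. The bounds on \<open>\<rho>'\<close> give the stress linear
  growth, so it is square integrable and the test with smooth maps extends to
  \<open>W012\<close>.\<close>

lemma stationary_if_classical:
  fixes \<rho> :: "real \<Rightarrow> real" and u U :: "real^2 \<Rightarrow> real^2"
  assumes cont: "continuous_on UNIV (deriv \<rho>)" and bounds: "\<And>s. 0 \<le> deriv \<rho> s" "\<And>s. deriv \<rho> s \<le> \<gamma>"
    and u: "W12 Bdisk u" "AE x in lebesgue. x \<in> Bdisk \<longrightarrow> u x = U x"
    and U: "continuous_on (cball 0 1) U" "\<And>x. x \<in> Bdisk \<Longrightarrow> (U has_derivative U' x) (at x)"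
      "\<And>j. continuous_on (cball 0 1) (\<lambda>x. U' x (axis j 1))"
    and test: "\<And>\<phi>. Cc_inf Bdisk \<phi> \<Longrightarrow>
      (LINT x:Bdisk|lebesgue. (matrix (U' x) + deriv \<rho> (det (matrix (U' x))) *\<^sub>R cof2 (matrix (U' x))) \<bullet> jacobian \<phi> (at x)) = 0"
  shows "stationary \<rho> u"
proof -
  define S where "S A = A + deriv \<rho> (det A) *\<^sub>R cof2 A" for A :: "real^2^2"
  have cdet: "continuous_on UNIV (\<lambda>A :: real^2^2. det A)" unfolding det_2 by (intro continuous_intros)
  have S_cont: "continuous_on UNIV S" unfolding S_def
    by (intro continuous_intros continuous_on_compose2[OF cont cdet] linear_continuous_on[OF bounded_linear_cof2]) auto
  have S_0: "S 0 = 0" by (simp add: S_def linear_0[OF bounded_linear.linear[OF bounded_linear_cof2]])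
  have S_norm: "norm (S A) \<le> (1 + \<gamma>) * norm A" for A
  proof -
    have "norm (S A) \<le> norm A + norm (deriv \<rho> (det A) *\<^sub>R cof2 A)" unfolding S_def by (rule norm_triangle_ineq)
    also have "norm (deriv \<rho> (det A) *\<^sub>R cof2 A) \<le> \<gamma> * norm A"
      using bounds by (simp add: norm_cof2 mult_right_mono)
    finally show ?thesis by (simp add: algebra_simps)
  qed
  have L2_S: "L2_on Bdisk (\<lambda>x. S (G x))" if G: "L2_on Bdisk G" for G :: "real^2 \<Rightarrow> real^2^2"
  proof (rule L2_on_bound[OF G _ S_norm])
    have "(\<lambda>x. S (indicator Bdisk x *\<^sub>R G x)) \<in> borel_measurable lebesgue"
      using G unfolding L2_on_def set_borel_measurable_def
      by (intro measurable_compose[OF _ borel_measurable_continuous_onI[OF S_cont]]) auto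
    moreover have "S (indicator Bdisk x *\<^sub>R G x) = indicator Bdisk x *\<^sub>R S (G x)" for x
      by (simp add: indicator_def S_0)
    ultimately show "set_borel_measurable lebesgue Bdisk (\<lambda>x. S (G x))" by (simp add: set_borel_measurable_def)
  qed
  have uL2: "L2_on Bdisk u" using u(1) by (simp add: W12_def)
  have UL2: "L2_on Bdisk U" by (rule L2_on_continuous_cball[OF U(1)])
  have U'L2: "L2_on Bdisk (\<lambda>x. matrix (U' x))" by (intro L2_on_matrix L2_on_continuous_cball U(3))
  have U'c: "continuous_on Bdisk (\<lambda>x. U' x (axis j 1))" for j
    by (rule continuous_on_subset[OF U(3) ball_subset_cball])
  have wU: "weak_grad Bdisk U (\<lambda>x. matrix (U' x))" by (rule weak_grad_classical[OF open_ball U(2) U'c])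
  show ?thesis unfolding stationary_def S_def[symmetric]
  proof (intro allI impI, elim conjE)
    fix Du D\<phi> :: "real^2 \<Rightarrow> real^2^2" and \<phi>
    assume Du: "weak_grad Bdisk u Du" "L2_on Bdisk Du"
      and \<phi>: "W012 Bdisk \<phi>" "weak_grad Bdisk \<phi> D\<phi>" "L2_on Bdisk D\<phi>"
    have eq: "AE x in lebesgue. x \<in> Bdisk \<longrightarrow> Du x = matrix (U' x)"
      by (rule weak_grad_unique[OF open_ball uL2 UL2 u(2) Du(2) U'L2 Du(1) wU])
    have "(LINT x:Bdisk|lebesgue. S (Du x) \<bullet> D\<phi> x) = 0"
    proof (rule W012_inner_eq_0[OF \<phi>(1) open_ball \<phi>(2,3) L2_S[OF Du(2)]])
      fix \<psi> :: "real^2 \<Rightarrow> real^2" assume \<psi>: "Cc_inf Bdisk \<psi>"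
      note i = L2_on_inner[OF L2_S[OF Du(2)] test_jacobian(1)[OF \<psi>]] L2_on_inner[OF L2_S[OF U'L2] test_jacobian(1)[OF \<psi>]]
      have "(LINT x:Bdisk|lebesgue. S (Du x) \<bullet> jacobian \<psi> (at x)) = (LINT x:Bdisk|lebesgue. S (matrix (U' x)) \<bullet> jacobian \<psi> (at x))"
        by (intro antisym set_integral_mono_AE i; use eq in \<open>eventually_elim, simp\<close>)
      then show "(LINT x:Bdisk|lebesgue. S (Du x) \<bullet> jacobian \<psi> (at x)) = 0"
        using test[OF \<psi>] by (simp add: S_def)
    qed
    then show "set_integrable lebesgue Bdisk (\<lambda>x. S (Du x) \<bullet> D\<phi> x) \<and> (LINT x:Bdisk|lebesgue. S (Du x) \<bullet> D\<phi> x) = 0"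
      using L2_on_inner[OF L2_S[OF Du(2)] \<phi>(3)] by simp
  qed
qed

text \<open>The stress of the identity is a constant multiple of the identity matrix, and the
  entries of the Jacobian of a test map have integral zero.\<close>

lemma stationary_ident:
  assumes cont: "continuous_on UNIV (deriv \<rho>)" and bounds: "\<And>s. 0 \<le> deriv \<rho> s" "\<And>s. deriv \<rho> s \<le> \<gamma>"
    and u: "W12 Bdisk u" "AE x in lebesgue. x \<in> Bdisk \<longrightarrow> u x = x"
  shows "stationary \<rho> u"
proof (rule stationary_if_classical[OF cont bounds u, where U' = "\<lambda>x h. h"])
  fix \<phi> :: "real^2 \<Rightarrow> real^2" assume \<phi>: "Cc_inf Bdisk \<phi>"
  have m: "matrix (\<lambda>h :: real^2. h) = (mat 1 :: real^2^2)" by (rule matrix_id_mat_1[unfolded id_def])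
  have e: "(mat 1 + c *\<^sub>R cof2 (mat 1)) \<bullet> J = (1 + c) * (J$1$1 + J$2$2)" for c and J :: "real^2^2"
    by (simp add: inner_vec_def sum_2 cof2_def mat_def algebra_simps)
  have i: "set_integrable lebesgue Bdisk (\<lambda>x. jacobian \<phi> (at x) $ i $ i)" for i
    using L2_on_mult[OF L2_on_const[of 1] test_entries_L2[OF \<phi>]] by simp
  have "(LINT x:Bdisk|lebesgue. jacobian \<phi> (at x) $ 1 $ 1 + jacobian \<phi> (at x) $ 2 $ 2) = 0"
    using set_integral_add(2)[OF i i] test_partial_integral[OF \<phi>] by simp
  then show "(LINT x:Bdisk|lebesgue. (matrix (\<lambda>h. h) + deriv \<rho> (det (matrix (\<lambda>h. h) :: real^2^2)) *\<^sub>R cof2 (matrix (\<lambda>h. h))) \<bullet> jacobian \<phi> (at x)) = 0"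
    unfolding m e by simp
qed (auto intro!: continuous_intros)

lemma column_cof2: "column 1 (cof2 A) = - rot90 (column 2 A)" "column 2 (cof2 A) = rot90 (column 1 A)"
  by (simp_all add: vec_eq_iff forall_2 column_def cof2_def)

text \<open>The scalar divergence equation is \<open>H\<close> times the singular equation for
  \<open>\<pi>\<close>. It therefore holds on the open interval, and at the end points by
  continuity.\<close>

lemma stationary_radial:
  fixes \<rho> :: "real \<Rightarrow> real" and H \<pi> :: "real \<Rightarrow> real"
  assumes M: "2 \<le> M" and der: "\<And>s. (deriv \<rho> has_real_derivative f2 s) (at s)"
    and bounds: "\<And>s. 0 \<le> deriv \<rho> s" "\<And>s. deriv \<rho> s \<le> \<gamma>" and smooth: "\<And>k. Ck k UNIV (deriv \<rho>)"
    and H: "\<And>k. Ck k {0..1} H" and \<pi>: "\<And>k. Ck k {0..1} \<pi>"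
    and dH: "\<And>s. s \<in> {0<..<1} \<Longrightarrow> (H has_real_derivative \<pi> s * H s / 2) (at s)"
    and d\<pi>: "\<And>s. s \<in> {0<..<1} \<Longrightarrow> \<exists>\<pi>'. (\<pi> has_real_derivative \<pi>') (at s) \<and>
       2 * s * \<pi>' = - (2 * real M + 2) * \<pi> s - s * (\<pi> s)\<^sup>2 - 2 * real M * f2 (det_profile M H (\<lambda>s. s * \<pi> s) s) * D' s"
    and dD: "\<And>s. s \<in> {0<..<1} \<Longrightarrow> (det_profile M H (\<lambda>s. s * \<pi> s) has_real_derivative D' s) (at s)"
    and u: "W12 Bdisk u" "AE x in lebesgue. x \<in> Bdisk \<longrightarrow> u x = H (x \<bullet> x) *\<^sub>R zpow M x"
  shows "stationary \<rho> u"
proof -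
  obtain n where n: "M = Suc n" "1 \<le> n" using M by (cases M) auto
  define D where "D = det_profile M H (\<lambda>s. s * \<pi> s)"
  \<comment> \<open>Here \<open>a = 2 H'\<close>, so column \<open>j\<close> of the gradient is
    \<open>x$j a z^M\<close> plus \<open>M H z^n\<close> or \<open>M H i z^n\<close>. The columns of
    the cofactor matrix are quarter turns of the other column, up to sign, which yields
    \<open>b\<close> and \<open>c\<close>.\<close>
  define a where "a s = \<pi> s * H s" for s
  define g where "g s = deriv \<rho> (D s)" for s
  define b where "b s = real M * H s * (1 + g s)" for s
  define c where "c s = - (g s * a s)" for s
  have Ck_D: "Ck k {0..1} D" for k unfolding D_def by (intro Ck_det_profile Ck_mult Ck_ident H \<pi>)
  have Ck_g: "Ck k {0..1} g" for k unfolding g_def[abs_def] by (rule Ck_compose[OF smooth Ck_D]) simp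
  have Ck_a: "Ck k {0..1} a" for k unfolding a_def[abs_def] by (intro Ck_mult H \<pi>)
  have Ck_b: "Ck k {0..1} b" for k unfolding b_def[abs_def] by (intro Ck_mult Ck_add Ck_const H Ck_g)
  have Ck_c: "Ck k {0..1} c" for k unfolding c_def[abs_def] by (intro Ck_uminus Ck_mult Ck_g Ck_a)
  obtain a' where a': "\<And>s. s \<in> {0..1} \<Longrightarrow> (a has_real_derivative a' s) (at s within {0..1})" "Ck 0 {0..1} a'"
    by (rule Ck_real_SucE[OF Ck_a]) (rule that; assumption)
  obtain b' where b': "\<And>s. s \<in> {0..1} \<Longrightarrow> (b has_real_derivative b' s) (at s within {0..1})" "Ck 0 {0..1} b'"
    by (rule Ck_real_SucE[OF Ck_b]) (rule that; assumption)
  obtain c' where c': "\<And>s. s \<in> {0..1} \<Longrightarrow> (c has_real_derivative c' s) (at s within {0..1})" "Ck 0 {0..1} c'"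
    by (rule Ck_real_SucE[OF Ck_c]) (rule that; assumption)
  note cont = a'(2)[THEN Ck_imp_continuous_on] b'(2)[THEN Ck_imp_continuous_on] c'(2)[THEN Ck_imp_continuous_on]
  have Hc: "continuous_on {0..1} H" and ac: "continuous_on {0..1} a" and bc: "continuous_on {0..1} b" and cc: "continuous_on {0..1} c"
    using Ck_imp_continuous_on[OF H] Ck_imp_continuous_on[OF Ck_a] Ck_imp_continuous_on[OF Ck_b] Ck_imp_continuous_on[OF Ck_c] by auto
  have H': "(H has_real_derivative a s / 2) (at s within {0..1})" if "s \<in> {0..1}" for s
  proof (rule derivative_extend_closed[OF Hc _ _ that])
    show "continuous_on {0..1} (\<lambda>s. a s / 2)" by (intro continuous_intros ac) simp
    show "(H has_real_derivative a x / 2) (at x)" if "x \<in> {0<..<1}" for x using dH[OF that] by (simp add: a_def)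
  qed
  let ?L = "\<lambda>s. 2 * a s + 2 * s * a' s + (real n + 1) * a s + 2 * b' s + (real n + 1) * c s"
  have open_ode: "?L s = 0" if s: "s \<in> {0<..<1}" for s
  proof -
    have w: "at s within {0..1} = at s" using s by (intro at_within_interior) (simp add: interior_atLeastAtMost_real)
    have s': "s \<in> {0..1}" using s by auto
    obtain \<pi>' where \<pi>': "(\<pi> has_real_derivative \<pi>') (at s)"
      "2 * s * \<pi>' = - (2 * real M + 2) * \<pi> s - s * (\<pi> s)\<^sup>2 - 2 * real M * f2 (D s) * D' s"
      using d\<pi>[OF s] unfolding D_def by blast
    have dg: "(g has_real_derivative f2 (D s) * D' s) (at s)"
      unfolding g_def[abs_def] by (rule DERIV_chain2[OF der dD[OF s, folded D_def]])
    have da: "(a has_real_derivative \<pi>' * H s + \<pi> s * H s / 2 * \<pi> s) (at s)"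
      unfolding a_def[abs_def] by (rule DERIV_mult[OF \<pi>'(1) dH[OF s]])
    have "(b has_real_derivative (\<pi> s * H s / 2 * real M) * (1 + g s) + (0 + f2 (D s) * D' s) * (real M * H s)) (at s)"
      unfolding b_def[abs_def] by (intro DERIV_mult DERIV_add DERIV_const dg DERIV_cmult_right[of H, OF dH[OF s], of "real M", unfolded mult.commute[of "H _" "real M"]])
    then have "b' s = (\<pi> s * H s / 2 * real M) * (1 + g s) + (0 + f2 (D s) * D' s) * (real M * H s)"
      by (rule DERIV_unique[OF b'(1)[OF s', unfolded w]])
    moreover have "a' s = \<pi>' * H s + \<pi> s * H s / 2 * \<pi> s" by (rule DERIV_unique[OF a'(1)[OF s', unfolded w] da])
    moreover have "real n + 1 = real M" by (simp add: n)
    ultimately have "?L s = H s * (2 * s * \<pi>' + (2 * real M + 2) * \<pi> s + s * (\<pi> s)\<^sup>2 + 2 * real M * f2 (D s) * D' s)"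
      by (simp add: a_def c_def power2_eq_square algebra_simps)
    moreover have "2 * s * \<pi>' + (2 * real M + 2) * \<pi> s + s * (\<pi> s)\<^sup>2 + 2 * real M * f2 (D s) * D' s = 0"
      using \<pi>'(2) by (simp add: algebra_simps)
    ultimately show ?thesis by simp
  qed
  have ode: "?L s = 0" if s: "s \<in> {0..1}" for s
  proof (rule continuous_constant_on_closure[of "{0<..<1}" ?L])
    show "continuous_on (closure {0<..<1}) ?L"
      unfolding closure_greaterThanLessThan[OF zero_less_one] by (intro continuous_intros cont ac bc cc)
    show "s \<in> closure {0<..<1}" using s by simp
  qed (rule open_ode)
  define U where "U x = H (x \<bullet> x) *\<^sub>R zpow M x" for x
  define U' where "U' x h = H (x \<bullet> x) *\<^sub>R zpow' M x h + (a (x \<bullet> x) / 2 * (2 * (x \<bullet> h))) *\<^sub>R zpow M x" for x h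
  have dU: "(U has_derivative U' x) (at x)" if "x \<in> Bdisk" for x
    unfolding U_def[abs_def] U'_def[abs_def]
    by (intro has_derivative_scaleR zpow_derivative radial_coefficient_derivative[OF H' that])
  have col: "column j (matrix (U' x)) = U' x (axis j 1)" for j x by (simp add: column_def matrix_def)
  have in_axis: "x \<bullet> axis i 1 = x $ i" for i and x :: "real^2" by (simp add: inner_axis)
  \<comment> \<open>The terms quadratic in \<open>z^n\<close> combine to
    \<open>\<bar>z^n\<bar>^2 = s^n\<close>; this links the argument of \<open>\<rho>'\<close> to the
    profile \<open>D\<close> of the equation.\<close>
  have det: "det (matrix (U' x)) = D (x \<bullet> x)" for x
  proof -
    have s: "x \<bullet> x = x$1 * x$1 + x$2 * x$2" by (simp add: inner_vec_def sum_2)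
    have dA: "det A = column 1 A $ 1 * column 2 A $ 2 - column 2 A $ 1 * column 1 A $ 2" for A :: "real^2^2"
      by (simp add: det_2 column_def)
    define q1 q2 h p where "q1 = zpow n x $ 1" and "q2 = zpow n x $ 2" and "h = H (x \<bullet> x)" and "p = \<pi> (x \<bullet> x)"
    note q = q1_def[symmetric] q2_def[symmetric] h_def[symmetric] p_def[symmetric]
    have U1: "U' x (axis 1 1) $ 1 = h * (real M * q1) + p * h * x$1 * (x$1 * q1 - x$2 * q2)"
      "U' x (axis 1 1) $ 2 = h * (real M * q2) + p * h * x$1 * (x$1 * q2 + x$2 * q1)"
      "U' x (axis 2 1) $ 1 = - (h * (real M * q2)) + p * h * x$2 * (x$1 * q1 - x$2 * q2)"
      "U' x (axis 2 1) $ 2 = h * (real M * q1) + p * h * x$2 * (x$1 * q2 + x$2 * q1)"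
      unfolding U'_def zpow'_def in_axis a_def by (simp_all add: n axis_def q)
    have "det (matrix (U' x)) = real M * h\<^sup>2 * (q1\<^sup>2 + q2\<^sup>2) * (real M + (x$1 * x$1 + x$2 * x$2) * p)"
      unfolding dA col U1 by (simp add: power2_eq_square algebra_simps)
    then have "det (matrix (U' x)) = real M * (H (x \<bullet> x))\<^sup>2 * ((zpow n x $ 1)\<^sup>2 + (zpow n x $ 2)\<^sup>2)
        * (real M + (x$1 * x$1 + x$2 * x$2) * \<pi> (x \<bullet> x))"
      unfolding q1_def q2_def h_def p_def .
    then show ?thesis unfolding zpow_norm D_def det_profile_def s[symmetric] by (simp add: n)
  qed
  show ?thesis
  proof (rule stationary_if_classical[OF Ck_imp_continuous_on[OF smooth] bounds u[folded U_def] _ dU])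
    have H2: "continuous_on (cball 0 1) (\<lambda>x :: real^2. H (x \<bullet> x))" "continuous_on (cball 0 1) (\<lambda>x :: real^2. a (x \<bullet> x))"
      by (rule radial_coefficient_continuous[OF Hc order_refl], rule radial_coefficient_continuous[OF ac order_refl])
    show "continuous_on (cball 0 1) U" unfolding U_def[abs_def] by (intro continuous_intros H2 zpow_continuous)
    show "continuous_on (cball 0 1) (\<lambda>x. U' x (axis j 1))" for j
      unfolding U'_def by (intro continuous_intros H2 zpow_continuous zpow'_continuous) auto
  next
    fix \<phi> :: "real^2 \<Rightarrow> real^2" assume \<phi>: "Cc_inf Bdisk \<phi>"
    show "(LINT x:Bdisk|lebesgue. (matrix (U' x) + deriv \<rho> (det (matrix (U' x))) *\<^sub>R cof2 (matrix (U' x))) \<bullet> jacobian \<phi> (at x)) = 0"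
    proof (rule radial_stress_divergence_free[OF a'(1) b'(1) c'(1) cont ode _ _ \<phi>])
      fix x :: "real^2"
      have cl: "column j (A + t *\<^sub>R B) = column j A + t *\<^sub>R column j B" for j t and A B :: "real^2^2"
        by (simp add: column_def vec_eq_iff)
      show "column 1 (matrix (U' x) + deriv \<rho> (det (matrix (U' x))) *\<^sub>R cof2 (matrix (U' x))) = stress_col a b c (zpow n) (Suc n) 1 2 x"
        "column 2 (matrix (U' x) + deriv \<rho> (det (matrix (U' x))) *\<^sub>R cof2 (matrix (U' x)))
          = stress_col a b (\<lambda>s. - c s) (\<lambda>x. rot90 (zpow n x)) (Suc n) 2 1 x"
        unfolding cl column_cof2 col det g_def[symmetric] stress_col_def U'_def zpow'_def in_axis b_def c_def
        by (simp_all add: n axis_def vec_eq_iff forall_2 algebra_simps)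
    qed
  qed
qed

section \<open>Regularity up to the origin\<close>

lemma radial_weak_sol_ode:
  assumes der: "\<And>s. (deriv \<rho> has_real_derivative f2 s) (at s)" and cont: "continuous_on UNIV (deriv \<rho>)"
    and bounds: "\<And>s. 0 \<le> deriv \<rho> s" "\<And>s. deriv \<rho> s \<le> \<gamma>" "\<And>s. 0 \<le> f2 s" "\<And>s. f2 s \<le> K"
    and M: "1 \<le> M" and sol: "radial_weak_sol \<rho> M r"
  obtains p w where "radial_ode (deriv \<rho>) f2 r p w (real M) \<gamma> K"
proof -
  have mono: "mono (deriv \<rho>)"
  proof (rule monoI)
    fix x y :: real assume "x \<le> y"
    then show "deriv \<rho> x \<le> deriv \<rho> y"
      by (rule DERIV_nonneg_imp_nondecreasing) (rule exI, rule conjI, rule der, rule bounds(3))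
  qed
  obtain p w where "continuous_on {0<..1} r" "continuous_on {0<..1} p" "continuous_on {0<..1} w"
    "\<And>R. R \<in> {0<..1} \<Longrightarrow> flux (deriv \<rho>) (real M) R (r R) (p R) = w R"
    "\<And>R. R \<in> {0<..<1} \<Longrightarrow> (r has_real_derivative p R) (at R)"
    "\<And>R. R \<in> {0<..<1} \<Longrightarrow> (w has_real_derivative
       (real M)\<^sup>2 * r R / R + real M * deriv \<rho> (real M * r R * p R / R) * p R) (at R)"
    by (rule radial_C1[OF cont mono bounds(1,2) sol]) (rule that; assumption)
  moreover have "set_integrable lborel {0<..<1} (\<lambda>R. (r R)\<^sup>2 / R)" "r 1 = 1"
    using sol by (simp_all add: radial_weak_sol_def)
  moreover have "1 \<le> real M" using M by simp
  ultimately have "radial_ode (deriv \<rho>) f2 r p w (real M) \<gamma> K" by (intro radial_ode.intro der bounds)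
  then show ?thesis by (rule that)
qed

text \<open>The numerator contains \<open>(q - 1)^2 + M^2 - 1\<close> with
  \<open>q = M + Z s\<close>.\<close>

lemma det_profile'_nonneg:
  assumes "2 \<le> M" "0 \<le> s" "\<And>s. 0 \<le> f2 s"
  shows "0 \<le> det_profile' f2 M H Z s"
proof -
  have "1 \<le> (real M)\<^sup>2" using assms(1) by simp
  then have "0 \<le> (real M + Z s - 1)\<^sup>2 + ((real M)\<^sup>2 - 1)" by (intro add_nonneg_nonneg) auto
  also have "\<dots> = (real M + Z s)\<^sup>2 + (real M)\<^sup>2 - 2 * (real M + Z s)" by (simp add: power2_eq_square algebra_simps)
  finally show ?thesis unfolding det_profile'_def
    using assms by (intro divide_nonneg_nonneg mult_nonneg_nonneg add_nonneg_nonneg) auto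
qed

text \<open>\<open>r 0\<close> is arbitrary, so the conclusions concern the extension
  \<open>R^M H(R^2)\<close>. The determinant is a smooth function of \<open>R^2\<close> with
  nonnegative derivative, from which its regularity and monotonicity in \<open>R\<close>
  follow.\<close>

lemma radial_profile_regularity:
  fixes H \<pi> D' r :: "real \<Rightarrow> real"
  assumes M: "2 \<le> M" and H: "\<And>k. Ck k {0..1} H" and \<pi>: "\<And>k. Ck k {0..1} \<pi>"
    and H1: "\<And>s. s \<in> {0..1} \<Longrightarrow> 1 \<le> H s" and q: "\<And>s. s \<in> {0..1} \<Longrightarrow> 0 \<le> real M + s * \<pi> s"
    and r: "\<And>R. R \<in> {0<..1} \<Longrightarrow> r R = R ^ M * H (R\<^sup>2)"
    and dH: "\<And>s. s \<in> {0<..<1} \<Longrightarrow> (H has_real_derivative \<pi> s * H s / 2) (at s)"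
    and D': "continuous_on {0..1} D'" "\<And>s. s \<in> {0..1} \<Longrightarrow> 0 \<le> D' s"
    and dD: "\<And>s. s \<in> {0<..<1} \<Longrightarrow> (det_profile M H (\<lambda>s. s * \<pi> s) has_real_derivative D' s) (at s)"
  obtains rt r' d v where "d = (\<lambda>R. real M * rt R * r' R / R)"
    "\<And>R. R \<in> {0<..1} \<Longrightarrow> rt R = r R" "\<And>R. R \<in> {0..1} \<Longrightarrow> (rt has_real_derivative r' R) (at R within {0..1})"
    "Cinf (cball 0 1) v" "\<And>x. x \<in> Bdisk - {0} \<Longrightarrow> v x = r (norm x) *\<^sub>R eM M x"
    "Cinf {0..1} rt" "\<And>R. R \<in> {0..1} \<Longrightarrow> 0 \<le> rt R \<and> 0 \<le> r' R" "rt 0 = 0" "r' 0 = 0" "\<And>R. R \<in> {0<..1} \<Longrightarrow> 0 < rt R"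
    "Cinf {0..1} d" "\<And>R. R \<in> {0..1} \<Longrightarrow> 0 \<le> d R" "d 0 = 0"
    "\<exists>d'. \<forall>R\<in>{0<..1}. (d has_real_derivative d' R) (at R within {0<..1}) \<and> 0 \<le> d' R"
proof -
  obtain n where n: "M = Suc (Suc n)" using M by (metis Suc_le_D add_2_eq_Suc le_Suc_ex)
  define rt where "rt R = R ^ M * H (R\<^sup>2)" for R
  define r' where "r' R = R ^ (M - 1) * H (R\<^sup>2) * (real M + R\<^sup>2 * \<pi> (R\<^sup>2))" for R
  define d where "d R = real M * rt R * r' R / R" for R
  define \<delta> where "\<delta> R = det_profile M H (\<lambda>s. s * \<pi> s) (R\<^sup>2)" for R
  define v where "v x = H (x \<bullet> x) *\<^sub>R zpow M x" for x
  have sq: "R\<^sup>2 \<in> {0..1}" if "R \<in> {0..1}" for R :: real using that by (auto simp: power_le_one)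
  have sq': "R\<^sup>2 \<in> {0<..<1}" if "R \<in> {0<..<1}" for R :: real using that by (auto simp: power_less_one_iff abs_square_less_1)
  have Ck_sq: "Ck k {0..1} (\<lambda>R. \<alpha> (R\<^sup>2))" if "Ck k {0..1} \<alpha>" for k and \<alpha> :: "real \<Rightarrow> real"
    by (rule Ck_compose[OF that]) (use sq in \<open>auto intro!: Ck_power Ck_ident\<close>)
  have Ck_rt: "Ck k {0..1} rt" for k unfolding rt_def[abs_def] by (intro Ck_mult Ck_power Ck_ident Ck_sq H)
  have Ck_r': "Ck k {0..1} r'" for k unfolding r'_def[abs_def] by (intro Ck_mult Ck_add Ck_const Ck_power Ck_ident Ck_sq H \<pi>)
  have Ck_\<delta>: "Ck k {0..1} \<delta>" for k unfolding \<delta>_def[abs_def] by (intro Ck_sq Ck_det_profile Ck_mult Ck_ident H \<pi>)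
  have d_eq: "d = \<delta>"
  proof
    \<comment> \<open>At \<open>R = 0\<close> both sides vanish: the left by division by zero, the
      right by the factor \<open>s^(M - 1)\<close> with \<open>M \<ge> 2\<close>.\<close>
    show "d R = \<delta> R" for R
      by (cases "R = 0") (simp_all add: d_def \<delta>_def rt_def r'_def det_profile_def n power2_eq_square power_mult_distrib field_simps)
  qed
  have dsq: "((\<lambda>R. R\<^sup>2) has_real_derivative 2 * R) (at R)" for R :: real using DERIV_power[OF DERIV_ident, of 2 R UNIV] by simp
  have drt: "(rt has_real_derivative r' R) (at R within {0..1})" if "R \<in> {0..1}" for R
  proof (rule derivative_extend_closed[OF Ck_imp_continuous_on[OF Ck_rt] Ck_imp_continuous_on[OF Ck_r'] _ that])
    fix R :: real assume R: "R \<in> {0<..<1}"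
    have "((\<lambda>R. R ^ M) has_real_derivative real M * R ^ (M - 1)) (at R)" using DERIV_pow[of M R] by simp
    then have "(rt has_real_derivative real M * R ^ (M - 1) * H (R\<^sup>2) + \<pi> (R\<^sup>2) * H (R\<^sup>2) / 2 * (2 * R) * R ^ M) (at R)"
      unfolding rt_def[abs_def] by (rule DERIV_mult[OF _ DERIV_chain2[OF dH[OF sq'[OF R]] dsq]])
    moreover have "real M * R ^ (M - 1) * H (R\<^sup>2) + \<pi> (R\<^sup>2) * H (R\<^sup>2) / 2 * (2 * R) * R ^ M = r' R"
      by (simp add: r'_def n power2_eq_square algebra_simps)
    ultimately show "(rt has_real_derivative r' R) (at R)" by (simp only:)
  qed
  have d\<delta>': "(\<delta> has_real_derivative D' (R\<^sup>2) * (2 * R)) (at R within {0..1})" if "R \<in> {0..1}" for R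
  proof (rule derivative_extend_closed[OF Ck_imp_continuous_on[OF Ck_\<delta>] _ _ that])
    show "continuous_on {0..1} (\<lambda>R. D' (R\<^sup>2) * (2 * R))"
      by (intro continuous_intros continuous_on_compose2[OF D'(1)]) (use sq in auto)
    show "(\<delta> has_real_derivative D' (R\<^sup>2) * (2 * R)) (at R)" if "R \<in> {0<..<1}" for R
      unfolding \<delta>_def[abs_def] by (rule DERIV_chain2[OF dD[OF sq'[OF that]] dsq])
  qed
  show thesis
  proof (rule that)
    show "d = (\<lambda>R. real M * rt R * r' R / R)" by (simp add: d_def[abs_def])
    show "rt R = r R" if "R \<in> {0<..1}" for R using r[OF that] by (simp add: rt_def)
    show "Cinf (cball 0 1) v" unfolding Cinf_def v_def[abs_def]
    proof (intro allI Ck_scaleR Ck_zpow)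
      show "Ck k (cball 0 1) (\<lambda>x :: real^2. H (x \<bullet> x))" for k
        by (rule Ck_compose[OF H]) (use inner_self_le_1 in \<open>auto intro!: Ck_inner Ck_ident\<close>)
    qed
    show "v x = r (norm x) *\<^sub>R eM M x" if "x \<in> Bdisk - {0}" for x
      using r[of "norm x"] that by (simp add: v_def zpow_eM power2_norm_eq_inner)
    show "Cinf {0..1} rt" using Ck_rt by (simp add: Cinf_def)
    show nn: "0 \<le> rt R \<and> 0 \<le> r' R" if "R \<in> {0..1}" for R
      unfolding rt_def r'_def using that H1[OF sq[OF that]] q[OF sq[OF that]] by (intro conjI mult_nonneg_nonneg) auto
    show "rt 0 = 0" "r' 0 = 0" "d 0 = 0" by (simp_all add: rt_def r'_def d_def n)
    show "0 < rt R" if "R \<in> {0<..1}" for R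
      unfolding rt_def using that H1[OF sq, of R] by (intro mult_pos_pos zero_less_power) auto
    show "Cinf {0..1} d" unfolding Cinf_def d_eq using Ck_\<delta> by simp
    show "0 \<le> d R" if "R \<in> {0..1}" for R using nn[OF that] that by (simp add: d_def)
    show "\<exists>d'. \<forall>R\<in>{0<..1}. (d has_real_derivative d' R) (at R within {0<..1}) \<and> 0 \<le> d' R"
    proof (intro exI[of _ "\<lambda>R. D' (R\<^sup>2) * (2 * R)"] ballI conjI)
      fix R :: real assume R: "R \<in> {0<..1}"
      then have R': "R \<in> {0..1}" by simp
      show "0 \<le> D' (R\<^sup>2) * (2 * R)" using D'(2)[OF sq[OF R']] R by simp
      show "(d has_real_derivative D' (R\<^sup>2) * (2 * R)) (at R within {0<..1})"
        unfolding d_eq by (rule DERIV_subset[OF d\<delta>'[OF R']]) auto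
    qed
  qed (rule drt)
qed

text \<open>In (3) the pair \<open>rt\<close>, \<open>r'\<close> is the extension of
  \<open>r\<close> and of its derivative to \<open>[0, 1]\<close>, because a weak solution says
  nothing about \<open>r 0\<close>. For the same reason \<open>u\<close> is compared with its
  regular representative \<open>v\<close> away from the origin.\<close>

theorem theorem1p3:
  fixes M :: nat and \<gamma> s0 \<kappa> :: real and \<rho> :: "real \<Rightarrow> real"
  assumes M: "M \<ge> 1"
    and \<gamma>: "\<gamma> > 0" and s0: "s0 \<ge> 0" and \<kappa>: "\<kappa> \<ge> - \<gamma> * s0"
    and \<rho>_smooth: "Cinf UNIV \<rho>" and \<rho>_convex: "convex_on UNIV \<rho>"
    and \<rho>_neg: "\<forall>s\<le>0. \<rho> s = 0"
    and \<rho>_lin: "\<forall>s\<ge>s0. \<rho> s = \<gamma> * s + \<kappa>"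
  shows
    \<comment> \<open>(1)\<close>
    "(\<forall>u r. in_Ar M u r \<and> radial_weak_sol \<rho> M r \<longrightarrow> stationary \<rho> u)
     \<comment> \<open>(2)\<close>
   \<and> (M = 1 \<longrightarrow>
        (\<lambda>x. x) \<in> A_uM 1 \<and>
        (\<forall>v\<in>A_uM 1. energy \<rho> (\<lambda>x. x) \<le> energy \<rho> v \<and>
            (energy \<rho> v = energy \<rho> (\<lambda>x. x) \<longrightarrow>
               (AE x in lebesgue. x \<in> Bdisk \<longrightarrow> v x = x))))
     \<comment> \<open>(3)\<close>
   \<and> (M \<ge> 2 \<longrightarrow>
        (\<forall>r. radial_weak_sol \<rho> M r \<longrightarrow>
          (\<exists>rt r'.
             let d = (\<lambda>R. real M * rt R * r' R / R);
                 u = (\<lambda>x. r (norm x) *\<^sub>R eM M x) in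
             (\<forall>R\<in>{0<..1}. rt R = r R) \<and>
             (\<forall>R\<in>{0..1}. (rt has_real_derivative r' R) (at R within {0..1}))
             \<comment> \<open>(a)\<close>
           \<and> (\<exists>v. Ck 1 (cball 0 1) v \<and> (\<forall>x\<in>Bdisk - {0}. v x = u x))
             \<comment> \<open>(b)\<close>
           \<and> Ck 1 {0..1} rt \<and> Cinf {0<..1} rt
           \<and> (\<forall>R\<in>{0..1}. rt R \<ge> 0 \<and> r' R \<ge> 0) \<and> rt 0 = 0 \<and> r' 0 = 0
             \<comment> \<open>(c)\<close>
           \<and> continuous_on {0..1} d \<and> Cinf {0<..1} d
           \<and> (\<forall>R\<in>{0..1}. d R \<ge> 0) \<and> d 0 = 0
           \<and> (\<exists>d'. \<forall>R\<in>{0<..1}. (d has_real_derivative d' R) (at R within {0<..1}) \<and> d' R \<ge> 0)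
             \<comment> \<open>(d)\<close>
           \<and> (delayed_liftoff {0..} \<rho> \<longrightarrow>
                Cinf {0..1} rt \<and> Cinf {0..1} d \<and>
                (\<exists>v. Cinf (cball 0 1) v \<and> (\<forall>x\<in>Bdisk - {0}. v x = u x)))
             \<comment> \<open>(e)\<close>
           \<and> (immediate_liftoff {0..} \<rho> \<longrightarrow>
                ((delayed_liftoff {0..1} rt \<and> Cinf {0..1} rt) \<or>
                 (immediate_liftoff {0..1} rt \<and> Ck 1 {0..1} rt \<and> Cinf {0<..1} rt
                    \<and> rt 0 = 0 \<and> r' 0 = 0)) \<and>
                (W22 Bdisk u \<longrightarrow>
                   Cinf {0..1} rt \<and> Cinf {0..1} d \<and>
                   (\<exists>v. Cinf (cball 0 1) v \<and> (\<forall>x\<in>Bdisk - {0}. v x = u x)))))))"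
proof -
  obtain f2 K where \<rho>: "\<And>s. (\<rho> has_real_derivative deriv \<rho> s) (at s)"
    "\<And>s. (deriv \<rho> has_real_derivative f2 s) (at s)" "\<And>k. Ck k UNIV (deriv \<rho>)" "\<And>k. Ck k UNIV f2"
    "\<And>s. 0 \<le> deriv \<rho> s" "\<And>s. deriv \<rho> s \<le> \<gamma>" "\<And>s. 0 \<le> f2 s" "\<And>s. f2 s \<le> K"
    "\<And>s t. deriv \<rho> s * (t - s) \<le> \<rho> t - \<rho> s"
    by (rule convex_profile_derivatives[OF \<rho>_smooth \<rho>_convex \<rho>_neg \<rho>_lin s0]) (rule that; assumption)
  note cont = Ck_imp_continuous_on[OF \<rho>(3)]
  note ode = radial_weak_sol_ode[OF \<rho>(2) cont \<rho>(5,6,7,8) M]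
  \<comment> \<open>The origin, where \<open>r\<close> is unconstrained, is a null set.\<close>
  have polar: "AE x in lebesgue. x \<in> Bdisk \<longrightarrow> u x = H (x \<bullet> x) *\<^sub>R zpow M x"
    if "in_Ar M u r" and r: "\<And>R. R \<in> {0<..1} \<Longrightarrow> r R = R ^ M * H (R\<^sup>2)" for u r H
  proof -
    have "AE x in lebesgue. x \<in> Bdisk \<longrightarrow> u x = r (norm x) *\<^sub>R eM M x" using that(1) by (simp add: in_Ar_def)
    moreover have "AE x in lebesgue. (x :: real^2) \<noteq> 0" by (rule AE_completion[OF AE_lborel_singleton])
    ultimately show ?thesis
    proof eventually_elim
      case (elim x)
      then show ?case using r[of "norm x"] by (simp add: zpow_eM power2_norm_eq_inner)
    qed
  qed
  have stat: "stationary \<rho> u" if u: "in_Ar M u r" and sol: "radial_weak_sol \<rho> M r" for u r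
  proof -
    have W: "W12 Bdisk u" using u by (simp add: in_Ar_def)
    obtain p w where "radial_ode (deriv \<rho>) f2 r p w (real M) \<gamma> K" by (rule ode[OF sol]) (rule that)
    then interpret radial_ode "deriv \<rho>" f2 r p w "real M" \<gamma> K .
    show ?thesis
    \<comment> \<open>For \<open>M = 1\<close> trapping gives \<open>r = R\<close>, so
      \<open>u\<close> is the identity almost everywhere; \<open>smooth_profile\<close> starts at
      \<open>M = 2\<close>.\<close>
    proof (cases "M = 1")
      case True
      have "AE x in lebesgue. x \<in> Bdisk \<longrightarrow> u x = 1 *\<^sub>R zpow M x"
        by (rule polar[OF u]) (use r_eq_id_if_m_eq_1 True in simp)
      moreover have "zpow M x = x" for x unfolding True by (simp add: vec_eq_iff forall_2 axis_def)
      ultimately show ?thesis by (intro stationary_ident[OF cont \<rho>(5,6) W]) simp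
    next
      case False
      then have M2: "2 \<le> M" using M by simp
      obtain H \<pi> where H: "\<And>k. Ck k {0..1} H" "\<And>k. Ck k {0..1} \<pi>"
        "\<And>s. s \<in> {0..1} \<Longrightarrow> 1 \<le> H s" "\<And>s. s \<in> {0..1} \<Longrightarrow> 0 \<le> real M + s * \<pi> s"
        "\<And>R. R \<in> {0<..1} \<Longrightarrow> r R = R ^ M * H (R\<^sup>2)"
        "\<And>R. R \<in> {0<..1} \<Longrightarrow> p R = R ^ (M - 1) * H (R\<^sup>2) * (real M + R\<^sup>2 * \<pi> (R\<^sup>2))"
        "\<And>s. s \<in> {0<..<1} \<Longrightarrow> (H has_real_derivative \<pi> s * H s / 2) (at s)"
        "\<And>s. s \<in> {0<..<1} \<Longrightarrow> \<exists>\<pi>'. (\<pi> has_real_derivative \<pi>') (at s) \<and>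
           2 * s * \<pi>' = - (2 * real M + 2) * \<pi> s - s * (\<pi> s)\<^sup>2
             - 2 * real M * f2 (det_profile M H (\<lambda>s. s * \<pi> s) s) * det_profile' f2 M H (\<lambda>s. s * \<pi> s) s"
        "\<And>s. s \<in> {0<..<1} \<Longrightarrow> (det_profile M H (\<lambda>s. s * \<pi> s) has_real_derivative
           det_profile' f2 M H (\<lambda>s. s * \<pi> s) s) (at s)"
        by (rule smooth_profile[OF refl M2 \<rho>(4)]) (rule that; assumption)
      show ?thesis
        by (rule stationary_radial[OF M2 \<rho>(2,5,6,3) H(1,2,7,8,9) W polar[OF u H(5)]])
    qed
  qed
  have regular: "\<exists>rt r' d v. d = (\<lambda>R. real M * rt R * r' R / R)
      \<and> (\<forall>R\<in>{0<..1}. rt R = r R) \<and> (\<forall>R\<in>{0..1}. (rt has_real_derivative r' R) (at R within {0..1}))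
      \<and> Cinf (cball 0 1) v \<and> (\<forall>x\<in>Bdisk - {0}. v x = r (norm x) *\<^sub>R eM M x)
      \<and> Cinf {0..1} rt \<and> (\<forall>R\<in>{0..1}. 0 \<le> rt R \<and> 0 \<le> r' R) \<and> rt 0 = 0 \<and> r' 0 = 0 \<and> (\<forall>R\<in>{0<..1}. 0 < rt R)
      \<and> Cinf {0..1} d \<and> (\<forall>R\<in>{0..1}. 0 \<le> d R) \<and> d 0 = 0
      \<and> (\<exists>d'. \<forall>R\<in>{0<..1}. (d has_real_derivative d' R) (at R within {0<..1}) \<and> 0 \<le> d' R)"
    if M2: "2 \<le> M" and sol: "radial_weak_sol \<rho> M r" for r
  proof -
    obtain p w where "radial_ode (deriv \<rho>) f2 r p w (real M) \<gamma> K" by (rule ode[OF sol]) (rule that)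
    then interpret radial_ode "deriv \<rho>" f2 r p w "real M" \<gamma> K .
    obtain H \<pi> where H: "\<And>k. Ck k {0..1} H" "\<And>k. Ck k {0..1} \<pi>"
      "\<And>s. s \<in> {0..1} \<Longrightarrow> 1 \<le> H s" "\<And>s. s \<in> {0..1} \<Longrightarrow> 0 \<le> real M + s * \<pi> s"
      "\<And>R. R \<in> {0<..1} \<Longrightarrow> r R = R ^ M * H (R\<^sup>2)"
      "\<And>R. R \<in> {0<..1} \<Longrightarrow> p R = R ^ (M - 1) * H (R\<^sup>2) * (real M + R\<^sup>2 * \<pi> (R\<^sup>2))"
      "\<And>s. s \<in> {0<..<1} \<Longrightarrow> (H has_real_derivative \<pi> s * H s / 2) (at s)"
      "\<And>s. s \<in> {0<..<1} \<Longrightarrow> \<exists>\<pi>'. (\<pi> has_real_derivative \<pi>') (at s) \<and>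
         2 * s * \<pi>' = - (2 * real M + 2) * \<pi> s - s * (\<pi> s)\<^sup>2
           - 2 * real M * f2 (det_profile M H (\<lambda>s. s * \<pi> s) s) * det_profile' f2 M H (\<lambda>s. s * \<pi> s) s"
      "\<And>s. s \<in> {0<..<1} \<Longrightarrow> (det_profile M H (\<lambda>s. s * \<pi> s) has_real_derivative
         det_profile' f2 M H (\<lambda>s. s * \<pi> s) s) (at s)"
      by (rule smooth_profile[OF refl M2 \<rho>(4)]) (rule that; assumption)
    have D'c: "continuous_on {0..1} (det_profile' f2 M H (\<lambda>s. s * \<pi> s))"
      by (intro Ck_imp_continuous_on Ck_det_profile' Ck_mult Ck_ident H(1,2) \<rho>(4,7))
    have D'n: "0 \<le> det_profile' f2 M H (\<lambda>s. s * \<pi> s) s" if "s \<in> {0..1}" for s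
      by (rule det_profile'_nonneg[OF M2 _ \<rho>(7)]) (use that in simp)
    show ?thesis
      by (rule radial_profile_regularity[OF M2 H(1-5,7) D'c D'n H(9)]; (assumption | (intro exI conjI ballI; assumption | blast)))
  qed
  show ?thesis
  proof (intro conjI allI impI)
    show "stationary \<rho> u" if "in_Ar M u r \<and> radial_weak_sol \<rho> M r" for u r using stat that by blast
    show "(\<lambda>x. x) \<in> A_uM 1" by (rule ident_in_A_uM_1)
    have "\<rho> 0 = 0" using \<rho>_neg by simp
    note min = ident_unique_minimizer[OF \<rho>(1,5,6,9) this]
    show "\<forall>v\<in>A_uM 1. energy \<rho> (\<lambda>x. x) \<le> energy \<rho> v \<and>
        (energy \<rho> v = energy \<rho> (\<lambda>x. x) \<longrightarrow> (AE x in lebesgue. x \<in> Bdisk \<longrightarrow> v x = x))"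
      by (intro ballI conjI impI) (rule min(1), assumption, rule min(2))
  next
    fix r assume M2: "2 \<le> M" and sol: "radial_weak_sol \<rho> M r"
    from regular[OF this] obtain rt r' d v where reg: "d = (\<lambda>R. real M * rt R * r' R / R)"
      "\<forall>R\<in>{0<..1}. rt R = r R" "\<forall>R\<in>{0..1}. (rt has_real_derivative r' R) (at R within {0..1})"
      "Cinf (cball 0 1) v" "\<forall>x\<in>Bdisk - {0}. v x = r (norm x) *\<^sub>R eM M x"
      "Cinf {0..1} rt" "\<forall>R\<in>{0..1}. 0 \<le> rt R \<and> 0 \<le> r' R" "rt 0 = 0" "r' 0 = 0" "\<forall>R\<in>{0<..1}. 0 < rt R"
      "Cinf {0..1} d" "\<forall>R\<in>{0..1}. 0 \<le> d R" "d 0 = 0"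
      "\<exists>d'. \<forall>R\<in>{0<..1}. (d has_real_derivative d' R) (at R within {0<..1}) \<and> 0 \<le> d' R"
      by (elim exE conjE) (rule that; (assumption | (rule exI, assumption)))
    have sub: "Cinf {0<..1} g" if "Cinf {0..1} g" for g :: "real \<Rightarrow> real"
      using that by (auto simp: Cinf_def intro: Ck_subset)
    have Ck: "Ck k S g" if "Cinf S g" for k and S :: "'a::euclidean_space set" and g :: "'a \<Rightarrow> 'b::euclidean_space"
      using that by (simp add: Cinf_def)
    \<comment> \<open>Positivity of \<open>rt\<close> on \<open>(0, 1]\<close>, a consequence of
      \<open>H \<ge> 1\<close>, selects the second alternative in (e).\<close>
    have lift: "immediate_liftoff {0..1} rt"
      unfolding immediate_liftoff_def using Ck_imp_continuous_on[OF Ck[OF reg(6)]] reg(8,10) by auto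
    show "\<exists>rt r'.
             let d = (\<lambda>R. real M * rt R * r' R / R);
                 u = (\<lambda>x. r (norm x) *\<^sub>R eM M x) in
             (\<forall>R\<in>{0<..1}. rt R = r R) \<and>
             (\<forall>R\<in>{0..1}. (rt has_real_derivative r' R) (at R within {0..1}))
           \<and> (\<exists>v. Ck 1 (cball 0 1) v \<and> (\<forall>x\<in>Bdisk - {0}. v x = u x))
           \<and> Ck 1 {0..1} rt \<and> Cinf {0<..1} rt
           \<and> (\<forall>R\<in>{0..1}. rt R \<ge> 0 \<and> r' R \<ge> 0) \<and> rt 0 = 0 \<and> r' 0 = 0
           \<and> continuous_on {0..1} d \<and> Cinf {0<..1} d
           \<and> (\<forall>R\<in>{0..1}. d R \<ge> 0) \<and> d 0 = 0
           \<and> (\<exists>d'. \<forall>R\<in>{0<..1}. (d has_real_derivative d' R) (at R within {0<..1}) \<and> d' R \<ge> 0)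
           \<and> (delayed_liftoff {0..} \<rho> \<longrightarrow>
                Cinf {0..1} rt \<and> Cinf {0..1} d \<and>
                (\<exists>v. Cinf (cball 0 1) v \<and> (\<forall>x\<in>Bdisk - {0}. v x = u x)))
           \<and> (immediate_liftoff {0..} \<rho> \<longrightarrow>
                ((delayed_liftoff {0..1} rt \<and> Cinf {0..1} rt) \<or>
                 (immediate_liftoff {0..1} rt \<and> Ck 1 {0..1} rt \<and> Cinf {0<..1} rt
                    \<and> rt 0 = 0 \<and> r' 0 = 0)) \<and>
                (W22 Bdisk u \<longrightarrow>
                   Cinf {0..1} rt \<and> Cinf {0..1} d \<and>
                   (\<exists>v. Cinf (cball 0 1) v \<and> (\<forall>x\<in>Bdisk - {0}. v x = u x))))"
      unfolding Let_def
      by (rule exI[of _ rt], rule exI[of _ r'], fold reg(1), intro conjI impI disjI2 exI[of _ v] reg reg(12,13)[unfolded reg(1)] lift sub Ck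
          Ck_imp_continuous_on[OF Ck[OF reg(11)]])
  qed
qed

end
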